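(* Assume the following. (1) (Separation) There exists $\Delta>0$ such that for all $n\ge 1$ and all $1\le i\ne j\le n$, $\|f_i-f_j\|\ge 2\Delta$. (2) (Projection control) There exist an integer $J_0\ge 1$ and non-negative numbers $(s_j)_{j\ge J_0}$ with $\sum_{j\ge J_0}s_j^2<\infty$ such that for all $n\ge1$, $1\le i\le n$ and $j\ge J_0$, $|\langle f_i,e_j\rangle|\le s_j$. Let $d_0\ge J_0$ be the associated integer described in the context. (3) (Stationarity and decay) The covariance functions are stationary, $K_\theta(f,g)=K_\theta(f-g)$ for all $\theta\in\Theta$, $f,g\in\mathcal H$, and there are a fixed $\gamma_0>d_0$ and a constant $C>0$ with $\sup_{\theta\in\Theta}|K_\theta(f)|\le \frac{C}{1+\|f\|^{\gamma_0}}$ for all $f\in\mathcal H$. (4) There is a fixed $c>0$ such that $\lambda_{\min}(R_\theta)\ge c$ for all $n\ge1$ and all $\theta\in\Theta$. (5) For all $\alpha>0$, $\displaystyle\liminf_{n\to\infty}\inf_{\theta\in\Theta,\ \|\theta-\theta_0\|\ge\alpha}\frac1n\sum_{i,j=1}^n[K_\theta(f_i,f_j)-K_{\theta_0}(f_i,f_j)]^2>0$. (6) For all $(\lambda_1,\dots,\lambda_p)\ne(0,\dots,0)$ in $\mathbb R^p$, $\displaystyle\liminf_{n\to\infty}\frac1n\sum_{i,j=1}^n\Big(\sum_{k=1}^p\lambda_k\frac{\partial K_\theta}{\partial\theta_k}\Big|_{\theta=\theta_0}(f_i,f_j)\Big)^2>0$. (7) For every $f\in\mathcal H$, $K_\theta(f)$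 is continuously differentiable with respect to $\theta$ and, for some $\gamma_1>d_0$ and $C_1>0$, $\sup_{\theta\in\Theta}\max_{i=1,\dots,p}\left|\frac{\partial K_\theta}{\partial\theta_i}(f)\right|\le\frac{C_1}{1+\|f\|^{\gamma_1}}$ for all $f\in\mathcal H$. (8) For every $f\in\mathcal H$, $K_\theta(f)$ is three times continuously differentiable with respect to $\theta$ and, for some $\gamma_2>d_0$ and $C_2>0$, for all $q\in\{2,3\}$, $i_1,\dots,i_q\in\{1,\dots,p\}$ and $f\in\mathcal H$, $\sup_{\theta\in\Theta}\left|\frac{\partial^qK_\theta}{\partial\theta_{i_1}\cdots\partial\theta_{i_q}}(f)\right|\le\frac{C_2}{1+\|f\|^{\gamma_2}}$. For each $n$, let $M_n$ be the $p\times p$ matrix with entries $$(M_n)_{i,j}=\frac1{2n}\operatorname{tr}\Big(R_{\theta_0}^{-1}\frac{\partial R}{\partial\theta_i}(\theta_0)R_{\theta_0}^{-1}\frac{\partial R}{\partial\theta_j}(\theta_0)\Big),$$ and let $\widehat\theta_n\in\operatorname{argmin}_{\theta\in\Theta}\mathcal L_n(\theta)$ be the maximum likelihood estimator. Then, in distribution, $$\sqrt n\,M_n^{1/2}(\widehat\theta_n-\theta_0)\xrightarrow[n\to\infty]{}\mathcal N(0,I_p).$$ Furthermore, $$0<\liminf_{n\to\infty}\lambda_{\min}(M_n)\le\limsup_{n\to\infty}\lambda_{\max}(M_n)<\infty.$$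
   Context: $\mathcal H$ is a separable Hilbert space (not necessarily real, finite- or infinite-dimensional) with inner product $\langle\cdot,\cdot\rangle$ and norm $\|\cdot\|$; $(e_j)_{j\ge1}$ is a fixed orthonormal basis of $\mathcal H$ (with the convention $e_j=0$ for $j>\dim\mathcal H$ if $\dim\mathcal H<\infty$). $\Theta\subset\mathbb R^p$ is compact, $\theta_0$ lies in the interior of $\Theta$, and $\{K_\theta:\theta\in\Theta\}$ is a parametric family of real covariance functions on $\mathcal H\times\mathcal H$. $Y$ is a real Gaussian process indexed by $\mathcal H$ with zero mean and covariance function $K_{\theta_0}$. For stationary kernels the same symbol $K_\theta$ is used for the function of one variable. For each $n\ge1$, $f_1,\dots,f_n\in\mathcal H$ are deterministic inputs which may depend on $n$ (triangular array $f_i=f_i^{n}$, the superscript being omitted). Put $y=[Y(f_1),\dots,Y(f_n)]^\top$, $R_\theta=R(\theta)=(K_\theta(f_i,f_j))_{1\le i,j\le n}$, $|R_\theta|$ its determinant, $\frac{\partial R}{\partial\theta_i}(\theta)$ the entrywise derivative, and $$\mathcal L_n(\theta)=\frac1n\ln|R_\theta|+\frac1n y^\top R_\theta^{-1}y .$$ $\lambda_{\min},\lambda_{\max}$ denote the smallest and largest eigenvalues of a symmetric matrix and $M^{1/2}$ is the symmetric positive semidefinite square root. For $d\ge1$ let $f_{i,d}=\sum_{j=1}^d\langle f_i,e_j\rangle e_j$. When the separation and projection-control hypotheses hold with $\Delta,J_0,(s_j)$, $d_0$ denotes a fixed integer $d_0\ge J_0$, independent of $n$, such that $\|f_{i,d_0}-f_{j,d_0}\|\ge\Delta$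 for all $n$ and all $1\le i<j\le n$, and $\sum_{k=d_0+1}^\infty s_k^2<\Delta^2/16$ (such an integer exists).
   Formalization: K_θ(f) is assumed to extend in θ to an open set U containing Θ (same U for all f), to be C^1 and C^3 there, and to satisfy the first-derivative bound of (7) for all θ in U, not only in Θ; for a general (e.g. disconnected) compact Θ the claim with the bound on Θ alone is false. *)

theory Defs
  imports
    "HOL-Probability.Probability"
    "Jordan_Normal_Form.Spectral_Radius"
    "Jordan_Normal_Form.Gauss_Jordan_Elimination"
begin

section \<open>Real and complex Hilbert spaces\<close>

text \<open>
  The law \<open>a * conjugate a = \<bar>a\<bar>\<^sup>2\<close> makes every scalar a root of a real quadratic polynomial, so
  the scalar field \<open>'k\<close> is (a copy of) the reals or the complex numbers.  Norm, completeness and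
  separability of the space are those of its type class; separability is second countability,
  which is the same in a metric space.  The inner product is linear in its first argument.
\<close>

locale hilbert_space = Vector_Spaces.vector_space scl
  for scl :: "'k::{real_normed_field, conjugatable_field} \<Rightarrow> 'h::{banach, second_countable_topology} \<Rightarrow> 'h" +
  fixes ip :: "'h \<Rightarrow> 'h \<Rightarrow> 'k"
  assumes scalar_mult_conjugate: "a * conjugate a = of_real ((norm a)\<^sup>2)"
    and scl_of_real: "scl (of_real r) x = r *\<^sub>R x"
    and ip_add_left: "ip (x + y) z = ip x z + ip y z"
    and ip_scl_left: "ip (scl a x) z = a * ip x z"
    and ip_commute: "ip y x = conjugate (ip x y)"
    and ip_self: "ip x x = of_real ((norm x)\<^sup>2)"

lemma hilbert_space_real:
  "hilbert_space ((*\<^sub>R) :: real \<Rightarrow> 'h \<Rightarrow> 'h) (inner :: 'h::{real_inner, banach, second_countable_topology} \<Rightarrow> _)"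
  by unfold_locales
    (auto simp: scaleR_add_right scaleR_add_left inner_add_left inner_add_right inner_commute
      dot_square_norm power2_eq_square)

lemma hilbert_space_complex:
  "hilbert_space ((*) :: complex \<Rightarrow> complex \<Rightarrow> complex) (\<lambda>x y. x * cnj y)"
  by unfold_locales
    (auto simp: algebra_simps scaleR_conv_of_real complex_norm_square[symmetric] conjugate_complex_def)

text \<open>
  The basis is indexed from 1 (\<open>e 0\<close> is irrelevant) and \<open>N\<close> is the Hilbert dimension;
  the sequence is padded with zeros beyond \<open>N\<close>.
\<close>

definition orthonormal_basis ::
  "('k::{real_normed_field, conjugatable_field} \<Rightarrow> 'h::{banach, second_countable_topology} \<Rightarrow> 'h) \<Rightarrow>
    ('h \<Rightarrow> 'h \<Rightarrow> 'k) \<Rightarrow> (nat \<Rightarrow> 'h) \<Rightarrow> bool" where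
  "orthonormal_basis scl ip e \<longleftrightarrow>
    (\<exists>N::enat.
      (\<forall>i\<ge>1. \<forall>j\<ge>1. enat i \<le> N \<and> enat j \<le> N \<longrightarrow> ip (e i) (e j) = (if i = j then 1 else 0)) \<and>
      (\<forall>j. N < enat j \<longrightarrow> e j = 0)) \<and>
    closure (Modules.module.span scl (e ` {1..})) = UNIV"

definition onb_projection ::
  "('k::{real_normed_field, conjugatable_field} \<Rightarrow> 'h::{banach, second_countable_topology} \<Rightarrow> 'h) \<Rightarrow>
    ('h \<Rightarrow> 'h \<Rightarrow> 'k) \<Rightarrow> (nat \<Rightarrow> 'h) \<Rightarrow> nat \<Rightarrow> 'h \<Rightarrow> 'h" where
  "onb_projection scl ip e d x = (\<Sum>j=1..d. scl (ip x (e j)) (e j))"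

section \<open>Gaussian processes and convergence in distribution\<close>

definition covariance_function :: "('h \<Rightarrow> 'h \<Rightarrow> real) \<Rightarrow> bool" where
  "covariance_function k \<longleftrightarrow>
    (\<forall>f g. k f g = k g f) \<and>
    (\<forall>S a. finite S \<longrightarrow> 0 \<le> (\<Sum>f\<in>S. \<Sum>g\<in>S. a f * a g * k f g))"

text \<open>Constants count as (degenerate) Gaussian variables.\<close>

definition gaussian_variable :: "'w measure \<Rightarrow> ('w \<Rightarrow> real) \<Rightarrow> bool" where
  "gaussian_variable P X \<longleftrightarrow> X \<in> borel_measurable P \<and>
    ((\<exists>\<mu> \<sigma>. 0 < \<sigma> \<and> distributed P lborel X (normal_density \<mu> \<sigma>)) \<or> (\<exists>\<mu>. AE \<omega> in P. X \<omega> = \<mu>))"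

definition gaussian_process :: "'w measure \<Rightarrow> ('h \<Rightarrow> 'w \<Rightarrow> real) \<Rightarrow> bool" where
  "gaussian_process P Y \<longleftrightarrow>
    (\<forall>S a. finite S \<longrightarrow> gaussian_variable P (\<lambda>\<omega>. \<Sum>f\<in>S. a f * Y f \<omega>))"

definition centred_gaussian_process ::
  "'w measure \<Rightarrow> ('h \<Rightarrow> 'w \<Rightarrow> real) \<Rightarrow> ('h \<Rightarrow> 'h \<Rightarrow> real) \<Rightarrow> bool" where
  "centred_gaussian_process P Y k \<longleftrightarrow> gaussian_process P Y \<and>
    (\<forall>f. (\<integral>\<omega>. Y f \<omega> \<partial>P) = 0) \<and> (\<forall>f g. (\<integral>\<omega>. Y f \<omega> * Y g \<omega> \<partial>P) = k f g)"

definition std_normal_vec :: "(real^'p) measure" where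
  "std_normal_vec = density lborel (\<lambda>x. ennreal (\<Prod>i\<in>UNIV. std_normal_density (x $ i)))"

definition converges_in_distribution ::
  "'w measure \<Rightarrow> (nat \<Rightarrow> 'w \<Rightarrow> 'a::topological_space) \<Rightarrow> 'a measure \<Rightarrow> bool" where
  "converges_in_distribution P X \<nu> \<longleftrightarrow>
    (\<forall>g :: 'a \<Rightarrow> real. continuous_on UNIV g \<and> bounded (range g) \<longrightarrow>
      (\<lambda>n. \<integral>x. g x \<partial>(distr P borel (X n))) \<longlonglongrightarrow> (\<integral>x. g x \<partial>\<nu>))"

section \<open>Partial derivatives in the parameter\<close>

definition partial :: "'p \<Rightarrow> (real^'p \<Rightarrow> real) \<Rightarrow> real^'p \<Rightarrow> real" where
  "partial i F \<theta> = frechet_derivative F (at \<theta>) (axis i 1)"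

definition partials :: "'p list \<Rightarrow> (real^'p \<Rightarrow> real) \<Rightarrow> real^'p \<Rightarrow> real" where
  "partials is F = foldr partial is F"

text \<open>\<open>m\<close> times continuously differentiable on an open set \<open>U\<close>.\<close>

fun Ck_on :: "nat \<Rightarrow> (real^'p \<Rightarrow> real) \<Rightarrow> (real^'p) set \<Rightarrow> bool" where
  "Ck_on 0 F U \<longleftrightarrow> continuous_on U F"
| "Ck_on (Suc m) F U \<longleftrightarrow> (\<forall>\<theta>\<in>U. F differentiable (at \<theta>)) \<and> (\<forall>i. Ck_on m (partial i F) U)"

section \<open>Matrices\<close>

text \<open>
  Matrices whose size \<open>n\<close> varies are those of Jordan_Normal_Form; \<open>p \<times> p\<close> matrices, with \<open>p\<close>
  fixed, are of type \<open>real^'p^'p\<close>.  The inputs are \<open>x 0, \<dots>, x (n - 1)\<close>.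
\<close>

definition gram_mat :: "('h \<Rightarrow> 'h \<Rightarrow> real) \<Rightarrow> nat \<Rightarrow> (nat \<Rightarrow> 'h) \<Rightarrow> real mat" where
  "gram_mat k n x = mat n n (\<lambda>(i, j). k (x i) (x j))"

definition gram_mat_deriv ::
  "'p \<Rightarrow> (real^'p \<Rightarrow> 'h \<Rightarrow> 'h \<Rightarrow> real) \<Rightarrow> real^'p \<Rightarrow> nat \<Rightarrow> (nat \<Rightarrow> 'h) \<Rightarrow> real mat" where
  "gram_mat_deriv i K \<theta> n x = gram_mat (\<lambda>f g. partial i (\<lambda>\<theta>. K \<theta> f g) \<theta>) n x"

text \<open>Only used on invertible matrices.\<close>

definition mat_inv :: "real mat \<Rightarrow> real mat" where
  "mat_inv A = the (mat_inverse A)"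

definition mat_trace :: "real mat \<Rightarrow> real" where
  "mat_trace A = (\<Sum>i<dim_row A. A $$ (i, i))"

definition likelihood_criterion ::
  "(real^'p \<Rightarrow> 'h \<Rightarrow> 'h \<Rightarrow> real) \<Rightarrow> nat \<Rightarrow> (nat \<Rightarrow> 'h) \<Rightarrow> ('h \<Rightarrow> real) \<Rightarrow> real^'p \<Rightarrow> real" where
  "likelihood_criterion K n x Yobs \<theta> =
    (let R = gram_mat (K \<theta>) n x; y = Matrix.vec n (\<lambda>i. Yobs (x i))
     in 1 / real n * ln (Determinant.det R) +
        1 / real n * Matrix.scalar_prod y (mult_mat_vec (mat_inv R) y))"

definition fisher_mat ::
  "(real^'p \<Rightarrow> 'h \<Rightarrow> 'h \<Rightarrow> real) \<Rightarrow> real^'p \<Rightarrow> nat \<Rightarrow> (nat \<Rightarrow> 'h) \<Rightarrow> real^'p^'p" where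
  "fisher_mat K \<theta> n x = (\<chi> i j. 1 / (2 * real n) *
    mat_trace (mat_inv (gram_mat (K \<theta>) n x) * gram_mat_deriv i K \<theta> n x *
               mat_inv (gram_mat (K \<theta>) n x) * gram_mat_deriv j K \<theta> n x))"

definition eigenvalues :: "real^'p^'p \<Rightarrow> real set" where
  "eigenvalues A = {l. \<exists>v. v \<noteq> 0 \<and> A *v v = l *\<^sub>R v}"

definition psd_sqrt :: "real^'p^'p \<Rightarrow> real^'p^'p" where
  "psd_sqrt A = (THE B. transpose B = B \<and> (\<forall>v. 0 \<le> inner v (B *v v)) \<and> B ** B = A)"

end

theory Submission
 imports Defs "HOL-Real_Asymp.Real_Asymp"
begin

text \<open>
  Put \<open>a i j = 1 / (1 + \<parallel>f i - f j\<parallel> powr \<gamma>)\<close> with \<open>\<gamma>\<close> the smallest of the three decay exponents.  Over the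
  complex numbers the first \<open>d\<^sub>0\<close> coordinates of the inputs fill a real space of dimension \<open>2 * d\<^sub>0\<close>, so
  \<open>\<gamma> > d\<^sub>0\<close> bounds only the sums of \<open>a\<^sup>2\<close> along a row; the sums of \<open>a\<close> may grow, but by a factor
  \<open>n powr -\<epsilon>'\<close> more slowly than \<open>sqrt n\<close> (\<open>envelope_sums\<close>).  Covariance matrices and their derivatives
  therefore have Frobenius norms of order \<open>sqrt n\<close>, whereas their operator norms need not be bounded.
  The argument is arranged so that this is enough.

  Choose \<open>V\<close> with \<open>V\<^sup>T R(\<theta>\<^sub>0) V = 1\<close>.  Then \<open>z = V\<^sup>T y\<close> has independent standard normal entries, and if
  \<open>x\<^sub>k\<close> are the eigenvalues of \<open>V\<^sup>T (R(\<theta>) - R(\<theta>\<^sub>0)) V\<close> and \<open>w\<^sub>k\<close> the coordinates of \<open>z\<close> in an orthonormal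
  eigenbasis, \<open>n * (L(\<theta>) - L(\<theta>\<^sub>0))\<close> is the sum of \<open>ln (1 + x\<^sub>k) + w\<^sub>k\<^sup>2 * (1 / (1 + x\<^sub>k) - 1)\<close>
  (\<open>gauss_crit_difference\<close>).  Everything is read off from this formula, with the scale \<open>b = n powr \<epsilon>\<close>.

  Far from the true parameter, where \<open>sqrt n * \<parallel>\<theta> - \<theta>\<^sub>0\<parallel> \<ge> b\<^sup>2\<close>, the exponential moment of order \<open>1/4\<close>
  shows that the difference is at most 1 with probability at most \<open>2 * exp (- q / 4)\<close>, \<open>q\<close> being the sum
  of \<open>(x\<^sub>k / (2 + x\<^sub>k))\<^sup>2\<close> (\<open>gaussian_likelihood_chernoff\<close>).  Identifiability bounds \<open>q\<close> below by a multiple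
  of \<open>n * \<parallel>\<theta> - \<theta>\<^sub>0\<parallel>\<^sup>2\<close>; in the absence of operator norm bounds this uses duality with a truncation of
  \<open>R(\<theta>) - R(\<theta>\<^sub>0)\<close>, whose row sums are bounded (\<open>truncated_test_bound\<close>).  As \<open>exp (- C * b ^ 4)\<close> beats
  every power of \<open>n\<close>, a union bound over a net of mesh \<open>n ^ -4\<close> excludes a minimiser there
  (\<open>outer_region\<close>).

  Near the true parameter a Taylor expansion gives
  \<open>n * (L(\<theta>\<^sub>0 + t) - L(\<theta>\<^sub>0)) = - sqrt n * (t \<bullet> S) + n * (t \<bullet> M t)\<close> up to \<open>O(1 / b)\<close>, uniformly in \<open>t\<close>,
  where \<open>S\<close> is a vector of centred quadratic forms in \<open>z\<close>; the exceptional event is controlled by the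
  second moments of finitely many quadratic forms (\<open>inner_region\<close>).  Comparing the minimiser of the
  left-hand side with that of the quadratic function, \<open>sqrt n * M\<^sup>1\<^sup>/\<^sup>2 (\<theta>hat - \<theta>\<^sub>0)\<close> differs from
  \<open>M\<^sup>-\<^sup>1\<^sup>/\<^sup>2 S / 2\<close> by a quantity that tends to 0 in probability (\<open>estimator_near_score\<close>).  The
  characteristic function of the latter is a product over eigenvalues and converges to that of the
  standard normal law (\<open>score_limit\<close>), and the continuity theorem together with Slutsky's argument
  gives the limit law (\<open>converges_in_distribution_slutsky\<close>).  The same duality bounds the eigenvalues of
  \<open>M\<close> from below, and the envelope bounds them from above.
\<close>

section \<open>Real symmetric matrices\<close>

text \<open>A complex eigenvalue of a real symmetric matrix is real because the Hermitian form of an eigenvector is real;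
the real or the imaginary part of the eigenvector is then a real eigenvector.\<close>
lemma symmetric_real_eigenvector_exists:
 fixes B :: "real mat"
 assumes B: "B \<in> carrier_mat n n" and sym: "transpose_mat B = B" and n: "0 < n"
 shows "\<exists>v \<mu>. v \<in> carrier_vec n \<and> v \<bullet> v = 1 \<and> B *\<^sub>v v = \<mu> \<cdot>\<^sub>v v"
proof -
 define C where "C = map_mat complex_of_real B"
 have C: "C \<in> carrier_mat n n" using B by (simp add: C_def)
 obtain \<mu> where "eigenvalue C \<mu>"
  using spectrum_non_empty[OF C n] by (auto simp: spectrum_def)
 then obtain w where w: "w \<in> carrier_vec n" "w \<noteq> 0\<^sub>v n" "C *\<^sub>v w = \<mu> \<cdot>\<^sub>v w"
  using C by (auto simp: eigenvalue_def eigenvector_def)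
 have Bsym: "B $$ (i,j) = B $$ (j,i)" if "i < n" "j < n" for i j
  using that B arg_cong[OF sym, of "%M. M $$ (i,j)"] by auto
 have ev: "(\<Sum>j<n. complex_of_real (B $$ (i,j)) * w $ j) = \<mu> * w $ i" if "i < n" for i
 proof -
  have "(C *\<^sub>v w) $ i = \<mu> * w $ i" using w that by simp
  then show ?thesis using that B w(1)
   by (simp add: C_def scalar_prod_def atLeast0LessThan)
 qed
 define S where "S = (\<Sum>i<n. (cmod (w $ i))\<^sup>2)"
 have S: "S > 0"
 proof -
  obtain i where i: "i < n" "w $ i \<noteq> 0"
   using w(1,2) by (metis eq_vecI carrier_vecD index_zero_vec(1) index_zero_vec(2))
  have "0 < (cmod (w $ i))\<^sup>2" using i by simp
  also have "... <= S" unfolding S_def using i by (intro member_le_sum) auto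
  finally show ?thesis .
 qed
 define q where "q = (\<Sum>i<n. \<Sum>j<n. cnj (w $ i) * (complex_of_real (B $$ (i,j)) * w $ j))"
 have q1: "q = \<mu> * of_real S"
 proof -
  have "q = (\<Sum>i<n. cnj (w $ i) * (\<mu> * w $ i))"
   unfolding q_def by (intro sum.cong) (auto simp: sum_distrib_left[symmetric] ev)
  also have "... = (\<Sum>i<n. \<mu> * of_real ((cmod (w $ i))\<^sup>2))"
   by (intro sum.cong refl) (simp add: complex_norm_square[symmetric] mult.commute mult.left_commute del: of_real_power)
  finally show ?thesis by (simp add: S_def sum_distrib_left)
 qed
 have "cnj q = (\<Sum>i<n. \<Sum>j<n. w $ i * (complex_of_real (B $$ (i,j)) * cnj (w $ j)))"
  by (simp add: q_def)
 also have "... = (\<Sum>j<n. \<Sum>i<n. w $ i * (complex_of_real (B $$ (i,j)) * cnj (w $ j)))"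
  by (rule sum.swap)
 also have "... = q"
  unfolding q_def by (intro sum.cong refl) (simp add: Bsym mult.left_commute mult.commute)
 finally have "cnj \<mu> * of_real S = \<mu> * of_real S" using q1 by (metis complex_cnj_complex_of_real complex_cnj_mult)
 then have "cnj \<mu> = \<mu>" using S by simp
 then obtain m where m: "\<mu> = of_real m" by (metis Reals_cases Reals_cnj_iff)
 have evre: "(\<Sum>j<n. B $$ (i,j) * Re (w $ j)) = m * Re (w $ i)" if "i < n" for i
  using arg_cong[OF ev[OF that], of Re] by (simp add: m)
 have evim: "(\<Sum>j<n. B $$ (i,j) * Im (w $ j)) = m * Im (w $ i)" if "i < n" for i
  using arg_cong[OF ev[OF that], of Im] by (simp add: m)
 obtain x :: "real vec" where x: "x \<in> carrier_vec n" "x \<bullet> x > 0" "B *\<^sub>v x = m \<cdot>\<^sub>v x"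
 proof -
  define a where "a = Matrix.vec n (%i. Re (w $ i))"
  define b where "b = Matrix.vec n (%i. Im (w $ i))"
  have "a \<bullet> a + b \<bullet> b = S"
   unfolding S_def cmod_power2
   by (simp add: a_def b_def scalar_prod_def atLeast0LessThan sum.distrib power2_eq_square)
  moreover have "B *\<^sub>v a = m \<cdot>\<^sub>v a" "B *\<^sub>v b = m \<cdot>\<^sub>v b"
   using B by (auto intro!: eq_vecI simp: a_def b_def scalar_prod_def atLeast0LessThan evre evim)
  moreover have "a \<in> carrier_vec n" "b \<in> carrier_vec n" by (auto simp: a_def b_def)
  ultimately show thesis using S that[of a] that[of b] by linarith
 qed
 define v where "v = (1 / sqrt (x \<bullet> x)) \<cdot>\<^sub>v x"
 have "v \<in> carrier_vec n" "v \<bullet> v = 1" "B *\<^sub>v v = m \<cdot>\<^sub>v v"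
  using x B by (auto simp: v_def mult_mat_vec smult_smult_assoc mult.commute)
 then show ?thesis by blast
qed

definition dmat :: "nat => (nat => real) => real mat" where
 "dmat n x = mat n n (%(i, j). if i = j then x i else 0)"

lemma dmat_carrier [simp]: "dmat n x \<in> carrier_mat n n"
 by (simp add: dmat_def)

text \<open>The Householder reflection that exchanges \<open>v\<close> and the first unit vector.\<close>
lemma orthogonal_mat_to_first_unit_vec:
 fixes v :: "real vec"
 assumes v: "v \<in> carrier_vec n" "v \<bullet> v = 1" and n: "0 < n"
 shows "\<exists>H. H \<in> carrier_mat n n \<and> transpose_mat H = H \<and> H * H = 1\<^sub>m n \<and> H *\<^sub>v unit_vec n 0 = v"
proof -
 define u where "u = v - unit_vec n 0"
 define t where "t = u \<bullet> u"
 define H where "H = mat n n (%(i,j). (if i = j then 1 else 0) - 2 / t * u $ i * u $ j)"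
 have u: "u \<in> carrier_vec n" using v by (simp add: u_def)
 have H: "H \<in> carrier_mat n n" by (simp add: H_def)
 have tsum: "t = (\<Sum>k<n. u $ k * u $ k)" using u by (simp add: t_def scalar_prod_def atLeast0LessThan)
 have ui: "u $ i = v $ i - (if i = 0 then 1 else 0)" if "i < n" for i using that v n by (simp add: u_def)
 have v1: "(\<Sum>k<n. v $ k * v $ k) = 1" using v by (simp add: scalar_prod_def atLeast0LessThan)
 have "t = (\<Sum>k<n. v $ k * v $ k - (if k = 0 then 2 * v $ 0 - 1 else 0))"
  unfolding tsum by (intro sum.cong) (auto simp: ui algebra_simps)
 also have "... = 2 - 2 * v $ 0" using n by (simp add: sum_subtractf v1)
 finally have t: "t = 2 - 2 * v $ 0" .
 have tr: "transpose_mat H = H" by (rule eq_matI) (auto simp: H_def)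
 have HH: "H * H = 1\<^sub>m n"
 proof (rule eq_matI)
  fix i j assume "i < dim_row (1\<^sub>m n :: real mat)" "j < dim_col (1\<^sub>m n :: real mat)"
  then have ij: "i < n" "j < n" by auto
  have "(H * H) $$ (i,j) = (\<Sum>k<n. ((if i = k then 1 else 0) - 2 / t * u $ i * u $ k) * ((if k = j then 1 else 0) - 2 / t * u $ k * u $ j))"
   using ij by (simp add: H_def scalar_prod_def atLeast0LessThan)
  also have "... = (\<Sum>k<n. (if k = i then (if i = j then 1 else 0) - 2 / t * u $ i * u $ j else 0)
    + ((if k = j then - 2 / t * u $ i * u $ j else 0) + 4 / t / t * u $ i * u $ j * (u $ k * u $ k)))"
   by (intro sum.cong refl) (auto simp: algebra_simps)
  also have "... = (if i = j then 1 else 0) - 4 / t * u $ i * u $ j + 4 / t / t * u $ i * u $ j * t"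
   using ij by (simp only: sum.distrib sum_distrib_left[symmetric] tsum[symmetric]) simp
  also have "... = (if i = j then 1 else 0)"
   by (cases "t = 0") auto
  finally show "(H * H) $$ (i,j) = 1\<^sub>m n $$ (i,j)" using ij by simp
 qed (use H in auto)
 have u0: "u $ i = 0" if "t = 0" "i < n" for i
  using that tsum by (subst (asm) tsum) (simp add: sum_nonneg_eq_0_iff)
 have "H *\<^sub>v unit_vec n 0 = v"
 proof (rule eq_vecI)
  fix i assume "i < dim_vec v"
  then have i: "i < n" using v by simp
  have "(H *\<^sub>v unit_vec n 0) $ i = (if i = 0 then 1 else 0) - 2 / t * u $ i * u $ 0"
   using i n by (simp add: H_def)
  also have "... = v $ i"
  proof (cases "t = 0")
   case True then show ?thesis using u0[OF True i] ui[OF i] by simp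
  next
   case False
   have a: "2 / t * u $ 0 = -1" using False ui[of 0] n t by (simp add: field_simps)
   have "2 / t * u $ i * u $ 0 = u $ i * (2 / t * u $ 0)" by (simp only: ac_simps)
   then show ?thesis unfolding a using ui[OF i] by simp
  qed
  finally show "(H *\<^sub>v unit_vec n 0) $ i = v $ i" .
 qed (use H v in auto)
 then show ?thesis using H tr HH by blast
qed

text \<open>By induction on the size: rotating an eigenvector to the first unit vector splits off a \<open>1 \<times> 1\<close> block, by symmetry.\<close>
theorem symmetric_mat_orthogonally_diagonalizable:
 fixes B :: "real mat"
 assumes "B \<in> carrier_mat n n" "transpose_mat B = B"
 shows "\<exists>P x. P \<in> carrier_mat n n \<and> transpose_mat P * P = 1\<^sub>m n \<and> P * transpose_mat P = 1\<^sub>m n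
  \<and> B = P * dmat n x * transpose_mat P"
 using assms
proof (induction n arbitrary: B)
 case 0
 then show ?case by (intro exI[of _ "1\<^sub>m 0"] exI) auto
next
 case (Suc n)
 note B = Suc.prems(1) and sym = Suc.prems(2)
 obtain v :: "real vec" and \<mu> where v: "v \<in> carrier_vec (Suc n)" "v \<bullet> v = 1" "B *\<^sub>v v = \<mu> \<cdot>\<^sub>v v"
  using symmetric_real_eigenvector_exists[OF B sym] by auto
 obtain H where H: "H \<in> carrier_mat (Suc n) (Suc n)" "transpose_mat H = H" "H * H = 1\<^sub>m (Suc n)"
   "H *\<^sub>v unit_vec (Suc n) 0 = v"
  using orthogonal_mat_to_first_unit_vec[OF v(1,2)] by auto
 define D where "D = H * B * H"
 have D: "D \<in> carrier_mat (Suc n) (Suc n)" using H B by (auto simp: D_def)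
 have Hv: "H *\<^sub>v v = unit_vec (Suc n) 0"
  using H by (metis assoc_mult_mat_vec one_mult_mat_vec unit_vec_carrier)
 have De: "D *\<^sub>v unit_vec (Suc n) 0 = \<mu> \<cdot>\<^sub>v unit_vec (Suc n) 0"
 proof -
  have "D *\<^sub>v unit_vec (Suc n) 0 = H *\<^sub>v (B *\<^sub>v v)"
   unfolding D_def using H B v
   by (simp add: assoc_mult_mat_vec[of _ "Suc n" "Suc n" _ "Suc n"])
  also have "... = \<mu> \<cdot>\<^sub>v unit_vec (Suc n) 0"
   unfolding v(3) using H v Hv by (simp add: mult_mat_vec[of _ "Suc n" "Suc n"])
  finally show ?thesis .
 qed
 have Dsym: "transpose_mat D = D"
  unfolding D_def using H B sym
  by (simp add: transpose_mult[of _ "Suc n" "Suc n" _ "Suc n"] assoc_mult_mat[of _ "Suc n" "Suc n" _ "Suc n" _ "Suc n"] mult_carrier_mat[of _ "Suc n" "Suc n" _ "Suc n"])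
 have D0: "D $$ (i, 0) = (if i = 0 then \<mu> else 0)" if "i < Suc n" for i
  using arg_cong[OF De, of "%w. w $ i"] that D by simp
 have D0': "D $$ (0, i) = (if i = 0 then \<mu> else 0)" if "i < Suc n" for i
  using D0[OF that] arg_cong[OF Dsym, of "%M. M $$ (0,i)"] D that by auto
 define C where "C = mat n n (%(i,j). D $$ (Suc i, Suc j))"
 have C: "C \<in> carrier_mat n n" by (simp add: C_def)
 have "D $$ (i, j) = D $$ (j, i)" if "i < Suc n" "j < Suc n" for i j
  using arg_cong[OF Dsym, of "%M. M $$ (i,j)"] D that by auto
 then have "transpose_mat C = C" by (intro eq_matI) (auto simp: C_def)
 then obtain P' x where P': "P' \<in> carrier_mat n n" "transpose_mat P' * P' = 1\<^sub>m n" "P' * transpose_mat P' = 1\<^sub>m n"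
   "C = P' * dmat n x * transpose_mat P'"
  using Suc.IH[OF C] by blast
 define Q where "Q = four_block_mat (1\<^sub>m 1) (0\<^sub>m 1 n) (0\<^sub>m n 1) P'"
 have Q: "Q \<in> carrier_mat (Suc n) (Suc n)"
  unfolding Q_def using four_block_carrier_mat[of "1\<^sub>m 1" 1 1 P' n n] P'(1) by simp
 have QT: "transpose_mat Q = four_block_mat (1\<^sub>m 1) (0\<^sub>m 1 n) (0\<^sub>m n 1) (transpose_mat P')"
  unfolding Q_def using P'(1) by (subst transpose_four_block_mat[of _ 1 1 _ n _ n]) auto
 have one: "four_block_mat (1\<^sub>m 1) (0\<^sub>m 1 n) (0\<^sub>m n 1) (1\<^sub>m n) = (1\<^sub>m (Suc n) :: real mat)"
  by (rule eq_matI) auto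
 have Q1: "transpose_mat Q * Q = 1\<^sub>m (Suc n)"
  unfolding QT unfolding Q_def using P'
  by (subst mult_four_block_mat[of _ 1 1 _ n _ n _ _ 1 _ n]) (auto simp: one)
 have Q2: "Q * transpose_mat Q = 1\<^sub>m (Suc n)"
  unfolding QT unfolding Q_def using P'
  by (subst mult_four_block_mat[of _ 1 1 _ n _ n _ _ 1 _ n]) (auto simp: one)
 define x' where "x' = (%i. case i of 0 => \<mu> | Suc k => x k)"
 have dm: "dmat (Suc n) x' = four_block_mat (dmat 1 (%_. \<mu>)) (0\<^sub>m 1 n) (0\<^sub>m n 1) (dmat n x)"
  by (rule eq_matI) (auto simp: dmat_def x'_def split: nat.split)
 have Dblock: "D = four_block_mat (dmat 1 (%_. \<mu>)) (0\<^sub>m 1 n) (0\<^sub>m n 1) C"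
  using D D0 D0' by (intro eq_matI) (auto simp: dmat_def C_def)
 have "Q * dmat (Suc n) x' = four_block_mat (dmat 1 (%_. \<mu>)) (0\<^sub>m 1 n) (0\<^sub>m n 1) (P' * dmat n x)"
  unfolding dm Q_def using P'
  by (subst mult_four_block_mat[of _ 1 1 _ n _ n _ _ 1 _ n]) (auto simp: left_mult_one_mat[OF dmat_carrier] left_mult_zero_mat[OF dmat_carrier] right_mult_zero_mat[OF dmat_carrier] simp del: left_mult_one_mat')
 moreover have PD: "P' * dmat n x \<in> carrier_mat n n" using P'(1) by simp
 moreover have "P' * dmat n x * 0\<^sub>m n 1 = 0\<^sub>m n 1" using PD by (rule right_mult_zero_mat)
 moreover have "0\<^sub>m n n + P' * dmat n x * transpose_mat P' = P' * dmat n x * transpose_mat P'"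
  by (rule left_add_zero_mat) (use PD P'(1) in auto)
 ultimately have "Q * dmat (Suc n) x' * transpose_mat Q = D"
  unfolding QT Dblock P'(4) using P'(1)
  by (simp only:, subst mult_four_block_mat[of _ 1 1 _ n _ n _ _ 1 _ n]) (auto simp: right_mult_one_mat[OF dmat_carrier] left_mult_zero_mat[OF dmat_carrier] right_mult_zero_mat[OF dmat_carrier])
 moreover have "B = H * D * H"
 proof -
  have "H * D * H = (H * H) * B * (H * H)" unfolding D_def using H(1,2) B
   by (simp add: assoc_mult_mat[of _ "Suc n" "Suc n" _ "Suc n" _ "Suc n"] mult_carrier_mat[of _ "Suc n" "Suc n" _ "Suc n"])
  then show ?thesis using H(1,2) B unfolding H(3) by simp
 qed
 ultimately have "B = H * (Q * dmat (Suc n) x' * transpose_mat Q) * H" by simp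
 also have "... = (H * Q) * dmat (Suc n) x' * transpose_mat (H * Q)"
  using H(1,2) Q
  by (simp add: transpose_mult[of _ "Suc n" "Suc n" _ "Suc n"] assoc_mult_mat[of _ "Suc n" "Suc n" _ "Suc n" _ "Suc n"] mult_carrier_mat[of _ "Suc n" "Suc n" _ "Suc n"])
 finally have "B = (H * Q) * dmat (Suc n) x' * transpose_mat (H * Q)" .
 moreover have "transpose_mat (H * Q) * (H * Q) = 1\<^sub>m (Suc n)"
 proof -
  have "transpose_mat (H * Q) * (H * Q) = transpose_mat Q * ((H * H) * Q)"
   using H(1,2) Q
   by (simp add: transpose_mult[of _ "Suc n" "Suc n" _ "Suc n"] assoc_mult_mat[of _ "Suc n" "Suc n" _ "Suc n" _ "Suc n"] mult_carrier_mat[of _ "Suc n" "Suc n" _ "Suc n"])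
  then show ?thesis using H Q Q1 by simp
 qed
 moreover have "(H * Q) * transpose_mat (H * Q) = 1\<^sub>m (Suc n)"
 proof -
  have "(H * Q) * transpose_mat (H * Q) = H * ((Q * transpose_mat Q) * H)"
   using H(1,2) Q
   by (simp add: transpose_mult[of _ "Suc n" "Suc n" _ "Suc n"] assoc_mult_mat[of _ "Suc n" "Suc n" _ "Suc n" _ "Suc n"] mult_carrier_mat[of _ "Suc n" "Suc n" _ "Suc n"])
  then show ?thesis using H Q2 by simp
 qed
 moreover have "H * Q \<in> carrier_mat (Suc n) (Suc n)" using H Q by simp
 ultimately show ?case by blast
qed

section \<open>Standard normal families\<close>

abbreviation "std_gauss \<equiv> std_normal_distribution"

text \<open>Independence and marginal laws are encoded by the joint characteristic function, in the real form
that is equivalent to knowing it for all shifts \<open>a\<close>; this makes rotations of the family immediate.\<close>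
definition std_normal_family :: "'w measure => nat => (nat => 'w => real) => bool" where
 "std_normal_family P n z \<longleftrightarrow> (\<forall>k<n. z k \<in> borel_measurable P) \<and>
  (\<forall>t a. (\<integral>\<xi>. cos ((\<Sum>k<n. t k * z k \<xi>) - a) \<partial>P) = exp (- (\<Sum>k<n. (t k)\<^sup>2) / 2) * cos a)"

text \<open>After normalisation \<open>g\<close> is a probability density and the hypothesis is the characteristic function of \<open>X\<close> under it,
so uniqueness of characteristic functions applies.\<close>
lemma (in prob_space) weighted_std_normal:
 fixes X g :: "'a => real"
 assumes [measurable]: "X \<in> borel_measurable M" "g \<in> borel_measurable M"
  and g: "\<And>\<xi>. 0 <= g \<xi>" "\<And>\<xi>. g \<xi> <= B"
  and cf: "\<And>t a. (\<integral>\<xi>. g \<xi> * cos (t * X \<xi> - a) \<partial>M) = exp (- t\<^sup>2 / 2) * cos a * expectation g"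
  and S: "S \<in> sets borel"
 shows "(\<integral>\<xi>. indicator S (X \<xi>) * g \<xi> \<partial>M) = measure std_gauss S * expectation g"
proof -
 have gi: "integrable M g"
  by (rule integrable_const_bound[where B = B]) (auto simp: g abs_of_nonneg)
 define c where "c = expectation g"
 have c0: "c \<ge> 0" unfolding c_def by (rule Bochner_Integration.integral_nonneg) (simp add: g)
 show ?thesis
 proof (cases "c = 0")
  case True
  have "AE \<xi> in M. g \<xi> = 0"
   using integral_nonneg_eq_0_iff_AE[OF gi] True g by (auto simp: c_def)
  then have "(\<integral>\<xi>. indicator S (X \<xi>) * g \<xi> \<partial>M) = (\<integral>\<xi>. 0 \<partial>M)"
   by (intro integral_cong_AE) (use S in auto)
  then show ?thesis using True by (simp add: c_def)
 next
  case False
  define D where "D = density M (%\<xi>. ennreal (g \<xi> / c))"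
  have gc: "0 <= g \<xi> / c" for \<xi> using c0 g by simp
  interpret D: prob_space D
  proof (rule prob_spaceI)
   have "emeasure D (space D) = (\<integral>\<^sup>+\<xi>. ennreal (g \<xi> / c) \<partial>M)"
    by (simp add: D_def emeasure_density cong: nn_integral_cong_simp)
   also have "... = ennreal (\<integral>\<xi>. g \<xi> / c \<partial>M)"
    by (rule nn_integral_eq_integral) (use gi gc in auto)
   also have "(\<integral>\<xi>. g \<xi> / c \<partial>M) = 1" using False by (simp add: c_def)
   finally show "emeasure D (space D) = 1" by simp
  qed
  have XD [measurable]: "X \<in> borel_measurable D" by (simp add: D_def)
  have dens: "(\<integral>\<xi>. h \<xi> \<partial>D) = (\<integral>\<xi>. g \<xi> * h \<xi> \<partial>M) / c" if [measurable]: "h \<in> borel_measurable M" for h :: "'a => real"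
  proof -
   have "(\<integral>\<xi>. h \<xi> \<partial>D) = (\<integral>\<xi>. (g \<xi> / c) *\<^sub>R h \<xi> \<partial>M)"
    unfolding D_def by (rule integral_density) (use gc in auto)
   also have "... = (\<integral>\<xi>. g \<xi> * h \<xi> / c \<partial>M)"
    by (intro Bochner_Integration.integral_cong) auto
   finally show ?thesis by simp
  qed
  have "distr D borel X = std_gauss"
  proof (rule Levy_uniqueness)
   show "real_distribution (distr D borel X)" by (rule D.real_distribution_distr) (rule XD)
   show "char (distr D borel X) = char std_gauss"
   proof
    fix t
    have i: "integrable D (%\<xi>. iexp (t * X \<xi>))"
     using D.integrable_iexp[of "%\<xi>. t * X \<xi>"] by simp
    have "char (distr D borel X) t = (CLINT \<xi>|D. iexp (t * X \<xi>))"
     by (simp add: char_def integral_distr)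
    also have "... = Complex (\<integral>\<xi>. cos (t * X \<xi>) \<partial>D) (\<integral>\<xi>. sin (t * X \<xi>) \<partial>D)"
     using integral_Re[OF i] integral_Im[OF i] by (simp add: complex_eq_iff Re_exp Im_exp)
    also have "(\<integral>\<xi>. cos (t * X \<xi>) \<partial>D) = exp (- t\<^sup>2 / 2)"
     using cf[of t 0] False by (subst dens) (auto simp: c_def)
    also have "(\<integral>\<xi>. sin (t * X \<xi>) \<partial>D) = 0"
     using cf[of t "pi/2"] by (subst dens) (auto simp: cos_sin_eq)
    finally show "char (distr D borel X) t = char std_gauss t"
     by (simp add: char_std_normal_distribution complex_eq_iff)
   qed
  qed (rule real_dist_normal_dist)
  then have "measure std_gauss S = measure (distr D borel X) S" by simp
  also have "... = measure D (X -` S \<inter> space D)" using S by (simp add: measure_distr)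
  also have "... = (\<integral>\<xi>. indicator (X -` S \<inter> space D) \<xi> \<partial>D)"
   using S by simp
  also have "... = (\<integral>\<xi>. indicator S (X \<xi>) \<partial>D)"
   by (intro Bochner_Integration.integral_cong) (auto simp: indicator_def)
  also have "... = (\<integral>\<xi>. g \<xi> * indicator S (X \<xi>) \<partial>M) / c"
   using S by (intro dens) auto
  finally show ?thesis using False by (simp add: c_def mult.commute)
 qed
qed

text \<open>The indicators are inserted one variable at a time: those already present are part of the weight \<open>g\<close>, and
\<open>weighted_std_normal\<close> applies to the next variable.\<close>
lemma (in prob_space) std_normal_prob_product:
 assumes "finite I" "\<And>k. k \<in> I ==> z k \<in> borel_measurable M" "\<And>k. k \<in> I ==> S k \<in> sets borel"
  and "g \<in> borel_measurable M" "\<And>\<xi>. 0 <= g \<xi>" "\<And>\<xi>. g \<xi> <= (1::real)"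
  and "\<And>t a. (\<integral>\<xi>. g \<xi> * cos ((\<Sum>k\<in>I. t k * z k \<xi>) - a) \<partial>M)
    = exp (- (\<Sum>k\<in>I. (t k)\<^sup>2) / 2) * cos a * expectation g"
 shows "(\<integral>\<xi>. (\<Prod>k\<in>I. indicator (S k) (z k \<xi>)) * g \<xi> \<partial>M)
  = (\<Prod>k\<in>I. measure std_gauss (S k)) * expectation g"
 using assms
proof (induction I arbitrary: g rule: finite_induct)
 case empty
 then show ?case by simp
next
 case (insert x I)
 note [measurable] = insert.prems(3)
 have zm [measurable]: "z x \<in> borel_measurable M" and Sm [measurable]: "S x \<in> sets borel"
  using insert.prems(1,2) by auto
 have [measurable]: "(%\<xi>. \<Sum>k\<in>I. t k * z k \<xi>) \<in> borel_measurable M" for t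
  using insert.prems(1) by (intro borel_measurable_sum borel_measurable_times) auto
 note g = insert.prems(4,5)
 have bint: "integrable M (%\<xi>. g \<xi> * h \<xi>)" if [measurable]: "h \<in> borel_measurable M" and "\<And>\<xi>. \<bar>h \<xi>\<bar> <= 1" for h
  by (rule integrable_const_bound[where B = 1]) (auto simp: abs_mult g abs_of_nonneg that intro!: mult_le_one)
 have gi: "integrable M g" using bint[of "%_. 1"] by simp
 have cf: "(\<integral>\<xi>. g \<xi> * cos (r * z x \<xi> + ((\<Sum>k\<in>I. t k * z k \<xi>) - a)) \<partial>M)
   = exp (- r\<^sup>2 / 2) * exp (- (\<Sum>k\<in>I. (t k)\<^sup>2) / 2) * cos a * expectation g" for r t a
 proof -
  have "(\<Sum>k\<in>I. (t(x := r)) k * z k \<xi>) = (\<Sum>k\<in>I. t k * z k \<xi>)" for \<xi>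
   using insert.hyps by (intro sum.cong) auto
  moreover have "(\<Sum>k\<in>I. ((t(x := r)) k)\<^sup>2) = (\<Sum>k\<in>I. (t k)\<^sup>2)"
   using insert.hyps by (intro sum.cong) auto
  ultimately show ?thesis
   using insert.prems(6)[of "t(x := r)" a] insert.hyps
   by (simp add: add_diff_eq exp_add[symmetric] add_divide_distrib)
 qed
 have base: "(\<integral>\<xi>. indicator (S x) (z x \<xi>) * g \<xi> \<partial>M) = measure std_gauss (S x) * expectation g"
  by (rule weighted_std_normal[where B = 1]) (use g cf[of _ "%_. 0"] in auto)
 have key: "(\<integral>\<xi>. indicator (S x) (z x \<xi>) * g \<xi> * cos ((\<Sum>k\<in>I. t k * z k \<xi>) - a) \<partial>M)
   = exp (- (\<Sum>k\<in>I. (t k)\<^sup>2) / 2) * cos a * (\<integral>\<xi>. indicator (S x) (z x \<xi>) * g \<xi> \<partial>M)" for t a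
 proof -
  define Z where "Z = (%\<xi>. (\<Sum>k\<in>I. t k * z k \<xi>) - a)"
  define e where "e = exp (- (\<Sum>k\<in>I. (t k)\<^sup>2) / 2)"
  have [measurable]: "Z \<in> borel_measurable M" by (simp add: Z_def)
  define w where "w \<xi> = g \<xi> * (1 + cos (Z \<xi>))" for \<xi>
  have wE: "expectation w = (1 + e * cos a) * expectation g"
  proof -
   have "expectation w = expectation g + (\<integral>\<xi>. g \<xi> * cos (Z \<xi>) \<partial>M)"
    unfolding w_def distrib_left using gi bint by (subst Bochner_Integration.integral_add) auto
   then show ?thesis using cf[of 0 t a] by (simp add: Z_def e_def distrib_right)
  qed
  have "(\<integral>\<xi>. indicator (S x) (z x \<xi>) * w \<xi> \<partial>M) = measure std_gauss (S x) * expectation w"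
  proof (rule weighted_std_normal[where B = 2])
   fix \<xi>
   have c: "cos (Z \<xi>) \<ge> -1" "cos (Z \<xi>) <= 1" by auto
   then show "0 <= w \<xi>" unfolding w_def using g[of \<xi>] by (intro mult_nonneg_nonneg) linarith+
   have "w \<xi> <= 1 * 2" unfolding w_def using g[of \<xi>] c by (intro mult_mono) linarith+
   then show "w \<xi> <= 2" by simp
  next
   fix r b
   have "w \<xi> * cos (r * z x \<xi> - b) = g \<xi> * cos (r * z x \<xi> - b)
     + (g \<xi> * cos (r * z x \<xi> + ((\<Sum>k\<in>I. t k * z k \<xi>) - (a + b)))
      + g \<xi> * cos ((- r) * z x \<xi> + ((\<Sum>k\<in>I. t k * z k \<xi>) - (a - b)))) / 2" for \<xi>
   proof -
    have "cos (Z \<xi>) * cos (r * z x \<xi> - b) = (cos (Z \<xi> - (r * z x \<xi> - b)) + cos (Z \<xi> + (r * z x \<xi> - b))) / 2"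
     by (rule cos_times_cos)
    also have "Z \<xi> - (r * z x \<xi> - b) = (- r) * z x \<xi> + ((\<Sum>k\<in>I. t k * z k \<xi>) - (a - b))"
     by (simp add: Z_def)
    also have "Z \<xi> + (r * z x \<xi> - b) = r * z x \<xi> + ((\<Sum>k\<in>I. t k * z k \<xi>) - (a + b))"
     by (simp add: Z_def)
    finally have "w \<xi> * cos (r * z x \<xi> - b) = g \<xi> * cos (r * z x \<xi> - b) + g \<xi> * ((cos ((- r) * z x \<xi> + ((\<Sum>k\<in>I. t k * z k \<xi>) - (a - b))) + cos (r * z x \<xi> + ((\<Sum>k\<in>I. t k * z k \<xi>) - (a + b)))) / 2)"
     by (metis (no_types, lifting) w_def distrib_left distrib_right mult.assoc mult.right_neutral)
    then show ?thesis by (simp add: algebra_simps)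
   qed
   then have "(\<integral>\<xi>. w \<xi> * cos (r * z x \<xi> - b) \<partial>M) = (\<integral>\<xi>. g \<xi> * cos (r * z x \<xi> - b)
     + (g \<xi> * cos (r * z x \<xi> + ((\<Sum>k\<in>I. t k * z k \<xi>) - (a + b)))
      + g \<xi> * cos ((- r) * z x \<xi> + ((\<Sum>k\<in>I. t k * z k \<xi>) - (a - b)))) / 2 \<partial>M)" by simp
   also have "... = (\<integral>\<xi>. g \<xi> * cos (r * z x \<xi> - b) \<partial>M)
     + ((\<integral>\<xi>. g \<xi> * cos (r * z x \<xi> + ((\<Sum>k\<in>I. t k * z k \<xi>) - (a + b))) \<partial>M)
      + (\<integral>\<xi>. g \<xi> * cos ((- r) * z x \<xi> + ((\<Sum>k\<in>I. t k * z k \<xi>) - (a - b))) \<partial>M)) / 2"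
    using bint by (subst Bochner_Integration.integral_add, simp, simp, subst integral_divide_zero, subst Bochner_Integration.integral_add) auto
   also have "... = exp (- r\<^sup>2 / 2) * expectation g * (cos b + e * ((cos (a + b) + cos (a - b)) / 2))"
    unfolding cf using cf[of r "%_. 0" b] by (simp add: e_def algebra_simps add_divide_distrib)
   also have "(cos (a + b) + cos (a - b)) / 2 = cos a * cos b"
    by (simp add: cos_times_cos)
   finally show "(\<integral>\<xi>. w \<xi> * cos (r * z x \<xi> - b) \<partial>M) = exp (- r\<^sup>2 / 2) * cos b * expectation w"
    unfolding wE by (simp add: algebra_simps)
  qed (auto simp: w_def)
  also have "(\<integral>\<xi>. indicator (S x) (z x \<xi>) * w \<xi> \<partial>M) =
    (\<integral>\<xi>. g \<xi> * indicator (S x) (z x \<xi>) + g \<xi> * (indicator (S x) (z x \<xi>) * cos (Z \<xi>)) \<partial>M)"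
   by (intro Bochner_Integration.integral_cong) (auto simp: w_def algebra_simps)
  also have "... = (\<integral>\<xi>. g \<xi> * indicator (S x) (z x \<xi>) \<partial>M) + (\<integral>\<xi>. g \<xi> * (indicator (S x) (z x \<xi>) * cos (Z \<xi>)) \<partial>M)"
   by (intro Bochner_Integration.integral_add bint) (auto simp: indicator_def abs_mult)
  finally show ?thesis
   using base unfolding wE by (simp add: Z_def e_def algebra_simps)
 qed
 have "(\<integral>\<xi>. (\<Prod>k\<in>insert x I. indicator (S k) (z k \<xi>)) * g \<xi> \<partial>M)
   = (\<integral>\<xi>. (\<Prod>k\<in>I. indicator (S k) (z k \<xi>)) * (indicator (S x) (z x \<xi>) * g \<xi>) \<partial>M)"
  using insert.hyps by (intro Bochner_Integration.integral_cong) (auto simp: ac_simps)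
 also have "... = (\<Prod>k\<in>I. measure std_gauss (S k)) * (\<integral>\<xi>. indicator (S x) (z x \<xi>) * g \<xi> \<partial>M)"
  by (rule insert.IH) (use insert.prems(1,2) g key in \<open>auto simp: indicator_def\<close>)
 finally show ?case using base insert.hyps by simp
qed

lemma (in prob_space) std_normal_family_prob:
 assumes fam: "std_normal_family M n z"
  and I: "I \<subseteq> {..<n}" "I \<noteq> {}" and S: "\<And>k. k \<in> I ==> S k \<in> sets borel"
 shows "prob (\<Inter>k\<in>I. z k -` S k \<inter> space M) = (\<Prod>k\<in>I. measure std_gauss (S k))"
 proof -
 have zm: "z k \<in> borel_measurable M" if "k < n" for k using fam that by (auto simp: std_normal_family_def)
  have fI: "finite I" using I finite_subset by blast
  have "(\<integral>\<xi>. (\<Prod>k\<in>I. indicator (S k) (z k \<xi>)) * 1 \<partial>M)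
   = (\<Prod>k\<in>I. measure std_gauss (S k)) * expectation (%_. 1)"
  proof (rule std_normal_prob_product[OF fI, where z = z and S = S and g = "%_. 1"])
   fix t :: "nat => real" and a
   have "(\<Sum>k<n. (if k \<in> I then t k else 0) * z k \<xi>) = (\<Sum>k\<in>I. t k * z k \<xi>)" for \<xi>
    using I(1) by (intro sum.mono_neutral_cong_right) auto
   moreover have "(\<Sum>k<n. (if k \<in> I then t k else 0)\<^sup>2) = (\<Sum>k\<in>I. (t k)\<^sup>2)"
    using I(1) by (intro sum.mono_neutral_cong_right) auto
   ultimately show "(\<integral>\<xi>. 1 * cos ((\<Sum>k\<in>I. t k * z k \<xi>) - a) \<partial>M) = exp (- (\<Sum>k\<in>I. (t k)\<^sup>2) / 2) * cos a * expectation (%_. 1)"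
    using fam[unfolded std_normal_family_def, THEN conjunct2, rule_format, of "%k. if k \<in> I then t k else 0" a]
    by (simp add: prob_space)
  qed (use I zm S in auto)
  moreover have "(\<integral>\<xi>. (\<Prod>k\<in>I. indicator (S k) (z k \<xi>)) * 1 \<partial>M) = (\<integral>\<xi>. (indicator (\<Inter>k\<in>I. z k -` S k \<inter> space M) \<xi> :: real) \<partial>M)"
  proof (intro Bochner_Integration.integral_cong refl)
   fix \<xi> assume "\<xi> \<in> space M"
   then show "(\<Prod>k\<in>I. indicator (S k) (z k \<xi>)) * 1 = (indicator (\<Inter>k\<in>I. z k -` S k \<inter> space M) \<xi> :: real)"
    using fI I(2) by (auto simp: indicator_def prod_eq_1_iff intro!: prod.neutral)
  qed
  moreover have "(\<Inter>k\<in>I. z k -` S k \<inter> space M) \<in> events"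
   using I fI zm S by (intro sets.finite_INT) (auto intro!: measurable_sets)
  ultimately show ?thesis by (simp add: prob_space)
 qed

lemma (in prob_space) std_normal_family_distr:
 assumes fam: "std_normal_family M n z" and k: "k < n"
 shows "distr M borel (z k) = std_gauss"
 proof (rule measure_eqI)
  have zm: "z k \<in> borel_measurable M" using assms by (auto simp: std_normal_family_def)
  interpret N: real_distribution std_gauss by (rule real_dist_normal_dist)
  interpret D: prob_space "distr M borel (z k)" by (rule prob_space_distr) (rule zm)
  fix A assume A: "A \<in> sets (distr M borel (z k))"
  then have "prob (z k -` A \<inter> space M) = measure std_gauss A"
   using std_normal_family_prob[OF fam, of "{k}" "%_. A"] k by simp
  then have "measure (distr M borel (z k)) A = measure std_gauss A"
   using A zm by (simp add: measure_distr)
  then show "emeasure (distr M borel (z k)) A = emeasure std_gauss A"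
   by (simp add: D.emeasure_eq_measure N.emeasure_eq_measure)
 qed simp

lemma (in prob_space) std_normal_family_indep:
 assumes fam: "std_normal_family M n z"
 shows "indep_vars (%_. borel) z {..<n}"
proof -
 have zm: "z k \<in> borel_measurable M" if "k < n" for k using fam that by (auto simp: std_normal_family_def)
 have "indep_sets (%i. {z i -` A \<inter> space M |A. A \<in> sets borel}) {..<n}"
 proof (rule indep_setsI)
  fix k assume "k \<in> {..<n}" then show "{z k -` A \<inter> space M |A. A \<in> sets borel} \<subseteq> events"
   using zm by (auto intro!: measurable_sets)
 next
  fix A J assume J: "J \<noteq> {}" "J \<subseteq> {..<n}" "finite J" "\<forall>j\<in>J. A j \<in> {z j -` A \<inter> space M |A. A \<in> sets borel}"
  then obtain S where S: "\<And>j. j \<in> J ==> S j \<in> sets borel \<and> A j = z j -` S j \<inter> space M"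
   by (simp add: Bex_def) metis
  have "prob (\<Inter>j\<in>J. A j) = prob (\<Inter>j\<in>J. z j -` S j \<inter> space M)"
   using S by (intro arg_cong[where f = prob] INF_cong refl) auto
  also have "... = (\<Prod>k\<in>J. measure std_gauss (S k))"
   by (rule std_normal_family_prob[OF fam J(2,1)]) (use S in auto)
  also have "... = (\<Prod>k\<in>J. prob (A k))"
  proof (intro prod.cong refl)
   fix k assume k: "k \<in> J"
   then have "k < n" using J(2) by auto
   then show "measure std_gauss (S k) = prob (A k)"
    using S[OF k] zm by (simp add: std_normal_family_distr[OF fam, symmetric] measure_distr)
  qed
  finally show "prob (\<Inter>j\<in>J. A j) = (\<Prod>j\<in>J. prob (A j))" .
 qed
 then show "indep_vars (%_. borel) z {..<n}"
  unfolding indep_vars_def2 using zm by simp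
qed

section \<open>A continuity theorem for the standard normal law\<close>

lemma lborel_vec_prod_integral:
 fixes h :: "'p::finite => real => 'b :: {real_normed_field, banach, second_countable_topology}"
 assumes h: "\<And>i. integrable lborel (h i)"
 shows "integrable (lborel :: (real^'p) measure) (%x. \<Prod>i\<in>UNIV. h i (x $ i))"
  "(\<integral>x. (\<Prod>i\<in>UNIV. h i (x $ i)) \<partial>(lborel :: (real^'p) measure)) = (\<Prod>i\<in>UNIV. \<integral>t. h i t \<partial>lborel)"
proof -
 interpret product_sigma_finite "%_::real^'p. lborel :: real measure" ..
 define H where "H b = h (THE i. b = axis i 1)" for b :: "real^'p"
 have H: "H (axis i 1) = h i" for i by (simp add: H_def axis_eq_axis)
 have B: "(Basis :: (real^'p) set) = (%i. axis i 1) ` UNIV" by (auto simp: Basis_vec_def)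
 have inj: "inj (%i. axis i (1::real) :: real^'p)" by (auto simp: inj_on_def axis_eq_axis)
 have Hm [measurable]: "H b \<in> borel_measurable borel" if "b \<in> Basis" for b
  using that h by (auto simp: B H)
 have e: "(\<Prod>b\<in>Basis. H b (f b)) = (\<Prod>i\<in>UNIV. h i ((\<Sum>b\<in>Basis. f b *\<^sub>R b) $ i))" for f :: "real^'p => real"
 proof -
  have "(\<Sum>b\<in>Basis. f b *\<^sub>R b) $ i = f (axis i 1)" for i
  proof -
   have "(\<Sum>b\<in>Basis. f b *\<^sub>R b) \<bullet> axis i 1 = f (axis i 1)"
    by (rule inner_sum_left_Basis) (simp add: B)
   then show ?thesis by (simp add: inner_axis)
  qed
  then show ?thesis
   by (simp add: B prod.reindex[OF inj] H)
 qed
 have m [measurable]: "(%x::real^'p. \<Prod>i\<in>UNIV. h i (x $ i)) \<in> borel_measurable borel"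
 proof (intro borel_measurable_prod)
  fix i
  have [measurable]: "h i \<in> borel_measurable borel" using h by (auto dest: borel_measurable_integrable)
  show "(%x. h i (x $ i)) \<in> borel_measurable borel" by measurable
 qed
 have i: "integrable lborel (H b)" if "b \<in> Basis" for b using that h by (auto simp: B H)
 have P: "integrable (\<Pi>\<^sub>M b\<in>Basis. lborel) (%f. \<Prod>b\<in>Basis. H b (f b))"
  "(\<integral>f. (\<Prod>b\<in>Basis. H b (f b)) \<partial>(\<Pi>\<^sub>M b\<in>Basis. lborel)) = (\<Prod>b\<in>Basis. \<integral>t. H b t \<partial>lborel)"
  using i by (auto intro!: product_integrable_prod product_integral_prod)
 have T: "(%f. \<Sum>b\<in>Basis. f b *\<^sub>R b) \<in> measurable (\<Pi>\<^sub>M b\<in>Basis. lborel) (borel :: (real^'p) measure)"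
  by simp
 show "integrable (lborel :: (real^'p) measure) (%x. \<Prod>i\<in>UNIV. h i (x $ i))"
  by (subst lborel_eq, subst integrable_distr_eq[OF T m], subst e[symmetric], rule P(1))
 have "(\<integral>x. (\<Prod>i\<in>UNIV. h i (x $ i)) \<partial>(lborel :: (real^'p) measure))
  = (\<integral>f. (\<Prod>b\<in>Basis. H b (f b)) \<partial>(\<Pi>\<^sub>M b\<in>Basis. lborel))"
  by (subst lborel_eq, subst integral_distr[OF T m], subst e, rule refl)
 also have "... = (\<Prod>i\<in>UNIV. \<integral>t. h i t \<partial>lborel)"
  unfolding P(2) by (simp add: B prod.reindex[OF inj] H)
 finally show "(\<integral>x. (\<Prod>i\<in>UNIV. h i (x $ i)) \<partial>(lborel :: (real^'p) measure)) = (\<Prod>i\<in>UNIV. \<integral>t. h i t \<partial>lborel)" .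
qed

lemma std_normal_vec_density_nonneg: "0 <= (\<Prod>i\<in>UNIV. std_normal_density ((x::real^'p) $ i))"
 by (intro prod_nonneg) auto

lemma std_normal_vec_density_measurable [measurable]:
 "(%x::real^'p. \<Prod>i\<in>UNIV. std_normal_density (x $ i)) \<in> borel_measurable borel"
 by measurable

lemma sets_std_normal_vec [measurable_cong, simp]: "sets (std_normal_vec :: (real^'p) measure) = sets borel"
 by (simp add: std_normal_vec_def)

lemma space_std_normal_vec [simp]: "space (std_normal_vec :: (real^'p) measure) = UNIV"
 by (simp add: std_normal_vec_def)

lemma integral_std_normal_vec:
 fixes h :: "real^'p => 'b :: {banach, second_countable_topology}"
 assumes [measurable]: "h \<in> borel_measurable borel"
 shows "(\<integral>x. h x \<partial>std_normal_vec) = (\<integral>x. (\<Prod>i\<in>UNIV. std_normal_density (x $ i)) *\<^sub>R h x \<partial>lborel)"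
 unfolding std_normal_vec_def by (rule integral_density) (auto intro!: prod_nonneg)

lemma prob_space_std_normal_vec: "prob_space (std_normal_vec :: (real^'p) measure)"
proof (rule prob_spaceI)
 have i: "integrable lborel (std_normal_density)" by (rule integrable_normal_density) simp
 have "emeasure (std_normal_vec :: (real^'p) measure) (space std_normal_vec)
  = (\<integral>\<^sup>+x. ennreal (\<Prod>i\<in>UNIV. std_normal_density ((x::real^'p) $ i)) \<partial>lborel)"
  by (simp add: std_normal_vec_def emeasure_density)
 also have "... = ennreal (\<integral>x. (\<Prod>i\<in>UNIV. std_normal_density ((x::real^'p) $ i)) \<partial>lborel)"
  by (rule nn_integral_eq_integral) (use lborel_vec_prod_integral(1)[of "%_. std_normal_density"] i in \<open>auto intro!: prod_nonneg\<close>)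
 also have "(\<integral>x. (\<Prod>i\<in>UNIV. std_normal_density ((x::real^'p) $ i)) \<partial>lborel) = 1"
  using lborel_vec_prod_integral(2)[of "%_. std_normal_density"] i integral_normal_density by simp
 finally show "emeasure (std_normal_vec :: (real^'p) measure) (space std_normal_vec) = 1" by simp
qed

lemma std_normal_vec_char:
 fixes l :: "real^'p"
 shows "(CLINT x|std_normal_vec. iexp (l \<bullet> x)) = of_real (exp (- (norm l)\<^sup>2 / 2))"
proof -
 have one: "integrable lborel (%t. std_normal_density t *\<^sub>R iexp (s * t)) \<and> (\<integral>t. std_normal_density t *\<^sub>R iexp (s * t) \<partial>lborel) = of_real (exp (- s\<^sup>2 / 2))" for s
 proof -
  have "(\<integral>t. std_normal_density t *\<^sub>R iexp (s * t) \<partial>lborel) = char std_gauss s"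
   unfolding char_def by (subst integral_density) auto
  moreover have "integrable lborel (%t. std_normal_density t *\<^sub>R iexp (s * t))"
   by (rule Bochner_Integration.integrable_bound[OF integrable_normal_density[of 1 0]]) auto
  ultimately show ?thesis by (simp add: char_std_normal_distribution)
 qed
 have "(CLINT x|std_normal_vec. iexp (l \<bullet> x)) = (\<integral>x. (\<Prod>i\<in>UNIV. std_normal_density (x $ i)) *\<^sub>R iexp (l \<bullet> x) \<partial>lborel)"
  by (rule integral_std_normal_vec) simp
 also have "... = (\<integral>x. (\<Prod>i\<in>UNIV. std_normal_density (x $ i) *\<^sub>R iexp (l $ i * x $ i)) \<partial>lborel)"
 proof (intro Bochner_Integration.integral_cong refl)
  fix x :: "real^'p"
  have "iexp (l \<bullet> x) = exp (\<Sum>i\<in>UNIV. \<i> * complex_of_real (l $ i * x $ i))"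
   by (simp add: inner_vec_def sum_distrib_left)
  also have "... = (\<Prod>i\<in>UNIV. iexp (l $ i * x $ i))" by (rule exp_sum) simp
  finally have e: "iexp (l \<bullet> x) = (\<Prod>i\<in>UNIV. iexp (l $ i * x $ i))" .
  show "(\<Prod>i\<in>UNIV. std_normal_density (x $ i)) *\<^sub>R iexp (l \<bullet> x) = (\<Prod>i\<in>UNIV. std_normal_density (x $ i) *\<^sub>R iexp (l $ i * x $ i))"
   unfolding e scaleR_conv_of_real prod.distrib by simp
 qed
 also have "... = (\<Prod>i\<in>UNIV. of_real (exp (- (l $ i)\<^sup>2 / 2)))"
  using one by (subst lborel_vec_prod_integral(2)) auto
 also have "... = of_real (exp (- (norm l)\<^sup>2 / 2))"
 proof -
  have "(\<Prod>i\<in>UNIV. exp (- (l $ i)\<^sup>2 / 2)) = exp (\<Sum>i\<in>UNIV. - (l $ i)\<^sup>2 / 2)" by (rule exp_sum[symmetric]) simp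
  also have "(\<Sum>i\<in>UNIV. - (l $ i)\<^sup>2 / 2) = - (norm l)\<^sup>2 / 2"
   by (simp add: norm_vec_def L2_set_def sum_nonneg sum_divide_distrib[symmetric] sum_negf)
  finally show ?thesis by (simp only: of_real_prod[symmetric])
 qed
 finally show ?thesis .
qed

lemma (in prob_space) cos_shift_eq_Re:
 fixes X :: "'a => real"
 assumes [measurable]: "X \<in> borel_measurable M"
 shows "(\<integral>\<xi>. cos (X \<xi> - a) \<partial>M) = Re (iexp (- a) * (CLINT \<xi>|M. iexp (X \<xi>)))"
proof -
 have i: "integrable M (%\<xi>. iexp (- a) * iexp (X \<xi>))"
  by (intro integrable_mult_right integrable_iexp) auto
 have "Re (iexp (- a) * (CLINT \<xi>|M. iexp (X \<xi>))) = (\<integral>\<xi>. Re (iexp (- a) * iexp (X \<xi>)) \<partial>M)"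
  using integral_Re[OF i] by simp
 also have "... = (\<integral>\<xi>. cos (X \<xi> - a) \<partial>M)"
  by (intro Bochner_Integration.integral_cong) (auto simp: exp_add[symmetric] Re_exp)
 finally show ?thesis by simp
qed

lemma std_normal_vec_cos:
 fixes l :: "real^'p"
 shows "(\<integral>x. cos (l \<bullet> x - a) \<partial>std_normal_vec) = exp (- (norm l)\<^sup>2 / 2) * cos a"
proof -
 interpret prob_space "std_normal_vec :: (real^'p) measure" by (rule prob_space_std_normal_vec)
 have "(\<integral>x. cos (l \<bullet> x - a) \<partial>std_normal_vec) = Re (iexp (- a) * of_real (exp (- (norm l)\<^sup>2 / 2)))"
  by (subst cos_shift_eq_Re) (simp_all add: std_normal_vec_char)
 then show ?thesis by (simp add: Re_exp)
qed

text \<open>The Gaussian kernel is its own Fourier transform, up to scaling.\<close>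
lemma gaussian_kernel_expectation:
 fixes T :: "'w => real^'p"
 assumes P: "prob_space P" and [measurable]: "T \<in> borel_measurable P"
 shows "(\<integral>\<xi>. exp (- (norm (\<sigma> *\<^sub>R (T \<xi> - v)))\<^sup>2 / 2) \<partial>P) = (\<integral>w. (\<integral>\<xi>. cos ((\<sigma> *\<^sub>R w) \<bullet> T \<xi> - (\<sigma> *\<^sub>R w) \<bullet> v) \<partial>P) \<partial>std_normal_vec)"
proof -
 interpret P: prob_space P by fact
 interpret N: prob_space "std_normal_vec :: (real^'p) measure" by (rule prob_space_std_normal_vec)
 interpret NP: pair_prob_space P "std_normal_vec :: (real^'p) measure" ..
 have "exp (- (norm (\<sigma> *\<^sub>R (T \<xi> - v)))\<^sup>2 / 2) = (\<integral>w. cos ((\<sigma> *\<^sub>R w) \<bullet> T \<xi> - (\<sigma> *\<^sub>R w) \<bullet> v) \<partial>std_normal_vec)" for \<xi>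
  using std_normal_vec_cos[of "\<sigma> *\<^sub>R (T \<xi> - v)" 0] by (simp add: inner_diff_right inner_diff_left algebra_simps inner_commute)
 then have "(\<integral>\<xi>. exp (- (norm (\<sigma> *\<^sub>R (T \<xi> - v)))\<^sup>2 / 2) \<partial>P) = (\<integral>\<xi>. (\<integral>w. cos ((\<sigma> *\<^sub>R w) \<bullet> T \<xi> - (\<sigma> *\<^sub>R w) \<bullet> v) \<partial>std_normal_vec) \<partial>P)" by simp
 also have "... = (\<integral>w. (\<integral>\<xi>. cos ((\<sigma> *\<^sub>R w) \<bullet> T \<xi> - (\<sigma> *\<^sub>R w) \<bullet> v) \<partial>P) \<partial>std_normal_vec)"
 proof (rule NP.Fubini_integral[symmetric])
  show "integrable (P \<Otimes>\<^sub>M std_normal_vec) (%(\<xi>, w). cos ((\<sigma> *\<^sub>R w) \<bullet> T \<xi> - (\<sigma> *\<^sub>R w) \<bullet> v))"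
   by (rule NP.integrable_const_bound[where B = 1]) (auto simp: split_beta)
 qed
 finally show ?thesis .
qed

lemma gaussian_kernel_convergence:
 fixes T :: "nat => 'w => real^'p"
 assumes P: "prob_space P" and T [measurable]: "\<And>n. T n \<in> borel_measurable P"
  and cf: "\<And>l a. (%n. \<integral>\<xi>. cos (l \<bullet> T n \<xi> - a) \<partial>P) \<longlonglongrightarrow> exp (- (norm l)\<^sup>2 / 2) * cos a"
 shows "(%n. \<integral>\<xi>. exp (- (norm (\<sigma> *\<^sub>R (T n \<xi> - v)))\<^sup>2 / 2) \<partial>P)
   \<longlonglongrightarrow> (\<integral>x. exp (- (norm (\<sigma> *\<^sub>R (x - v)))\<^sup>2 / 2) \<partial>std_normal_vec)"
proof -
 interpret P: prob_space P by fact
 interpret N: prob_space "std_normal_vec :: (real^'p) measure" by (rule prob_space_std_normal_vec)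
 have lim: "(\<integral>x. exp (- (norm (\<sigma> *\<^sub>R (x - v)))\<^sup>2 / 2) \<partial>std_normal_vec)
   = (\<integral>w. exp (- (norm (\<sigma> *\<^sub>R w))\<^sup>2 / 2) * cos ((\<sigma> *\<^sub>R w) \<bullet> v) \<partial>std_normal_vec)"
  by (subst gaussian_kernel_expectation[OF prob_space_std_normal_vec]) (simp_all only: std_normal_vec_cos, simp)
 show ?thesis
  unfolding lim gaussian_kernel_expectation[OF P T]
 proof (rule integral_dominated_convergence[where w = "%_. 1"])
  show "AE w in std_normal_vec. norm (\<integral>\<xi>. cos ((\<sigma> *\<^sub>R w) \<bullet> T n \<xi> - (\<sigma> *\<^sub>R w) \<bullet> v) \<partial>P) <= 1" for n
  proof (intro AE_I2)
   fix w
   have "norm (\<integral>\<xi>. cos ((\<sigma> *\<^sub>R w) \<bullet> T n \<xi> - (\<sigma> *\<^sub>R w) \<bullet> v) \<partial>P) <= (\<integral>\<xi>. norm (cos ((\<sigma> *\<^sub>R w) \<bullet> T n \<xi> - (\<sigma> *\<^sub>R w) \<bullet> v)) \<partial>P)"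
    by (rule integral_norm_bound)
   also have "... <= (\<integral>\<xi>. 1 \<partial>P)"
    by (rule integral_mono) (auto intro!: P.integrable_const_bound[where B = 1])
   finally show "norm (\<integral>\<xi>. cos ((\<sigma> *\<^sub>R w) \<bullet> T n \<xi> - (\<sigma> *\<^sub>R w) \<bullet> v) \<partial>P) <= 1" by (simp add: P.prob_space)
  qed
  show "AE w in std_normal_vec. (%n. \<integral>\<xi>. cos ((\<sigma> *\<^sub>R w) \<bullet> T n \<xi> - (\<sigma> *\<^sub>R w) \<bullet> v) \<partial>P)
   \<longlonglongrightarrow> exp (- (norm (\<sigma> *\<^sub>R w))\<^sup>2 / 2) * cos ((\<sigma> *\<^sub>R w) \<bullet> v)"
   by (intro AE_I2 cf)
 qed auto
qed

section \<open>Quadratic forms and likelihood ratios in independent normal variables\<close>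

lemma std_normal_even_moment_integrable:
 "integrable std_gauss (%x. (x\<^sup>2 + c) ^ k)"
proof -
 have "(%x::real. (x\<^sup>2 + c) ^ k) = (%x. \<Sum>j\<le>k. of_nat (k choose j) * c ^ (k - j) * x ^ (2 * j))"
 proof
  fix x :: real
  have "(x\<^sup>2 + c) ^ k = (\<Sum>j\<le>k. of_nat (k choose j) * (x\<^sup>2) ^ j * c ^ (k - j))" by (rule binomial_ring)
  also have "... = (\<Sum>j\<le>k. of_nat (k choose j) * c ^ (k - j) * x ^ (2 * j))"
   by (intro sum.cong refl) (simp only: power_mult[symmetric] ac_simps)
  finally show "(x\<^sup>2 + c) ^ k = (\<Sum>j\<le>k. of_nat (k choose j) * c ^ (k - j) * x ^ (2 * j))" .
 qed
 then show ?thesis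
  by (simp only:) (intro Bochner_Integration.integrable_sum integrable_mult_right integrable_std_normal_distribution_moment)
qed

lemma std_normal_moments:
 "(\<integral>x. x\<^sup>2 - 1 \<partial>std_gauss) = 0"
 "(\<integral>x. (x\<^sup>2 - 1)\<^sup>2 \<partial>std_gauss) = 2"
 "(\<integral>x. x\<^sup>2 \<partial>std_gauss) = 1"
proof -
 interpret N: real_distribution std_gauss by (rule real_dist_normal_dist)
 note i = integrable_std_normal_distribution_moment
 have m2: "(\<integral>x. x\<^sup>2 \<partial>std_gauss) = 1"
  using std_normal_distribution_even_moments[of 1] by (simp add: has_bochner_integral_iff)
 have m4: "(\<integral>x. x^4 \<partial>std_gauss) = 3"
  using std_normal_distribution_even_moments[of 2] by (simp add: has_bochner_integral_iff fact_numeral)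
 show "(\<integral>x. x\<^sup>2 \<partial>std_gauss) = 1" by (rule m2)
 show "(\<integral>x. x\<^sup>2 - 1 \<partial>std_gauss) = 0"
  using i[of 2] m2 N.prob_space by simp
 have e: "(x\<^sup>2 - 1)\<^sup>2 = x ^ 4 - 2 * x\<^sup>2 + 1" for x :: real by (simp add: power2_eq_square power4_eq_xxxx algebra_simps)
 show "(\<integral>x. (x\<^sup>2 - 1)\<^sup>2 \<partial>std_gauss) = 2"
  unfolding e using i[of 2] i[of 4] m2 m4 N.prob_space by simp
qed

lemma (in prob_space) std_normal_integral:
 fixes h :: "real => 'b::{banach,second_countable_topology}"
 assumes "std_normal_family M n z" "k < n" and [measurable]: "h \<in> borel_measurable borel"
 shows "(\<integral>\<xi>. h (z k \<xi>) \<partial>M) = (\<integral>x. h x \<partial>std_gauss)"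
  "integrable M (%\<xi>. h (z k \<xi>)) \<longleftrightarrow> integrable std_gauss h"
proof -
 have zm [measurable]: "z k \<in> borel_measurable M" using assms by (auto simp: std_normal_family_def)
 note d = std_normal_family_distr[OF assms(1,2), symmetric]
 show "(\<integral>\<xi>. h (z k \<xi>) \<partial>M) = (\<integral>x. h x \<partial>std_gauss)" unfolding d by (simp add: integral_distr)
 show "integrable M (%\<xi>. h (z k \<xi>)) \<longleftrightarrow> integrable std_gauss h" unfolding d by (simp add: integrable_distr_eq)
qed

lemma (in prob_space) std_normal_nn_integral:
 assumes "std_normal_family M n z" "k < n" and [measurable]: "h \<in> borel_measurable borel"
 shows "(\<integral>\<^sup>+\<xi>. h (z k \<xi>) \<partial>M) = (\<integral>\<^sup>+x. h x \<partial>std_gauss)"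
proof -
 have zm [measurable]: "z k \<in> borel_measurable M" using assms by (auto simp: std_normal_family_def)
 show ?thesis unfolding std_normal_family_distr[OF assms(1,2), symmetric] by (simp add: nn_integral_distr)
qed

lemma (in prob_space) std_normal_sq_variance:
 fixes a :: "nat => real"
 assumes z: "std_normal_family M n z"
 shows "integrable M (%\<xi>. (\<Sum>k<n. a k * ((z k \<xi>)\<^sup>2 - 1))\<^sup>2)"
  and "(\<integral>\<xi>. (\<Sum>k<n. a k * ((z k \<xi>)\<^sup>2 - 1))\<^sup>2 \<partial>M) = 2 * (\<Sum>k<n. (a k)\<^sup>2)"
proof -
 define v where "v k \<xi> = (z k \<xi>)\<^sup>2 - 1" for k \<xi>
 have iv: "indep_vars (%_. borel) v {..<n}"
  unfolding v_def by (rule indep_vars_compose2[OF std_normal_family_indep[OF z]]) auto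
 have vi: "integrable M (v k)" if "k < n" for k
  unfolding v_def using std_normal_integral(2)[OF z that, of "%x. x\<^sup>2 - 1"] std_normal_even_moment_integrable[of "-1" 1] by simp
 have v0: "expectation (v k) = 0" if "k < n" for k
  unfolding v_def using std_normal_integral(1)[OF z that, of "%x. x\<^sup>2 - 1"] std_normal_moments by simp
 have v2i: "integrable M (%\<xi>. v k \<xi> * v k \<xi>)" if "k < n" for k
  unfolding v_def using std_normal_integral(2)[OF z that, of "%x. (x\<^sup>2 - 1)\<^sup>2"] std_normal_even_moment_integrable[of "-1" 2]
  by (simp add: power2_eq_square)
 have v2: "(\<integral>\<xi>. v k \<xi> * v k \<xi> \<partial>M) = 2" if "k < n" for k
  unfolding v_def using std_normal_integral(1)[OF z that, of "%x. (x\<^sup>2 - 1)\<^sup>2"] std_normal_moments by (simp add: power2_eq_square)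
 have cross: "integrable M (%\<xi>. v k \<xi> * v l \<xi>) \<and> (\<integral>\<xi>. v k \<xi> * v l \<xi> \<partial>M) = (if k = l then 2 else 0)"
  if "k < n" "l < n" for k l
 proof (cases "k = l")
  case False
  have "indep_vars (%_. borel) v {k, l}" using indep_vars_subset[OF iv, of "{k,l}"] that by auto
  then have "integrable M (%\<xi>. \<Prod>i\<in>{k,l}. v i \<xi>)" "(\<integral>\<xi>. (\<Prod>i\<in>{k,l}. v i \<xi>) \<partial>M) = (\<Prod>i\<in>{k,l}. expectation (v i))"
   using vi that by (auto intro!: indep_vars_integrable indep_vars_lebesgue_integral)
  then show ?thesis using False v0 that by simp
 qed (use that v2i v2 in auto)
 have e: "(\<Sum>k<n. a k * ((z k \<xi>)\<^sup>2 - 1))\<^sup>2 = (\<Sum>k<n. \<Sum>l<n. (a k * a l) * (v k \<xi> * v l \<xi>))" for \<xi>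
  by (simp add: power2_eq_square sum_product v_def ac_simps)
 show "integrable M (%\<xi>. (\<Sum>k<n. a k * ((z k \<xi>)\<^sup>2 - 1))\<^sup>2)"
  unfolding e using cross by (intro Bochner_Integration.integrable_sum integrable_mult_right) auto
 have "(\<integral>\<xi>. (\<Sum>k<n. a k * ((z k \<xi>)\<^sup>2 - 1))\<^sup>2 \<partial>M) = (\<Sum>k<n. \<Sum>l<n. (a k * a l) * (if k = l then 2 else 0))"
  unfolding e using cross
  by (subst Bochner_Integration.integral_sum, force, intro sum.cong refl, subst Bochner_Integration.integral_sum) auto
 also have "... = (\<Sum>k<n. 2 * (a k)\<^sup>2)"
  by (intro sum.cong refl) (simp add: power2_eq_square if_distrib mult.commute cong: if_cong)
 also have "... = 2 * (\<Sum>k<n. (a k)\<^sup>2)" by (simp add: sum_distrib_left)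
 finally show "(\<integral>\<xi>. (\<Sum>k<n. a k * ((z k \<xi>)\<^sup>2 - 1))\<^sup>2 \<partial>M) = 2 * (\<Sum>k<n. (a k)\<^sup>2)" .
qed

text \<open>The variable \<open>x\<^sup>2 - 1\<close> is centred with variance 2 and finite third moment, so both sides equal \<open>1 - a\<^sup>2\<close>
up to a cubic error.\<close>
lemma std_normal_char_sq_approx:
 "\<exists>C. \<forall>a. \<bar>a\<bar> <= 1 --> cmod ((CLINT x|std_gauss. iexp (a * (x\<^sup>2 - 1))) - of_real (exp (- a\<^sup>2))) <= C * \<bar>a\<bar> ^ 3"
proof -
 interpret N: real_distribution std_gauss by (rule real_dist_normal_dist)
 define C0 where "C0 = (\<integral>x. \<bar>x\<^sup>2 - 1\<bar> ^ 3 \<partial>std_gauss)"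
 have i3: "integrable std_gauss (%x. \<bar>x\<^sup>2 - 1\<bar> ^ 3)"
  using integrable_abs[OF std_normal_even_moment_integrable[of "-1" 3]] by (simp add: power_abs)
 have i1: "integrable std_gauss (%x. x\<^sup>2 - 1)"
  using std_normal_even_moment_integrable[of "-1" 1] by simp
 have i2: "integrable std_gauss (%x. (x\<^sup>2 - 1)\<^sup>2)"
  using std_normal_even_moment_integrable[of "-1" 2] by simp
 show ?thesis
 proof (intro exI allI impI)
  fix a :: real assume a: "\<bar>a\<bar> <= 1"
  have ie: "integrable std_gauss (%x. iexp (a * (x\<^sup>2 - 1)))"
   by (rule N.integrable_iexp) auto
  define p where "p x = complex_of_real (1 - a\<^sup>2 / 2 * (x\<^sup>2 - 1)\<^sup>2) + \<i> * complex_of_real (a * (x\<^sup>2 - 1))" for x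
  have ip: "integrable std_gauss p"
   unfolding p_def by (intro Bochner_Integration.integrable_add integrable_of_real Bochner_Integration.integrable_diff integrable_mult_right i1 i2) auto
  have Ip: "(\<integral>x. p x \<partial>std_gauss) = of_real (1 - a\<^sup>2)"
  proof -
   have "(\<integral>x. p x \<partial>std_gauss) = of_real (\<integral>x. 1 - a\<^sup>2 / 2 * (x\<^sup>2 - 1)\<^sup>2 \<partial>std_gauss)
     + \<i> * of_real (\<integral>x. a * (x\<^sup>2 - 1) \<partial>std_gauss)"
    unfolding p_def using i1 i2 by (subst Bochner_Integration.integral_add) (auto simp del: of_real_diff of_real_mult)
   also have "(\<integral>x. 1 - a\<^sup>2 / 2 * (x\<^sup>2 - 1)\<^sup>2 \<partial>std_gauss) = 1 - a\<^sup>2"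
    using i2 std_normal_moments N.prob_space by (subst Bochner_Integration.integral_diff) auto
   also have "(\<integral>x. a * (x\<^sup>2 - 1) \<partial>std_gauss) = 0"
    using std_normal_moments by simp
   finally show ?thesis by simp
  qed
  have "cmod ((CLINT x|std_gauss. iexp (a * (x\<^sup>2 - 1))) - of_real (1 - a\<^sup>2))
    = cmod (CLINT x|std_gauss. iexp (a * (x\<^sup>2 - 1)) - p x)"
   using ie ip by (simp add: Ip)
  also have "... <= (\<integral>x. cmod (iexp (a * (x\<^sup>2 - 1)) - p x) \<partial>std_gauss)"
   by (rule integral_norm_bound)
  also have "... <= (\<integral>x. \<bar>a\<bar> ^ 3 * \<bar>x\<^sup>2 - 1\<bar> ^ 3 \<partial>std_gauss)"
  proof (rule integral_mono)
   fix x :: real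
   define y where "y = a * (x\<^sup>2 - 1)"
   have "(\<Sum>k\<le>2. (\<i> * complex_of_real y) ^ k / fact k) = 1 + \<i> * complex_of_real y - complex_of_real (y\<^sup>2) / 2"
    by (simp add: eval_nat_numeral power_mult_distrib)
   also have "... = p x" by (simp add: p_def y_def power_mult_distrib)
   finally have "p x = (\<Sum>k\<le>2. (\<i> * complex_of_real (a * (x\<^sup>2 - 1))) ^ k / fact k)" by (simp only: y_def)
   then have "cmod (iexp (a * (x\<^sup>2 - 1)) - p x) <= \<bar>a * (x\<^sup>2 - 1)\<bar> ^ 3 / 6"
    using iexp_approx1[of "a * (x\<^sup>2 - 1)" 2] by (simp add: eval_nat_numeral)
   also have "... <= \<bar>a * (x\<^sup>2 - 1)\<bar> ^ 3" by simp
   finally show "cmod (iexp (a * (x\<^sup>2 - 1)) - p x) <= \<bar>a\<bar> ^ 3 * \<bar>x\<^sup>2 - 1\<bar> ^ 3" by (simp add: abs_mult power_mult_distrib)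
  qed (use ie ip i3 in auto)
  also have "... = \<bar>a\<bar> ^ 3 * C0" by (simp add: C0_def)
  finally have 1: "cmod ((CLINT x|std_gauss. iexp (a * (x\<^sup>2 - 1))) - of_real (1 - a\<^sup>2)) <= \<bar>a\<bar> ^ 3 * C0" .
  have "\<bar>exp (- a\<^sup>2) - (1 - a\<^sup>2)\<bar> <= \<bar>a\<bar> ^ 3"
  proof -
   have l: "1 - a\<^sup>2 <= exp (- a\<^sup>2)" using exp_ge_add_one_self[of "- a\<^sup>2"] by simp
   have "1 + a\<^sup>2 <= exp (a\<^sup>2)" using exp_ge_add_one_self[of "a\<^sup>2"] by simp
   then have "exp (- a\<^sup>2) <= 1 / (1 + a\<^sup>2)" by (simp add: exp_minus field_simps add_pos_nonneg)
   also have "... <= 1 - a\<^sup>2 + a\<^sup>2 * a\<^sup>2"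
   proof -
    have "(1 - b + b * b) * (1 + b) = 1 + b * b * b" for b :: real by (simp add: algebra_simps)
    from this[of "a\<^sup>2"] have "1 <= (1 - a\<^sup>2 + a\<^sup>2 * a\<^sup>2) * (1 + a\<^sup>2)"
     by (simp only:) simp
    then show ?thesis by (subst divide_le_eq) (auto simp: add_pos_nonneg)
   qed
   also have "a\<^sup>2 * a\<^sup>2 = \<bar>a\<bar> ^ 3 * \<bar>a\<bar>" by (simp add: power3_eq_cube power2_eq_square abs_mult[symmetric] mult.assoc)
   also have "... <= \<bar>a\<bar> ^ 3" using a by (simp add: mult_left_le)
   finally show ?thesis using l by simp
  qed
  then have 2: "cmod (of_real (1 - a\<^sup>2) - of_real (exp (- a\<^sup>2))) <= \<bar>a\<bar> ^ 3"
   by (metis abs_minus_commute norm_of_real of_real_diff)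
  show "cmod ((CLINT x|std_gauss. iexp (a * (x\<^sup>2 - 1))) - of_real (exp (- a\<^sup>2))) <= (C0 + 1) * \<bar>a\<bar> ^ 3"
   using norm_triangle_le[OF add_mono[OF 1 2]] by (simp add: algebra_simps)
 qed
qed

text \<open>The factors of the two products have modulus at most one, so the difference of the products is at most the sum
of the differences.\<close>
lemma (in prob_space) std_normal_sq_char:
 fixes a :: "nat => real"
 assumes z: "std_normal_family M n z"
  and C: "\<forall>a. \<bar>a\<bar> <= 1 --> cmod ((CLINT x|std_gauss. iexp (a * (x\<^sup>2 - 1))) - of_real (exp (- a\<^sup>2))) <= C * \<bar>a\<bar> ^ 3"
  and a: "\<And>k. k < n ==> \<bar>a k\<bar> <= \<epsilon>" "\<epsilon> <= 1" "0 <= C"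
 shows "cmod ((CLINT \<xi>|M. iexp (\<Sum>k<n. a k * ((z k \<xi>)\<^sup>2 - 1))) - of_real (exp (- (\<Sum>k<n. (a k)\<^sup>2)))) <= C * \<epsilon> * (\<Sum>k<n. (a k)\<^sup>2)"
proof -
 interpret N: real_distribution std_gauss by (rule real_dist_normal_dist)
 define \<phi> where "\<phi> a = (CLINT x|std_gauss. iexp (a * (x\<^sup>2 - 1)))" for a :: real
 define v where "v k \<xi> = iexp (a k * ((z k \<xi>)\<^sup>2 - 1))" for k \<xi>
 have zm: "z k \<in> borel_measurable M" if "k < n" for k using z that by (auto simp: std_normal_family_def)
 have iv: "indep_vars (%_. borel) v {..<n}"
  unfolding v_def by (rule indep_vars_compose2[OF std_normal_family_indep[OF z]]) measurable
 have ev: "expectation (v k) = \<phi> (a k)" if "k < n" for k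
  unfolding v_def \<phi>_def using std_normal_integral(1)[OF z that, of "%x. iexp (a k * (x\<^sup>2 - 1))"] by simp
 have vi: "integrable M (v k)" if "k < n" for k
  unfolding v_def using zm[OF that] by (intro integrable_iexp) auto
 have "(CLINT \<xi>|M. iexp (\<Sum>k<n. a k * ((z k \<xi>)\<^sup>2 - 1))) = (CLINT \<xi>|M. \<Prod>k<n. v k \<xi>)"
  unfolding v_def of_real_sum sum_distrib_left by (subst exp_sum) auto
 also have "... = (\<Prod>k<n. expectation (v k))"
  using iv vi by (intro indep_vars_lebesgue_integral) auto
 also have "... = (\<Prod>k<n. \<phi> (a k))" by (intro prod.cong) (auto simp: ev)
 finally have 1: "(CLINT \<xi>|M. iexp (\<Sum>k<n. a k * ((z k \<xi>)\<^sup>2 - 1))) = (\<Prod>k<n. \<phi> (a k))" .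
 have 2: "of_real (exp (- (\<Sum>k<n. (a k)\<^sup>2))) = (\<Prod>k<n. complex_of_real (exp (- (a k)\<^sup>2)))"
  by (simp add: exp_sum sum_negf[symmetric])
 have ph1: "cmod (\<phi> b) <= 1" for b
 proof -
  have "cmod (\<phi> b) <= (\<integral>x. cmod (iexp (b * (x\<^sup>2 - 1))) \<partial>std_gauss)"
   unfolding \<phi>_def by (rule integral_norm_bound)
  also have "... = 1" using N.prob_space by simp
  finally show ?thesis .
 qed
 have "cmod ((\<Prod>k<n. \<phi> (a k)) - (\<Prod>k<n. complex_of_real (exp (- (a k)\<^sup>2)))) <= (\<Sum>k<n. cmod (\<phi> (a k) - of_real (exp (- (a k)\<^sup>2))))"
  by (rule norm_prod_diff) (auto simp: ph1)
 also have "... <= (\<Sum>k<n. C * \<epsilon> * (a k)\<^sup>2)"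
 proof (rule sum_mono)
  fix k assume "k \<in> {..<n}"
  then have k: "\<bar>a k\<bar> <= \<epsilon>" "\<bar>a k\<bar> <= 1" using a by force+
  have "cmod (\<phi> (a k) - of_real (exp (- (a k)\<^sup>2))) <= C * \<bar>a k\<bar> ^ 3"
   using C k by (auto simp: \<phi>_def)
  also have "... = C * \<bar>a k\<bar> * (a k)\<^sup>2" by (simp add: power3_eq_cube power2_eq_square)
  also have "... <= C * \<epsilon> * (a k)\<^sup>2" using k a(3) by (intro mult_right_mono mult_left_mono) auto
  finally show "cmod (\<phi> (a k) - of_real (exp (- (a k)\<^sup>2))) <= C * \<epsilon> * (a k)\<^sup>2" .
 qed
 finally show ?thesis unfolding 1 2 by (simp add: sum_distrib_left)
qed

lemma std_normal_exp_sq: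
 assumes "1 + 2 * s > 0"
 shows "(\<integral>\<^sup>+x. ennreal (exp (- s * x\<^sup>2)) \<partial>std_gauss) = ennreal (1 / sqrt (1 + 2 * s))"
proof -
 define \<sigma> where "\<sigma> = 1 / sqrt (1 + 2 * s)"
 have \<sigma>: "\<sigma> > 0" "\<sigma>\<^sup>2 = 1 / (1 + 2 * s)" using assms by (auto simp: \<sigma>_def power_divide)
 have e: "std_normal_density x * exp (- (s * x\<^sup>2)) = \<sigma> * normal_density 0 \<sigma> x" for x
 proof -
  have "- (x\<^sup>2 / (2 * \<sigma>\<^sup>2)) = - (x\<^sup>2 / 2) + - (s * x\<^sup>2)"
   using assms by (simp add: \<sigma>(2) field_simps)
  then have "exp (- (x\<^sup>2 / (2 * \<sigma>\<^sup>2))) = exp (- (x\<^sup>2 / 2)) * exp (- (s * x\<^sup>2))" by (simp only: exp_add)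
  then show ?thesis using \<sigma>(1)
   by (simp add: normal_density_def std_normal_density_def real_sqrt_mult)
 qed
 have "(\<integral>\<^sup>+x. ennreal (exp (- s * x\<^sup>2)) \<partial>std_gauss) = (\<integral>\<^sup>+x. ennreal (std_normal_density x) * ennreal (exp (- s * x\<^sup>2)) \<partial>lborel)"
  by (subst nn_integral_density) auto
 also have "... = (\<integral>\<^sup>+x. ennreal \<sigma> * ennreal (normal_density 0 \<sigma> x) \<partial>lborel)"
  using \<sigma>(1) by (intro nn_integral_cong) (simp add: e ennreal_mult[symmetric] del: ennreal_mult'')
 also have "... = ennreal \<sigma> * (\<integral>\<^sup>+x. ennreal (normal_density 0 \<sigma> x) \<partial>lborel)"
  by (rule nn_integral_cmult) auto
 also have "(\<integral>\<^sup>+x. ennreal (normal_density 0 \<sigma> x) \<partial>lborel) = 1"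
  using prob_space_normal_density[OF \<sigma>(1), of 0, THEN prob_space.emeasure_space_1]
  by (simp add: emeasure_density)
 finally show ?thesis by (simp add: \<sigma>_def)
qed

text \<open>Markov's inequality for \<open>exp (- L / 4)\<close>.  The expectation of one factor is the fourth root of
\<open>4 * \<mu> / (\<mu> + 1)\<^sup>2 = 1 - ((\<mu> - 1) / (\<mu> + 1))\<^sup>2\<close>; the order \<open>1/4\<close> makes it finite for every positive \<open>\<mu>\<close>.\<close>
lemma (in prob_space) gaussian_likelihood_chernoff:
 assumes w: "std_normal_family M n w" and \<mu>: "\<And>k. k < n ==> 0 < \<mu> k"
 shows "prob {\<xi> \<in> space M. (\<Sum>k<n. ln (\<mu> k) + (w k \<xi>)\<^sup>2 * (1 / \<mu> k - 1)) <= 1}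
  <= 2 * exp (- (\<Sum>k<n. ((\<mu> k - 1) / (\<mu> k + 1))\<^sup>2) / 4)"
proof -
 define L where "L \<xi> = (\<Sum>k<n. ln (\<mu> k) + (w k \<xi>)\<^sup>2 * (1 / \<mu> k - 1))" for \<xi>
 define v where "v k \<xi> = ennreal (exp (- (ln (\<mu> k) + (w k \<xi>)\<^sup>2 * (1 / \<mu> k - 1)) / 4))" for k \<xi>
 define r where "r k = ((\<mu> k - 1) / (\<mu> k + 1))\<^sup>2" for k
 have wm: "w k \<in> borel_measurable M" if "k < n" for k using w that by (auto simp: std_normal_family_def)
 have Lm [measurable]: "L \<in> borel_measurable M" unfolding L_def using wm by measurable
 have ev: "(\<integral>\<^sup>+\<xi>. v k \<xi> \<partial>M) <= ennreal (exp (- r k / 4))" if k: "k < n" for k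
 proof -
  define m where "m = \<mu> k"
  have m: "m > 0" using \<mu>[OF k] by (simp add: m_def)
  define s where "s = (1 / m - 1) / 4"
  have s: "1 + 2 * s = (m + 1) / (2 * m)" using m by (simp add: s_def field_simps)
  have sp: "1 + 2 * s > 0" unfolding s using m by simp
  have "(\<integral>\<^sup>+\<xi>. v k \<xi> \<partial>M) = (\<integral>\<^sup>+\<xi>. ennreal (exp (- ln m / 4)) * ennreal (exp (- s * (w k \<xi>)\<^sup>2)) \<partial>M)"
   by (intro nn_integral_cong) (simp add: v_def m_def s_def ennreal_mult[symmetric] exp_add[symmetric] algebra_simps add_divide_distrib diff_divide_distrib del: ennreal_mult'')
  also have "... = (\<integral>\<^sup>+x. ennreal (exp (- ln m / 4)) * ennreal (exp (- s * x\<^sup>2)) \<partial>std_gauss)"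
   by (rule std_normal_nn_integral[OF w k]) auto
  also have "... = ennreal (exp (- ln m / 4)) * ennreal (1 / sqrt (1 + 2 * s))"
   by (subst nn_integral_cmult, measurable, simp only: std_normal_exp_sq[OF sp])
  also have "... = ennreal (exp (- ln m / 4) * (1 / sqrt (1 + 2 * s)))"
   using sp by (simp add: ennreal_mult[symmetric] del: ennreal_mult'')
  also have "exp (- ln m / 4) * (1 / sqrt (1 + 2 * s)) <= exp (- r k / 4)"
  proof -
   have "1 / sqrt (1 + 2 * s) = exp (- ln (1 + 2 * s) / 2)"
    using sp by (simp add: ln_sqrt[symmetric] exp_minus inverse_eq_divide)
   then have "exp (- ln m / 4) * (1 / sqrt (1 + 2 * s)) = exp ((- ln m - 2 * ln (1 + 2 * s)) / 4)"
    by (simp add: exp_add[symmetric] field_simps)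
   also have "- ln m - 2 * ln (1 + 2 * s) = ln (4 * m / (m + 1)\<^sup>2)"
    unfolding s using m by (simp add: ln_div ln_mult ln_realpow power2_eq_square[of m] ln_powr[of 2, symmetric] flip: ln_realpow) (simp add: ln_realpow power2_eq_square ln_mult flip: mult_2)
   also have "4 * m / (m + 1)\<^sup>2 = 1 - r k"
   proof -
    have "1 - r k = ((m + 1)\<^sup>2 - (m - 1)\<^sup>2) / (m + 1)\<^sup>2"
     using m unfolding r_def m_def[symmetric] power_divide by (simp add: diff_divide_distrib)
    also have "(m + 1)\<^sup>2 - (m - 1)\<^sup>2 = 4 * m" by (simp add: power2_eq_square algebra_simps)
    finally show ?thesis by simp
   qed
   also have "ln (1 - r k) <= - r k"
   proof -
    have "1 - r k > 0" using m by (simp add: \<open>4 * m / (m + 1)\<^sup>2 = 1 - r k\<close>[symmetric])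
    then show ?thesis using ln_le_minus_one[of "1 - r k"] by simp
   qed
   finally show ?thesis by simp
  qed
  finally show ?thesis by (simp add: ennreal_leI)
 qed
 have iv: "indep_vars (%_. borel) v {..<n}"
  unfolding v_def by (rule indep_vars_compose2[OF std_normal_family_indep[OF w]]) measurable
 have "(\<integral>\<^sup>+\<xi>. ennreal (exp (- L \<xi> / 4)) \<partial>M) = (\<integral>\<^sup>+\<xi>. (\<Prod>k<n. v k \<xi>) \<partial>M)"
 proof (intro nn_integral_cong)
  fix \<xi>
  have "exp (- L \<xi> / 4) = exp (\<Sum>k<n. - (ln (\<mu> k) + (w k \<xi>)\<^sup>2 * (1 / \<mu> k - 1)) / 4)"
   by (simp only: L_def sum_negf[symmetric] sum_divide_distrib)
  also have "... = (\<Prod>k<n. exp (- (ln (\<mu> k) + (w k \<xi>)\<^sup>2 * (1 / \<mu> k - 1)) / 4))"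
   by (rule exp_sum) simp
  finally show "ennreal (exp (- L \<xi> / 4)) = (\<Prod>k<n. v k \<xi>)"
   unfolding v_def by (subst prod_ennreal) auto
 qed
 also have "... = (\<Prod>k<n. \<integral>\<^sup>+\<xi>. v k \<xi> \<partial>M)"
  by (rule indep_vars_nn_integral[OF _ iv]) auto
 also have "... <= (\<Prod>k<n. ennreal (exp (- r k / 4)))"
 proof -
  have "(\<Prod>k<m. a k) <= (\<Prod>k<m. b k :: ennreal)" if "\<And>k. k < m ==> a k <= b k" for m :: nat and a b
   using that by (induction m) (auto intro!: mult_mono)
  then show ?thesis using ev by simp
 qed
 also have "... = ennreal (exp (- (\<Sum>k<n. r k) / 4))"
 proof -
  have "(\<Prod>k<n. exp (- r k / 4)) = exp (\<Sum>k<n. - r k / 4)" by (rule exp_sum[symmetric]) simp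
  also have "(\<Sum>k<n. - r k / 4) = - (\<Sum>k<n. r k) / 4" by (simp only: sum_negf[symmetric] sum_divide_distrib)
  finally show ?thesis by (subst prod_ennreal) auto
 qed
 finally have E: "(\<integral>\<^sup>+\<xi>. ennreal (exp (- L \<xi> / 4)) \<partial>M) <= ennreal (exp (- (\<Sum>k<n. r k) / 4))" .
 have e4: "exp (1/4) <= (2::real)"
 proof -
  have "exp (1/4 :: real) <= exp (ln 2)" using ln_2_less_1 ln2_ge_two_thirds by (intro exp_le_cancel_iff[THEN iffD2]) linarith
  then show ?thesis by simp
 qed
 have "emeasure M {\<xi> \<in> space M. L \<xi> <= 1} = (\<integral>\<^sup>+\<xi>. indicator {\<xi> \<in> space M. L \<xi> <= 1} \<xi> \<partial>M)"
  by simp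
 also have "... <= (\<integral>\<^sup>+\<xi>. ennreal (exp (1/4)) * ennreal (exp (- L \<xi> / 4)) \<partial>M)"
 proof (intro nn_integral_mono)
  fix \<xi> show "indicator {\<xi> \<in> space M. L \<xi> <= 1} \<xi> <= ennreal (exp (1/4)) * ennreal (exp (- L \<xi> / 4))"
   by (auto simp: indicator_def ennreal_mult[symmetric] exp_add[symmetric] add_divide_distrib[symmetric] diff_divide_distrib[symmetric] simp del: ennreal_mult'')
 qed
 also have "... = ennreal (exp (1/4)) * (\<integral>\<^sup>+\<xi>. ennreal (exp (- L \<xi> / 4)) \<partial>M)"
  by (rule nn_integral_cmult) auto
 also have "... <= ennreal 2 * ennreal (exp (- (\<Sum>k<n. r k) / 4))"
  using e4 E by (intro mult_mono ennreal_leI) auto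
 also have "... = ennreal (2 * exp (- (\<Sum>k<n. r k) / 4))" by (simp add: ennreal_mult)
 finally show ?thesis
  by (simp add: emeasure_eq_measure L_def r_def)
qed

text \<open>The sum of squares in the joint characteristic function is invariant under rotations.\<close>
lemma std_normal_family_orthogonal:
 assumes z: "std_normal_family M n z"
  and Q: "\<And>k l. k < n ==> l < n ==> (\<Sum>j<n. Q k j * Q l j) = (if k = l then 1 else (0::real))"
 shows "std_normal_family M n (%k \<xi>. \<Sum>j<n. Q k j * z j \<xi>)"
 unfolding std_normal_family_def
proof (intro conjI allI impI)
 fix k show "(%\<xi>. \<Sum>j<n. Q k j * z j \<xi>) \<in> borel_measurable M"
  using z by (intro borel_measurable_sum borel_measurable_times) (auto simp: std_normal_family_def)
next
 fix t :: "nat => real" and a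
 define s where "s j = (\<Sum>k<n. t k * Q k j)" for j
 have 1: "(\<Sum>k<n. t k * (\<Sum>j<n. Q k j * z j \<xi>)) = (\<Sum>j<n. s j * z j \<xi>)" for \<xi>
  unfolding s_def sum_distrib_left sum_distrib_right by (subst sum.swap) (simp add: ac_simps)
 have "(\<Sum>j<n. (s j)\<^sup>2) = (\<Sum>j<n. \<Sum>k<n. \<Sum>l<n. t k * t l * (Q k j * Q l j))"
  by (simp add: s_def power2_eq_square sum_product ac_simps)
 also have "... = (\<Sum>k<n. \<Sum>l<n. \<Sum>j<n. t k * t l * (Q k j * Q l j))"
  by (subst sum.swap, rule sum.cong[OF refl], rule sum.swap)
 also have "... = (\<Sum>k<n. (t k)\<^sup>2)"
  by (simp add: sum_distrib_left[symmetric] Q power2_eq_square if_distrib[of "(*) _"] cong: if_cong)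
 finally have 2: "(\<Sum>j<n. (s j)\<^sup>2) = (\<Sum>k<n. (t k)\<^sup>2)" .
 show "(\<integral>\<xi>. cos ((\<Sum>k<n. t k * (\<Sum>j<n. Q k j * z j \<xi>)) - a) \<partial>M) = exp (- (\<Sum>k<n. (t k)\<^sup>2) / 2) * cos a"
  unfolding 1 2[symmetric] using z by (simp add: std_normal_family_def)
qed

section \<open>Continuity theorem and Slutsky argument\<close>

lemma (in prob_space) prob_norm_large_small:
 fixes X :: "'a => 'b::euclidean_space"
 assumes [measurable]: "X \<in> borel_measurable M" and "0 < \<epsilon>"
 shows "\<exists>r>0. prob {\<xi> \<in> space M. r <= norm (X \<xi>)} < \<epsilon>"
proof -
 define A where "A n = {\<xi> \<in> space M. real n <= norm (X \<xi>)}" for n :: nat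
 have [measurable]: "A n \<in> events" for n by (simp add: A_def)
 have "(\<Inter>n. A n) = {}"
 proof (intro equals0I)
  fix \<xi> assume "\<xi> \<in> (\<Inter>n. A n)"
  then have "real n <= norm (X \<xi>)" for n by (auto simp: A_def)
  then show False using reals_Archimedean2[of "norm (X \<xi>)"] by (meson not_less)
 qed
 moreover have "(%n. prob (A n)) \<longlonglongrightarrow> prob (\<Inter>n. A n)"
  by (rule finite_Lim_measure_decseq) (auto simp: A_def decseq_def)
 ultimately have "(%n. prob (A n)) \<longlonglongrightarrow> 0" by simp
 then have "\<forall>\<^sub>F n in sequentially. prob (A n) < \<epsilon>" using assms(2) by (rule order_tendstoD)
 then have "\<forall>\<^sub>F n in sequentially. prob (A n) < \<epsilon> \<and> 0 < n" using eventually_gt_at_top[of 0] by eventually_elim auto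
 then obtain n where "prob (A n) < \<epsilon>" "0 < n" by (auto simp: eventually_sequentially)
 then show ?thesis by (intro exI[of _ "real n"]) (auto simp: A_def)
qed

lemma gaussian_smoothing_kernel:
 fixes G :: "real^'p => real"
 assumes [measurable]: "G \<in> borel_measurable borel" and s: "0 < s"
 shows "(\<integral>w. G (x + s *\<^sub>R w) \<partial>std_normal_vec)
  = (\<integral>v. (1 / (s * sqrt (2 * pi))) ^ CARD('p) * exp (- (norm ((1 / s) *\<^sub>R (x - v)))\<^sup>2 / 2) * G v \<partial>lborel)"
proof -
 define h where "h v = (1 / (s * sqrt (2 * pi))) ^ CARD('p) * exp (- (norm ((1 / s) *\<^sub>R (x - v)))\<^sup>2 / 2) * G v" for v
 have [measurable]: "h \<in> borel_measurable borel" unfolding h_def by measurable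
 have d: "(\<Prod>i\<in>UNIV. std_normal_density (w $ i)) = (1 / sqrt (2 * pi)) ^ CARD('p) * exp (- (norm w)\<^sup>2 / 2)" for w :: "real^'p"
 proof -
  have "(\<Prod>i\<in>UNIV. std_normal_density (w $ i)) = (\<Prod>i\<in>(UNIV::'p set). 1 / sqrt (2 * pi)) * (\<Prod>i\<in>UNIV. exp (- (w $ i)\<^sup>2 / 2))"
   by (simp add: std_normal_density_def prod.distrib[symmetric] del: prod_constant)
  also have "(\<Prod>i\<in>UNIV. exp (- (w $ i)\<^sup>2 / 2)) = exp (- (norm w)\<^sup>2 / 2)"
  proof -
   have "(\<Prod>i\<in>UNIV. exp (- (w $ i)\<^sup>2 / 2)) = exp (\<Sum>i\<in>UNIV. - (w $ i)\<^sup>2 / 2)" by (rule exp_sum[symmetric]) simp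
   also have "(\<Sum>i\<in>UNIV. - (w $ i)\<^sup>2 / 2) = - (norm w)\<^sup>2 / 2"
    by (simp add: norm_vec_def L2_set_def sum_nonneg sum_divide_distrib[symmetric] sum_negf)
   finally show ?thesis .
  qed
  finally show ?thesis by simp
 qed
 have "(\<integral>v. h v \<partial>lborel) = (\<integral>v. h v \<partial>density (distr lborel borel (%w. x + s *\<^sub>R w)) (%_. ennreal (\<bar>s\<bar> ^ DIM(real^'p))))"
  using lborel_affine[of s x] s by simp
 also have "... = (\<integral>v. (s ^ CARD('p)) *\<^sub>R h v \<partial>(distr lborel borel (%w. x + s *\<^sub>R w)))"
  using s by (subst integral_density) auto
 also have "... = (\<integral>w. (s ^ CARD('p)) *\<^sub>R h (x + s *\<^sub>R w) \<partial>lborel)"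
  by (subst integral_distr) auto
 also have "... = (\<integral>w. (\<Prod>i\<in>UNIV. std_normal_density (w $ i)) *\<^sub>R G (x + s *\<^sub>R w) \<partial>lborel)"
  using s by (intro Bochner_Integration.integral_cong) (auto simp: d h_def power_divide power_mult_distrib)
 also have "... = (\<integral>w. G (x + s *\<^sub>R w) \<partial>std_normal_vec)"
  by (rule integral_std_normal_vec[symmetric]) measurable
 finally show ?thesis by (simp add: h_def)
qed

text \<open>Convolution with a Gaussian turns the integral of \<open>G\<close> into a mixture of Gaussian kernels, for which
convergence is known; dominated convergence interchanges the limit with the mixture.\<close>
lemma gaussian_smoothing_convergence:
 fixes T :: "nat => 'w => real^'p" and G :: "real^'p => real"
 assumes P: "prob_space P" and T [measurable]: "\<And>n. T n \<in> borel_measurable P"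
  and cf: "\<And>l a. (%n. \<integral>\<xi>. cos (l \<bullet> T n \<xi> - a) \<partial>P) \<longlonglongrightarrow> exp (- (norm l)\<^sup>2 / 2) * cos a"
  and G: "integrable lborel G" and s: "0 < s"
 shows "(%n. \<integral>\<xi>. (\<integral>w. G (T n \<xi> + s *\<^sub>R w) \<partial>std_normal_vec) \<partial>P)
   \<longlonglongrightarrow> (\<integral>x. (\<integral>w. G (x + s *\<^sub>R w) \<partial>std_normal_vec) \<partial>std_normal_vec)"
proof -
 interpret P: prob_space P by fact
 have Gm [measurable]: "G \<in> borel_measurable borel" using G by auto
 define \<kappa> where "\<kappa> = (1 / (s * sqrt (2 * pi))) ^ CARD('p)"
 have fub: "(\<integral>\<xi>. (\<integral>w. G (X \<xi> + s *\<^sub>R w) \<partial>std_normal_vec) \<partial>Q)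
  = (\<integral>v. \<kappa> * G v * (\<integral>\<xi>. exp (- (norm ((1 / s) *\<^sub>R (X \<xi> - v)))\<^sup>2 / 2) \<partial>Q) \<partial>lborel)"
  if Q: "prob_space Q" and [measurable]: "X \<in> borel_measurable Q" for Q :: "'q measure" and X :: "'q => real^'p"
 proof -
  interpret Q: prob_space Q by fact
  interpret QL: pair_sigma_finite Q "lborel :: (real^'p) measure" ..
  define F where "F = (%(\<xi>, v). \<kappa> * G v * exp (- (norm ((1 / s) *\<^sub>R (X \<xi> - v)))\<^sup>2 / 2))"
  have [measurable]: "F \<in> borel_measurable (Q \<Otimes>\<^sub>M lborel)" unfolding F_def by measurable
  have "integrable (Q \<Otimes>\<^sub>M lborel) (%(\<xi>, v). \<kappa> * G v)"
  proof (rule QL.Fubini_integrable)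
   show "AE x in Q. integrable lborel (%y. case (x, y) of (\<xi>, v) => \<kappa> * G v)" using G by simp
  qed auto
  then have Fi: "integrable (Q \<Otimes>\<^sub>M lborel) F"
   by (rule Bochner_Integration.integrable_bound) (auto simp: F_def abs_mult mult_left_le)
  have "(\<integral>\<xi>. (\<integral>w. G (X \<xi> + s *\<^sub>R w) \<partial>std_normal_vec) \<partial>Q) = (\<integral>\<xi>. (\<integral>v. F (\<xi>, v) \<partial>lborel) \<partial>Q)"
   by (simp add: gaussian_smoothing_kernel[OF Gm s] F_def \<kappa>_def ac_simps)
  also have "... = (\<integral>v. (\<integral>\<xi>. F (\<xi>, v) \<partial>Q) \<partial>lborel)"
   using QL.Fubini_integral[of "%\<xi> v. F (\<xi>, v)"] Fi by simp
  finally show ?thesis by (simp add: F_def)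
 qed
 have fubN: "(\<integral>x. (\<integral>w. G (x + s *\<^sub>R w) \<partial>std_normal_vec) \<partial>std_normal_vec)
  = (\<integral>v. \<kappa> * G v * (\<integral>x. exp (- (norm ((1 / s) *\<^sub>R (x - v)))\<^sup>2 / 2) \<partial>std_normal_vec) \<partial>lborel)"
  by (rule fub[OF prob_space_std_normal_vec]) simp
 have km: "(%v. \<integral>\<xi>. exp (- (norm ((1 / s) *\<^sub>R (X \<xi> - v)))\<^sup>2 / 2) \<partial>Q) \<in> borel_measurable borel"
  if "prob_space Q" and [measurable]: "X \<in> borel_measurable Q" for Q :: "'q measure" and X :: "'q => real^'p"
 proof -
  interpret Q: prob_space Q by fact
  show ?thesis by measurable
 qed
 show ?thesis
  unfolding fub[OF P T] fubN
 proof (rule integral_dominated_convergence[where w = "%v. norm (\<kappa> * G v)"])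
  show "AE v in lborel. (%n. \<kappa> * G v * (\<integral>\<xi>. exp (- (norm ((1 / s) *\<^sub>R (T n \<xi> - v)))\<^sup>2 / 2) \<partial>P))
    \<longlonglongrightarrow> \<kappa> * G v * (\<integral>x. exp (- (norm ((1 / s) *\<^sub>R (x - v)))\<^sup>2 / 2) \<partial>std_normal_vec)"
   by (intro AE_I2 tendsto_mult tendsto_const gaussian_kernel_convergence[OF P T cf])
  show "AE v in lborel. norm (\<kappa> * G v * (\<integral>\<xi>. exp (- (norm ((1 / s) *\<^sub>R (T n \<xi> - v)))\<^sup>2 / 2) \<partial>P)) <= norm (\<kappa> * G v)" for n
  proof (intro AE_I2)
   fix v
   have "norm (\<integral>\<xi>. exp (- (norm ((1 / s) *\<^sub>R (T n \<xi> - v)))\<^sup>2 / 2) \<partial>P) <= (\<integral>\<xi>. norm (exp (- (norm ((1 / s) *\<^sub>R (T n \<xi> - v)))\<^sup>2 / 2)) \<partial>P)"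
    by (rule integral_norm_bound)
   also have "... <= (\<integral>\<xi>. 1 \<partial>P)"
    by (rule integral_mono) (auto intro!: P.integrable_const_bound[where B = 1])
   also have "... = 1" by (simp add: P.prob_space)
   finally show "norm (\<kappa> * G v * (\<integral>\<xi>. exp (- (norm ((1 / s) *\<^sub>R (T n \<xi> - v)))\<^sup>2 / 2) \<partial>P)) <= norm (\<kappa> * G v)"
    by (simp add: norm_mult mult_left_le abs_mult)
  qed
  show "(%v. \<kappa> * G v * (\<integral>x. exp (- (norm ((1 / s) *\<^sub>R (x - v)))\<^sup>2 / 2) \<partial>std_normal_vec)) \<in> borel_measurable lborel"
   using km[OF prob_space_std_normal_vec, of "%x. x"] by (intro borel_measurable_times) auto
  show "(%v. \<kappa> * G v * (\<integral>\<xi>. exp (- (norm ((1 / s) *\<^sub>R (T n \<xi> - v)))\<^sup>2 / 2) \<partial>P)) \<in> borel_measurable lborel" for n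
   using km[OF P T] by (intro borel_measurable_times) auto
  show "integrable lborel (%v. norm (\<kappa> * G v))" using G by simp
 qed
qed

text \<open>A compactly supported continuous function is uniformly continuous, hence uniformly close to its Gaussian smoothings.\<close>
lemma levy_continuity_compact_support:
 fixes T :: "nat => 'w => real^'p" and G :: "real^'p => real"
 assumes P: "prob_space P" and T [measurable]: "\<And>n. T n \<in> borel_measurable P"
  and cf: "\<And>l a. (%n. \<integral>\<xi>. cos (l \<bullet> T n \<xi> - a) \<partial>P) \<longlonglongrightarrow> exp (- (norm l)\<^sup>2 / 2) * cos a"
  and G: "continuous_on UNIV G" and supp: "\<And>x. r < norm x ==> G x = 0"
 shows "(%n. \<integral>\<xi>. G (T n \<xi>) \<partial>P) \<longlonglongrightarrow> (\<integral>x. G x \<partial>std_normal_vec)"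
proof -
 interpret P: prob_space P by fact
 interpret N: prob_space "std_normal_vec :: (real^'p) measure" by (rule prob_space_std_normal_vec)
 have Gm [measurable]: "G \<in> borel_measurable borel" using G by (rule borel_measurable_continuous_onI)
 obtain B where B: "B > 0" "\<And>x. \<bar>G x\<bar> <= B"
 proof -
  have "bounded (G ` cball 0 r)"
   by (intro compact_imp_bounded compact_continuous_image continuous_on_subset[OF G]) auto
  then obtain b where b: "\<And>x. norm x <= r ==> \<bar>G x\<bar> <= b" by (auto simp: bounded_iff simp del: mem_cball) (metis mem_cball_0)
  show thesis by (rule that[of "max 1 b"]) (use b supp in \<open>fastforce simp: not_le[symmetric] le_max_iff_disj\<close>)+
 qed
 have Gi: "integrable lborel G"
 proof -
  have "integrable lborel (%x. indicator (cball 0 r) x *\<^sub>R G x)"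
   by (rule borel_integrable_compact) (auto intro: continuous_on_subset[OF G])
  moreover have "(%x. indicator (cball 0 r) x *\<^sub>R G x) = G" using supp by (auto simp: indicator_def fun_eq_iff not_le)
  ultimately show ?thesis by simp
 qed
 have uc: "\<exists>\<delta>>0. \<forall>x y. dist x y < \<delta> --> \<bar>G x - G y\<bar> < \<epsilon>" if e: "\<epsilon> > 0" for \<epsilon>
 proof -
  have "uniformly_continuous_on (cball 0 (r + 1)) G"
   by (intro compact_uniformly_continuous continuous_on_subset[OF G]) auto
  then obtain d where d: "d > 0" "\<And>x y. norm x <= r + 1 ==> norm y <= r + 1 ==> dist y x < d ==> dist (G y) (G x) < \<epsilon>"
   by (rule uniformly_continuous_onE[OF _ e]) auto
  show ?thesis
  proof (intro exI[of _ "min d 1"] conjI allI impI)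
   fix x y :: "real^'p" assume xy: "dist x y < min d 1"
   show "\<bar>G x - G y\<bar> < \<epsilon>"
   proof (cases "r < norm x \<and> r < norm y")
    case True then show ?thesis using supp e by simp
   next
    case False
    have "norm x <= norm y + 1" "norm y <= norm x + 1"
     using xy norm_triangle_ineq2[of x y] norm_triangle_ineq2[of y x] by (auto simp: dist_norm norm_minus_commute)
    then show ?thesis using False d(2)[of y x] xy by (auto simp: dist_real_def)
   qed
  qed (use d in auto)
 qed
 show ?thesis
 proof (rule LIMSEQ_I)
  fix \<epsilon>0 :: real assume e0: "\<epsilon>0 > 0"
  define \<epsilon> where "\<epsilon> = \<epsilon>0 / 6"
  have e: "\<epsilon> > 0" using e0 by (simp add: \<epsilon>_def)
  obtain \<delta> where \<delta>: "\<delta> > 0" "\<And>x y. dist x y < \<delta> ==> \<bar>G x - G y\<bar> < \<epsilon>" using uc[OF e] by blast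
  obtain q where q: "q > 0" "N.prob {w. q <= norm w} < \<epsilon> / (2 * B)"
   using N.prob_norm_large_small[of "%x. x" "\<epsilon> / (2 * B)"] e B by auto
  define s where "s = \<delta> / q"
  have s: "s > 0" using \<delta> q by (simp add: s_def)
  define H where "H x = (\<integral>w. G (x + s *\<^sub>R w) \<partial>std_normal_vec)" for x
  have Hm [measurable]: "H \<in> borel_measurable borel" unfolding H_def by measurable
  have HG: "\<bar>H x - G x\<bar> <= 2 * \<epsilon>" for x
  proof -
   have i: "integrable std_normal_vec (%w. G (x + s *\<^sub>R w))"
    by (rule N.integrable_const_bound[where B = B]) (auto simp: B)
   have i2: "integrable (std_normal_vec :: (real^'p) measure) (%w. \<epsilon> + 2 * B * indicator {w. q <= norm w} w)"
    by (rule N.integrable_const_bound[where B = "\<epsilon> + 2 * B"]) (use e B(1) in \<open>auto simp: indicator_def\<close>)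
   have "\<bar>H x - G x\<bar> = \<bar>\<integral>w. G (x + s *\<^sub>R w) - G x \<partial>std_normal_vec\<bar>"
    unfolding H_def using i by (simp add: N.prob_space[simplified])
   also have "... <= (\<integral>w. \<bar>G (x + s *\<^sub>R w) - G x\<bar> \<partial>std_normal_vec)"
    using integral_norm_bound[of "std_normal_vec" "%w. G (x + s *\<^sub>R w) - G x"] by simp
   also have "... <= (\<integral>w. \<epsilon> + 2 * B * indicator {w. q <= norm w} w \<partial>(std_normal_vec :: (real^'p) measure))"
   proof (intro integral_mono)
    show "integrable std_normal_vec (%w. \<bar>G (x + s *\<^sub>R w) - G x\<bar>)" using i by simp
    fix w :: "real^'p"
    show "\<bar>G (x + s *\<^sub>R w) - G x\<bar> <= \<epsilon> + 2 * B * indicator {w. q <= norm w} w"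
    proof (cases "q <= norm w")
     case True
     then show ?thesis using B(2)[of "x + s *\<^sub>R w"] B(2)[of x] e by simp
    next
     case False
     then have "s * norm w < \<delta>" using q \<delta> by (simp add: s_def field_simps)
     then have "dist (x + s *\<^sub>R w) x < \<delta>" using s by (simp add: dist_norm)
     then show ?thesis using \<delta>(2) False by (simp add: less_imp_le)
    qed
   qed (use i i2 in auto)
   also have "... = \<epsilon> + 2 * B * N.prob {w. q <= norm w}"
   proof -
    have "integrable (std_normal_vec :: (real^'p) measure) (indicator {w. q <= norm w} :: _ => real)"
     by (rule N.integrable_const_bound[where B = 1]) (auto simp: indicator_def)
    then show ?thesis by (subst Bochner_Integration.integral_add) (auto simp: N.prob_space[simplified])
   qed
   also have "... <= 2 * \<epsilon>" using q B by (simp add: field_simps)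
   finally show ?thesis .
  qed
  have Gb: "integrable Q (%\<xi>. G (X \<xi>))" "integrable Q (%\<xi>. H (X \<xi>))"
   if "prob_space Q" and [measurable]: "X \<in> borel_measurable Q" for Q :: "'q measure" and X
  proof -
   interpret Q: prob_space Q by fact
   show "integrable Q (%\<xi>. G (X \<xi>))" by (rule Q.integrable_const_bound[where B = B]) (auto simp: B)
   have "\<bar>H x\<bar> <= B + 2 * \<epsilon>" for x using HG[of x] B(2)[of x] by linarith
   then show "integrable Q (%\<xi>. H (X \<xi>))" by (intro Q.integrable_const_bound[where B = "B + 2 * \<epsilon>"]) auto
  qed
  have cl: "\<bar>(\<integral>\<xi>. G (X \<xi>) \<partial>Q) - (\<integral>\<xi>. H (X \<xi>) \<partial>Q)\<bar> <= 2 * \<epsilon>"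
   if Q: "prob_space Q" and [measurable]: "X \<in> borel_measurable Q" for Q :: "'q measure" and X
  proof -
   interpret Q: prob_space Q by fact
   have "\<bar>(\<integral>\<xi>. G (X \<xi>) \<partial>Q) - (\<integral>\<xi>. H (X \<xi>) \<partial>Q)\<bar> = \<bar>\<integral>\<xi>. G (X \<xi>) - H (X \<xi>) \<partial>Q\<bar>"
    using Gb[OF that] by simp
   also have "... <= (\<integral>\<xi>. \<bar>G (X \<xi>) - H (X \<xi>)\<bar> \<partial>Q)"
    using integral_norm_bound[of Q "%\<xi>. G (X \<xi>) - H (X \<xi>)"] by simp
   also have "... <= (\<integral>\<xi>. 2 * \<epsilon> \<partial>Q)"
    using Gb[OF that] HG by (intro integral_mono) (auto simp: abs_minus_commute)
   finally show ?thesis by (simp add: Q.prob_space)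
  qed
  have "(%n. \<integral>\<xi>. H (T n \<xi>) \<partial>P) \<longlonglongrightarrow> (\<integral>x. H x \<partial>std_normal_vec)"
   unfolding H_def by (rule gaussian_smoothing_convergence[OF P T cf Gi s])
  from LIMSEQ_D[OF this e] obtain n0 where n0: "\<And>n. n \<ge> n0 ==> norm ((\<integral>\<xi>. H (T n \<xi>) \<partial>P) - (\<integral>x. H x \<partial>std_normal_vec)) < \<epsilon>" by auto
  show "\<exists>no. \<forall>n\<ge>no. norm ((\<integral>\<xi>. G (T n \<xi>) \<partial>P) - (\<integral>x. G x \<partial>std_normal_vec)) < \<epsilon>0"
  proof (intro exI[of _ n0] allI impI)
   fix n assume n: "n \<ge> n0"
   show "norm ((\<integral>\<xi>. G (T n \<xi>) \<partial>P) - (\<integral>x. G x \<partial>std_normal_vec)) < \<epsilon>0"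
   proof -
    have "\<bar>(\<integral>x. G x \<partial>std_normal_vec) - (\<integral>x. H x \<partial>std_normal_vec)\<bar> <= 2 * \<epsilon>"
     by (rule cl[OF prob_space_std_normal_vec]) simp
    then show ?thesis using n0[OF n] cl[OF P T, of n] e0 unfolding real_norm_def \<epsilon>_def by linarith
   qed
  qed
 qed
qed

text \<open>The limit has total mass one, so a continuous cutoff that keeps most of its mass keeps most of the mass of
\<open>T n\<close> for large \<open>n\<close>; the rest is the compactly supported case.\<close>
theorem levy_continuity_std_normal_vec:
 fixes T :: "nat => 'w => real^'p"
 assumes P: "prob_space P" and T [measurable]: "\<And>n. T n \<in> borel_measurable P"
  and cf: "\<And>l a. (%n. \<integral>\<xi>. cos (l \<bullet> T n \<xi> - a) \<partial>P) \<longlonglongrightarrow> exp (- (norm l)\<^sup>2 / 2) * cos a"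
 shows "converges_in_distribution P T std_normal_vec"
 unfolding converges_in_distribution_def
proof (intro allI impI, elim conjE)
 fix g :: "real^'p => real" assume g: "continuous_on UNIV g" "bounded (range g)"
 interpret P: prob_space P by fact
 interpret N: prob_space "std_normal_vec :: (real^'p) measure" by (rule prob_space_std_normal_vec)
 have gm [measurable]: "g \<in> borel_measurable borel" using g(1) by (rule borel_measurable_continuous_onI)
 obtain B where B: "B > 0" "\<And>x. \<bar>g x\<bar> <= B" using g(2) by (auto simp: bounded_pos)
 define cutf where "cutf r x = max 0 (min 1 (r + 1 - norm x))" for r :: real and x :: "real^'p"
 have cutfc: "continuous_on UNIV (cutf r)" for r unfolding cutf_def by (intro continuous_intros)
 have cutf: "0 <= cutf r x" "cutf r x <= 1" "r + 1 < norm x ==> cutf r x = 0" "norm x <= r ==> cutf r x = 1" for r x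
  by (auto simp: cutf_def)
 have cutfm [measurable]: "cutf r \<in> borel_measurable borel" for r using cutfc by (rule borel_measurable_continuous_onI)
 have I: "integrable Q (%\<xi>. g (X \<xi>) * cutf r (X \<xi>))" "integrable Q (%\<xi>. cutf r (X \<xi>))"
   "\<bar>(\<integral>\<xi>. g (X \<xi>) \<partial>Q) - (\<integral>\<xi>. g (X \<xi>) * cutf r (X \<xi>) \<partial>Q)\<bar> <= B * (1 - (\<integral>\<xi>. cutf r (X \<xi>) \<partial>Q))"
  if "prob_space Q" and [measurable]: "X \<in> borel_measurable Q" for Q :: "'q measure" and X r
 proof -
  interpret Q: prob_space Q by fact
  have g1: "integrable Q (%\<xi>. g (X \<xi>))" by (rule Q.integrable_const_bound[where B = B]) (auto simp: B)
  show g2: "integrable Q (%\<xi>. g (X \<xi>) * cutf r (X \<xi>))"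
  proof (rule Q.integrable_const_bound[where B = B])
   have "\<bar>g x\<bar> * \<bar>cutf r x\<bar> <= B * 1" for x
    by (rule mult_mono) (use B cutf(1,2)[of r x] in auto)
   then show "AE \<xi> in Q. norm (g (X \<xi>) * cutf r (X \<xi>)) <= B" by (simp add: abs_mult)
  qed measurable
  show g3: "integrable Q (%\<xi>. cutf r (X \<xi>))"
   by (rule Q.integrable_const_bound[where B = 1]) (auto simp: cutf)
  have "\<bar>(\<integral>\<xi>. g (X \<xi>) \<partial>Q) - (\<integral>\<xi>. g (X \<xi>) * cutf r (X \<xi>) \<partial>Q)\<bar> = \<bar>\<integral>\<xi>. g (X \<xi>) - g (X \<xi>) * cutf r (X \<xi>) \<partial>Q\<bar>"
   using g1 g2 by simp
  also have "... <= (\<integral>\<xi>. \<bar>g (X \<xi>) - g (X \<xi>) * cutf r (X \<xi>)\<bar> \<partial>Q)"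
   using integral_norm_bound[of Q "%\<xi>. g (X \<xi>) - g (X \<xi>) * cutf r (X \<xi>)"] by simp
  also have "... <= (\<integral>\<xi>. B * (1 - cutf r (X \<xi>)) \<partial>Q)"
  proof (rule integral_mono)
   fix \<xi>
   have "\<bar>g (X \<xi>) - g (X \<xi>) * cutf r (X \<xi>)\<bar> = \<bar>g (X \<xi>)\<bar> * (1 - cutf r (X \<xi>))"
   proof -
    have "g (X \<xi>) - g (X \<xi>) * cutf r (X \<xi>) = g (X \<xi>) * (1 - cutf r (X \<xi>))" by (simp add: algebra_simps)
    then show ?thesis using cutf(2)[of r "X \<xi>"] by (simp only: abs_mult)
   qed
   also have "... <= B * (1 - cutf r (X \<xi>))" using B cutf(2) by (intro mult_right_mono) auto
   finally show "\<bar>g (X \<xi>) - g (X \<xi>) * cutf r (X \<xi>)\<bar> <= B * (1 - cutf r (X \<xi>))" .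
  qed (use g1 g2 g3 in auto)
  also have "... = B * (1 - (\<integral>\<xi>. cutf r (X \<xi>) \<partial>Q))" using g3 by (simp add: Q.prob_space)
  finally show "\<bar>(\<integral>\<xi>. g (X \<xi>) \<partial>Q) - (\<integral>\<xi>. g (X \<xi>) * cutf r (X \<xi>) \<partial>Q)\<bar> <= B * (1 - (\<integral>\<xi>. cutf r (X \<xi>) \<partial>Q))" .
 qed
 have "(%n. \<integral>\<xi>. g (T n \<xi>) \<partial>P) \<longlonglongrightarrow> (\<integral>x. g x \<partial>std_normal_vec)"
 proof (rule LIMSEQ_I)
  fix \<epsilon>0 :: real assume e0: "\<epsilon>0 > 0"
  define \<epsilon> where "\<epsilon> = \<epsilon>0 / (4 * B + 1)"
  have e: "\<epsilon> > 0" using e0 B by (simp add: \<epsilon>_def)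
  have e': "\<epsilon> * (4 * B + 1) = \<epsilon>0" using B by (simp add: \<epsilon>_def)
  obtain r where r: "r > 0" "N.prob {x. r <= norm x} < \<epsilon>"
   using N.prob_norm_large_small[of "%x. x" \<epsilon>] e by auto
  have cutfN: "1 - (\<integral>x. cutf r x \<partial>std_normal_vec) <= \<epsilon>"
  proof -
   have "(\<integral>x. 1 - indicator {x. r <= norm x} x \<partial>(std_normal_vec :: (real^'p) measure)) <= (\<integral>x. cutf r x \<partial>std_normal_vec)"
   proof (intro integral_mono)
    show "integrable (std_normal_vec :: (real^'p) measure) (%x. 1 - indicator {x. r <= norm x} x :: real)"
     by (rule N.integrable_const_bound[where B = 1]) (auto simp: indicator_def)
    show "integrable std_normal_vec (cutf r)" using I(2)[OF prob_space_std_normal_vec, of "%x. x"] by simp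
   qed (auto simp: indicator_def cutf)
   also have "(\<integral>x. 1 - indicator {x. r <= norm x} x \<partial>(std_normal_vec :: (real^'p) measure)) = 1 - N.prob {x. r <= norm x}"
   proof -
    have "integrable (std_normal_vec :: (real^'p) measure) (indicator {x. r <= norm x} :: _ => real)"
     by (rule N.integrable_const_bound[where B = 1]) (auto simp: indicator_def)
    then show ?thesis by (subst Bochner_Integration.integral_diff) (auto simp: N.prob_space[simplified])
   qed
   finally show ?thesis using r by simp
  qed
  have 1: "(%n. \<integral>\<xi>. g (T n \<xi>) * cutf r (T n \<xi>) \<partial>P) \<longlonglongrightarrow> (\<integral>x. g x * cutf r x \<partial>std_normal_vec)"
   by (rule levy_continuity_compact_support[OF P T cf, where r = "r + 1"]) (auto intro!: continuous_intros g cutfc simp: cutf)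
  have 2: "(%n. \<integral>\<xi>. cutf r (T n \<xi>) \<partial>P) \<longlonglongrightarrow> (\<integral>x. cutf r x \<partial>std_normal_vec)"
   by (rule levy_continuity_compact_support[OF P T cf cutfc, where r = "r + 1"]) (auto simp: cutf)
  obtain n1 where n1: "\<And>n. n \<ge> n1 ==> norm ((\<integral>\<xi>. g (T n \<xi>) * cutf r (T n \<xi>) \<partial>P) - (\<integral>x. g x * cutf r x \<partial>std_normal_vec)) < \<epsilon>"
   using LIMSEQ_D[OF 1 e] by auto
  obtain n2 where n2: "\<And>n. n \<ge> n2 ==> norm ((\<integral>\<xi>. cutf r (T n \<xi>) \<partial>P) - (\<integral>x. cutf r x \<partial>std_normal_vec)) < \<epsilon>"
   using LIMSEQ_D[OF 2 e] by auto
  show "\<exists>no. \<forall>n\<ge>no. norm ((\<integral>\<xi>. g (T n \<xi>) \<partial>P) - (\<integral>x. g x \<partial>std_normal_vec)) < \<epsilon>0"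
  proof (intro exI[of _ "max n1 n2"] allI impI)
   fix n assume "n \<ge> max n1 n2"
   then have n: "n \<ge> n1" "n \<ge> n2" by auto
   have "B * (1 - (\<integral>\<xi>. cutf r (T n \<xi>) \<partial>P)) <= B * (2 * \<epsilon>)"
    using n2[OF n(2)] cutfN B by (intro mult_left_mono) auto
   moreover have "B * (1 - (\<integral>x. cutf r x \<partial>std_normal_vec)) <= B * \<epsilon>"
    using cutfN B by (intro mult_left_mono) auto
   ultimately have "\<bar>(\<integral>\<xi>. g (T n \<xi>) \<partial>P) - (\<integral>x. g x \<partial>std_normal_vec)\<bar> < B * (2 * \<epsilon>) + \<epsilon> + B * \<epsilon>"
    using n1[OF n(1)] I(3)[OF P T, of n r] I(3)[OF prob_space_std_normal_vec, of "%x. x" r] by simp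
   also have "... <= \<epsilon>0" unfolding e'[symmetric] using e B by (simp add: algebra_simps)
   finally show "norm ((\<integral>\<xi>. g (T n \<xi>) \<partial>P) - (\<integral>x. g x \<partial>std_normal_vec)) < \<epsilon>0" by simp
  qed
 qed
 then show "(%n. \<integral>x. g x \<partial>(distr P borel (T n))) \<longlonglongrightarrow> (\<integral>x. g x \<partial>std_normal_vec)"
  by (simp add: integral_distr)
qed

text \<open>A cosine is bounded and 1-Lipschitz, so the two characteristic functions have the same limit.\<close>
theorem converges_in_distribution_slutsky:
 fixes T T' :: "nat => 'w => real^'p"
 assumes P: "prob_space P" and T [measurable]: "\<And>n. T n \<in> borel_measurable P"
  and T' [measurable]: "\<And>n. T' n \<in> borel_measurable P"
  and cf: "\<And>l a. (%n. \<integral>\<xi>. cos (l \<bullet> T n \<xi> - a) \<partial>P) \<longlonglongrightarrow> exp (- (norm l)\<^sup>2 / 2) * cos a"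
  and close: "\<And>\<delta>. 0 < \<delta> ==> (%n. measure P {\<xi> \<in> space P. \<delta> < norm (T' n \<xi> - T n \<xi>)}) \<longlonglongrightarrow> 0"
 shows "converges_in_distribution P T' std_normal_vec"
proof (rule levy_continuity_std_normal_vec[OF P T'])
 fix l :: "real^'p" and a
 interpret P: prob_space P by fact
 have i: "integrable P (%\<xi>. cos (l \<bullet> X \<xi> - a))" if [measurable]: "X \<in> borel_measurable P" for X
  by (rule P.integrable_const_bound[where B = 1]) auto
 have "(%n. (\<integral>\<xi>. cos (l \<bullet> T' n \<xi> - a) \<partial>P) - (\<integral>\<xi>. cos (l \<bullet> T n \<xi> - a) \<partial>P)) \<longlonglongrightarrow> 0"
 proof (rule LIMSEQ_I)
  fix \<epsilon> :: real assume e: "\<epsilon> > 0"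
  define \<delta> where "\<delta> = \<epsilon> / (2 * (norm l + 1))"
  have d: "\<delta> > 0" using e by (simp add: \<delta>_def add_nonneg_pos)
  have ld: "norm l * \<delta> <= \<epsilon> / 2"
  proof -
   have "norm l * \<delta> <= (norm l + 1) * \<delta>" using d by (intro mult_right_mono) auto
   also have "... = \<epsilon> / 2" unfolding \<delta>_def using norm_ge_zero[of l] by (simp add: field_simps del: norm_ge_zero)
   finally show ?thesis .
  qed
  obtain n0 where n0: "\<And>n. n \<ge> n0 ==> norm (measure P {\<xi> \<in> space P. \<delta> < norm (T' n \<xi> - T n \<xi>)} - 0) < \<epsilon> / 4"
   using LIMSEQ_D[OF close[OF d], of "\<epsilon> / 4"] e by auto
  show "\<exists>no. \<forall>n\<ge>no. norm ((\<integral>\<xi>. cos (l \<bullet> T' n \<xi> - a) \<partial>P) - (\<integral>\<xi>. cos (l \<bullet> T n \<xi> - a) \<partial>P) - 0) < \<epsilon>"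
  proof (intro exI[of _ n0] allI impI)
   fix n assume n: "n \<ge> n0"
   define A where "A = {\<xi> \<in> space P. \<delta> < norm (T' n \<xi> - T n \<xi>)}"
   have [measurable]: "A \<in> sets P" unfolding A_def by measurable
   have "\<bar>(\<integral>\<xi>. cos (l \<bullet> T' n \<xi> - a) \<partial>P) - (\<integral>\<xi>. cos (l \<bullet> T n \<xi> - a) \<partial>P)\<bar>
     = \<bar>\<integral>\<xi>. cos (l \<bullet> T' n \<xi> - a) - cos (l \<bullet> T n \<xi> - a) \<partial>P\<bar>"
    using i by simp
   also have "... <= (\<integral>\<xi>. \<bar>cos (l \<bullet> T' n \<xi> - a) - cos (l \<bullet> T n \<xi> - a)\<bar> \<partial>P)"
    using integral_norm_bound[of P "%\<xi>. cos (l \<bullet> T' n \<xi> - a) - cos (l \<bullet> T n \<xi> - a)"] by simp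
   also have "... <= (\<integral>\<xi>. norm l * \<delta> + 2 * indicator A \<xi> \<partial>P)"
   proof (rule integral_mono)
    fix \<xi> assume w: "\<xi> \<in> space P"
    show "\<bar>cos (l \<bullet> T' n \<xi> - a) - cos (l \<bullet> T n \<xi> - a)\<bar> <= norm l * \<delta> + 2 * indicator A \<xi>"
    proof (cases "\<xi> \<in> A")
     case True
     have "\<bar>cos (l \<bullet> T' n \<xi> - a) - cos (l \<bullet> T n \<xi> - a)\<bar> <= 2"
      using abs_cos_le_one[of "l \<bullet> T' n \<xi> - a"] abs_cos_le_one[of "l \<bullet> T n \<xi> - a"] by linarith
     then show ?thesis using True d by (simp add: add_increasing)
    next
     case False
     have "\<bar>cos (l \<bullet> T' n \<xi> - a) - cos (l \<bullet> T n \<xi> - a)\<bar> <= \<bar>(l \<bullet> T' n \<xi> - a) - (l \<bullet> T n \<xi> - a)\<bar>"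
     proof -
      have "\<bar>cos x - cos y\<bar> <= \<bar>x - y\<bar>" for x y :: real
      proof -
       have "\<bar>cos x - cos y\<bar> = 2 * (\<bar>sin ((x + y) / 2)\<bar> * \<bar>sin ((y - x) / 2)\<bar>)"
        by (simp add: cos_diff_cos abs_mult)
       also have "... <= 2 * (1 * \<bar>(y - x) / 2\<bar>)"
        by (intro mult_left_mono mult_mono abs_sin_x_le_abs_x) auto
       finally show ?thesis by simp
      qed
      then show ?thesis .
     qed
     also have "... = \<bar>l \<bullet> (T' n \<xi> - T n \<xi>)\<bar>" by (simp add: inner_diff_right)
     also have "... <= norm l * norm (T' n \<xi> - T n \<xi>)" by (rule Cauchy_Schwarz_ineq2)
     also have "... <= norm l * \<delta>" using False w by (intro mult_left_mono) (auto simp: A_def)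
     finally show ?thesis using False by simp
    qed
   next
    show "integrable P (%\<xi>. norm l * \<delta> + 2 * indicator A \<xi>)"
     by (rule P.integrable_const_bound[where B = "norm l * \<delta> + 2"]) (use d in \<open>auto simp: indicator_def A_def\<close>)
   qed (use i in auto)
   also have "... = norm l * \<delta> + 2 * measure P A"
   proof -
    have "integrable P (indicator A :: _ => real)"
     by (rule P.integrable_const_bound[where B = 1]) (auto simp: indicator_def)
    then show ?thesis by (subst Bochner_Integration.integral_add) (auto simp: P.prob_space)
   qed
   also have "... < \<epsilon>" using n0[OF n] ld by (simp add: A_def)
   finally show "norm ((\<integral>\<xi>. cos (l \<bullet> T' n \<xi> - a) \<partial>P) - (\<integral>\<xi>. cos (l \<bullet> T n \<xi> - a) \<partial>P) - 0) < \<epsilon>" by simp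
  qed
 qed
 from tendsto_add[OF this cf[of l a]]
 show "(%n. \<integral>\<xi>. cos (l \<bullet> T' n \<xi> - a) \<partial>P) \<longlonglongrightarrow> exp (- (norm l)\<^sup>2 / 2) * cos a" by simp
qed

section \<open>Counting separated points in a Hilbert space\<close>

context hilbert_space
begin

lemma conjugate_one: "conjugate (1::'k) = 1"
 using scalar_mult_conjugate[of 1] by simp

lemma norm_conjugate: "norm (conjugate (a::'k)) = norm a"
proof -
 have "of_real ((norm (conjugate a))\<^sup>2) = conjugate a * conjugate (conjugate a)"
  by (rule scalar_mult_conjugate[symmetric])
 also have "... = a * conjugate a" by (simp add: mult.commute)
 also have "... = of_real ((norm a)\<^sup>2)" by (rule scalar_mult_conjugate)
 finally have "(norm (conjugate a))\<^sup>2 = (norm a)\<^sup>2" by (simp only: of_real_eq_iff)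
 then show ?thesis by (simp add: power2_eq_iff_nonneg)
qed

definition scalar_re :: "'k => real" where
 "scalar_re a = ((norm (1 + a))\<^sup>2 - 1 - (norm a)\<^sup>2) / 2"

lemma scalar_re_eq: "a + conjugate a = of_real (2 * scalar_re a)"
proof -
 have "of_real ((norm (1 + a))\<^sup>2) = (1 + a) * conjugate (1 + a)" by (rule scalar_mult_conjugate[symmetric])
 also have "... = 1 + a * conjugate a + (a + conjugate a)"
  by (simp add: conjugate_dist_add conjugate_one algebra_simps)
 also have "a * conjugate a = of_real ((norm a)\<^sup>2)" by (rule scalar_mult_conjugate)
 finally show ?thesis by (simp add: scalar_re_def algebra_simps)
qed

lemma scalar_re_diff: "scalar_re (a - b) = scalar_re a - scalar_re b"
proof -
 have "of_real (2 * scalar_re (a - b)) = (a - b) + conjugate (a - b)" by (rule scalar_re_eq[symmetric])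
 also have "conjugate (a - b) = conjugate a - conjugate b"
  using conjugate_dist_add[of a "- b"] by (simp add: conjugate_neg)
 also have "(a - b) + (conjugate a - conjugate b) = (a + conjugate a) - (b + conjugate b)" by simp
 also have "... = of_real (2 * scalar_re a - 2 * scalar_re b)" by (simp only: scalar_re_eq of_real_diff)
 finally show ?thesis by (simp only: of_real_eq_iff)
qed

lemma conjugate_of_real: "conjugate (of_real r :: 'k) = of_real r"
proof -
 have "norm (1 + of_real r :: 'k) = \<bar>1 + r\<bar>" by (metis norm_of_real of_real_1 of_real_add)
 then have "scalar_re (of_real r) = r" by (simp add: scalar_re_def power2_eq_square algebra_simps)
 then show ?thesis using scalar_re_eq[of "of_real r"] by (simp add: algebra_simps)
qed

lemma scalar_re_le: "\<bar>scalar_re a\<bar> <= norm a"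
proof -
 have "2 * \<bar>scalar_re a\<bar> = norm (of_real (2 * scalar_re a) :: 'k)" by (simp only: norm_of_real abs_mult abs_numeral)
 also have "... = norm (a + conjugate a)" by (simp only: scalar_re_eq)
 also have "... <= norm a + norm (conjugate a)" by (rule norm_triangle_ineq)
 finally show ?thesis by (simp add: norm_conjugate)
qed

text \<open>The scalar field has real dimension at most two: every scalar is a root of a real quadratic polynomial.\<close>
lemma scalar_coordinates:
 "\<exists>re im :: 'k => real. (\<forall>a b. \<bar>re a - re b\<bar> <= norm (a - b)) \<and> (\<forall>a b. \<bar>im a - im b\<bar> <= norm (a - b))
   \<and> (\<forall>a b. norm (a - b) <= \<bar>re a - re b\<bar> + \<bar>im a - im b\<bar>)"
proof (cases "\<forall>a::'k. conjugate a = a")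
 case True
 have "a = of_real (scalar_re a)" for a
  using scalar_re_eq[of a] True by (simp add: mult_2[symmetric])
 then have "norm a = \<bar>scalar_re a\<bar>" for a by (metis norm_of_real)
 then show ?thesis
  by (intro exI[of _ scalar_re] exI[of _ "%_. 0"]) (simp add: scalar_re_diff[symmetric])
next
 case False
 then obtain b :: 'k where b: "conjugate b \<noteq> b" by auto
 define d where "d = b - conjugate b"
 have conj_diff: "conjugate (x - y) = conjugate x - conjugate y" for x y :: 'k
  using conjugate_dist_add[of x "- y"] by (simp add: conjugate_neg)
 have d: "d \<noteq> 0" "conjugate d = - d" using b by (auto simp: d_def conj_diff)
 define j where "j = of_real (1 / norm d) * d"
 have j1: "norm j = 1" using d by (simp add: j_def norm_divide)
 have j2: "conjugate j = - j" by (simp only: j_def conjugate_dist_mul conjugate_of_real d) simp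
 have jj: "j * j = - 1"
  using scalar_mult_conjugate[of j] j1 j2 by (simp add: minus_equation_iff)
 define im where "im a = - scalar_re ((a - conjugate a) * j) / 2" for a
 have im_diff: "im a - im b = im (a - b)" for a b
 proof -
  have e: "(a - b - conjugate (a - b)) * j = (a - conjugate a) * j - (b - conjugate b) * j"
   by (simp add: conj_diff algebra_simps)
  show ?thesis unfolding im_def e scalar_re_diff by (simp add: field_simps)
 qed
 have im_le: "\<bar>im a\<bar> <= norm a" for a
 proof -
  have "2 * \<bar>im a\<bar> <= norm ((a - conjugate a) * j)" using scalar_re_le[of "(a - conjugate a) * j"] by (simp add: im_def)
  also have "... <= norm a + norm (conjugate a)" using norm_triangle_ineq4[of a "conjugate a"] by (simp add: norm_mult j1)
  finally show ?thesis by (simp add: norm_conjugate)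
 qed
 have norm_le: "norm a <= \<bar>scalar_re a\<bar> + \<bar>im a\<bar>" for a
 proof -
  define x where "x = (a - conjugate a) * j"
  have "conjugate x = x" by (simp add: x_def conjugate_dist_mul conj_diff j2 algebra_simps)
  then have "2 *\<^sub>R x = of_real (2 * scalar_re x)" using scalar_re_eq[of x] by (simp only: scaleR_2)
  also have "... = 2 *\<^sub>R of_real (scalar_re x)" by (simp add: scaleR_conv_of_real)
  finally have x: "x = of_real (scalar_re x)" by simp
  have "x * j = (a - conjugate a) * (j * j)" by (simp add: x_def mult.assoc)
  then have m: "a - conjugate a = - (x * j)" by (simp add: jj)
  have "2 *\<^sub>R a = (a + conjugate a) + (a - conjugate a)" by (simp add: scaleR_2)
  also have "... = of_real (2 * scalar_re a) - x * j" unfolding m scalar_re_eq by simp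
  finally have "norm (2 *\<^sub>R a) <= norm (of_real (2 * scalar_re a) :: 'k) + norm (x * j)"
   by (simp only: norm_triangle_ineq4)
  moreover have "norm (x * j) = \<bar>scalar_re x\<bar>"
   using arg_cong[OF x, of norm] by (simp add: norm_mult j1)
  moreover have "norm (of_real (2 * scalar_re a) :: 'k) = 2 * \<bar>scalar_re a\<bar>" by (simp only: norm_of_real abs_mult abs_numeral)
  ultimately have "2 * norm a <= 2 * \<bar>scalar_re a\<bar> + \<bar>scalar_re x\<bar>" by simp
  then show ?thesis by (simp add: im_def x_def)
 qed
 show ?thesis
  by (intro exI[of _ scalar_re] exI[of _ im])
   (simp add: scalar_re_diff[symmetric] im_diff scalar_re_le im_le norm_le)
qed

lemma ip_zero_left: "ip 0 x = 0"
 using ip_add_left[of 0 0 x] by simp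

lemma ip_diff_left: "ip (x - y) z = ip x z - ip y z"
 using ip_add_left[of "x - y" y z] by simp

lemma ip_unit_bound:
 assumes "e = 0 \<or> ip e e = 1"
 shows "norm (ip x e) <= norm x"
proof (cases "e = 0")
 case True
 have "ip x 0 = conjugate (ip 0 x)" by (rule ip_commute)
 then show ?thesis using True by (simp add: ip_zero_left)
next
 case False
 then have e: "ip e e = 1" using assms by simp
 define a where "a = ip x e"
 define w where "w = x - scl a e"
 have we: "ip w e = 0" by (simp add: w_def ip_diff_left ip_scl_left e a_def)
 have ew: "ip e w = 0" using ip_commute[of e w] we ip_zero_left by (metis conjugate_zero)
 have "of_real ((norm w)\<^sup>2) = ip w w" by (simp add: ip_self)
 also have "... = ip x w" using ip_diff_left[of x "scl a e" w] ew unfolding w_def[symmetric] ip_scl_left by simp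
 also have "... = conjugate (ip w x)" by (rule ip_commute)
 also have "ip w x = ip x x - a * ip e x" by (simp add: w_def ip_diff_left ip_scl_left)
 also have "ip e x = conjugate a" unfolding a_def by (rule ip_commute)
 also have "ip x x - a * conjugate a = of_real ((norm x)\<^sup>2 - (norm a)\<^sup>2)" by (simp only: ip_self scalar_mult_conjugate of_real_diff)
 finally have "(norm w)\<^sup>2 = (norm x)\<^sup>2 - (norm a)\<^sup>2" by (simp only: conjugate_of_real of_real_eq_iff)
 then have "(norm a)\<^sup>2 <= (norm x)\<^sup>2" using zero_le_power2[of "norm w"] by linarith
 then show ?thesis unfolding a_def by (simp add: power2_le_iff_abs_le)
qed

lemma norm_scl: "norm (scl a x) = norm a * norm x"
proof -
 have "of_real ((norm (scl a x))\<^sup>2) = ip (scl a x) (scl a x)" by (simp add: ip_self)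
 also have "... = a * conjugate (ip (scl a x) x)" by (simp only: ip_scl_left ip_commute[of x "scl a x"])
 also have "... = (a * conjugate a) * conjugate (ip x x)" by (simp add: ip_scl_left conjugate_dist_mul mult.assoc)
 also have "conjugate (ip x x) = ip x x" by (rule ip_commute[symmetric])
 also have "(a * conjugate a) * ip x x = of_real ((norm a * norm x)\<^sup>2)" by (simp only: scalar_mult_conjugate ip_self power_mult_distrib of_real_mult)
 finally have "(norm (scl a x))\<^sup>2 = (norm a * norm x)\<^sup>2" by (simp only: of_real_eq_iff)
 then show ?thesis by (simp add: power2_eq_iff_nonneg)
qed

lemma orthonormal_basis_unit:
 assumes "orthonormal_basis scl ip e" "1 <= j"
 shows "e j = 0 \<or> ip (e j) (e j) = 1"
proof -
 obtain N :: enat where N: "\<forall>i\<ge>1. \<forall>j\<ge>1. enat i <= N \<and> enat j <= N --> ip (e i) (e j) = (if i = j then 1 else 0)"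
   "\<forall>j. N < enat j --> e j = 0"
  using assms(1) unfolding orthonormal_basis_def by (elim conjE exE) (rule that)
 show ?thesis using N assms(2) by (cases "enat j <= N") auto
qed

text \<open>Rounding the real and imaginary parts of the first \<open>d\<close> coordinates to a grid of small mesh separates the points,
and a ball of radius \<open>r\<close> meets at most a multiple of \<open>(1 + r) ^ (2 * d)\<close> cells.\<close>
lemma separated_projections_count:
 assumes onb: "orthonormal_basis scl ip e" and \<Delta>: "0 < \<Delta>"
 shows "\<exists>C\<ge>1. \<forall>n (x :: nat => 'h) i r.
  (\<forall>i j. i < j --> j < n --> \<Delta> <= norm (onb_projection scl ip e d (x i) - onb_projection scl ip e d (x j))) --> 0 <= r -->
  real (card {j \<in> {..<n}. norm (x i - x j) <= r}) <= C * (1 + r) ^ (2 * d)"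
proof -
 obtain re im :: "'k => real" where re: "\<And>a b. \<bar>re a - re b\<bar> <= norm (a - b)" and im: "\<And>a b. \<bar>im a - im b\<bar> <= norm (a - b)"
  and ri: "\<And>a b. norm (a - b) <= \<bar>re a - re b\<bar> + \<bar>im a - im b\<bar>"
  using scalar_coordinates by auto
 define \<eta> where "\<eta> = \<Delta> / (2 * real d + 1)"
 have \<eta>: "\<eta> > 0" using \<Delta> by (simp add: \<eta>_def)
 have \<eta>d: "2 * \<eta> * real d < \<Delta>" using \<Delta> by (simp add: \<eta>_def field_simps)
 define C where "C = (5 + 2 / \<eta>) ^ (2 * d)"
 have C1: "C \<ge> 1" unfolding C_def using \<eta> by (intro one_le_power) simp
 show ?thesis
 proof (intro exI[of _ C] conjI C1 allI impI)
  fix n and x :: "nat => 'h" and i and r :: real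
  assume sep: "\<forall>i j. i < j --> j < n --> \<Delta> <= norm (onb_projection scl ip e d (x i) - onb_projection scl ip e d (x j))" and r: "0 <= r"
  define A where "A = {j \<in> {..<n}. norm (x i - x j) <= r}"
  define cell where "cell a = (\<lfloor>re a / \<eta>\<rfloor>, \<lfloor>im a / \<eta>\<rfloor>)" for a
  define M where "M = \<lceil>r / \<eta>\<rceil> + 1"
  define Z where "Z k = {fst (cell (ip (x i) (e k))) - M..fst (cell (ip (x i) (e k))) + M} \<times> {snd (cell (ip (x i) (e k))) - M..snd (cell (ip (x i) (e k))) + M}" for k
  define F where "F j = (\<lambda>k\<in>{1..d}. cell (ip (x j) (e k)))" for j
  have "0 <= r / \<eta>" using r \<eta> by simp
  then have M0: "M \<ge> 1" unfolding M_def by linarith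
  have unit: "e k = 0 \<or> ip (e k) (e k) = 1" if "k \<in> {1..d}" for k using orthonormal_basis_unit[OF onb] that by auto
  have fl: "\<lfloor>u / \<eta>\<rfloor> \<in> {\<lfloor>v / \<eta>\<rfloor> - M..\<lfloor>v / \<eta>\<rfloor> + M}" if "\<bar>v - u\<bar> <= r" for u v
  proof -
   have "\<bar>v / \<eta> - u / \<eta>\<bar> <= r / \<eta>" using that \<eta> by (simp add: divide_right_mono flip: diff_divide_distrib)
   then show ?thesis unfolding M_def by (auto) linarith+
  qed
  have inj: "inj_on F A"
  proof (rule inj_onI, rule ccontr)
   fix j l assume jl: "j \<in> A" "l \<in> A" "F j = F l" "j \<noteq> l"
   have c: "cell (ip (x j) (e k)) = cell (ip (x l) (e k))" if "k \<in> {1..d}" for k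
    using fun_cong[OF jl(3), of k] that by (simp add: F_def)
   have fle: "\<bar>u - v\<bar> <= \<eta>" if "\<lfloor>u / \<eta>\<rfloor> = \<lfloor>v / \<eta>\<rfloor>" for u v
   proof -
    have "\<bar>u / \<eta> - v / \<eta>\<bar> <= 1" using that by linarith
    then show ?thesis using \<eta> by (simp add: field_simps flip: diff_divide_distrib)
   qed
   have dk: "norm (ip (x j) (e k) - ip (x l) (e k)) <= 2 * \<eta>" if "k \<in> {1..d}" for k
   proof -
    have "\<bar>re (ip (x j) (e k)) - re (ip (x l) (e k))\<bar> <= \<eta>" "\<bar>im (ip (x j) (e k)) - im (ip (x l) (e k))\<bar> <= \<eta>"
     using c[OF that] by (auto intro!: fle simp: cell_def)
    then show ?thesis using ri[of "ip (x j) (e k)" "ip (x l) (e k)"] by linarith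
   qed
   have "norm (onb_projection scl ip e d (x j) - onb_projection scl ip e d (x l))
    = norm (\<Sum>k=1..d. scl (ip (x j) (e k) - ip (x l) (e k)) (e k))"
    by (simp add: onb_projection_def sum_subtractf scale_left_diff_distrib)
   also have "... <= (\<Sum>k=1..d. 2 * \<eta>)"
   proof (rule sum_norm_le)
    fix k assume k: "k \<in> {1..d}"
    have "norm (e k) <= 1"
    proof (cases "e k = 0")
     case False
     then have "of_real ((norm (e k))\<^sup>2) = (1 :: 'k)" using unit[OF k] ip_self[of "e k"] by simp
     then have "(norm (e k))\<^sup>2 = 1" by (simp only: of_real_eq_1_iff)
     then show ?thesis using norm_ge_zero[of "e k"] by (auto simp: power2_eq_1_iff)
    qed simp
    then show "norm (scl (ip (x j) (e k) - ip (x l) (e k)) (e k)) <= 2 * \<eta>"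
     unfolding norm_scl using mult_mono[OF dk[OF k], of "norm (e k)" 1] \<eta> by simp
   qed
   also have "... < \<Delta>" using \<eta>d by (simp add: algebra_simps)
   finally have lt: "norm (onb_projection scl ip e d (x j) - onb_projection scl ip e d (x l)) < \<Delta>" .
   have "j < n" "l < n" using jl by (auto simp: A_def)
   then show False using lt sep jl(4) by (metis linorder_neqE_nat norm_minus_commute not_less)
  qed
  have img: "F ` A \<subseteq> PiE {1..d} Z"
  proof
   fix y assume "y \<in> F ` A"
   then obtain j where j: "j \<in> A" "y = F j" by auto
   have "cell (ip (x j) (e k)) \<in> Z k" if k: "k \<in> {1..d}" for k
   proof -
    have "norm (ip (x i) (e k) - ip (x j) (e k)) <= r"
     using ip_unit_bound[OF unit[OF k], of "x i - x j"] j by (simp add: ip_diff_left A_def)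
    then have "\<bar>re (ip (x i) (e k)) - re (ip (x j) (e k))\<bar> <= r" "\<bar>im (ip (x i) (e k)) - im (ip (x j) (e k))\<bar> <= r"
     using re im order_trans by blast+
    then show ?thesis using fl by (simp add: Z_def cell_def)
   qed
   then show "y \<in> PiE {1..d} Z" by (auto simp: j F_def)
  qed
  have fZ: "finite (PiE {1..d} Z)" by (intro finite_PiE) (auto simp: Z_def)
  have cZ: "real (card (Z k)) = (real_of_int (2 * M + 1))\<^sup>2" for k
   using M0 by (simp add: Z_def card_cartesian_product power2_eq_square)
  have "real (card A) = real (card (F ` A))" by (simp add: card_image[OF inj])
  also have "... <= real (card (PiE {1..d} Z))" by (rule of_nat_mono[OF card_mono[OF fZ img]])
  also have "... = (real_of_int (2 * M + 1)) ^ (2 * d)"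
   by (simp add: card_PiE cZ power_mult del: of_int_add of_int_mult)
  also have "... <= ((5 + 2 / \<eta>) * (1 + r)) ^ (2 * d)"
  proof (rule power_mono)
   have "real_of_int M <= r / \<eta> + 2" unfolding M_def by linarith
   then have "real_of_int (2 * M + 1) <= 5 + 2 * (r / \<eta>)" by simp
   also have "... <= 5 + 5 * r + 2 / \<eta> + 2 * (r / \<eta>)" using r \<eta> by simp
   also have "... = (5 + 2 / \<eta>) * (1 + r)" by (simp add: distrib_left distrib_right)
   finally show "real_of_int (2 * M + 1) <= (5 + 2 / \<eta>) * (1 + r)" .
  qed (use M0 in simp)
  finally show "real (card {j \<in> {..<n}. norm (x i - x j) <= r}) <= C * (1 + r) ^ (2 * d)"
   by (simp add: A_def C_def power_mult_distrib)
 qed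
qed

end

text \<open>On the shell where \<open>\<rho>\<close> lies between \<open>2 ^ i * L\<close> and twice this value there are at most of the order of
\<open>(2 ^ i * L) ^ m\<close> terms, each at most \<open>(2 ^ i * L) powr (- 2 * \<gamma>)\<close>; the geometric series converges because \<open>m < 2 * \<gamma>\<close>.\<close>
lemma dyadic_tail_sum:
 fixes \<rho> :: "'j => real" and \<gamma> :: real
 assumes J: "finite J" and count: "\<And>r. 0 <= r ==> real (card {j \<in> J. \<rho> j <= r}) <= C * (1 + r) ^ m"
  and C: "0 <= C" and \<gamma>: "real m < 2 * \<gamma>" and L: "1 <= L"
 shows "(\<Sum>j | j \<in> J \<and> L < \<rho> j. (1 / (1 + \<rho> j powr \<gamma>))\<^sup>2)
   <= C * 4 ^ m / (1 - 2 powr (real m - 2 * \<gamma>)) * L powr (real m - 2 * \<gamma>)"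
proof -
 define q where "q = 2 powr (real m - 2 * \<gamma>)"
 have q: "0 < q" "q < 1" using \<gamma> by (auto simp: q_def powr_less_one)
 define J' where "J' = {j \<in> J. L < \<rho> j}"
 have fJ': "finite J'" using J by (simp add: J'_def)
 obtain K where K: "\<And>j. j \<in> J' ==> \<rho> j <= 2 ^ K * L"
 proof -
  obtain b where b: "\<And>j. j \<in> J' ==> \<rho> j <= b"
   using bdd_above_finite[of "\<rho> ` J'"] fJ' by (auto simp: bdd_above_def)
  obtain K where "b < 2 ^ K" using real_arch_pow[of 2 b] by auto
  moreover have "(2::real) ^ K <= 2 ^ K * L" using L by simp
  ultimately have "\<rho> j <= 2 ^ K * L" if "j \<in> J'" for j using b[OF that] by linarith
  then show thesis by (rule that)
 qed
 define S where "S k = {j \<in> J'. 2 ^ k * L < \<rho> j \<and> \<rho> j <= 2 ^ (k + 1) * L}" for k :: nat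
 have cover: "J' \<subseteq> (\<Union>k<K. S k)"
 proof
  fix j assume j: "j \<in> J'"
  define k where "k = (LEAST k. \<rho> j <= 2 ^ (k + 1) * L)"
  have ex: "\<rho> j <= 2 ^ (K + 1) * L" using K[OF j] L by (simp add: mult_mono order_trans[of _ "2 ^ K * L"])
  have k1: "\<rho> j <= 2 ^ (k + 1) * L" unfolding k_def by (rule LeastI[of _ K]) (rule ex)
  have k0: "2 ^ k * L < \<rho> j"
  proof (cases k)
   case 0 then show ?thesis using j by (simp add: J'_def)
  next
   case (Suc l)
   then have "\<not> \<rho> j <= 2 ^ (l + 1) * L" using not_less_Least[of l "%k. \<rho> j <= 2 ^ (k + 1) * L"] by (simp add: k_def)
   then show ?thesis using Suc by simp
  qed
  have "k < K"
  proof (rule ccontr)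
   assume "\<not> k < K"
   then have "2 ^ K * L <= 2 ^ k * L" using L by (simp add: mult_right_mono)
   then show False using K[OF j] k0 by simp
  qed
  then show "j \<in> (\<Union>k<K. S k)" using j k0 k1 by (auto simp: S_def)
 qed
 have bound: "(\<Sum>j\<in>S k. (1 / (1 + \<rho> j powr \<gamma>))\<^sup>2) <= C * 4 ^ m * L powr (real m - 2 * \<gamma>) * q ^ k" for k
 proof -
  define B where "B = 2 ^ k * L"
  have B: "B \<ge> 1" using L by (simp add: B_def mult_ge1_I)
  have "(\<Sum>j\<in>S k. (1 / (1 + \<rho> j powr \<gamma>))\<^sup>2) <= (\<Sum>j\<in>S k. B powr (- 2 * \<gamma>))"
  proof (rule sum_mono)
   fix j assume "j \<in> S k"
   then have j: "B < \<rho> j" by (simp add: S_def B_def)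
   have "1 / (1 + \<rho> j powr \<gamma>) <= 1 / (B powr \<gamma>)"
    using B j \<gamma> by (intro divide_left_mono mult_pos_pos) (auto intro!: add_increasing powr_mono2 add_pos_nonneg)
   then have "(1 / (1 + \<rho> j powr \<gamma>))\<^sup>2 <= (1 / (B powr \<gamma>))\<^sup>2" by (intro power_mono) auto
   also have "... = B powr (- 2 * \<gamma>)"
    using B by (simp add: power_divide powr_minus_divide powr_add[symmetric] power2_eq_square)
   finally show "(1 / (1 + \<rho> j powr \<gamma>))\<^sup>2 <= B powr (- 2 * \<gamma>)" .
  qed
  also have "... = real (card (S k)) * B powr (- 2 * \<gamma>)" by simp
  also have "real (card (S k)) <= C * (1 + 2 * B) ^ m"
  proof -
   have "real (card (S k)) <= real (card {j \<in> J. \<rho> j <= 2 * B})"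
    using J by (intro of_nat_mono card_mono) (auto simp: S_def J'_def B_def)
   also have "... <= C * (1 + 2 * B) ^ m" using B by (intro count) auto
   finally show ?thesis .
  qed
  also have "C * (1 + 2 * B) ^ m <= C * (4 * B) ^ m" using B C by (intro mult_left_mono power_mono) auto
  also have "C * (4 * B) ^ m * B powr (- 2 * \<gamma>) = C * 4 ^ m * B powr (real m - 2 * \<gamma>)"
   using B by (simp add: power_mult_distrib powr_diff powr_minus_divide powr_realpow)
  also have "B powr (real m - 2 * \<gamma>) = q ^ k * L powr (real m - 2 * \<gamma>)"
   using L by (simp add: B_def powr_mult q_def powr_realpow[symmetric] powr_powr mult.commute)
  finally show ?thesis by (simp add: mult_right_mono ac_simps)
 qed
 have "(\<Sum>j | j \<in> J \<and> L < \<rho> j. (1 / (1 + \<rho> j powr \<gamma>))\<^sup>2) = (\<Sum>j\<in>J'. (1 / (1 + \<rho> j powr \<gamma>))\<^sup>2)" by (simp add: J'_def)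
 also have "... <= (\<Sum>j\<in>(\<Union>k<K. S k). (1 / (1 + \<rho> j powr \<gamma>))\<^sup>2)"
  using cover fJ' by (intro sum_mono2) (auto simp: S_def)
 also have "... <= (\<Sum>k<K. \<Sum>j\<in>S k. (1 / (1 + \<rho> j powr \<gamma>))\<^sup>2)"
 proof -
  define h where "h j = (1 / (1 + \<rho> j powr \<gamma>))\<^sup>2" for j
  have h: "0 <= h j" for j by (simp add: h_def)
  have fS: "finite (S k)" for k using fJ' by (simp add: S_def)
  have "sum h (\<Union>k<N. S k) <= (\<Sum>k<N. sum h (S k))" for N
  proof (induction N)
   case (Suc N)
   have "sum h (\<Union>k<Suc N. S k) = sum h ((\<Union>k<N. S k) \<union> S N)" by (simp add: lessThan_Suc Un_commute)
   also have "... <= sum h (\<Union>k<N. S k) + sum h (S N)"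
    using sum.union_inter[of "\<Union>k<N. S k" "S N" h] fS sum_nonneg[of "(\<Union>k<N. S k) \<inter> S N" h] h by simp
   finally show ?case using Suc by simp
  qed simp
  then show ?thesis by (simp add: h_def)
 qed
 also have "... <= (\<Sum>k<K. C * 4 ^ m * L powr (real m - 2 * \<gamma>) * q ^ k)" by (intro sum_mono bound)
 also have "... = C * 4 ^ m * L powr (real m - 2 * \<gamma>) * (\<Sum>k<K. q ^ k)" by (simp add: sum_distrib_left)
 also have "... <= C * 4 ^ m * L powr (real m - 2 * \<gamma>) * (1 / (1 - q))"
 proof (rule mult_left_mono)
  show "(\<Sum>k<K. q ^ k) <= 1 / (1 - q)" using q by (simp add: sum_gp_strict divide_right_mono)
 qed (use C in simp)
 finally show ?thesis by (simp add: q_def ac_simps)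
qed

section \<open>Calculus with partial derivatives\<close>

lemma differentiable_frechet_eq_partials:
 fixes F :: "real^'p => real"
 assumes "F differentiable (at \<theta>)"
 shows "(F has_derivative (%v. \<Sum>m\<in>UNIV. v $ m * partial m F \<theta>)) (at \<theta>)"
proof -
 let ?D = "frechet_derivative F (at \<theta>)"
 have D: "(F has_derivative ?D) (at \<theta>)" using assms by (simp add: frechet_derivative_works)
 have lin: "linear ?D" using D by (rule has_derivative_linear)
 have "?D v = (\<Sum>m\<in>UNIV. v $ m * partial m F \<theta>)" for v
 proof -
  have "?D v = ?D (\<Sum>m\<in>UNIV. (v $ m) *\<^sub>R axis m 1)" by (simp add: basis_expansion scalar_mult_eq_scaleR[symmetric])
  also have "... = (\<Sum>m\<in>UNIV. v $ m * partial m F \<theta>)"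
   by (simp add: linear_sum[OF lin] linear_cmul[OF lin] partial_def)
  finally show ?thesis .
 qed
 then have "?D = (%v. \<Sum>m\<in>UNIV. v $ m * partial m F \<theta>)" by auto
 then show ?thesis using D by simp
qed

lemma has_real_derivative_along_line:
 fixes F :: "real^'p => real"
 assumes "F differentiable (at (\<theta> + t *\<^sub>R v))"
 shows "((%t. F (\<theta> + t *\<^sub>R v)) has_real_derivative (\<Sum>m\<in>UNIV. v $ m * partial m F (\<theta> + t *\<^sub>R v))) (at t)"
proof -
 have "((%t. \<theta> + t *\<^sub>R v) has_derivative (%h. h *\<^sub>R v)) (at t)"
  by (auto intro!: derivative_eq_intros)
 from has_derivative_compose[OF this differentiable_frechet_eq_partials[OF assms]]
 have "((%t. F (\<theta> + t *\<^sub>R v)) has_derivative (%h. \<Sum>m\<in>UNIV. (h *\<^sub>R v) $ m * partial m F (\<theta> + t *\<^sub>R v))) (at t)" .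
 moreover have "(%h. \<Sum>m\<in>UNIV. (h *\<^sub>R v) $ m * partial m F (\<theta> + t *\<^sub>R v)) = (*) (\<Sum>m\<in>UNIV. v $ m * partial m F (\<theta> + t *\<^sub>R v))"
  by (auto simp: sum_distrib_left mult.assoc mult.commute)
 ultimately show ?thesis by (simp add: has_field_derivative_def)
qed

lemma partial_cong_open:
 assumes "open S" "\<theta> \<in> S" "\<And>x. x \<in> S ==> F x = G x" "F differentiable (at \<theta>)"
 shows "partial m F \<theta> = partial m G \<theta>"
 unfolding partial_def using frechet_derivative_transform_within_open[OF assms(4,1,2)] assms(3) by metis

lemma sum_abs_le_card_norm:
 fixes v :: "real^'p"
 assumes "\<And>m. \<bar>x m\<bar> <= B"
 shows "\<bar>\<Sum>m\<in>UNIV. v $ m * x m\<bar> <= CARD('p) * norm v * B"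
proof -
 have B: "0 <= B" using assms[of undefined] by linarith
 have "\<bar>\<Sum>m\<in>UNIV. v $ m * x m\<bar> <= (\<Sum>m\<in>UNIV. \<bar>v $ m * x m\<bar>)" by (rule sum_abs)
 also have "... <= (\<Sum>m\<in>(UNIV::'p set). norm v * B)"
  unfolding abs_mult using assms B by (intro sum_mono mult_mono component_le_norm_cart) auto
 finally show ?thesis by simp
qed

lemma Lipschitz_of_partials:
 fixes F :: "real^'p => real"
 assumes "\<And>t. 0 <= t ==> t <= 1 ==> F differentiable (at (\<theta> + t *\<^sub>R v)) \<and> (\<forall>m. \<bar>partial m F (\<theta> + t *\<^sub>R v)\<bar> <= B)"
 shows "\<bar>F (\<theta> + v) - F \<theta>\<bar> <= CARD('p) * norm v * B"
proof -
 have "\<exists>z>0. z < 1 \<and> F (\<theta> + 1 *\<^sub>R v) - F (\<theta> + 0 *\<^sub>R v) = (1 - 0) * (\<Sum>m\<in>UNIV. v $ m * partial m F (\<theta> + z *\<^sub>R v))"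
  by (rule MVT2) (use assms in \<open>auto intro!: has_real_derivative_along_line\<close>)
 then obtain z where z: "0 < z" "z < 1" "F (\<theta> + v) - F \<theta> = (\<Sum>m\<in>UNIV. v $ m * partial m F (\<theta> + z *\<^sub>R v))" by auto
 show ?thesis unfolding z(3) using assms[of z] z(1,2) by (intro sum_abs_le_card_norm) auto
qed

text \<open>Taylor's theorem for the restriction of \<open>F\<close> to the segment.\<close>
lemma third_order_Taylor_partials:
 fixes F :: "real^'p => real"
 assumes D: "\<And>t. 0 <= t ==> t <= 1 ==> F differentiable (at (\<theta> + t *\<^sub>R v))"
   "\<And>t m. 0 <= t ==> t <= 1 ==> partial m F differentiable (at (\<theta> + t *\<^sub>R v))"
   "\<And>t m l. 0 <= t ==> t <= 1 ==> partial l (partial m F) differentiable (at (\<theta> + t *\<^sub>R v))"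
  and B: "\<And>t m l r. 0 <= t ==> t <= 1 ==> \<bar>partial r (partial l (partial m F)) (\<theta> + t *\<^sub>R v)\<bar> <= B"
 shows "\<bar>F (\<theta> + v) - (F \<theta> + (\<Sum>m\<in>UNIV. v $ m * partial m F \<theta>)
   + (\<Sum>m\<in>UNIV. v $ m * (\<Sum>l\<in>UNIV. v $ l * partial l (partial m F) \<theta>)) / 2)\<bar> <= CARD('p) ^ 3 * norm v ^ 3 * B"
proof -
 define g0 where "g0 t = F (\<theta> + t *\<^sub>R v)" for t
 define g1 where "g1 t = (\<Sum>m\<in>UNIV. v $ m * partial m F (\<theta> + t *\<^sub>R v))" for t
 define g2 where "g2 t = (\<Sum>m\<in>UNIV. v $ m * (\<Sum>l\<in>UNIV. v $ l * partial l (partial m F) (\<theta> + t *\<^sub>R v)))" for t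
 define g3 where "g3 t = (\<Sum>m\<in>UNIV. v $ m * (\<Sum>l\<in>UNIV. v $ l * (\<Sum>r\<in>UNIV. v $ r * partial r (partial l (partial m F)) (\<theta> + t *\<^sub>R v))))" for t
 define diff where "diff k = (if k = 0 then g0 else if k = 1 then g1 else if k = 2 then g2 else g3)" for k :: nat
 have d0: "(g0 has_real_derivative g1 t) (at t)" if "0 <= t" "t <= 1" for t
  unfolding g0_def g1_def by (rule has_real_derivative_along_line[OF D(1)[OF that]])
 have d1: "(g1 has_real_derivative g2 t) (at t)" if "0 <= t" "t <= 1" for t
  unfolding g1_def g2_def by (intro DERIV_sum DERIV_cmult has_real_derivative_along_line D that)
 have d2: "(g2 has_real_derivative g3 t) (at t)" if "0 <= t" "t <= 1" for t
  unfolding g2_def g3_def by (intro DERIV_sum DERIV_cmult has_real_derivative_along_line D that)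
 have "\<exists>t>0. t < 1 \<and> g0 1 = (\<Sum>m<3. diff m 0 / fact m * 1 ^ m) + diff 3 t / fact 3 * 1 ^ 3"
 proof (rule Maclaurin)
  show "\<forall>m t. m < 3 \<and> 0 <= t \<and> t <= 1 --> (diff m has_real_derivative diff (Suc m) t) (at t)"
  proof (intro allI impI, elim conjE)
   fix m :: nat and t :: real assume m: "m < 3" "0 <= t" "t <= 1"
   then have "m = 0 \<or> m = 1 \<or> m = 2" by auto
   then show "(diff m has_real_derivative diff (Suc m) t) (at t)"
    using d0[OF m(2,3)] d1[OF m(2,3)] d2[OF m(2,3)] by (auto simp: diff_def)
  qed
 qed (auto simp: diff_def)
 then obtain t where t: "0 < t" "t < 1" "g0 1 = g0 0 + g1 0 + g2 0 / 2 + g3 t / 6"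
  by (auto simp: diff_def eval_nat_numeral)
 have b: "\<bar>g3 t\<bar> <= CARD('p) * norm v * (CARD('p) * norm v * (CARD('p) * norm v * B))"
  unfolding g3_def using t by (intro sum_abs_le_card_norm B) auto
 have "\<bar>F (\<theta> + v) - (F \<theta> + (\<Sum>m\<in>UNIV. v $ m * partial m F \<theta>)
   + (\<Sum>m\<in>UNIV. v $ m * (\<Sum>l\<in>UNIV. v $ l * partial l (partial m F) \<theta>)) / 2)\<bar> = \<bar>g3 t\<bar> / 6"
  using t(3) by (simp add: g0_def g1_def g2_def)
 also have "... <= \<bar>g3 t\<bar>" by simp
 also have "... <= CARD('p) ^ 3 * norm v ^ 3 * B" using b by (simp add: power3_eq_cube ac_simps)
 finally show ?thesis .
qed

section \<open>Whitening\<close>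

abbreviation mat_of :: "nat => (nat => nat => real) => real mat" where
 "mat_of n f \<equiv> mat n n (%(i, j). f i j)"

lemma mat_of_carrier: "mat_of n f \<in> carrier_mat n n" by simp

lemma mat_of_mult: "mat_of n f * mat_of n g = mat_of n (%i j. \<Sum>k<n. f i k * g k j)"
 by (rule eq_matI) (auto simp: scalar_prod_def atLeast0LessThan)

lemma mat_of_transpose: "transpose_mat (mat_of n f) = mat_of n (%i j. f j i)"
 by (rule eq_matI) auto

lemma mat_of_one: "1\<^sub>m n = mat_of n (%i j. if i = j then 1 else 0)"
 by (rule eq_matI) auto

lemma mat_of_dmat: "dmat n x = mat_of n (%i j. if i = j then x i else 0)"
 by (simp add: dmat_def)

lemma mat_of_index: "B \<in> carrier_mat n n ==> B = mat_of n (%i j. B $$ (i, j))"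
 by (rule eq_matI) auto

lemma mat_of_eqD: "mat_of n f = mat_of n g ==> i < n ==> j < n ==> f i j = g i j"
 by (drule arg_cong[where f = "%M. M $$ (i, j)"]) simp

lemma mat_of_eqI: "(\<And>i j. i < n ==> j < n ==> f i j = g i j) ==> mat_of n f = mat_of n g"
 by (rule eq_matI) auto

definition orthogonal_family :: "nat => (nat => nat => real) => bool" where
 "orthogonal_family n Q \<longleftrightarrow>
  (\<forall>k<n. \<forall>l<n. (\<Sum>j<n. Q k j * Q l j) = (if k = l then 1 else 0)) \<and>
  (\<forall>i<n. \<forall>j<n. (\<Sum>k<n. Q k i * Q k j) = (if i = j then 1 else 0))"

abbreviation diagonalizes :: "nat => (nat => nat => real) => (nat => real) => (nat => nat => real) => bool" where
 "diagonalizes n Q x X \<equiv> mat_of n X = transpose_mat (mat_of n Q) * dmat n x * mat_of n Q"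

lemma orthogonal_family_mat:
 "orthogonal_family n Q \<longleftrightarrow> mat_of n Q * transpose_mat (mat_of n Q) = 1\<^sub>m n \<and> transpose_mat (mat_of n Q) * mat_of n Q = 1\<^sub>m n"
 unfolding orthogonal_family_def mat_of_transpose mat_of_mult mat_of_one
 by (auto intro!: mat_of_eqI dest: mat_of_eqD)

lemma spectral_decomposition:
 assumes sym: "\<And>i j. i < n ==> j < n ==> G i j = G j i"
 shows "\<exists>Q x. orthogonal_family n Q \<and> diagonalizes n Q x G"
proof -
 have "transpose_mat (mat_of n G) = mat_of n G" unfolding mat_of_transpose by (rule mat_of_eqI) (rule sym)
 then obtain P x where P: "P \<in> carrier_mat n n" "transpose_mat P * P = 1\<^sub>m n" "P * transpose_mat P = 1\<^sub>m n"
   "mat_of n G = P * dmat n x * transpose_mat P"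
  using symmetric_mat_orthogonally_diagonalizable[OF mat_of_carrier] by metis
 define Q where "Q i j = P $$ (j, i)" for i j
 have Q: "mat_of n Q = transpose_mat P" using P(1) by (intro eq_matI) (auto simp: Q_def)
 have Q': "transpose_mat (mat_of n Q) = P" unfolding Q by simp
 show ?thesis
  by (intro exI[of _ Q] exI[of _ x]) (simp only: orthogonal_family_mat Q', simp only: Q P(2,3,4) simp_thms)
qed

lemma spectral_decomposition_entries:
 assumes "diagonalizes n Q x G" "i < n" "j < n"
 shows "G i j = (\<Sum>k<n. Q k i * x k * Q k j)"
proof -
 have "(\<Sum>k<n. Q k i * (if k = l then x k else 0)) = Q l i * x l" if "l < n" for l
  using that by (simp add: if_distrib[of "(*) _"] cong: if_cong)
 then show ?thesis
  using mat_of_eqD[OF assms(1)[unfolded mat_of_transpose mat_of_dmat mat_of_mult] assms(2,3)] by simp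
qed

text \<open>\<open>V\<close> transforms \<open>A\<close> into the identity and \<open>W\<close> is its inverse; the two inequalities say that \<open>V\<close> and its
transpose have operator norm at most \<open>1 / sqrt c\<close>.\<close>
definition whitening :: "nat => (nat => nat => real) => real => (nat => nat => real) => (nat => nat => real) => bool" where
 "whitening n A c V W \<longleftrightarrow>
  mat_of n V * mat_of n W = 1\<^sub>m n \<and> mat_of n W * mat_of n V = 1\<^sub>m n \<and>
  mat_of n A = transpose_mat (mat_of n W) * mat_of n W \<and>
  (\<forall>x. (\<Sum>k<n. (\<Sum>i<n. V i k * x i)\<^sup>2) <= (\<Sum>i<n. (x i)\<^sup>2) / c) \<and>
  (\<forall>x. (\<Sum>i<n. (\<Sum>k<n. V i k * x k)\<^sup>2) <= (\<Sum>k<n. (x k)\<^sup>2) / c)"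

lemma orthogonal_family_sum_squares:
 assumes "orthogonal_family n Q"
 shows "(\<Sum>k<n. (\<Sum>i<n. Q k i * x i)\<^sup>2) = (\<Sum>i<n. (x i)\<^sup>2)"
  and "(\<Sum>i<n. (\<Sum>k<n. Q k i * x k)\<^sup>2) = (\<Sum>i<n. (x i)\<^sup>2)"
proof -
 have gen: "(\<Sum>k<n. (\<Sum>i<n. R k i * x i)\<^sup>2) = (\<Sum>i<n. (x i)\<^sup>2)"
  if R: "\<And>i j. i < n ==> j < n ==> (\<Sum>k<n. R k i * R k j) = (if i = j then 1 else (0::real))" for R :: "nat => nat => real"
 proof -
  have "(\<Sum>k<n. (\<Sum>i<n. R k i * x i)\<^sup>2) = (\<Sum>k<n. \<Sum>i<n. \<Sum>j<n. x i * x j * (R k i * R k j))"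
   by (simp add: power2_eq_square sum_product ac_simps)
  also have "... = (\<Sum>i<n. \<Sum>j<n. \<Sum>k<n. x i * x j * (R k i * R k j))"
   by (subst sum.swap, rule sum.cong[OF refl], rule sum.swap)
  also have "... = (\<Sum>i<n. (x i)\<^sup>2)"
   by (simp add: sum_distrib_left[symmetric] R power2_eq_square if_distrib[of "(*) _"] cong: if_cong)
  finally show ?thesis .
 qed
 show "(\<Sum>k<n. (\<Sum>i<n. Q k i * x i)\<^sup>2) = (\<Sum>i<n. (x i)\<^sup>2)"
  using assms by (intro gen) (simp add: orthogonal_family_def)
 show "(\<Sum>i<n. (\<Sum>k<n. Q k i * x k)\<^sup>2) = (\<Sum>i<n. (x i)\<^sup>2)"
  using assms by (intro gen[of "%i k. Q k i"]) (simp add: orthogonal_family_def)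
qed

text \<open>\<open>V\<close> is an orthonormal eigenbasis of \<open>A\<close> scaled by the inverse square roots of the eigenvalues, all of which are at least \<open>c\<close>.\<close>
lemma whitening_exists:
 assumes sym: "\<And>i j. i < n ==> j < n ==> A i j = A j i"
  and c: "0 < c" "c <= Min (spectrum (mat_of n A))"
 shows "\<exists>V W. whitening n A c V W"
proof -
 obtain Q a where Q: "orthogonal_family n Q" and A: "diagonalizes n Q a A"
  using spectral_decomposition[of n A] sym by blast
 note Qm = Q[unfolded orthogonal_family_mat]
 have ac: "c <= a k" if k: "k < n" for k
 proof -
  define v where "v = Matrix.vec n (%i. Q k i)"
  have "(mat_of n A *\<^sub>v v) $ i = a k * v $ i" if i: "i < n" for i
  proof -
   have "(mat_of n A *\<^sub>v v) $ i = (\<Sum>j<n. A i j * Q k j)" using i by (simp add: v_def scalar_prod_def atLeast0LessThan)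
   also have "... = (\<Sum>j<n. \<Sum>l<n. Q l i * a l * (Q l j * Q k j))"
    using spectral_decomposition_entries[OF A i] by (simp add: sum_distrib_right mult.assoc)
   also have "... = (\<Sum>l<n. Q l i * a l * (\<Sum>j<n. Q l j * Q k j))"
    by (subst sum.swap) (simp add: sum_distrib_left)
   also have "... = a k * Q k i" using Q k by (simp add: orthogonal_family_def if_distrib[of "(*) _"] cong: if_cong)
   finally show ?thesis using i by (simp add: v_def)
  qed
  then have ev: "mat_of n A *\<^sub>v v = a k \<cdot>\<^sub>v v" by (intro eq_vecI) (auto simp: v_def)
  have "v \<noteq> 0\<^sub>v n"
  proof
   assume "v = 0\<^sub>v n"
   then have "Q k i = 0" if "i < n" for i using that by (metis v_def index_vec index_zero_vec(1))
   then have "(\<Sum>j<n. Q k j * Q k j) = 0" by simp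
   then show False using Q k by (simp add: orthogonal_family_def)
  qed
  moreover have "v \<in> carrier_vec n" by (simp add: v_def)
  ultimately have "a k \<in> spectrum (mat_of n A)" using ev unfolding spectrum_def eigenvalue_def eigenvector_def by auto
  then have "Min (spectrum (mat_of n A)) <= a k"
   by (intro Min_le card_finite_spectrum(1)[OF mat_of_carrier])
  then show ?thesis using c by simp
 qed
 have a0: "0 < a k" if "k < n" for k using ac[OF that] c by simp
 define V where "V i k = Q k i / sqrt (a k)" for i k
 define W where "W k i = sqrt (a k) * Q k i" for k i
 have 1: "mat_of n V * mat_of n W = 1\<^sub>m n"
  unfolding mat_of_mult mat_of_one
 proof (rule mat_of_eqI)
  fix i j assume ij: "i < n" "j < n"
  have "(\<Sum>k<n. V i k * W k j) = (\<Sum>k<n. Q k i * Q k j)"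
   by (intro sum.cong refl) (simp add: V_def W_def less_imp_neq[OF a0, symmetric])
  then show "(\<Sum>k<n. V i k * W k j) = (if i = j then 1 else 0)" using Q ij by (simp add: orthogonal_family_def)
 qed
 have 2: "mat_of n W * mat_of n V = 1\<^sub>m n"
  unfolding mat_of_mult mat_of_one
 proof (rule mat_of_eqI)
  fix i j assume ij: "i < n" "j < n"
  have "(\<Sum>k<n. W i k * V k j) = sqrt (a i) / sqrt (a j) * (\<Sum>k<n. Q i k * Q j k)"
   by (simp add: V_def W_def sum_distrib_left ac_simps)
  then show "(\<Sum>k<n. W i k * V k j) = (if i = j then 1 else 0)" using Q ij a0[of i] by (auto simp: orthogonal_family_def)
 qed
 have 3: "mat_of n A = transpose_mat (mat_of n W) * mat_of n W"
  unfolding mat_of_transpose mat_of_mult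
 proof (rule mat_of_eqI)
  fix i j assume ij: "i < n" "j < n"
  show "A i j = (\<Sum>k<n. W k i * W k j)"
   unfolding spectral_decomposition_entries[OF A ij]
   by (intro sum.cong refl) (use a0 in \<open>auto simp: W_def less_imp_le\<close>)
 qed
 have 4: "(\<Sum>k<n. (\<Sum>i<n. V i k * x i)\<^sup>2) <= (\<Sum>i<n. (x i)\<^sup>2) / c" for x
 proof -
  have "(\<Sum>k<n. (\<Sum>i<n. V i k * x i)\<^sup>2) = (\<Sum>k<n. (\<Sum>i<n. Q k i * x i)\<^sup>2 / a k)"
   by (intro sum.cong refl) (use a0 in \<open>auto simp: V_def sum_divide_distrib[symmetric] power_divide less_imp_le\<close>)
  also have "... <= (\<Sum>k<n. (\<Sum>i<n. Q k i * x i)\<^sup>2 / c)"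
   using ac a0 c by (intro sum_mono divide_left_mono) auto
  also have "... = (\<Sum>i<n. (x i)\<^sup>2) / c"
   by (simp add: sum_divide_distrib[symmetric] orthogonal_family_sum_squares(1)[OF Q])
  finally show ?thesis .
 qed
 have 5: "(\<Sum>i<n. (\<Sum>k<n. V i k * x k)\<^sup>2) <= (\<Sum>k<n. (x k)\<^sup>2) / c" for x
 proof -
  have "(\<Sum>i<n. (\<Sum>k<n. V i k * x k)\<^sup>2) = (\<Sum>i<n. (\<Sum>k<n. Q k i * (x k / sqrt (a k)))\<^sup>2)"
   by (simp add: V_def)
  also have "... = (\<Sum>k<n. (x k / sqrt (a k))\<^sup>2)" by (rule orthogonal_family_sum_squares(2)[OF Q])
  also have "... <= (\<Sum>k<n. (x k)\<^sup>2 / c)"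
   using ac a0 c by (intro sum_mono) (auto simp: power_divide less_imp_le intro!: divide_left_mono)
  finally show ?thesis by (simp add: sum_divide_distrib)
 qed
 show ?thesis using 1 2 3 4 5 unfolding whitening_def by blast
qed

lemma mat_inv_eqI:
 assumes A: "A \<in> carrier_mat n n" and B: "B \<in> carrier_mat n n" and AB: "A * B = 1\<^sub>m n" "B * A = 1\<^sub>m n"
 shows "mat_inv A = B"
proof -
 have "A \<in> Units (ring_mat TYPE(real) n ())" using A B AB by (auto simp: Units_def ring_mat_def)
 then obtain C where C: "mat_inverse A = Some C" using mat_inverse(1)[OF A, where b = "()"] by (cases "mat_inverse A") auto
 have C': "A * C = 1\<^sub>m n" "C \<in> carrier_mat n n" using mat_inverse(2)[OF A C] by auto
 have "C = (B * A) * C" using AB C' by simp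
 also have "... = B * (A * C)" using A B C' by (simp add: assoc_mult_mat[of _ n n _ n _ n])
 also have "... = B" using B C' by simp
 finally show ?thesis using C by (simp add: mat_inv_def)
qed

lemmas square_mat_simps = assoc_mult_mat[of _ n n _ n _ n] mult_carrier_mat[of _ n n _ n] for n

definition conj_by :: "nat => (nat => nat => real) => (nat => nat => real) => nat => nat => real" where
 "conj_by n V D i j = (\<Sum>k<n. \<Sum>l<n. V k i * D k l * V l j)"

lemma mat_of_conj_by: "mat_of n (conj_by n V D) = transpose_mat (mat_of n V) * mat_of n D * mat_of n V"
 unfolding mat_of_transpose mat_of_mult
proof (rule mat_of_eqI)
 fix i j
 show "conj_by n V D i j = (\<Sum>l<n. (\<Sum>k<n. V k i * D k l) * V l j)"
  unfolding conj_by_def by (subst sum.swap) (simp add: sum_distrib_right)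
qed

lemma dmat_mult: "dmat n a * dmat n b = dmat n (%k. a k * b k)"
 unfolding mat_of_dmat mat_of_mult by (rule mat_of_eqI) (auto simp: if_distrib[of "%t. t * _"] cong: if_cong)

lemma dmat_one: "dmat n (%_. 1) = 1\<^sub>m n"
 unfolding mat_of_dmat mat_of_one ..

lemma det_dmat: "Determinant.det (dmat n x) = (\<Prod>k<n. x k)"
proof -
 have "Determinant.det (dmat n x) = prod_list (diag_mat (dmat n x))"
  by (rule det_upper_triangular[of _ n]) (auto simp: dmat_def)
 also have "... = (\<Prod>k<n. x k)" by (simp add: prod_list_diag_prod dmat_def atLeast0LessThan)
 finally show ?thesis .
qed

lemma gaussian_criterion_diagonal:
 fixes U T R :: "real mat"
 assumes U: "U \<in> carrier_mat n n" and T: "T \<in> carrier_mat n n" and UT: "U * T = 1\<^sub>m n" "T * U = 1\<^sub>m n"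
  and R: "R = transpose_mat T * dmat n m * T" and m: "\<And>k. k < n ==> 0 < m k"
  and y: "y \<in> carrier_vec n"
 shows "ln (Determinant.det R) + Matrix.scalar_prod y (mult_mat_vec (mat_inv R) y)
  = ln ((Determinant.det T)\<^sup>2) + (\<Sum>k<n. ln (m k) + ((transpose_mat U *\<^sub>v y) $ k)\<^sup>2 / m k)"
proof -
 have "Determinant.det U * Determinant.det T = 1" using det_mult[OF U T] UT by simp
 then have dT: "Determinant.det T \<noteq> 0" by auto
 have det: "Determinant.det R = (Determinant.det T)\<^sup>2 * (\<Prod>k<n. m k)"
  unfolding R using T by (simp add: det_mult[of _ n] det_transpose[OF T] det_dmat power2_eq_square square_mat_simps[of _ n])
 have lndet: "ln (Determinant.det R) = ln ((Determinant.det T)\<^sup>2) + (\<Sum>k<n. ln (m k))"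
 proof -
  have "ln (\<Prod>k<n. m k) = (\<Sum>k<n. ln (m k))" by (rule ln_prod) (auto, metis m less_irrefl)
  moreover have "0 < (\<Prod>k<n. m k)" by (rule prod_pos) (use m in auto)
  moreover have "ln ((Determinant.det T)\<^sup>2 * (\<Prod>k<n. m k)) = ln ((Determinant.det T)\<^sup>2) + ln (\<Prod>k<n. m k)"
   by (rule ln_mult_pos) (use dT \<open>0 < (\<Prod>k<n. m k)\<close> in auto)
  ultimately show ?thesis unfolding det by simp
 qed
 define N where "N = U * dmat n (%k. 1 / m k) * transpose_mat U"
 have N: "N \<in> carrier_mat n n" using U by (simp add: N_def square_mat_simps[of _ n])
 have UTt: "transpose_mat U * transpose_mat T = 1\<^sub>m n" "transpose_mat T * transpose_mat U = 1\<^sub>m n"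
  using UT transpose_mult[OF T U] transpose_mult[OF U T] by (metis transpose_one)+
 have dd: "dmat n m * dmat n (%k. 1 / m k) = 1\<^sub>m n" "dmat n (%k. 1 / m k) * dmat n m = 1\<^sub>m n"
  unfolding dmat_mult using m unfolding dmat_def mat_of_one by (auto intro!: eq_matI) (metis less_irrefl)+
 have "R * N = transpose_mat T * (dmat n m * ((T * U) * (dmat n (%k. 1 / m k) * transpose_mat U)))"
  unfolding R N_def using U T by (simp add: square_mat_simps[of _ n])
 also have "... = transpose_mat T * ((dmat n m * dmat n (%k. 1 / m k)) * transpose_mat U)"
  unfolding UT using U T by (simp add: square_mat_simps[of _ n] left_mult_one_mat[of _ n n])
 also have "... = 1\<^sub>m n" unfolding dd using U T by (simp add: UTt left_mult_one_mat[of _ n n])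
 finally have RN: "R * N = 1\<^sub>m n" .
 have "N * R = U * (dmat n (%k. 1 / m k) * ((transpose_mat U * transpose_mat T) * (dmat n m * T)))"
  unfolding R N_def using U T by (simp add: square_mat_simps[of _ n])
 also have "... = U * ((dmat n (%k. 1 / m k) * dmat n m) * T)"
  unfolding UTt using U T by (simp add: square_mat_simps[of _ n] left_mult_one_mat[of _ n n])
 also have "... = 1\<^sub>m n" unfolding dd using U T by (simp add: UT left_mult_one_mat[of _ n n])
 finally have NR: "N * R = 1\<^sub>m n" .
 have Rc: "R \<in> carrier_mat n n" unfolding R using T by (simp add: square_mat_simps[of _ n])
 have inv: "mat_inv R = N" by (rule mat_inv_eqI[OF Rc N RN NR])
 define u where "u = transpose_mat U *\<^sub>v y"
 have u: "u \<in> carrier_vec n" using U y by (simp add: u_def)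
 have Ny: "N *\<^sub>v y = U *\<^sub>v (dmat n (%k. 1 / m k) *\<^sub>v u)"
  unfolding N_def u_def using U y by (simp add: assoc_mult_mat_vec[of _ n n _ n] square_mat_simps[of _ n])
 have du: "(dmat n (%k. 1 / m k) *\<^sub>v u) $ k = u $ k / m k" if "k < n" for k
 proof -
  have "(dmat n (%k. 1 / m k) *\<^sub>v u) $ k = (\<Sum>l<n. (if k = l then 1 / m k else 0) * u $ l)"
   using that u by (simp add: dmat_def scalar_prod_def atLeast0LessThan)
  then show ?thesis using that by (simp add: if_distrib[of "%t. t * _"] cong: if_cong)
 qed
 have "Matrix.scalar_prod y (N *\<^sub>v y) = Matrix.scalar_prod u (dmat n (%k. 1 / m k) *\<^sub>v u)"
  unfolding Ny unfolding u_def
  by (rule transpose_vec_mult_scalar[symmetric, OF U _ y]) (rule mult_mat_vec_carrier[OF dmat_carrier], use U y in simp)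
 also have "... = (\<Sum>k<n. (u $ k)\<^sup>2 / m k)"
 proof -
  have "Matrix.scalar_prod u (dmat n (%k. 1 / m k) *\<^sub>v u) = (\<Sum>k<n. u $ k * (dmat n (%k. 1 / m k) *\<^sub>v u) $ k)"
   by (simp add: scalar_prod_def atLeast0LessThan dmat_def)
  also have "... = (\<Sum>k<n. (u $ k)\<^sup>2 / m k)" by (intro sum.cong refl) (simp add: du power2_eq_square)
  finally show ?thesis .
 qed
 finally show ?thesis unfolding inv lndet u_def by (simp add: sum.distrib)
qed

text \<open>In coordinates that diagonalise both matrices the determinant of the coordinate change cancels in the difference.\<close>
lemma gaussian_criterion_difference:
 assumes wh: "whitening n R0 c V W"
  and Q: "orthogonal_family n Q"
  and X: "diagonalizes n Q x (conj_by n V (%i j. R1 i j - R0 i j))"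
  and x: "\<And>k. k < n ==> 0 < 1 + x k"
  and w: "\<And>k. k < n ==> w k = (\<Sum>l<n. Q k l * (\<Sum>i<n. V i l * y i))"
 shows "(ln (Determinant.det (mat_of n R1)) + Matrix.scalar_prod (Matrix.vec n y) (mult_mat_vec (mat_inv (mat_of n R1)) (Matrix.vec n y)))
   - (ln (Determinant.det (mat_of n R0)) + Matrix.scalar_prod (Matrix.vec n y) (mult_mat_vec (mat_inv (mat_of n R0)) (Matrix.vec n y)))
  = (\<Sum>k<n. ln (1 + x k) + (w k)\<^sup>2 * (1 / (1 + x k) - 1))"
proof -
 let ?V = "mat_of n V" and ?W = "mat_of n W" and ?Q = "mat_of n Q"
 note wh' = wh[unfolded whitening_def]
 note Q' = Q[unfolded orthogonal_family_mat]
 define U where "U = ?V * transpose_mat ?Q"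
 define T where "T = ?Q * ?W"
 have U: "U \<in> carrier_mat n n" and T: "T \<in> carrier_mat n n" by (simp_all add: U_def T_def square_mat_simps[of _ n])
 have "U * T = ?V * ((transpose_mat ?Q * ?Q) * ?W)" unfolding U_def T_def by (simp add: square_mat_simps[of _ n])
 then have UT: "U * T = 1\<^sub>m n" using Q' wh' by (simp add: left_mult_one_mat[of _ n n])
 have "T * U = ?Q * ((?W * ?V) * transpose_mat ?Q)" unfolding U_def T_def by (simp add: square_mat_simps[of _ n])
 then have TU: "T * U = 1\<^sub>m n" using Q' wh' by (simp add: left_mult_one_mat[of _ n n])
 have Tt: "transpose_mat T = transpose_mat ?W * transpose_mat ?Q"
  unfolding T_def by (rule transpose_mult) auto
 have R0: "mat_of n R0 = transpose_mat T * dmat n (%_. 1) * T"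
 proof -
  have "transpose_mat T * dmat n (%_. 1) * T = transpose_mat ?W * ((transpose_mat ?Q * ?Q) * ?W)"
   unfolding Tt dmat_one unfolding T_def by (simp add: square_mat_simps[of _ n] left_mult_one_mat[of _ n n])
  then show ?thesis using Q' wh' by (simp add: left_mult_one_mat[of _ n n])
 qed
 have VWt: "transpose_mat ?W * transpose_mat ?V = 1\<^sub>m n"
  using transpose_mult[OF mat_of_carrier mat_of_carrier, of n V W] wh'[THEN conjunct1] by simp
 have D: "mat_of n (%i j. R1 i j - R0 i j) = transpose_mat T * dmat n x * T"
 proof -
  let ?D = "mat_of n (%i j. R1 i j - R0 i j)"
  have "transpose_mat T * dmat n x * T = transpose_mat ?W * ((transpose_mat ?Q * dmat n x * ?Q) * ?W)"
   unfolding Tt unfolding T_def by (simp add: square_mat_simps[of _ n])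
  also have "... = transpose_mat ?W * ((transpose_mat ?V * ?D * ?V) * ?W)"
   unfolding X[symmetric] mat_of_conj_by ..
  also have "... = (transpose_mat ?W * transpose_mat ?V) * (?D * (?V * ?W))"
   by (simp add: square_mat_simps[of _ n])
  also have "... = ?D" using wh' VWt by (simp add: left_mult_one_mat[of _ n n])
  finally show ?thesis by simp
 qed
 have R1: "mat_of n R1 = transpose_mat T * dmat n (%k. 1 + x k) * T"
 proof -
  have "dmat n (%k. 1 + x k) = dmat n (%_. 1) + dmat n x" by (rule eq_matI) (auto simp: dmat_def)
  then have "transpose_mat T * dmat n (%k. 1 + x k) * T
   = transpose_mat T * dmat n (%_. 1) * T + transpose_mat T * dmat n x * T"
   using T by (simp add: mult_add_distrib_mat[of _ n n _ n] add_mult_distrib_mat[of _ n n _ _ n] square_mat_simps[of _ n])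
  also have "... = mat_of n R0 + mat_of n (%i j. R1 i j - R0 i j)" by (simp only: R0 D)
  also have "... = mat_of n R1" by (rule eq_matI) auto
  finally show ?thesis by simp
 qed
 have wk: "(transpose_mat U *\<^sub>v Matrix.vec n y) $ k = w k" if "k < n" for k
 proof -
  have "transpose_mat U = ?Q * transpose_mat ?V"
   unfolding U_def by (subst transpose_mult[of _ n n _ n]) auto
  then have "transpose_mat U *\<^sub>v Matrix.vec n y = ?Q *\<^sub>v (transpose_mat ?V *\<^sub>v Matrix.vec n y)"
   by (simp add: assoc_mult_mat_vec[of _ n n _ n])
  then show ?thesis using that by (simp add: w scalar_prod_def atLeast0LessThan)
 qed
 have g1: "ln (Determinant.det (mat_of n R1)) + Matrix.scalar_prod (Matrix.vec n y) (mult_mat_vec (mat_inv (mat_of n R1)) (Matrix.vec n y))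
  = ln ((Determinant.det T)\<^sup>2) + (\<Sum>k<n. ln (1 + x k) + ((transpose_mat U *\<^sub>v Matrix.vec n y) $ k)\<^sup>2 / (1 + x k))"
  by (rule gaussian_criterion_diagonal[OF U T UT TU R1 x vec_carrier])
 have g0: "ln (Determinant.det (mat_of n R0)) + Matrix.scalar_prod (Matrix.vec n y) (mult_mat_vec (mat_inv (mat_of n R0)) (Matrix.vec n y))
  = ln ((Determinant.det T)\<^sup>2) + (\<Sum>k<n. ln 1 + ((transpose_mat U *\<^sub>v Matrix.vec n y) $ k)\<^sup>2 / 1)"
  by (rule gaussian_criterion_diagonal[OF U T UT TU R0 _ vec_carrier]) simp
 show ?thesis
  unfolding g1 g0 by (simp add: wk sum_subtractf sum.distrib algebra_simps)
qed

lemma mat_trace_mult_comm: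
 assumes "A \<in> carrier_mat n n" "B \<in> carrier_mat n n"
 shows "mat_trace (A * B) = mat_trace (B * A)"
proof -
 have "mat_trace (A * B) = (\<Sum>i<n. \<Sum>j<n. A $$ (i,j) * B $$ (j,i))"
  using assms by (simp add: mat_trace_def scalar_prod_def atLeast0LessThan)
 also have "... = (\<Sum>j<n. \<Sum>i<n. A $$ (i,j) * B $$ (j,i))" by (rule sum.swap)
 also have "... = mat_trace (B * A)"
  using assms by (simp add: mat_trace_def scalar_prod_def atLeast0LessThan mult.commute)
 finally show ?thesis .
qed

text \<open>The inverse of the covariance matrix is \<open>V V\<^sup>T\<close>; the trace is invariant under cyclic permutations.\<close>
lemma whitened_trace:
 assumes wh: "whitening n R0 c V W" and sym: "\<And>i j. i < n ==> j < n ==> H i j = H j i"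
 shows "mat_trace (mat_inv (mat_of n R0) * mat_of n G * mat_inv (mat_of n R0) * mat_of n H)
  = (\<Sum>k<n. \<Sum>l<n. conj_by n V G k l * conj_by n V H k l)"
proof -
 let ?V = "mat_of n V" and ?W = "mat_of n W" and ?G = "mat_of n G" and ?H = "mat_of n H"
 note wh' = wh[unfolded whitening_def]
 have VWt: "transpose_mat ?W * transpose_mat ?V = 1\<^sub>m n" "transpose_mat ?V * transpose_mat ?W = 1\<^sub>m n"
  using transpose_mult[OF mat_of_carrier mat_of_carrier, of n V W] wh'[THEN conjunct1]
   transpose_mult[OF mat_of_carrier mat_of_carrier, of n W V] wh'[THEN conjunct2, THEN conjunct1] by (metis transpose_one)+
 have inv: "mat_inv (mat_of n R0) = ?V * transpose_mat ?V"
 proof (rule mat_inv_eqI[of _ n])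
  have "mat_of n R0 * (?V * transpose_mat ?V) = transpose_mat ?W * ((?W * ?V) * transpose_mat ?V)"
   unfolding wh'[THEN conjunct2, THEN conjunct2, THEN conjunct1] by (simp add: square_mat_simps[of _ n])
  also have "... = 1\<^sub>m n" unfolding wh'[THEN conjunct2, THEN conjunct1] by (simp add: VWt left_mult_one_mat[of _ n n])
  finally show "mat_of n R0 * (?V * transpose_mat ?V) = 1\<^sub>m n" .
  have "?V * transpose_mat ?V * mat_of n R0 = ?V * ((transpose_mat ?V * transpose_mat ?W) * ?W)"
   unfolding wh'[THEN conjunct2, THEN conjunct2, THEN conjunct1] by (simp add: square_mat_simps[of _ n])
  also have "... = 1\<^sub>m n" unfolding VWt using wh' by (simp add: left_mult_one_mat[of _ n n])
  finally show "?V * transpose_mat ?V * mat_of n R0 = 1\<^sub>m n" .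
 qed (auto simp: square_mat_simps[of _ n])
 have "mat_trace (mat_inv (mat_of n R0) * ?G * mat_inv (mat_of n R0) * ?H)
  = mat_trace (?V * (transpose_mat ?V * (?G * (?V * (transpose_mat ?V * ?H)))))"
  unfolding inv by (simp add: square_mat_simps[of _ n])
 also have "... = mat_trace ((transpose_mat ?V * (?G * (?V * (transpose_mat ?V * ?H)))) * ?V)"
  by (rule mat_trace_mult_comm) (auto simp: square_mat_simps[of _ n])
 also have "... = mat_trace (mat_of n (conj_by n V G) * mat_of n (conj_by n V H))"
  unfolding mat_of_conj_by by (simp add: square_mat_simps[of _ n])
 also have "... = (\<Sum>k<n. \<Sum>l<n. conj_by n V G k l * conj_by n V H l k)"
  by (simp add: mat_of_mult mat_trace_def)
 also have "... = (\<Sum>k<n. \<Sum>l<n. conj_by n V G k l * conj_by n V H k l)"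
 proof (intro sum.cong refl)
  fix k l
  have "conj_by n V H l k = (\<Sum>j<n. \<Sum>i<n. V i l * H i j * V j k)"
   unfolding conj_by_def by (rule sum.swap)
  also have "... = conj_by n V H k l"
   unfolding conj_by_def by (intro sum.cong refl) (simp add: sym mult.commute mult.left_commute)
  finally show "conj_by n V G k l * conj_by n V H l k = conj_by n V G k l * conj_by n V H k l" by simp
 qed
 finally show ?thesis .
qed

section \<open>Norms of matrices and quadratic forms\<close>

definition vnorm :: "nat => (nat => real) => real" where
 "vnorm n v = L2_set v {..<n}"

definition fnorm :: "nat => (nat => nat => real) => real" where
 "fnorm n G = L2_set (%(i, j). G i j) ({..<n} \<times> {..<n})"

definition mulv :: "nat => (nat => nat => real) => (nat => real) => nat => real" where
 "mulv n G v i = (\<Sum>j<n. G i j * v j)"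

definition dotn :: "nat => (nat => real) => (nat => real) => real" where
 "dotn n u v = (\<Sum>i<n. u i * v i)"

definition trn :: "nat => (nat => nat => real) => real" where
 "trn n G = (\<Sum>i<n. G i i)"

definition fdot :: "nat => (nat => nat => real) => (nat => nat => real) => real" where
 "fdot n G H = (\<Sum>i<n. \<Sum>j<n. G i j * H i j)"

definition cqf :: "nat => (nat => nat => real) => (nat => real) => real" where
 "cqf n G v = dotn n v (mulv n G v) - trn n G"

definition op_le :: "nat => (nat => nat => real) => real => bool" where
 "op_le n G K \<longleftrightarrow> 0 <= K \<and> (\<forall>v. vnorm n (mulv n G v) <= K * vnorm n v)"

lemma vnorm_nonneg [simp]: "0 <= vnorm n v" by (simp add: vnorm_def)
lemma fnorm_nonneg [simp]: "0 <= fnorm n v" by (simp add: fnorm_def)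

lemma vnorm_sq: "(vnorm n v)\<^sup>2 = (\<Sum>i<n. (v i)\<^sup>2)"
 by (simp add: vnorm_def L2_set_def sum_nonneg)

lemma fnorm_sq: "(fnorm n G)\<^sup>2 = (\<Sum>i<n. \<Sum>j<n. (G i j)\<^sup>2)"
 by (simp add: fnorm_def L2_set_def sum_nonneg sum.cartesian_product split_beta)

lemma vnorm_triangle: "vnorm n (%i. u i + v i) <= vnorm n u + vnorm n v"
 unfolding vnorm_def by (rule L2_set_triangle_ineq)

lemma fnorm_triangle: "fnorm n (%i j. G i j + H i j) <= fnorm n G + fnorm n H"
proof -
 have e: "(%(i, j). G i j + H i j) = (%p. (case p of (i, j) => G i j) + (case p of (i, j) => H i j))" by auto
 show ?thesis unfolding fnorm_def e by (rule L2_set_triangle_ineq)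
qed

lemma fnorm_cong: "(\<And>i j. i < n ==> j < n ==> G i j = H i j) ==> fnorm n G = fnorm n H"
 unfolding fnorm_def by (rule L2_set_cong) auto

lemma vnorm_cong: "(\<And>i. i < n ==> u i = v i) ==> vnorm n u = vnorm n v"
 unfolding vnorm_def by (rule L2_set_cong) auto

lemma fnorm_scale: "fnorm n (%i j. k * G i j) = \<bar>k\<bar> * fnorm n G"
proof (rule power2_eq_imp_eq)
 show "(fnorm n (%i j. k * G i j))\<^sup>2 = (\<bar>k\<bar> * fnorm n G)\<^sup>2"
  by (simp add: fnorm_sq power_mult_distrib sum_distrib_left)
qed auto

lemma vnorm_scale: "vnorm n (%i. k * v i) = \<bar>k\<bar> * vnorm n v"
proof (rule power2_eq_imp_eq)
 show "(vnorm n (%i. k * v i))\<^sup>2 = (\<bar>k\<bar> * vnorm n v)\<^sup>2"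
  by (simp add: vnorm_sq power_mult_distrib sum_distrib_left)
qed auto

lemma abs_dotn_le: "\<bar>dotn n u v\<bar> <= vnorm n u * vnorm n v"
proof -
 have "\<bar>dotn n u v\<bar> <= (\<Sum>i<n. \<bar>u i\<bar> * \<bar>v i\<bar>)"
  unfolding dotn_def by (rule order_trans[OF sum_abs]) (simp add: abs_mult)
 also have "... <= vnorm n u * vnorm n v" unfolding vnorm_def by (rule L2_set_mult_ineq)
 finally show ?thesis .
qed

lemma dotn_self: "dotn n v v = (vnorm n v)\<^sup>2"
 unfolding vnorm_sq by (simp add: dotn_def power2_eq_square)

lemma fdot_self: "fdot n G G = (fnorm n G)\<^sup>2"
 unfolding fnorm_sq by (simp add: fdot_def power2_eq_square)

lemma abs_fdot_le: "\<bar>fdot n G H\<bar> <= fnorm n G * fnorm n H"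
proof -
 have "fdot n G H = (\<Sum>p\<in>{..<n}\<times>{..<n}. (case p of (i,j) => G i j) * (case p of (i,j) => H i j))"
  by (simp add: fdot_def sum.cartesian_product split_beta)
 also have "\<bar>...\<bar> <= (\<Sum>p\<in>{..<n}\<times>{..<n}. \<bar>case p of (i,j) => G i j\<bar> * \<bar>case p of (i,j) => H i j\<bar>)"
  by (rule order_trans[OF sum_abs]) (simp add: abs_mult)
 also have "... <= fnorm n G * fnorm n H" unfolding fnorm_def by (rule L2_set_mult_ineq)
 finally show ?thesis .
qed

lemma op_leD: "op_le n G K ==> vnorm n (mulv n G v) <= K * vnorm n v" by (simp add: op_le_def)
lemma op_le_nonneg: "op_le n G K ==> 0 <= K" by (simp add: op_le_def)

lemma op_le_mono: "op_le n G K ==> K <= L ==> op_le n G L"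
 unfolding op_le_def by (meson mult_right_mono order_trans vnorm_nonneg)

lemma op_le_quadratic: "op_le n G K ==> \<bar>dotn n v (mulv n G v)\<bar> <= K * (vnorm n v)\<^sup>2"
proof -
 assume "op_le n G K"
 then have "vnorm n v * vnorm n (mulv n G v) <= vnorm n v * (K * vnorm n v)" by (intro mult_left_mono op_leD) auto
 then show ?thesis using abs_dotn_le[of n v "mulv n G v"] by (simp add: power2_eq_square ac_simps)
qed

lemma op_le_entry: "op_le n G K ==> i < n ==> \<bar>G i i\<bar> <= K"
proof -
 assume G: "op_le n G K" and i: "i < n"
 define v where "v = (%j. if j = i then 1 else (0::real))"
 have "mulv n G v j = G j i" for j using i by (simp add: mulv_def v_def if_distrib[of "(*) _"] cong: if_cong)
 then have "dotn n v (mulv n G v) = G i i" using i by (simp add: dotn_def v_def if_distrib[of "%t. t * _"] cong: if_cong)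
 moreover have "(vnorm n v)\<^sup>2 = 1" using i by (simp add: vnorm_sq v_def if_distrib[of "%t. t\<^sup>2"] cong: if_cong)
 ultimately show ?thesis using op_le_quadratic[OF G, of v] by simp
qed

lemma op_le_trace: "op_le n G K ==> \<bar>trn n G\<bar> <= K * real n"
proof -
 assume G: "op_le n G K"
 have "\<bar>trn n G\<bar> <= (\<Sum>i<n. \<bar>G i i\<bar>)" unfolding trn_def by (rule sum_abs)
 also have "... <= (\<Sum>i<n. K)" using op_le_entry[OF G] by (intro sum_mono) auto
 finally show ?thesis by (simp add: mult.commute)
qed

lemma op_le_cqf: "op_le n G K ==> \<bar>cqf n G v\<bar> <= K * ((vnorm n v)\<^sup>2 + real n)"
 using op_le_quadratic[of n G K v] op_le_trace[of n G K] unfolding cqf_def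
 by (simp add: algebra_simps abs_le_iff)

text \<open>Schur's test: a symmetric matrix has operator norm at most its largest absolute row sum.\<close>
lemma Schur_row_sum:
 assumes sym: "\<And>i j. i < n ==> j < n ==> G i j = G j i" and row: "\<And>i. i < n ==> (\<Sum>j<n. \<bar>G i j\<bar>) <= \<rho>" and \<rho>: "0 <= \<rho>"
 shows "op_le n G \<rho>"
 unfolding op_le_def
proof (intro conjI allI \<rho>)
 fix v
 have "(vnorm n (mulv n G v))\<^sup>2 <= (\<rho> * vnorm n v)\<^sup>2"
 proof -
  have "(mulv n G v i)\<^sup>2 <= \<rho> * (\<Sum>j<n. \<bar>G i j\<bar> * (v j)\<^sup>2)" if i: "i < n" for i
  proof -
   have "\<bar>mulv n G v i\<bar> <= (\<Sum>j<n. \<bar>sqrt \<bar>G i j\<bar>\<bar> * \<bar>sqrt \<bar>G i j\<bar> * v j\<bar>)"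
    unfolding mulv_def by (rule order_trans[OF sum_abs]) (simp add: abs_mult mult.assoc[symmetric])
   also have "... <= L2_set (%j. sqrt \<bar>G i j\<bar>) {..<n} * L2_set (%j. sqrt \<bar>G i j\<bar> * v j) {..<n}"
    by (rule L2_set_mult_ineq)
   finally have "(mulv n G v i)\<^sup>2 <= (L2_set (%j. sqrt \<bar>G i j\<bar>) {..<n} * L2_set (%j. sqrt \<bar>G i j\<bar> * v j) {..<n})\<^sup>2"
    by (rule abs_le_square_iff[THEN iffD1, OF order_trans[OF _ abs_ge_self]])
   also have "... = (\<Sum>j<n. \<bar>G i j\<bar>) * (\<Sum>j<n. \<bar>G i j\<bar> * (v j)\<^sup>2)"
    by (simp add: power_mult_distrib L2_set_def sum_nonneg)
   also have "... <= \<rho> * (\<Sum>j<n. \<bar>G i j\<bar> * (v j)\<^sup>2)" by (intro mult_right_mono row[OF i] sum_nonneg) auto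
   finally show ?thesis .
  qed
  then have "(vnorm n (mulv n G v))\<^sup>2 <= (\<Sum>i<n. \<rho> * (\<Sum>j<n. \<bar>G i j\<bar> * (v j)\<^sup>2))"
   unfolding vnorm_sq by (intro sum_mono) auto
  also have "... = \<rho> * (\<Sum>j<n. \<Sum>i<n. \<bar>G i j\<bar> * (v j)\<^sup>2)" by (subst sum.swap) (simp add: sum_distrib_left)
  also have "... = \<rho> * (\<Sum>j<n. (\<Sum>i<n. \<bar>G j i\<bar>) * (v j)\<^sup>2)"
   by (intro arg_cong2[where f = "(*)"] sum.cong refl) (simp add: sum_distrib_right sym)
  also have "... <= \<rho> * (\<Sum>j<n. \<rho> * (v j)\<^sup>2)" by (intro mult_left_mono sum_mono mult_right_mono row \<rho>) auto
  also have "... = (\<rho> * vnorm n v)\<^sup>2" by (simp add: vnorm_sq power_mult_distrib sum_distrib_left[symmetric] power2_eq_square[of \<rho>])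
  finally show ?thesis .
 qed
 then show "vnorm n (mulv n G v) <= \<rho> * vnorm n v" by (rule power2_le_imp_le) (simp add: \<rho>)
qed

lemma conj_by_sym:
 assumes "\<And>i j. i < n ==> j < n ==> G i j = G j i"
 shows "conj_by n V G i j = conj_by n V G j i"
proof -
 have "conj_by n V G i j = (\<Sum>l<n. \<Sum>k<n. V k i * G k l * V l j)" unfolding conj_by_def by (rule sum.swap)
 also have "... = conj_by n V G j i" unfolding conj_by_def by (intro sum.cong refl) (simp add: assms mult.commute mult.left_commute)
 finally show ?thesis .
qed

lemma conj_by_add: "conj_by n V (%i j. G i j + H i j) = (%i j. conj_by n V G i j + conj_by n V H i j)"
 by (simp add: conj_by_def algebra_simps sum.distrib fun_eq_iff)

lemma conj_by_scale: "conj_by n V (%i j. k * G i j) = (%i j. k * conj_by n V G i j)"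
 by (simp add: conj_by_def sum_distrib_left ac_simps fun_eq_iff)

lemma conj_by_sum: "conj_by n V (%i j. \<Sum>m\<in>A. G m i j) = (%i j. \<Sum>m\<in>A. conj_by n V (G m) i j)"
proof (cases "finite A")
 case True
 then show ?thesis by induction (simp_all add: conj_by_add, simp add: conj_by_def)
qed (simp add: conj_by_def fun_eq_iff)

lemma whitening_vnorm:
 assumes "whitening n R0 c V W" "0 < c"
 shows "vnorm n (%k. \<Sum>i<n. V i k * x i) <= vnorm n x / sqrt c" "vnorm n (mulv n V x) <= vnorm n x / sqrt c"
proof -
 have "(vnorm n (%k. \<Sum>i<n. V i k * x i))\<^sup>2 <= (vnorm n x / sqrt c)\<^sup>2"
  "(vnorm n (mulv n V x))\<^sup>2 <= (vnorm n x / sqrt c)\<^sup>2"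
  using assms by (auto simp: whitening_def vnorm_sq power_divide mulv_def)
 then show "vnorm n (%k. \<Sum>i<n. V i k * x i) <= vnorm n x / sqrt c" "vnorm n (mulv n V x) <= vnorm n x / sqrt c"
  using assms(2) by (auto intro!: power2_le_imp_le)
qed

lemma op_le_conj_by:
 assumes wh: "whitening n R0 c V W" "0 < c" and G: "op_le n G K"
 shows "op_le n (conj_by n V G) (K / c)"
 unfolding op_le_def
proof (intro conjI allI)
 show "0 <= K / c" using op_le_nonneg[OF G] wh by simp
 fix v
 have "mulv n (conj_by n V G) v i = (\<Sum>k<n. V k i * mulv n G (mulv n V v) k)" for i
 proof -
  have "mulv n (conj_by n V G) v i = (\<Sum>j<n. \<Sum>k<n. \<Sum>l<n. V k i * (G k l * (V l j * v j)))"
   by (simp add: mulv_def conj_by_def sum_distrib_right mult.assoc)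
  also have "... = (\<Sum>k<n. \<Sum>j<n. \<Sum>l<n. V k i * (G k l * (V l j * v j)))" by (rule sum.swap)
  also have "... = (\<Sum>k<n. \<Sum>l<n. \<Sum>j<n. V k i * (G k l * (V l j * v j)))"
   by (rule sum.cong[OF refl]) (rule sum.swap)
  finally show ?thesis by (simp add: mulv_def sum_distrib_left)
 qed
 then have "vnorm n (mulv n (conj_by n V G) v) = vnorm n (%i. \<Sum>k<n. V k i * mulv n G (mulv n V v) k)"
  by (intro vnorm_cong) simp
 also have "... <= vnorm n (mulv n G (mulv n V v)) / sqrt c" by (rule whitening_vnorm(1)[OF wh])
 also have "... <= K * vnorm n (mulv n V v) / sqrt c" using wh(2) by (intro divide_right_mono op_leD[OF G]) auto
 also have "... <= K * (vnorm n v / sqrt c) / sqrt c"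
  using wh(2) op_le_nonneg[OF G] by (intro divide_right_mono mult_left_mono whitening_vnorm(2)[OF wh]) auto
 also have "... = K / c * vnorm n v" using wh(2) by (simp add: field_simps)
 finally show "vnorm n (mulv n (conj_by n V G) v) <= K / c * vnorm n v" .
qed

lemma fnorm_conj_by:
 assumes wh: "whitening n R0 c V W" "0 < c"
 shows "fnorm n (conj_by n V G) <= fnorm n G / c"
proof (rule power2_le_imp_le)
 have b: "(\<Sum>k<n. (\<Sum>i<n. V i k * x i)\<^sup>2) <= (\<Sum>i<n. (x i)\<^sup>2) / c" for x using wh by (simp add: whitening_def)
 define H where "H k j = (\<Sum>l<n. V l j * G k l)" for k j
 have e: "conj_by n V G i j = (\<Sum>k<n. V k i * H k j)" for i j
  by (simp add: conj_by_def H_def sum_distrib_left ac_simps)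
 have "(fnorm n (conj_by n V G))\<^sup>2 = (\<Sum>j<n. \<Sum>i<n. (\<Sum>k<n. V k i * H k j)\<^sup>2)"
  unfolding fnorm_sq e by (rule sum.swap)
 also have "... <= (\<Sum>j<n. (\<Sum>k<n. (H k j)\<^sup>2) / c)" by (intro sum_mono b)
 also have "... = (\<Sum>k<n. \<Sum>j<n. (H k j)\<^sup>2) / c" by (subst sum.swap) (simp add: sum_divide_distrib)
 also have "... <= (\<Sum>k<n. (\<Sum>l<n. (G k l)\<^sup>2) / c) / c" unfolding H_def using wh(2) by (intro divide_right_mono sum_mono b) auto
 also have "... = (fnorm n G / c)\<^sup>2" unfolding power_divide fnorm_sq by (simp add: sum_divide_distrib[symmetric] power2_eq_square[of c])
 finally show "(fnorm n (conj_by n V G))\<^sup>2 <= (fnorm n G / c)\<^sup>2" .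
qed (use wh in simp)

lemma spectral_coordinates:
 assumes Q: "orthogonal_family n Q" and X: "diagonalizes n Q x X"
 defines "w \<equiv> mulv n Q"
 shows "trn n X = (\<Sum>k<n. x k)" "(fnorm n X)\<^sup>2 = (\<Sum>k<n. (x k)\<^sup>2)"
  "dotn n z (mulv n X z) = (\<Sum>k<n. x k * (w z k)\<^sup>2)" "(vnorm n (mulv n X z))\<^sup>2 = (\<Sum>k<n. (x k)\<^sup>2 * (w z k)\<^sup>2)"
  "op_le n X K ==> k < n ==> \<bar>x k\<bar> <= K"
proof -
 note X' = spectral_decomposition_entries[OF X]
 note q = Q[unfolded orthogonal_family_def]
 show "trn n X = (\<Sum>k<n. x k)"
 proof -
  have "trn n X = (\<Sum>i<n. \<Sum>k<n. x k * (Q k i * Q k i))" by (simp add: trn_def X' ac_simps)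
  also have "... = (\<Sum>k<n. x k * (\<Sum>i<n. Q k i * Q k i))" by (subst sum.swap) (simp add: sum_distrib_left)
  also have "... = (\<Sum>k<n. x k)" using q by simp
  finally show ?thesis .
 qed
 have mX: "mulv n X z i = (\<Sum>k<n. Q k i * (x k * w z k))" if "i < n" for i z
 proof -
  have "mulv n X z i = (\<Sum>j<n. \<Sum>k<n. Q k i * (x k * (Q k j * z j)))"
   using that by (simp add: mulv_def X' sum_distrib_right mult.assoc)
  also have "... = (\<Sum>k<n. \<Sum>j<n. Q k i * (x k * (Q k j * z j)))" by (rule sum.swap)
  finally show ?thesis by (simp add: w_def mulv_def sum_distrib_left)
 qed
 show v: "(vnorm n (mulv n X z))\<^sup>2 = (\<Sum>k<n. (x k)\<^sup>2 * (w z k)\<^sup>2)" for z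
 proof -
  have "(vnorm n (mulv n X z))\<^sup>2 = (\<Sum>i<n. (\<Sum>k<n. Q k i * (x k * w z k))\<^sup>2)"
   unfolding vnorm_sq by (intro sum.cong refl) (simp add: mX)
  also have "... = (\<Sum>k<n. (x k * w z k)\<^sup>2)" by (rule orthogonal_family_sum_squares(2)[OF Q])
  finally show ?thesis by (simp add: power_mult_distrib)
 qed
 show d: "dotn n z (mulv n X z) = (\<Sum>k<n. x k * (w z k)\<^sup>2)" for z
 proof -
  have "dotn n z (mulv n X z) = (\<Sum>i<n. \<Sum>k<n. x k * w z k * (Q k i * z i))"
   by (simp add: dotn_def mX sum_distrib_left ac_simps)
  also have "... = (\<Sum>k<n. x k * w z k * (\<Sum>i<n. Q k i * z i))" by (subst sum.swap) (simp add: sum_distrib_left)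
  finally show ?thesis by (simp add: w_def mulv_def power2_eq_square mult.assoc)
 qed
 show "(fnorm n X)\<^sup>2 = (\<Sum>k<n. (x k)\<^sup>2)"
 proof -
  have "(fnorm n X)\<^sup>2 = (\<Sum>j<n. \<Sum>i<n. (\<Sum>k<n. Q k i * (x k * Q k j))\<^sup>2)"
   unfolding fnorm_sq by (subst sum.swap) (simp add: X' mult.assoc)
  also have "... = (\<Sum>j<n. \<Sum>k<n. (x k * Q k j)\<^sup>2)" by (simp add: orthogonal_family_sum_squares(2)[OF Q])
  also have "... = (\<Sum>k<n. (x k)\<^sup>2 * (\<Sum>j<n. Q k j * Q k j))"
   by (subst sum.swap) (simp add: sum_distrib_left power2_eq_square ac_simps)
  also have "... = (\<Sum>k<n. (x k)\<^sup>2)" using q by simp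
  finally show ?thesis .
 qed
 show "\<bar>x k\<bar> <= K" if K: "op_le n X K" and k: "k < n"
 proof -
  have wk: "w (Q k) l = (if l = k then 1 else 0)" if "l < n" for l
   using q k that by (simp add: w_def mulv_def)
  have "(\<Sum>l<n. x l * (w (Q k) l)\<^sup>2) = (\<Sum>l<n. if l = k then x k else 0)" by (intro sum.cong refl) (simp add: wk)
  then have "dotn n (Q k) (mulv n X (Q k)) = x k" unfolding d using k by simp
  moreover have "(vnorm n (Q k))\<^sup>2 = 1" unfolding vnorm_sq using q k by (simp add: power2_eq_square)
  ultimately show ?thesis using op_le_quadratic[OF K, of "Q k"] by simp
 qed
qed

lemma ln_add_one_third_order: "\<bar>ln (1 + x) - x + x\<^sup>2 / 2\<bar> <= 2 * \<bar>x\<bar> ^ 3" if "\<bar>x\<bar> <= 1/2" for x :: real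
proof -
 have der: "((%t. ln (1 + t) - t + t\<^sup>2 / 2) has_real_derivative t\<^sup>2 / (1 + t)) (at t)" if "\<bar>t\<bar> <= 1/2" for t :: real
 proof -
  have "1 + t > 0" using that by linarith
  then show ?thesis by (auto intro!: derivative_eq_intros simp: field_simps power2_eq_square)
 qed
 have bd: "\<bar>t\<^sup>2 / (1 + t)\<bar> <= 2 * t\<^sup>2" if "\<bar>t\<bar> <= 1/2" for t :: real
 proof -
  have "1 + t \<ge> 1/2" using that by linarith
  then have "t\<^sup>2 / (1 + t) <= t\<^sup>2 / (1 / 2)" by (intro divide_left_mono) auto
  moreover have "0 <= t\<^sup>2 / (1 + t)" using \<open>1 + t \<ge> 1/2\<close> by simp
  ultimately show ?thesis by (simp only: abs_of_nonneg) simp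
 qed
 show ?thesis
 proof (cases "x = 0")
  case False
  have "\<exists>t. \<bar>t\<bar> <= \<bar>x\<bar> \<and> ln (1 + x) - x + x\<^sup>2 / 2 = x * (t\<^sup>2 / (1 + t))"
  proof (cases "0 < x")
   case True
   have "\<exists>t>0. t < x \<and> (ln (1 + x) - x + x\<^sup>2 / 2) - (ln (1 + 0) - 0 + 0\<^sup>2 / 2) = (x - 0) * (t\<^sup>2 / (1 + t))"
    by (rule MVT2) (use True that der in auto)
   then show ?thesis by force
  next
   case neg: False
   have "\<exists>t>x. t < 0 \<and> (ln (1 + 0) - 0 + 0\<^sup>2 / 2) - (ln (1 + x) - x + x\<^sup>2 / 2) = (0 - x) * (t\<^sup>2 / (1 + t))"
    by (rule MVT2) (use neg False that der in auto)
   then obtain t where "x < t" "t < 0" "ln (1 + x) - x + x\<^sup>2 / 2 = x * (t\<^sup>2 / (1 + t))" by auto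
   then show ?thesis by (intro exI[of _ t]) auto
  qed
  then obtain t where t: "\<bar>t\<bar> <= \<bar>x\<bar>" "ln (1 + x) - x + x\<^sup>2 / 2 = x * (t\<^sup>2 / (1 + t))" by auto
  have "t\<^sup>2 <= x\<^sup>2" using t(1) by (simp add: abs_le_square_iff)
  have "\<bar>t\<^sup>2 / (1 + t)\<bar> <= 2 * t\<^sup>2" using t(1) that by (intro bd) simp
  then have "\<bar>x * (t\<^sup>2 / (1 + t))\<bar> <= \<bar>x\<bar> * (2 * x\<^sup>2)"
   unfolding abs_mult using \<open>t\<^sup>2 <= x\<^sup>2\<close> by (intro mult_left_mono) auto
  then show ?thesis unfolding t(2) by (simp add: power3_eq_cube power2_eq_square abs_mult mult.assoc)
 qed simp
qed

section \<open>Local expansion of the criterion\<close>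

lemma inverse_add_one_third_order: "\<bar>1 / (1 + x) - 1 + x - x\<^sup>2\<bar> <= 2 * \<bar>x\<bar> ^ 3" if "\<bar>x\<bar> <= 1/2" for x :: real
proof -
 have p: "1 + x \<ge> 1/2" using that by linarith
 have "1 / (1 + x) - 1 + x - x\<^sup>2 = - (x ^ 3) / (1 + x)"
  using p by (simp add: field_simps power2_eq_square power3_eq_cube)
 then have "\<bar>1 / (1 + x) - 1 + x - x\<^sup>2\<bar> = \<bar>x\<bar> ^ 3 / (1 + x)"
  using p by (simp add: abs_divide power_abs)
 also have "... <= \<bar>x\<bar> ^ 3 / (1/2)" using p by (intro divide_left_mono) auto
 finally show ?thesis by simp
qed

text \<open>The logarithm and the reciprocal are expanded to second order in each eigenvalue; the cubic remainders are at most
the operator norm times the squares.\<close>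
lemma criterion_second_order:
 assumes Q: "orthogonal_family n Q" and X: "diagonalizes n Q x X"
  and K: "op_le n X K" "K <= 1/2"
 shows "\<bar>(\<Sum>k<n. ln (1 + x k) + (mulv n Q z k)\<^sup>2 * (1 / (1 + x k) - 1)) - (- cqf n X z + (vnorm n (mulv n X z))\<^sup>2 - (fnorm n X)\<^sup>2 / 2)\<bar>
  <= 2 * K * ((fnorm n X)\<^sup>2 + (vnorm n (mulv n X z))\<^sup>2)"
proof -
 note sc = spectral_coordinates[OF Q X]
 define w where "w = mulv n Q z"
 have K0: "0 <= K" using op_le_nonneg[OF K(1)] .
 have eq: "(\<Sum>k<n. ln (1 + x k) + (w k)\<^sup>2 * (1 / (1 + x k) - 1)) - (- cqf n X z + (vnorm n (mulv n X z))\<^sup>2 - (fnorm n X)\<^sup>2 / 2)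
  = (\<Sum>k<n. (ln (1 + x k) - x k + (x k)\<^sup>2 / 2) + (w k)\<^sup>2 * (1 / (1 + x k) - 1 + x k - (x k)\<^sup>2))"
  unfolding cqf_def sc(1-4) w_def[symmetric]
  by (simp add: algebra_simps sum.distrib sum_subtractf sum_divide_distrib)
 have le: "\<bar>\<Sum>k<n. (ln (1 + x k) - x k + (x k)\<^sup>2 / 2) + (w k)\<^sup>2 * (1 / (1 + x k) - 1 + x k - (x k)\<^sup>2)\<bar> <= (\<Sum>k<n. 2 * K * ((x k)\<^sup>2 + (x k)\<^sup>2 * (w k)\<^sup>2))"
 proof (rule order_trans[OF sum_abs], rule sum_mono)
  fix k assume "k \<in> {..<n}"
  then have xk: "\<bar>x k\<bar> <= K" using sc(5)[OF K(1)] by simp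
  then have h: "\<bar>x k\<bar> <= 1/2" using K by simp
  have "\<bar>(ln (1 + x k) - x k + (x k)\<^sup>2 / 2) + (w k)\<^sup>2 * (1 / (1 + x k) - 1 + x k - (x k)\<^sup>2)\<bar>
   <= 2 * \<bar>x k\<bar> ^ 3 + (w k)\<^sup>2 * (2 * \<bar>x k\<bar> ^ 3)"
  proof (rule order_trans[OF abs_triangle_ineq], rule add_mono)
   show "\<bar>ln (1 + x k) - x k + (x k)\<^sup>2 / 2\<bar> <= 2 * \<bar>x k\<bar> ^ 3" by (rule ln_add_one_third_order[OF h])
   show "\<bar>(w k)\<^sup>2 * (1 / (1 + x k) - 1 + x k - (x k)\<^sup>2)\<bar> <= (w k)\<^sup>2 * (2 * \<bar>x k\<bar> ^ 3)"
    unfolding abs_mult using inverse_add_one_third_order[OF h] by (intro mult_mono) auto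
  qed
  also have "... = \<bar>x k\<bar> * (2 * ((x k)\<^sup>2 + (x k)\<^sup>2 * (w k)\<^sup>2))"
   by (simp add: power3_eq_cube power2_eq_square algebra_simps)
  also have "... <= K * (2 * ((x k)\<^sup>2 + (x k)\<^sup>2 * (w k)\<^sup>2))" using xk by (intro mult_right_mono) auto
  finally show "\<bar>(ln (1 + x k) - x k + (x k)\<^sup>2 / 2) + (w k)\<^sup>2 * (1 / (1 + x k) - 1 + x k - (x k)\<^sup>2)\<bar> <= 2 * K * ((x k)\<^sup>2 + (x k)\<^sup>2 * (w k)\<^sup>2)"
   by (simp add: ac_simps)
 qed
 have "(\<Sum>k<n. 2 * K * ((x k)\<^sup>2 + (x k)\<^sup>2 * (w k)\<^sup>2)) = 2 * K * (\<Sum>k<n. (x k)\<^sup>2 + (x k)\<^sup>2 * (w k)\<^sup>2)"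
  by (simp only: sum_distrib_left)
 moreover have "(\<Sum>k<n. (x k)\<^sup>2 + (x k)\<^sup>2 * (w k)\<^sup>2) = (fnorm n X)\<^sup>2 + (vnorm n (mulv n X z))\<^sup>2"
  by (simp only: sum.distrib sc(2) sc(4) w_def)
 ultimately show ?thesis using le unfolding eq[unfolded w_def] w_def by (simp only:)
qed

lemma mulv_sum: "mulv n (%i j. \<Sum>m\<in>A. t m * G m i j) v = (%i. \<Sum>m\<in>A. t m * mulv n (G m) v i)"
proof (cases "finite A")
 case True
 then show ?thesis
  by induction (simp_all add: mulv_def fun_eq_iff algebra_simps sum.distrib sum_distrib_left)
qed (simp add: mulv_def fun_eq_iff)

lemma mulv_add: "mulv n (%i j. G i j + H i j) v = (%i. mulv n G v i + mulv n H v i)"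
 by (simp add: mulv_def algebra_simps sum.distrib fun_eq_iff)

lemma dotn_sum_left: "dotn n (%i. \<Sum>m\<in>A. t m * u m i) v = (\<Sum>m\<in>A. t m * dotn n (u m) v)"
 unfolding dotn_def sum_distrib_right sum_distrib_left by (subst sum.swap) (simp add: ac_simps)

lemma dotn_sum_right: "dotn n v (%i. \<Sum>m\<in>A. t m * u m i) = (\<Sum>m\<in>A. t m * dotn n v (u m))"
 unfolding dotn_def sum_distrib_left by (subst sum.swap) (simp add: ac_simps)

lemma fdot_sum_left: "fdot n (%i j. \<Sum>m\<in>A. t m * G m i j) H = (\<Sum>m\<in>A. t m * fdot n (G m) H)"
proof (cases "finite A")
 case True
 then show ?thesis by induction (simp_all add: fdot_def algebra_simps sum.distrib sum_distrib_left)
qed (simp add: fdot_def)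

lemma fdot_commute: "fdot n G H = fdot n H G" by (simp add: fdot_def mult.commute)

lemma fdot_sum_right: "fdot n H (%i j. \<Sum>m\<in>A. t m * G m i j) = (\<Sum>m\<in>A. t m * fdot n H (G m))"
 unfolding fdot_commute[of n H] by (rule fdot_sum_left)

lemma cqf_sum: "cqf n (%i j. \<Sum>m\<in>A. t m * G m i j) v = (\<Sum>m\<in>A. t m * cqf n (G m) v)"
proof -
 have "trn n (%i j. \<Sum>m\<in>A. t m * G m i j) = (\<Sum>m\<in>A. t m * trn n (G m))"
  unfolding trn_def sum_distrib_left by (rule sum.swap)
 then show ?thesis unfolding cqf_def mulv_sum dotn_sum_right by (simp add: algebra_simps sum_subtractf)
qed

lemma cqf_add: "cqf n (%i j. G i j + H i j) v = cqf n G v + cqf n H v"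
 unfolding cqf_def mulv_add by (simp add: dotn_def trn_def algebra_simps sum.distrib)

lemma cqf_scale: "cqf n (%i j. k * G i j) v = k * cqf n G v"
 by (simp add: cqf_def mulv_def dotn_def trn_def algebra_simps sum_distrib_left)

text \<open>All remainders are products of a norm of \<open>t\<close>, an operator norm of order \<open>\<rho>\<close> and Frobenius norms of order \<open>s\<close>.  Since
\<open>norm t * s \<le> b\<^sup>2\<close> while \<open>\<rho>\<close> and 1 are at most \<open>s / b ^ 10\<close>, each is at most a multiple of \<open>1 / b\<close>.  The events bound
only quadratic forms at the fixed matrices \<open>X1\<close> and \<open>X2\<close>; the part depending on \<open>t\<close> in a nonlinear way is
estimated by norms.\<close>
lemma local_expansion:
 fixes t :: "real^'p" and X1 :: "'p => nat => nat => real" and X2 :: "'p => 'p => nat => nat => real"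
 assumes b: "1 <= b" and s: "s = sqrt (real n)" "b ^ 10 <= s" and \<rho>: "0 <= \<rho>" "\<rho> * b ^ 10 <= s"
  and t: "norm t * s <= b\<^sup>2" and H: "1 <= H" "real CARD('p) ^ 2 <= H"
  and Q: "orthogonal_family n Q" and X: "diagonalizes n Q x X"
  and opX: "op_le n X (H * norm t * \<rho>)" and fX: "fnorm n X <= H * norm t * s"
  and fX1: "fnorm n (%i j. \<Sum>m\<in>UNIV. t $ m * X1 m i j) <= H * norm t * s"
  and opR: "op_le n R (H * (norm t)\<^sup>2 * \<rho>)" and fR: "fnorm n R <= H * (norm t)\<^sup>2 * s"
  and XR: "\<And>i j. X i j = (\<Sum>m\<in>UNIV. t $ m * X1 m i j) + R i j"
  and op3: "op_le n R3 (H * norm t ^ 3 * \<rho>)"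
  and R3: "\<And>i j. R i j = (\<Sum>m\<in>UNIV. t $ m * (\<Sum>l\<in>UNIV. t $ l * X2 m l i j)) / 2 + R3 i j"
  and ev2: "\<And>m l. \<bar>cqf n (X2 m l) z\<bar> <= s * b"
  and ev3: "\<And>m l. \<bar>dotn n (mulv n (X1 m) z) (mulv n (X1 l) z) - fdot n (X1 m) (X1 l)\<bar> <= s * \<rho> * b"
  and ev4: "vnorm n z <= s * b"
  and small: "2 * H <= b"
 shows "\<bar>(\<Sum>k<n. ln (1 + x k) + (mulv n Q z k)\<^sup>2 * (1 / (1 + x k) - 1))
   - (- (\<Sum>m\<in>UNIV. t $ m * cqf n (X1 m) z) + (\<Sum>m\<in>UNIV. t $ m * (\<Sum>l\<in>UNIV. t $ l * fdot n (X1 m) (X1 l))) / 2)\<bar> <= 40 * H ^ 3 / b"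
proof -
 define \<tau> where "\<tau> = norm t"
 have \<tau>0: "0 <= \<tau>" by (simp add: \<tau>_def)
 have b0: "b > 0" using b by simp
 have s1: "1 <= s" using s(2) one_le_power[OF b, of 10] by linarith
 have bk: "b ^ i <= b ^ j" if "i <= j" for i j using b that by (rule power_increasing[rotated])
 have ts: "\<tau> * s <= b\<^sup>2" using t by (simp add: \<tau>_def)
 have f1s: "\<tau> * \<rho> <= 1 / b ^ 8"
 proof -
  have "\<tau> * \<rho> * b ^ 10 <= \<tau> * s" using \<rho>(2) \<tau>0 by (simp add: mult.assoc mult_left_mono)
  also have "... <= b\<^sup>2" by (rule ts)
  finally have "\<tau> * \<rho> * b ^ 8 * b\<^sup>2 <= 1 * b\<^sup>2" by (simp add: mult.assoc power_add[symmetric])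
  then have "\<tau> * \<rho> * b ^ 8 <= 1" using b0 by (simp only: mult_le_cancel_right_pos zero_less_power)
  then show ?thesis using b0 by (simp add: pos_le_divide_eq)
 qed
 have f1: "\<tau> * \<rho> <= 1 / b ^ 6"
  using f1s b0 bk[of 6 8] by (intro order_trans[OF f1s] divide_left_mono) auto
 have f2: "\<tau>\<^sup>2 * \<rho> * s <= 1 / b ^ 4"
 proof -
  have "\<tau>\<^sup>2 * \<rho> * s = (\<tau> * \<rho>) * (\<tau> * s)" by (simp add: power2_eq_square)
  also have "... <= (1 / b ^ 6) * b\<^sup>2" using f1 ts \<tau>0 \<rho>(1) s1 b0 by (intro mult_mono) auto
  also have "... = 1 / b ^ 4" using b0 by (simp add: field_simps power_add[symmetric])
  finally show ?thesis .
 qed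
 have ts2: "(\<tau> * s)\<^sup>2 <= b ^ 4"
 proof -
  have "(\<tau> * s)\<^sup>2 <= (b\<^sup>2)\<^sup>2" using ts \<tau>0 s1 by (intro power_mono) auto
  then show ?thesis by (simp add: power_mult[symmetric])
 qed
 have f3: "\<tau>\<^sup>2 * s <= 1 / b ^ 4"
 proof -
  have "\<tau>\<^sup>2 * s * s <= b ^ 4" using ts2 by (simp add: power2_eq_square ac_simps)
  moreover have "\<tau>\<^sup>2 * s * b ^ 8 <= \<tau>\<^sup>2 * s * s" using s(2) s1 bk[of 8 10] by (intro mult_left_mono) auto
  ultimately have "\<tau>\<^sup>2 * s * b ^ 4 * b ^ 4 <= 1 * b ^ 4" by (simp add: mult.assoc power_add[symmetric])
  then have "\<tau>\<^sup>2 * s * b ^ 4 <= 1" using b0 by (simp only: mult_le_cancel_right_pos zero_less_power)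
  then show ?thesis using b0 by (simp add: pos_le_divide_eq)
 qed
 have f4: "\<tau> ^ 3 * \<rho> * s\<^sup>2 <= 1 / b ^ 4"
 proof -
  have "\<tau> ^ 3 * \<rho> * s\<^sup>2 = (\<tau> * \<rho>) * (\<tau> * s)\<^sup>2" by (simp add: power2_eq_square power3_eq_cube)
  also have "... <= (1 / b ^ 8) * b ^ 4" using f1s ts2 \<tau>0 \<rho>(1) s1 b0 by (intro mult_mono) auto
  also have "... = 1 / b ^ 4" using b0 by (simp add: field_simps power_add[symmetric])
  finally show ?thesis .
 qed
 define Y1 where "Y1 = (%i j. \<Sum>m\<in>UNIV. t $ m * X1 m i j)"
 have XY: "X = (%i j. Y1 i j + R i j)" using XR by (simp add: Y1_def fun_eq_iff)
 define N1 where "N1 = vnorm n (mulv n Y1 z)"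
 define NR where "NR = vnorm n (mulv n R z)"
 define NX where "NX = vnorm n (mulv n X z)"
 have pp: "\<bar>\<Sum>m\<in>UNIV. t $ m * (\<Sum>l\<in>UNIV. t $ l * a m l)\<bar> <= H * \<tau>\<^sup>2 * B" if a: "\<And>m l. \<bar>a m l\<bar> <= B" for a :: "'p => 'p => real" and B
 proof -
  have tm: "\<bar>t $ m\<bar> <= \<tau>" for m unfolding \<tau>_def by (rule component_le_norm_cart)
  have B0: "0 <= B" using a[of undefined undefined] by linarith
  have "\<bar>\<Sum>m\<in>UNIV. t $ m * (\<Sum>l\<in>UNIV. t $ l * a m l)\<bar> <= (\<Sum>m\<in>UNIV. \<bar>t $ m\<bar> * (\<Sum>l\<in>UNIV. \<bar>t $ l\<bar> * \<bar>a m l\<bar>))"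
   by (intro order_trans[OF sum_abs] sum_mono) (simp add: abs_mult mult_left_mono order_trans[OF sum_abs])
  also have "... <= (\<Sum>m\<in>(UNIV::'p set). \<tau> * (\<Sum>l\<in>(UNIV::'p set). \<tau> * B))"
   using tm a \<tau>0 B0 by (intro sum_mono mult_mono sum_nonneg mult_nonneg_nonneg) auto
  also have "... = real CARD('p) ^ 2 * (\<tau>\<^sup>2 * B)" by (simp add: power2_eq_square)
  also have "... <= H * (\<tau>\<^sup>2 * B)" using H(2) B0 by (intro mult_right_mono) auto
  finally show ?thesis by simp
 qed
 have N1e: "N1\<^sup>2 - (fnorm n Y1)\<^sup>2 = (\<Sum>m\<in>UNIV. t $ m * (\<Sum>l\<in>UNIV. t $ l * (dotn n (mulv n (X1 m) z) (mulv n (X1 l) z) - fdot n (X1 m) (X1 l))))"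
  unfolding N1_def Y1_def dotn_self[symmetric] fdot_self[symmetric] mulv_sum dotn_sum_left fdot_sum_left
  unfolding dotn_sum_right fdot_sum_right by (simp add: sum_subtractf algebra_simps)
 have e1: "\<bar>N1\<^sup>2 - (fnorm n Y1)\<^sup>2\<bar> <= H / b"
 proof -
  have "\<bar>N1\<^sup>2 - (fnorm n Y1)\<^sup>2\<bar> <= H * \<tau>\<^sup>2 * (s * \<rho> * b)" unfolding N1e by (rule pp) (rule ev3)
  also have "... = H * b * (\<tau>\<^sup>2 * \<rho> * s)" by simp
  also have "... <= H * b * (1 / b ^ 4)" using f2 H b0 by (intro mult_left_mono) auto
  also have "... = H * (1 / b ^ 3)" using b0 by (simp add: field_simps power_add[symmetric] eval_nat_numeral)
  also have "... <= H * (1 / b)" using b0 H bk[of 1 3] by (intro mult_left_mono divide_left_mono) auto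
  finally show ?thesis by simp
 qed
 have Hts: "H * \<tau> * s <= H * b\<^sup>2" using mult_left_mono[OF ts, of H] H by (simp add: mult.assoc)
 have fY: "fnorm n Y1 <= H * b\<^sup>2"
  unfolding Y1_def by (rule order_trans[OF fX1 Hts[unfolded \<tau>_def]])
 have fXb: "fnorm n X <= H * b\<^sup>2"
  by (rule order_trans[OF fX Hts[unfolded \<tau>_def]])
 have fRb: "fnorm n R <= H / b ^ 4"
 proof -
  have "H * \<tau>\<^sup>2 * s <= H * (1 / b ^ 4)" using mult_left_mono[OF f3, of H] H by (simp add: mult.assoc)
  then show ?thesis using fR unfolding \<tau>_def by simp
 qed
 have hb: "1 / b <= 1" using b by simp
 have N1b: "N1 <= 2 * H * b\<^sup>2"
 proof (rule power2_le_imp_le)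
  have "N1\<^sup>2 <= (fnorm n Y1)\<^sup>2 + H / b" using e1 by linarith
  also have "... <= (H * b\<^sup>2)\<^sup>2 + H\<^sup>2 * (b\<^sup>2)\<^sup>2"
  proof (rule add_mono)
   show "(fnorm n Y1)\<^sup>2 <= (H * b\<^sup>2)\<^sup>2" using fY by (intro power_mono) auto
   have "H / b <= H * 1" using mult_left_mono[OF hb, of H] H by simp
   also have "... <= H\<^sup>2 * 1" using H by (simp add: power2_eq_square mult_le_cancel_left1)
   also have "... <= H\<^sup>2 * (b\<^sup>2)\<^sup>2" using b by (intro mult_left_mono one_le_power) auto
   finally show "H / b <= H\<^sup>2 * (b\<^sup>2)\<^sup>2" .
  qed
  also have "... <= (2 * H * b\<^sup>2)\<^sup>2" by (simp add: power_mult_distrib)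
  finally show "N1\<^sup>2 <= (2 * H * b\<^sup>2)\<^sup>2" .
 qed (use H in simp)
 have NRb: "NR <= H / b ^ 3"
 proof -
  have "NR <= (H * \<tau>\<^sup>2 * \<rho>) * vnorm n z" unfolding NR_def using op_leD[OF opR] by (simp add: \<tau>_def)
  also have "... <= (H * \<tau>\<^sup>2 * \<rho>) * (s * b)" using ev4 H \<rho> by (intro mult_left_mono) auto
  also have "... = H * b * (\<tau>\<^sup>2 * \<rho> * s)" by simp
  also have "... <= H * b * (1 / b ^ 4)" using f2 H b0 by (intro mult_left_mono) auto
  also have "... = H / b ^ 3" using b0 by (simp add: field_simps power_add[symmetric] eval_nat_numeral)
  finally show ?thesis .
 qed
 have N0: "0 <= N1" "0 <= NR" "0 <= NX" by (simp_all add: N1_def NR_def NX_def)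
 have H2: "H <= H\<^sup>2" "H\<^sup>2 <= H ^ 3" "H <= H ^ 3" using H(1) power_increasing[of 1 2 H] power_increasing[of 2 3 H] power_increasing[of 1 3 H] by auto
 have NX_up: "NX <= N1 + NR" unfolding NX_def N1_def NR_def XY mulv_add by (rule vnorm_triangle)
 have N1_up: "N1 <= NX + NR"
 proof -
  have "mulv n Y1 z = (%i. mulv n X z i + - 1 * mulv n R z i)" unfolding XY mulv_add by simp
  then have "N1 <= NX + vnorm n (%i. - 1 * mulv n R z i)" unfolding N1_def NX_def by (simp only: vnorm_triangle)
  then show ?thesis unfolding vnorm_scale NR_def by simp
 qed
 have d1: "\<bar>NX\<^sup>2 - N1\<^sup>2\<bar> <= 5 * H\<^sup>2 / b"
 proof -
  have "\<bar>NX\<^sup>2 - N1\<^sup>2\<bar> = \<bar>NX - N1\<bar> * (NX + N1)"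
   using N0 by (simp add: power2_eq_square square_diff_square_factored abs_mult)
  also have "... <= NR * (2 * N1 + NR)" using NX_up N1_up N0 by (intro mult_mono) auto
  also have "... <= (H / b ^ 3) * (2 * (2 * H * b\<^sup>2) + H * b\<^sup>2)"
  proof (intro mult_mono add_mono mult_left_mono NRb N1b)
   have "H / b ^ 3 <= H * 1" using b H by (simp add: divide_le_eq mult_le_cancel_left1)
   also have "... <= H * b\<^sup>2" using b H by (intro mult_left_mono one_le_power) auto
   finally show "NR <= H * b\<^sup>2" using NRb by linarith
  qed (use N0 H b0 in auto)
  also have "... = 5 * H\<^sup>2 / b" using b0 by (simp add: field_simps power2_eq_square power3_eq_cube)
  finally show ?thesis .
 qed
 have d2: "\<bar>(fnorm n X)\<^sup>2 - (fnorm n Y1)\<^sup>2\<bar> <= 2 * H\<^sup>2 / b"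
 proof -
  have u: "fnorm n X <= fnorm n Y1 + fnorm n R" unfolding XY by (rule fnorm_triangle)
  have "Y1 = (%i j. X i j + - 1 * R i j)" unfolding XY by simp
  then have "fnorm n Y1 <= fnorm n X + fnorm n (%i j. - 1 * R i j)" by (simp only: fnorm_triangle)
  then have l: "fnorm n Y1 <= fnorm n X + fnorm n R" unfolding fnorm_scale by simp
  have "\<bar>(fnorm n X)\<^sup>2 - (fnorm n Y1)\<^sup>2\<bar> = \<bar>fnorm n X - fnorm n Y1\<bar> * (fnorm n X + fnorm n Y1)"
   by (simp add: power2_eq_square square_diff_square_factored abs_mult)
  also have "... <= (H / b ^ 4) * (H * b\<^sup>2 + H * b\<^sup>2)"
   using u l fRb fXb fY H b0 by (intro mult_mono add_mono) auto
  also have "... = 2 * H\<^sup>2 * (1 / b\<^sup>2)" using b0 by (simp add: field_simps power2_eq_square power4_eq_xxxx)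
  also have "... <= 2 * H\<^sup>2 * (1 / b)" using b0 bk[of 1 2] by (intro mult_left_mono divide_left_mono) auto
  finally show ?thesis by simp
 qed
 define K where "K = H * \<tau> * \<rho>"
 have Kb: "K <= H / b ^ 6" unfolding K_def using mult_left_mono[OF f1, of H] H by (simp add: ac_simps)
 have Kh: "K <= 1/2"
 proof -
  have "H / b ^ 6 <= H / b" using H b0 bk[of 1 6] by (intro divide_left_mono) auto
  also have "... <= 1/2" using small b0 by (simp add: field_simps)
  finally show ?thesis using Kb by linarith
 qed
 have opK: "op_le n X K" using opX by (simp add: K_def \<tau>_def)
 note so = criterion_second_order[OF Q X opK Kh, of z]
 have NXb: "NX\<^sup>2 <= 9 * H\<^sup>2 * b ^ 4"
 proof -
  have "N1\<^sup>2 <= (2 * H * b\<^sup>2)\<^sup>2" using N1b N0 by (intro power_mono) auto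
  also have "... = 4 * H\<^sup>2 * b ^ 4" by (simp add: power_mult_distrib power_mult[symmetric])
  finally have "N1\<^sup>2 <= 4 * H\<^sup>2 * b ^ 4" .
  moreover have "5 * H\<^sup>2 / b <= 5 * H\<^sup>2 * b ^ 4"
  proof -
   have "1 / b <= b ^ 4" using hb one_le_power[OF b, of 4] by linarith
   then have "5 * H\<^sup>2 * (1 / b) <= 5 * H\<^sup>2 * b ^ 4" by (intro mult_left_mono) auto
   then show ?thesis by simp
  qed
  ultimately show ?thesis using d1 by linarith
 qed
 have fX2: "(fnorm n X)\<^sup>2 <= H\<^sup>2 * b ^ 4"
 proof -
  have "(fnorm n X)\<^sup>2 <= (H * b\<^sup>2)\<^sup>2" using fXb by (intro power_mono) auto
  then show ?thesis by (simp add: power_mult_distrib power_mult[symmetric])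
 qed
 have err0: "2 * K * ((fnorm n X)\<^sup>2 + NX\<^sup>2) <= 20 * H ^ 3 / b"
 proof -
  have "2 * K * ((fnorm n X)\<^sup>2 + NX\<^sup>2) <= 2 * (H / b ^ 6) * (10 * (H\<^sup>2 * b ^ 4))"
   using Kb fX2 NXb H b0 op_le_nonneg[OF opK] by (intro mult_mono) auto
  also have "... = 20 * H ^ 3 * (1 / b\<^sup>2)" using b0 by (simp add: field_simps power2_eq_square power3_eq_cube eval_nat_numeral)
  also have "... <= 20 * H ^ 3 * (1 / b)" using b0 H bk[of 1 2] by (intro mult_left_mono divide_left_mono) auto
  finally show ?thesis by simp
 qed
 have lin: "\<bar>cqf n X z - (\<Sum>m\<in>UNIV. t $ m * cqf n (X1 m) z)\<bar> <= 4 * H / b"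
 proof -
  define Y2 where "Y2 = (%i j. \<Sum>m\<in>UNIV. t $ m * (\<Sum>l\<in>UNIV. t $ l * X2 m l i j))"
  have RY: "R = (%i j. 1/2 * Y2 i j + R3 i j)" using R3 by (simp add: Y2_def fun_eq_iff)
  have "cqf n Y2 z = (\<Sum>m\<in>UNIV. t $ m * (\<Sum>l\<in>UNIV. t $ l * cqf n (X2 m l) z))"
   unfolding Y2_def cqf_sum ..
  then have c2: "\<bar>cqf n Y2 z\<bar> <= H * \<tau>\<^sup>2 * (s * b)" using pp[OF ev2] by simp
  have "H * \<tau>\<^sup>2 * (s * b) = H * b * (\<tau>\<^sup>2 * s)" by simp
  also have "... <= H * b * (1 / b ^ 4)" using f3 H b0 by (intro mult_left_mono) auto
  also have "... = H * (1 / b ^ 3)" using b0 by (simp add: field_simps power_add[symmetric] eval_nat_numeral)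
  also have "... <= H * (1 / b)" using b0 H bk[of 1 3] by (intro mult_left_mono divide_left_mono) auto
  finally have c2': "\<bar>cqf n Y2 z\<bar> <= H / b" using c2 by simp
  have "\<bar>cqf n R3 z\<bar> <= H * \<tau> ^ 3 * \<rho> * ((vnorm n z)\<^sup>2 + real n)" using op_le_cqf[OF op3] by (simp add: \<tau>_def)
  also have "... <= H * \<tau> ^ 3 * \<rho> * (2 * (s * b)\<^sup>2)"
  proof (intro mult_left_mono)
   have "(vnorm n z)\<^sup>2 <= (s * b)\<^sup>2" using ev4 by (intro power_mono) auto
   moreover have "real n <= (s * b)\<^sup>2"
   proof -
    have "s\<^sup>2 * 1 <= s\<^sup>2 * b\<^sup>2" using b by (intro mult_left_mono one_le_power) auto
    then show ?thesis using s(1) by (simp add: power_mult_distrib)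
   qed
   ultimately show "(vnorm n z)\<^sup>2 + real n <= 2 * (s * b)\<^sup>2" by linarith
  qed (use H \<tau>0 \<rho> in auto)
  also have "... = 2 * H * b\<^sup>2 * (\<tau> ^ 3 * \<rho> * s\<^sup>2)" by (simp add: power_mult_distrib)
  also have "... <= 2 * H * b\<^sup>2 * (1 / b ^ 4)" using f4 H by (intro mult_left_mono) auto
  also have "... = 2 * H * (1 / b\<^sup>2)" using b0 by (simp add: field_simps power_add[symmetric])
  also have "... <= 2 * H * (1 / b)" using b0 H bk[of 1 2] by (intro mult_left_mono divide_left_mono) auto
  finally have c3: "\<bar>cqf n R3 z\<bar> <= 2 * (H / b)" by simp
  have "cqf n X z = cqf n Y1 z + (1/2 * cqf n Y2 z + cqf n R3 z)"
   unfolding XY cqf_add RY cqf_scale ..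
  moreover have "cqf n Y1 z = (\<Sum>m\<in>UNIV. t $ m * cqf n (X1 m) z)" unfolding Y1_def cqf_sum ..
  ultimately have "\<bar>cqf n X z - (\<Sum>m\<in>UNIV. t $ m * cqf n (X1 m) z)\<bar> <= 4 * (H / b)"
   using c2' c3 by linarith
  then show ?thesis by simp
 qed
 have fin: "(\<Sum>m\<in>UNIV. t $ m * (\<Sum>l\<in>UNIV. t $ l * fdot n (X1 m) (X1 l))) = (fnorm n Y1)\<^sup>2"
  unfolding Y1_def fdot_self[symmetric] fdot_sum_left fdot_sum_right ..
 have "\<bar>(\<Sum>k<n. ln (1 + x k) + (mulv n Q z k)\<^sup>2 * (1 / (1 + x k) - 1))
   - (- (\<Sum>m\<in>UNIV. t $ m * cqf n (X1 m) z) + (fnorm n Y1)\<^sup>2 / 2)\<bar>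
   <= 20 * H ^ 3 / b + 4 * H / b + 5 * H\<^sup>2 / b + H / b + 2 * H\<^sup>2 / b"
  using so[folded NX_def] err0 lin d1 d2 e1 by linarith
 also have "... = (20 * H ^ 3 + 5 * H + 7 * H\<^sup>2) / b" by (simp add: add_divide_distrib[symmetric])
 also have "... <= 40 * H ^ 3 / b" using H2 b0 H by (intro divide_right_mono) auto
 finally show ?thesis unfolding fin .
qed

section \<open>Tails of quadratic forms and duality\<close>

lemma (in prob_space) Markov_sq:
 fixes X :: "'a => real"
 assumes "integrable M (%w. (X w)\<^sup>2)" "0 < l" "X \<in> borel_measurable M"
 shows "prob {w \<in> space M. l < \<bar>X w\<bar>} <= expectation (%w. (X w)\<^sup>2) / l\<^sup>2"
proof -
 have "prob {w \<in> space M. l < \<bar>X w\<bar>} <= prob {w \<in> space M. l\<^sup>2 <= (X w)\<^sup>2}"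
 proof (rule finite_measure_mono)
  show "{w \<in> space M. l < \<bar>X w\<bar>} \<subseteq> {w \<in> space M. l\<^sup>2 <= (X w)\<^sup>2}"
   using assms(2) by (auto intro!: abs_le_square_iff[THEN iffD1])
  show "{w \<in> space M. l\<^sup>2 <= (X w)\<^sup>2} \<in> events" using assms(3) by measurable
 qed
 also have "... <= expectation (%w. (X w)\<^sup>2) / l\<^sup>2"
  using integral_Markov_inequality_measure[of M "%w. (X w)\<^sup>2" "space M" "l\<^sup>2"] assms by simp
 finally show ?thesis .
qed

lemma orthogonal_family_mulv:
 assumes "std_normal_family M n z" "orthogonal_family n Q"
 shows "std_normal_family M n (%k w. mulv n Q (%j. z j w) k)"
 unfolding mulv_def using assms by (intro std_normal_family_orthogonal) (simp_all add: orthogonal_family_def)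

lemma cqf_diagonal:
 assumes "orthogonal_family n Q" "diagonalizes n Q x X"
 shows "cqf n X z = (\<Sum>k<n. x k * ((mulv n Q z k)\<^sup>2 - 1))"
 unfolding cqf_def spectral_coordinates(1,3)[OF assms] by (simp add: algebra_simps sum_subtractf)

text \<open>In an orthonormal eigenbasis the form is a sum of independent centred variables of variance twice the squared eigenvalues.\<close>
lemma (in prob_space) cqf_second_moment:
 assumes z: "std_normal_family M n z" and sym: "\<And>i j. i < n ==> j < n ==> G i j = G j i"
 shows "integrable M (%w. (cqf n G (%k. z k w))\<^sup>2)"
  "expectation (%w. (cqf n G (%k. z k w))\<^sup>2) = 2 * (fnorm n G)\<^sup>2"
  "(%w. cqf n G (%k. z k w)) \<in> borel_measurable M"
proof -
 obtain Q x where Q: "orthogonal_family n Q" and X: "diagonalizes n Q x G"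
  using spectral_decomposition[of n G] sym by blast
 note v = std_normal_sq_variance[OF orthogonal_family_mulv[OF z Q], of x]
 show "integrable M (%w. (cqf n G (%k. z k w))\<^sup>2)" unfolding cqf_diagonal[OF Q X] by (rule v(1))
 show "expectation (%w. (cqf n G (%k. z k w))\<^sup>2) = 2 * (fnorm n G)\<^sup>2"
  unfolding cqf_diagonal[OF Q X] v(2) spectral_coordinates(2)[OF Q X] ..
 have [measurable]: "z k \<in> borel_measurable M" if "k \<in> {..<n}" for k using z that by (auto simp: std_normal_family_def)
 show "(%w. cqf n G (%k. z k w)) \<in> borel_measurable M"
  unfolding cqf_def dotn_def mulv_def by measurable
qed

lemma (in prob_space) cqf_tail:
 assumes z: "std_normal_family M n z" and sym: "\<And>i j. i < n ==> j < n ==> G i j = G j i"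
  and F: "fnorm n G <= F" and l: "0 < l"
 shows "prob {w \<in> space M. l < \<bar>cqf n G (%k. z k w)\<bar>} <= 2 * F\<^sup>2 / l\<^sup>2"
proof -
 note m = cqf_second_moment[OF z sym]
 have "prob {w \<in> space M. l < \<bar>cqf n G (%k. z k w)\<bar>} <= 2 * (fnorm n G)\<^sup>2 / l\<^sup>2"
  using Markov_sq[OF m(1) l m(3)] m(2) by simp
 also have "... <= 2 * F\<^sup>2 / l\<^sup>2" using F by (intro divide_right_mono mult_left_mono power_mono) auto
 finally show ?thesis .
qed

lemma (in prob_space) vnorm_tail:
 assumes z: "\<And>k. k < n ==> z k \<in> borel_measurable M" "\<And>k. k < n ==> integrable M (%w. (z k w)\<^sup>2)"
   "\<And>k. k < n ==> expectation (%w. (z k w)\<^sup>2) <= C" and l: "0 < l"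
 shows "prob {w \<in> space M. l < vnorm n (%k. z k w)} <= C * real n / l\<^sup>2"
  "{w \<in> space M. l < vnorm n (%k. z k w)} \<in> events"
proof -
 have [measurable]: "(%w. vnorm n (%k. z k w)) \<in> borel_measurable M"
  unfolding vnorm_def L2_set_def using z(1) by measurable
 have i: "integrable M (%w. (vnorm n (%k. z k w))\<^sup>2)" unfolding vnorm_sq using z by (intro Bochner_Integration.integrable_sum) auto
 have "expectation (%w. (vnorm n (%k. z k w))\<^sup>2) = (\<Sum>k<n. expectation (%w. (z k w)\<^sup>2))"
  unfolding vnorm_sq using z by (intro Bochner_Integration.integral_sum) auto
 also have "... <= (\<Sum>k<n. C)" by (intro sum_mono z(3)) auto
 finally have "expectation (%w. (vnorm n (%k. z k w))\<^sup>2) <= C * real n" by (simp add: mult.commute)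
 then have "expectation (%w. (vnorm n (%k. z k w))\<^sup>2) / l\<^sup>2 <= C * real n / l\<^sup>2" by (intro divide_right_mono) auto
 then show "prob {w \<in> space M. l < vnorm n (%k. z k w)} <= C * real n / l\<^sup>2"
  using Markov_sq[OF i l] by simp
 show "{w \<in> space M. l < vnorm n (%k. z k w)} \<in> events" by measurable
qed

lemma (in prob_space) cqf_char:
 assumes z: "std_normal_family M n z" and sym: "\<And>i j. i < n ==> j < n ==> G i j = G j i"
  and C: "\<forall>a. \<bar>a\<bar> <= 1 --> cmod ((CLINT x|std_gauss. iexp (a * (x\<^sup>2 - 1))) - of_real (exp (- a\<^sup>2))) <= C * \<bar>a\<bar> ^ 3" "0 <= C"
  and op: "op_le n G \<epsilon>" "\<epsilon> <= 1"
 shows "cmod ((CLINT w|M. iexp (cqf n G (%k. z k w))) - of_real (exp (- (fnorm n G)\<^sup>2))) <= C * \<epsilon> * (fnorm n G)\<^sup>2"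
proof -
 obtain Q x where Q: "orthogonal_family n Q" and X: "diagonalizes n Q x G"
  using spectral_decomposition[of n G] sym by blast
 show ?thesis
  unfolding cqf_diagonal[OF Q X] spectral_coordinates(2)[OF Q X]
  by (rule std_normal_sq_char[OF orthogonal_family_mulv[OF z Q] C(1) _ op(2) C(2)]) (rule spectral_coordinates(5)[OF Q X op(1)])
qed

definition matmul :: "nat => (nat => nat => real) => (nat => nat => real) => nat => nat => real" where
 "matmul n G H i j = (\<Sum>k<n. G i k * H k j)"

lemma fnorm_transpose: "fnorm n (%i j. G j i) = fnorm n G"
 by (rule power2_eq_imp_eq) (auto simp: fnorm_sq intro: sum.swap)

lemma fnorm_matmul_le:
 assumes "op_le n G K" shows "fnorm n (matmul n G H) <= K * fnorm n H"
proof (rule power2_le_imp_le)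
 have "(fnorm n (matmul n G H))\<^sup>2 = (\<Sum>j<n. \<Sum>i<n. (mulv n G (%k. H k j) i)\<^sup>2)"
  unfolding fnorm_sq matmul_def mulv_def by (rule sum.swap)
 also have "... = (\<Sum>j<n. (vnorm n (mulv n G (%k. H k j)))\<^sup>2)" by (simp only: vnorm_sq)
 also have "... <= (\<Sum>j<n. (K * vnorm n (%k. H k j))\<^sup>2)" by (intro sum_mono power_mono op_leD[OF assms]) auto
 also have "... = K\<^sup>2 * (\<Sum>j<n. \<Sum>i<n. (H i j)\<^sup>2)" by (simp only: power_mult_distrib vnorm_sq sum_distrib_left)
 also have "(\<Sum>j<n. \<Sum>i<n. (H i j)\<^sup>2) = (fnorm n H)\<^sup>2" unfolding fnorm_sq by (rule sum.swap)
 finally show "(fnorm n (matmul n G H))\<^sup>2 <= (K * fnorm n H)\<^sup>2" by (simp add: power_mult_distrib)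
qed (use op_le_nonneg[OF assms] in simp)

lemma dotn_mulv_mulv:
 assumes symG: "\<And>i j. i < n ==> j < n ==> G i j = G j i"
 shows "dotn n (mulv n G z) (mulv n H z) = dotn n z (mulv n (matmul n G H) z)"
proof -
 have "dotn n (mulv n G z) (mulv n H z) = (\<Sum>k<n. \<Sum>i<n. G k i * z i * mulv n H z k)"
  by (simp only: dotn_def mulv_def[of n G z] sum_distrib_right)
 also have "... = (\<Sum>i<n. \<Sum>k<n. G k i * z i * mulv n H z k)" by (rule sum.swap)
 also have "... = (\<Sum>i<n. \<Sum>k<n. z i * (G i k * mulv n H z k))"
  by (intro sum.cong refl) (simp add: symG)
 also have "... = (\<Sum>i<n. z i * (\<Sum>k<n. \<Sum>j<n. G i k * H k j * z j))"
  by (simp add: mulv_def sum_distrib_left mult.assoc)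
 also have "... = (\<Sum>i<n. z i * (\<Sum>j<n. matmul n G H i j * z j))"
  unfolding matmul_def sum_distrib_right by (rule sum.cong[OF refl], rule arg_cong[where f = "(*) _"], rule sum.swap)
 finally show ?thesis by (simp add: dotn_def mulv_def)
qed

text \<open>A product of two symmetric matrices enters a quadratic form only through its symmetrisation, whose trace is \<open>fdot n G H\<close>.\<close>
lemma product_cqf:
 assumes symG: "\<And>i j. i < n ==> j < n ==> G i j = G j i" and symH: "\<And>i j. i < n ==> j < n ==> H i j = H j i"
 defines "S \<equiv> %i j. (matmul n G H i j + matmul n H G i j) / 2"
 shows "dotn n (mulv n G z) (mulv n H z) - fdot n G H = cqf n S z"
  and "\<And>i j. i < n ==> j < n ==> S i j = S j i"
  and "op_le n G K ==> fnorm n S <= K * fnorm n H"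
proof -
 have tr: "matmul n H G i j = matmul n G H j i" if "i < n" "j < n" for i j
  unfolding matmul_def using that by (intro sum.cong refl) (simp add: symG symH mult.commute)
 show "S i j = S j i" if "i < n" "j < n" for i j using that tr by (simp add: S_def)
 have dc: "dotn n u v = dotn n v u" for u v by (simp add: dotn_def mult.commute)
 have "dotn n z (mulv n S z) = (dotn n z (mulv n (matmul n G H) z) + dotn n z (mulv n (matmul n H G) z)) / 2"
  by (simp add: dotn_def mulv_def S_def sum.distrib algebra_simps add_divide_distrib sum_divide_distrib sum_distrib_left)
 also have "... = dotn n (mulv n G z) (mulv n H z)"
  using dotn_mulv_mulv[of n G z H] dotn_mulv_mulv[of n H z G] symG symH dc by simp
 finally have 1: "dotn n z (mulv n S z) = dotn n (mulv n G z) (mulv n H z)" .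
 have "trn n S = (\<Sum>i<n. matmul n G H i i)" by (simp add: trn_def S_def tr)
 also have "... = fdot n G H" by (simp add: matmul_def fdot_def symH cong: sum.cong_simp)
 finally show "dotn n (mulv n G z) (mulv n H z) - fdot n G H = cqf n S z" by (simp add: cqf_def 1)
 show "fnorm n S <= K * fnorm n H" if K: "op_le n G K"
 proof -
  have "fnorm n S = fnorm n (%i j. 1/2 * (matmul n G H i j + matmul n H G i j))" by (simp add: S_def)
  also have "... <= 1/2 * (fnorm n (matmul n G H) + fnorm n (matmul n H G))"
   unfolding fnorm_scale using fnorm_triangle[of n "matmul n G H" "matmul n H G"] by simp
  also have "fnorm n (matmul n H G) = fnorm n (%i j. matmul n G H j i)" by (rule fnorm_cong) (rule tr)
  also have "... = fnorm n (matmul n G H)" by (rule fnorm_transpose)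
  also have "1/2 * (fnorm n (matmul n G H) + fnorm n (matmul n G H)) = fnorm n (matmul n G H)" by simp
  also have "... <= K * fnorm n H" by (rule fnorm_matmul_le[OF K])
  finally show ?thesis .
 qed
qed

text \<open>The whitened coordinates followed by a rotation diagonalise both matrices simultaneously.\<close>
lemma whitened_decomposition:
 assumes wh: "whitening n R0 c V W" and Q: "orthogonal_family n Q"
  and X: "diagonalizes n Q x (conj_by n V D)"
 defines "T \<equiv> mat_of n Q * mat_of n W"
 shows "mat_of n R0 = transpose_mat T * dmat n (%_. 1) * T" "mat_of n D = transpose_mat T * dmat n x * T"
proof -
 let ?V = "mat_of n V" and ?W = "mat_of n W" and ?Q = "mat_of n Q"
 note wh' = wh[unfolded whitening_def]
 note Q' = Q[unfolded orthogonal_family_mat]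
 have Tt: "transpose_mat T = transpose_mat ?W * transpose_mat ?Q"
  unfolding T_def by (rule transpose_mult) auto
 have "transpose_mat T * dmat n (%_. 1) * T = transpose_mat ?W * ((transpose_mat ?Q * ?Q) * ?W)"
  unfolding Tt dmat_one unfolding T_def by (simp add: square_mat_simps[of _ n] left_mult_one_mat[of _ n n])
 then show "mat_of n R0 = transpose_mat T * dmat n (%_. 1) * T" using Q' wh' by (simp add: left_mult_one_mat[of _ n n])
 have VWt: "transpose_mat ?W * transpose_mat ?V = 1\<^sub>m n"
  using transpose_mult[OF mat_of_carrier mat_of_carrier, of n V W] wh'[THEN conjunct1] by simp
 let ?D = "mat_of n D"
 have "transpose_mat T * dmat n x * T = transpose_mat ?W * ((transpose_mat ?Q * dmat n x * ?Q) * ?W)"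
  unfolding Tt unfolding T_def by (simp add: square_mat_simps[of _ n])
 also have "... = transpose_mat ?W * ((transpose_mat ?V * ?D * ?V) * ?W)"
  unfolding X[symmetric] mat_of_conj_by ..
 also have "... = (transpose_mat ?W * transpose_mat ?V) * (?D * (?V * ?W))"
  by (simp add: square_mat_simps[of _ n])
 also have "... = ?D" using wh' VWt by (simp add: left_mult_one_mat[of _ n n])
 finally show "mat_of n D = transpose_mat T * dmat n x * T" by simp
qed

lemma mat_of_trace: "mat_trace (mat_of n G) = trn n G" by (simp add: mat_trace_def trn_def)

text \<open>Expand \<open>fdot n D T\<close> in the common diagonal coordinates and apply the Cauchy-Schwarz inequality with weights \<open>s\<close>;
the second factor is controlled by the Frobenius norm of \<open>T G\<close>.\<close>
lemma weighted_eigenvalues_test: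
 assumes symT: "\<And>i j. i < n ==> j < n ==> T i j = T j i" and symG: "\<And>i j. i < n ==> j < n ==> G i j = G j i"
  and D: "mat_of n D = transpose_mat P * dmat n x * P" and G: "mat_of n G = transpose_mat P * dmat n s * P"
  and P: "P \<in> carrier_mat n n" and s: "\<And>k. k < n ==> 0 < s k" and T: "op_le n T K"
 shows "(fdot n D T)\<^sup>2 <= (\<Sum>k<n. (x k / s k)\<^sup>2) * (K * fnorm n G)\<^sup>2"
proof -
 define Y where "Y = P * mat_of n T * transpose_mat P"
 define y where "y k l = Y $$ (k, l)" for k l
 have Yc: "Y \<in> carrier_mat n n" using P by (simp add: Y_def square_mat_simps[of _ n])
 have Ym: "Y = mat_of n y" using mat_of_index[OF Yc] by (simp add: y_def)
 have tT: "transpose_mat (mat_of n T) = mat_of n T" unfolding mat_of_transpose by (rule mat_of_eqI) (simp add: symT)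
 have "transpose_mat Y = Y"
  unfolding Y_def using P tT by (simp add: transpose_mult[of _ n n _ n] square_mat_simps[of _ n])
 then have ysym: "y k l = y l k" if "k < n" "l < n" for k l
  using that Yc unfolding y_def by (metis carrier_matD index_transpose_mat(1))
 have tr_fdot: "mat_trace (mat_of n A * mat_of n B) = fdot n A B" if "\<And>i j. i < n ==> j < n ==> B i j = B j i" for A B
  unfolding mat_of_mult mat_of_trace trn_def fdot_def using that by (intro sum.cong refl) simp
 have d: "dmat n a * mat_of n y = mat_of n (%i j. a i * y i j)" for a
  unfolding mat_of_dmat mat_of_mult by (rule mat_of_eqI) (simp add: if_distrib[of "%t. t * _"] cong: if_cong)
 have 1: "fdot n D T = (\<Sum>k<n. x k * y k k)"
 proof -
  have "fdot n D T = mat_trace (mat_of n D * mat_of n T)" by (rule tr_fdot[symmetric]) (rule symT)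
  also have "... = mat_trace (transpose_mat P * (dmat n x * (P * mat_of n T)))" unfolding D using P by (simp add: square_mat_simps[of _ n])
  also have "... = mat_trace ((dmat n x * (P * mat_of n T)) * transpose_mat P)"
   using P by (intro mat_trace_mult_comm[of _ n]) (auto simp: square_mat_simps[of _ n])
  also have "... = mat_trace (dmat n x * Y)" unfolding Y_def using P by (simp add: square_mat_simps[of _ n])
  also have "... = (\<Sum>k<n. x k * y k k)" unfolding Ym d mat_of_trace by (simp add: trn_def)
  finally show ?thesis .
 qed
 have 2: "(\<Sum>k<n. \<Sum>l<n. s k * y k l * (s l * y l k)) <= (K * fnorm n G)\<^sup>2"
 proof -
  have "(\<Sum>k<n. \<Sum>l<n. s k * y k l * (s l * y l k)) = mat_trace ((dmat n s * Y) * (dmat n s * Y))"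
   unfolding Ym d mat_of_mult mat_of_trace by (simp add: trn_def)
  also have "(dmat n s * Y) * (dmat n s * Y) = (dmat n s * (P * (mat_of n T * (transpose_mat P * (dmat n s * (P * mat_of n T)))))) * transpose_mat P"
   unfolding Y_def using P by (simp add: square_mat_simps[of _ n])
  also have "mat_trace ... = mat_trace (transpose_mat P * (dmat n s * (P * (mat_of n T * (transpose_mat P * (dmat n s * (P * mat_of n T)))))))"
   using P by (intro mat_trace_mult_comm[of _ n]) (auto simp: square_mat_simps[of _ n])
  also have "... = mat_trace ((mat_of n G * mat_of n T) * (mat_of n G * mat_of n T))"
   unfolding G using P by (simp add: square_mat_simps[of _ n])
  also have "... = fdot n (matmul n G T) (%i j. matmul n G T j i)"
   unfolding mat_of_mult mat_of_trace by (simp add: trn_def fdot_def matmul_def)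
  also have "... <= fnorm n (matmul n G T) * fnorm n (%i j. matmul n G T j i)"
   using abs_fdot_le[of n "matmul n G T" "%i j. matmul n G T j i"] by linarith
  also have "... = (fnorm n (%i j. matmul n G T j i))\<^sup>2" unfolding fnorm_transpose[of n "matmul n G T"] by (simp add: power2_eq_square)
  also have "fnorm n (%i j. matmul n G T j i) = fnorm n (matmul n T G)"
  proof (rule fnorm_cong)
   fix i j assume ij: "i < n" "j < n"
   show "matmul n G T j i = matmul n T G i j" unfolding matmul_def
   proof (rule sum.cong[OF refl])
    fix k assume "k \<in> {..<n}"
    then have "k < n" by simp
    then show "G j k * T k i = T i k * G k j" using symG[of j k] symT[of k i] ij by simp
   qed
  qed
  also have "(fnorm n (matmul n T G))\<^sup>2 <= (K * fnorm n G)\<^sup>2" by (intro power_mono fnorm_matmul_le[OF T]) simp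
  finally show ?thesis .
 qed
 have "(fdot n D T)\<^sup>2 = (\<Sum>k<n. (x k / s k) * (s k * y k k))\<^sup>2"
 proof -
  have "x k * y k k = (x k / s k) * (s k * y k k)" if "k < n" for k using s[OF that] by simp
  then have "(\<Sum>k<n. x k * y k k) = (\<Sum>k<n. (x k / s k) * (s k * y k k))" by (intro sum.cong) auto
  then show ?thesis unfolding 1 by (simp only:)
 qed
 then have 3: "(fdot n D T)\<^sup>2 <= (\<Sum>k<n. (x k / s k)\<^sup>2) * (\<Sum>k<n. (s k * y k k)\<^sup>2)"
  using Cauchy_Schwarz_ineq_sum[of "%k. x k / s k" "%k. s k * y k k" "{..<n}"] by (simp only:)
 have "(\<Sum>k<n. (s k * y k k)\<^sup>2) <= (\<Sum>k<n. \<Sum>l<n. s k * y k l * (s l * y l k))"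
 proof (rule sum_mono)
  fix k assume k: "k \<in> {..<n}"
  have nn: "0 <= s k * y k l * (s l * y l k)" if l: "l < n" for l
  proof -
   have "y l k = y k l" using ysym[of l k] k l by simp
   then have e: "s k * y k l * (s l * y l k) = (s k * s l) * (y k l * y k l)" by simp
   have "0 <= s k * s l" using s[of k] s[of l] k l by simp
   then show ?thesis unfolding e by (rule mult_nonneg_nonneg) (rule zero_le_square)
  qed
  have "s k * y k k * (s k * y k k) <= (\<Sum>l<n. s k * y k l * (s l * y l k))"
   by (rule member_le_sum[OF k, where f = "%l. s k * y k l * (s l * y l k)"]) (use nn in auto)
  then show "(s k * y k k)\<^sup>2 <= (\<Sum>l<n. s k * y k l * (s l * y l k))" by (simp only: power2_eq_square)
 qed
 then have 4: "(\<Sum>k<n. (s k * y k k)\<^sup>2) <= (K * fnorm n G)\<^sup>2" using 2 by (rule order_trans)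
 have "(\<Sum>k<n. (x k / s k)\<^sup>2) * (\<Sum>k<n. (s k * y k k)\<^sup>2) <= (\<Sum>k<n. (x k / s k)\<^sup>2) * (K * fnorm n G)\<^sup>2"
  by (rule mult_left_mono[OF 4]) (simp add: sum_nonneg)
 with 3 show ?thesis by (rule order_trans)
qed

section \<open>Matrices indexed by a finite type\<close>

lemma symmetric_matrix_spectral:
 fixes M :: "real^'p^'p"
 assumes sym: "transpose M = M"
 shows "\<exists>(q :: nat => real^'p) x. (\<forall>k<CARD('p). \<forall>l<CARD('p). q k \<bullet> q l = (if k = l then 1 else 0)) \<and>
  (\<forall>v. v = (\<Sum>k<CARD('p). (q k \<bullet> v) *\<^sub>R q k)) \<and> (\<forall>v. M *v v = (\<Sum>k<CARD('p). (x k * (q k \<bullet> v)) *\<^sub>R q k))"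
proof -
 define n where "n = CARD('p)"
 obtain h where h: "bij_betw h {..<n} (UNIV :: 'p set)"
  using ex_bij_betw_nat_finite[of "UNIV :: 'p set"] by (auto simp: n_def atLeast0LessThan)
 have reidx: "(\<Sum>i\<in>UNIV. F i) = (\<Sum>k<n. F (h k))" for F :: "'p => 'b::comm_monoid_add"
  by (rule sum.reindex_bij_betw[OF h, symmetric])
 define G where "G i j = M $ h i $ h j" for i j
 have "G i j = G j i" for i j using arg_cong[OF sym, of "%A. A $ h j $ h i"] by (simp add: G_def transpose_def)
 then obtain Q x where Q: "orthogonal_family n Q" and X: "diagonalizes n Q x G"
  using spectral_decomposition[of n G] by blast
 define g where "g = the_inv_into {..<n} h"
 have g: "g (h k) = k" if "k < n" for k using h that by (simp add: g_def bij_betw_def the_inv_into_f_f)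
 have hg: "h (g i) = i" "g i < n" for i
  using h f_the_inv_into_f[of h "{..<n}" i] the_inv_into_into[of h "{..<n}" i "{..<n}"] by (auto simp: g_def bij_betw_def)
 define q :: "nat => real^'p" where "q k = (\<chi> i. Q k (g i))" for k
 have qh: "q k $ h j = Q k j" if "j < n" for k j using that by (simp add: q_def g)
 note Qd = Q[unfolded orthogonal_family_def]
 have ip: "q k \<bullet> v = (\<Sum>j<n. Q k j * v $ h j)" for k v
  unfolding inner_vec_def reidx by (intro sum.cong) (auto simp: qh)
 have comp: "v = w" if "\<And>i. i < n ==> v $ h i = w $ h i" for v w :: "real^'p"
  using that[OF hg(2)] by (simp add: Finite_Cartesian_Product.vec_eq_iff hg(1))
 show ?thesis
 proof (intro exI[of _ q] exI[of _ x] conjI allI impI)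
  fix k l assume "k < CARD('p)" "l < CARD('p)"
  then show "q k \<bullet> q l = (if k = l then 1 else 0)" using Qd by (simp add: ip qh n_def)
 next
  fix v
  show "v = (\<Sum>k<CARD('p). (q k \<bullet> v) *\<^sub>R q k)"
  proof (rule comp)
   fix i assume i: "i < n"
   have "(\<Sum>k<CARD('p). (q k \<bullet> v) *\<^sub>R q k) $ h i = (\<Sum>k<n. \<Sum>j<n. v $ h j * (Q k i * Q k j))"
    using i by (simp add: ip qh n_def[symmetric] sum_distrib_left ac_simps)
   also have "... = (\<Sum>j<n. v $ h j * (\<Sum>k<n. Q k i * Q k j))" by (subst sum.swap) (simp add: sum_distrib_left)
   also have "... = v $ h i" using Qd i by (simp add: if_distrib[of "(*) _"] cong: if_cong)
   finally show "v $ h i = (\<Sum>k<CARD('p). (q k \<bullet> v) *\<^sub>R q k) $ h i" by simp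
  qed
 next
  fix v
  show "M *v v = (\<Sum>k<CARD('p). (x k * (q k \<bullet> v)) *\<^sub>R q k)"
  proof (rule comp)
   fix i assume i: "i < n"
   have "(M *v v) $ h i = (\<Sum>j<n. G i j * v $ h j)" by (simp add: matrix_vector_mult_def reidx G_def)
   also have "... = (\<Sum>j<n. \<Sum>k<n. x k * (Q k j * v $ h j) * Q k i)"
    using spectral_decomposition_entries[OF X i] by (simp add: sum_distrib_left ac_simps)
   also have "... = (\<Sum>k<n. x k * (q k \<bullet> v) * Q k i)"
    unfolding ip by (subst sum.swap) (simp add: sum_distrib_left sum_distrib_right)
   also have "... = (\<Sum>k<CARD('p). (x k * (q k \<bullet> v)) *\<^sub>R q k) $ h i" using i by (simp add: qh n_def[symmetric])
   finally show "(M *v v) $ h i = (\<Sum>k<CARD('p). (x k * (q k \<bullet> v)) *\<^sub>R q k) $ h i" .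
  qed
 qed
qed

lemma transpose_inner: "u \<bullet> (M *v v) = (transpose M *v u) \<bullet> (v::real^'p)"
 by (simp add: dot_lmul_matrix transpose_matrix_vector)

lemma matrix_symmetric_iff:
 "transpose M = M \<longleftrightarrow> (\<forall>u v. u \<bullet> (M *v v) = (M *v u) \<bullet> (v::real^'p))"
proof
 assume "\<forall>u v. u \<bullet> (M *v v) = (M *v u) \<bullet> v"
 then have "(transpose M *v u) \<bullet> v = (M *v u) \<bullet> v" for u v by (simp add: transpose_inner)
 then have "transpose M *v u = M *v u" for u by (metis vector_eq_rdot)
 then show "transpose M = M" by (simp add: matrix_eq)
next
 assume "transpose M = M"
 then show "\<forall>u v. u \<bullet> (M *v v) = (M *v u) \<bullet> v" using transpose_inner[of _ M] by simp
qed

lemma eigenvalues_symmetric: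
 fixes M :: "real^'p^'p"
 assumes sym: "transpose M = M"
 shows "finite (eigenvalues M)" "eigenvalues M \<noteq> {}"
  and "\<And>l. l \<in> eigenvalues M ==> (\<And>v. a * (norm v)\<^sup>2 <= v \<bullet> (M *v v)) ==> a <= l"
  and "\<And>l. l \<in> eigenvalues M ==> (\<And>v. v \<bullet> (M *v v) <= a * (norm v)\<^sup>2) ==> l <= a"
proof -
 obtain q :: "nat => real^'p" and x where qx: "(\<forall>k<CARD('p). \<forall>l<CARD('p). q k \<bullet> q l = (if k = l then 1 else 0)) \<and>
  (\<forall>v. v = (\<Sum>k<CARD('p). (q k \<bullet> v) *\<^sub>R q k)) \<and> (\<forall>v. M *v v = (\<Sum>k<CARD('p). (x k * (q k \<bullet> v)) *\<^sub>R q k))"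
  using symmetric_matrix_spectral[OF sym] by (elim exE)
 have q: "\<And>k l. k < CARD('p) ==> l < CARD('p) ==> q k \<bullet> q l = (if k = l then 1 else 0)"
  "\<And>v. v = (\<Sum>k<CARD('p). (q k \<bullet> v) *\<^sub>R q k)" "\<And>v. M *v v = (\<Sum>k<CARD('p). (x k * (q k \<bullet> v)) *\<^sub>R q k)"
  using qx by blast+
 have ipM: "q k \<bullet> (M *v v) = x k * (q k \<bullet> v)" if "k < CARD('p)" for k v
  unfolding q(3) inner_sum_right using that by (simp add: q(1) if_distrib[of "(*) _"] cong: if_cong)
 have "eigenvalues M \<subseteq> x ` {..<CARD('p)}"
 proof
  fix l assume "l \<in> eigenvalues M"
  then obtain v where v: "v \<noteq> 0" "M *v v = l *\<^sub>R v" by (auto simp: eigenvalues_def)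
  have "\<exists>k<CARD('p). q k \<bullet> v \<noteq> 0"
  proof (rule ccontr)
   assume "\<not> (\<exists>k<CARD('p). q k \<bullet> v \<noteq> 0)"
   then have "(\<Sum>k<CARD('p). (q k \<bullet> v) *\<^sub>R q k) = 0" by (intro sum.neutral) auto
   with q(2)[of v] have "v = 0" by (rule trans)
   then show False using v(1) by simp
  qed
  then obtain k where k: "k < CARD('p)" "q k \<bullet> v \<noteq> 0" by auto
  have "x k * (q k \<bullet> v) = l * (q k \<bullet> v)" using ipM[OF k(1), of v] unfolding v(2) inner_scaleR_right by (rule HOL.sym)
  then have "l = x k" using k(2) by (metis mult_right_cancel)
  then show "l \<in> x ` {..<CARD('p)}" using k by auto
 qed
 then show "finite (eigenvalues M)" by (rule finite_subset) simp
 have "M *v q 0 = x 0 *\<^sub>R q 0"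
 proof -
  have "M *v q 0 = (\<Sum>k<CARD('p). if k = 0 then x 0 *\<^sub>R q 0 else 0)"
   unfolding q(3) by (intro sum.cong refl) (simp add: q(1))
  then show ?thesis by simp
 qed
 moreover have "q 0 \<noteq> 0" using q(1)[of 0 0] by auto
 ultimately have "x 0 \<in> eigenvalues M" by (auto simp: eigenvalues_def)
 then show "eigenvalues M \<noteq> {}" by auto
 fix l assume "l \<in> eigenvalues M"
 then obtain v where v: "v \<noteq> 0" "M *v v = l *\<^sub>R v" by (auto simp: eigenvalues_def)
 then have e: "v \<bullet> (M *v v) = l * (norm v)\<^sup>2" "0 < (norm v)\<^sup>2" by (simp_all add: dot_square_norm)
 show "a <= l" if "\<And>v. a * (norm v)\<^sup>2 <= v \<bullet> (M *v v)" using that[of v] e by simp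
 show "l <= a" if "\<And>v. v \<bullet> (M *v v) <= a * (norm v)\<^sup>2" using that[of v] e by simp
qed

lemma matrix_eq_iff_mv: "(\<And>v. A *v v = B *v v) ==> A = (B :: real^'p^'p)"
 by (simp add: matrix_eq)

text \<open>A symmetric square root without negative eigenvalues acts on an eigenvector of \<open>M\<close> as the square root of the
eigenvalue: it has no eigenvector for the opposite root.  Hence it is unique.\<close>
lemma psd_sqrt_pos_def:
 fixes M :: "real^'p^'p"
 assumes sym: "transpose M = M" and pd: "\<And>v. v \<noteq> 0 ==> 0 < v \<bullet> (M *v v)"
 shows "transpose (psd_sqrt M) = psd_sqrt M" "psd_sqrt M ** psd_sqrt M = M"
proof -
 obtain q :: "nat => real^'p" and x where qx: "(\<forall>k<CARD('p). \<forall>l<CARD('p). q k \<bullet> q l = (if k = l then 1 else 0)) \<and>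
  (\<forall>v. v = (\<Sum>k<CARD('p). (q k \<bullet> v) *\<^sub>R q k)) \<and> (\<forall>v. M *v v = (\<Sum>k<CARD('p). (x k * (q k \<bullet> v)) *\<^sub>R q k))"
  using symmetric_matrix_spectral[OF sym] by (elim exE)
 have q: "\<And>k l. k < CARD('p) ==> l < CARD('p) ==> q k \<bullet> q l = (if k = l then 1 else 0)"
  "\<And>v. v = (\<Sum>k<CARD('p). (q k \<bullet> v) *\<^sub>R q k)" "\<And>v. M *v v = (\<Sum>k<CARD('p). (x k * (q k \<bullet> v)) *\<^sub>R q k)"
  using qx by blast+
 have Mq: "M *v q k = x k *\<^sub>R q k" if k: "k < CARD('p)" for k
 proof -
  have "M *v q k = (\<Sum>l<CARD('p). if l = k then x k *\<^sub>R q k else 0)"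
   unfolding q(3) using k by (intro sum.cong refl) (simp add: q(1))
  then show ?thesis using k by simp
 qed
 have qn: "q k \<noteq> 0" if "k < CARD('p)" for k using q(1)[OF that that] by auto
 have x0: "0 < x k" if k: "k < CARD('p)" for k
  using pd[OF qn[OF k]] q(1)[OF k k] by (simp add: Mq[OF k])
 define B :: "real^'p^'p" where "B = matrix (%v. \<Sum>k<CARD('p). (sqrt (x k) * (q k \<bullet> v)) *\<^sub>R q k)"
 have lin: "linear (%v. \<Sum>k<CARD('p). (sqrt (x k) * (q k \<bullet> v)) *\<^sub>R q k)"
  by (rule linearI) (simp_all add: inner_right_distrib distrib_left scaleR_add_left sum.distrib scaleR_right.sum mult.left_commute)
 have B: "B *v v = (\<Sum>k<CARD('p). (sqrt (x k) * (q k \<bullet> v)) *\<^sub>R q k)" for v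
  unfolding B_def by (rule fun_cong[OF matrix_vector_mul(2)[OF lin], of v])
 have ipB: "q k \<bullet> (B *v v) = sqrt (x k) * (q k \<bullet> v)" if "k < CARD('p)" for k v
  unfolding B inner_sum_right using that by (simp add: q(1) if_distrib[of "(*) _"] cong: if_cong)
 have "transpose B = B"
 proof -
  have "u \<bullet> (B *v v) = v \<bullet> (B *v u)" for u v
   unfolding B inner_sum_right by (intro sum.cong refl) (simp add: inner_commute)
  then show ?thesis unfolding matrix_symmetric_iff by (simp add: inner_commute)
 qed
 moreover have "0 <= v \<bullet> (B *v v)" for v
  unfolding B inner_sum_right using x0 by (intro sum_nonneg) (use x0 in \<open>simp add: inner_commute mult.assoc less_imp_le\<close>)
 moreover have BB: "B ** B = M"
 proof (rule matrix_eq_iff_mv)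
  fix v
  have "(B ** B) *v v = B *v (B *v v)" by (simp add: matrix_vector_mul_assoc)
  also have "... = M *v v" unfolding B[of "B *v v"] q(3)
   by (intro sum.cong refl) (use x0 in \<open>auto simp: ipB less_imp_le mult.assoc[symmetric]\<close>)
  finally show "(B ** B) *v v = M *v v" .
 qed
 moreover have "B' = B" if B': "transpose B' = B'" "\<forall>v. 0 <= v \<bullet> (B' *v v)" "B' ** B' = M" for B'
 proof (rule matrix_eq_iff_mv)
  have e: "B' *v q k = sqrt (x k) *\<^sub>R q k" if k: "k < CARD('p)" for k
  proof -
   define w where "w = B' *v q k - sqrt (x k) *\<^sub>R q k"
   have "B' *v (B' *v q k) = x k *\<^sub>R q k" using Mq[OF k] B'(3) by (simp add: matrix_vector_mul_assoc)
   then have "B' *v w = - sqrt (x k) *\<^sub>R w"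
    using x0[OF k] by (simp add: w_def matrix_vector_mult_diff_distrib matrix_vector_mult_scaleR scaleR_right_diff_distrib less_imp_le)
   then have "0 <= - sqrt (x k) * (w \<bullet> w)" using B'(2)[rule_format, of w] by simp
   then have "w \<bullet> w <= 0" using x0[OF k] by (simp add: mult_le_0_iff)
   then have "w = 0" by (metis inner_gt_zero_iff not_le)
   then show ?thesis by (simp add: w_def)
  qed
  fix v
  have "B' *v v = B' *v (\<Sum>k<CARD('p). (q k \<bullet> v) *\<^sub>R q k)" by (rule arg_cong[OF q(2)])
  also have "... = (\<Sum>k<CARD('p). (q k \<bullet> v) *\<^sub>R (B' *v q k))"
   by (simp add: linear_sum[OF matrix_vector_mul_linear] matrix_vector_mult_scaleR)
  also have "... = B *v v" unfolding B by (intro sum.cong refl) (simp add: e mult.commute)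
  finally show "B' *v v = B *v v" .
 qed
 ultimately have p: "transpose B = B \<and> (\<forall>v. 0 <= v \<bullet> (B *v v)) \<and> B ** B = M"
  "\<And>B'. transpose B' = B' \<and> (\<forall>v. 0 <= v \<bullet> (B' *v v)) \<and> B' ** B' = M ==> B' = B" by blast+
 have "psd_sqrt M = B" unfolding psd_sqrt_def by (rule the_equality) (rule p(1), rule p(2))
 then show "transpose (psd_sqrt M) = psd_sqrt M" "psd_sqrt M ** psd_sqrt M = M"
  using p(1) by simp_all
qed

section \<open>Comparison of Gaussian criteria\<close>

text \<open>\<open>1 + x\<close> are the eigenvalues of the positive definite matrix \<open>R1\<close> relative to \<open>R0\<close>.\<close>
lemma relative_eigenvalue_pos:
 assumes wh: "whitening n R0 c V W" and wh1: "whitening n R1 c' V' W'" and Q: "orthogonal_family n Q"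
  and X: "diagonalizes n Q x (conj_by n V (%i j. R1 i j - R0 i j))"
  and k: "k < n"
 shows "0 < 1 + x k"
proof -
 let ?V = "mat_of n V" and ?W = "mat_of n W" and ?Q = "mat_of n Q" and ?V' = "mat_of n V'" and ?W' = "mat_of n W'"
 define T where "T = ?Q * ?W"
 define U where "U = ?V * transpose_mat ?Q"
 note wh' = wh[unfolded whitening_def] and wh1' = wh1[unfolded whitening_def]
 note Q' = Q[unfolded orthogonal_family_mat]
 have T: "T \<in> carrier_mat n n" and U: "U \<in> carrier_mat n n" by (simp_all add: T_def U_def square_mat_simps[of _ n])
 have "T * U = ?Q * ((?W * ?V) * transpose_mat ?Q)" unfolding U_def T_def by (simp add: square_mat_simps[of _ n])
 then have TU: "T * U = 1\<^sub>m n" using Q' wh' by (simp add: left_mult_one_mat[of _ n n])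
 have UTt: "transpose_mat U * transpose_mat T = 1\<^sub>m n" using transpose_mult[OF T U] TU by simp
 note dec = whitened_decomposition[OF wh Q X, folded T_def]
 have R1: "mat_of n R1 = transpose_mat T * dmat n (%k. 1 + x k) * T"
 proof -
  have "dmat n (%k. 1 + x k) = dmat n (%_. 1) + dmat n x" by (rule eq_matI) (auto simp: dmat_def)
  then have "transpose_mat T * dmat n (%k. 1 + x k) * T
   = transpose_mat T * dmat n (%_. 1) * T + transpose_mat T * dmat n x * T"
   using T by (simp add: mult_add_distrib_mat[of _ n n _ n] add_mult_distrib_mat[of _ n n _ _ n] square_mat_simps[of _ n])
  also have "... = mat_of n R0 + mat_of n (%i j. R1 i j - R0 i j)" by (simp only: dec)
  also have "... = mat_of n R1" by (rule eq_matI) auto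
  finally show ?thesis by simp
 qed
 define Z where "Z = ?W' * U"
 have Z: "Z \<in> carrier_mat n n" using U by (simp add: Z_def square_mat_simps[of _ n])
 have "transpose_mat Z * Z = transpose_mat U * (mat_of n R1 * U)"
  unfolding Z_def wh1'[THEN conjunct2, THEN conjunct2, THEN conjunct1] using U
  by (simp add: transpose_mult[of _ n n _ n] square_mat_simps[of _ n])
 also have "... = (transpose_mat U * transpose_mat T) * (dmat n (%k. 1 + x k) * (T * U))"
  unfolding R1 using T U by (simp add: square_mat_simps[of _ n])
 also have "... = dmat n (%k. 1 + x k)" unfolding UTt TU by (simp add: left_mult_one_mat[OF dmat_carrier] right_mult_one_mat[OF dmat_carrier])
 finally have ZZ: "transpose_mat Z * Z = dmat n (%k. 1 + x k)" .
 have sq: "1 + x k = (\<Sum>j<n. (Z $$ (j, k))\<^sup>2)"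
  using arg_cong[OF ZZ, of "%M. M $$ (k, k)"] k Z
  by (simp add: dmat_def scalar_prod_def atLeast0LessThan power2_eq_square)
 have "T * (?V' * Z) = 1\<^sub>m n"
 proof -
  have "T * (?V' * Z) = T * ((?V' * ?W') * U)" unfolding Z_def using T U by (simp add: square_mat_simps[of _ n])
  then show ?thesis unfolding wh1'[THEN conjunct1] using U TU by (simp add: left_mult_one_mat[of _ n n])
 qed
 then have inv: "(T * ?V') * Z = 1\<^sub>m n" using T Z by (simp add: square_mat_simps[of _ n])
 have "1 + x k \<noteq> 0"
 proof
  assume "1 + x k = 0"
  then have z0: "Z $$ (j, k) = 0" if "j < n" for j using sq that by (simp add: sum_nonneg_eq_0_iff)
  have "((T * ?V') * Z) $$ (k, k) = (\<Sum>j<n. (T * ?V') $$ (k, j) * Z $$ (j, k))"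
   using k T Z by (simp add: scalar_prod_def[of "row _ _"] atLeast0LessThan)
  also have "... = 0" using z0 by simp
  finally show False using inv k by simp
 qed
 moreover have "0 <= 1 + x k" unfolding sq by (simp add: sum_nonneg)
 ultimately show ?thesis by simp
qed

text \<open>The criterion without the factor \<open>1 / n\<close>.\<close>
definition gauss_crit :: "nat => (nat => nat => real) => (nat => real) => real" where
 "gauss_crit n R y = ln (Determinant.det (mat_of n R)) + Matrix.scalar_prod (Matrix.vec n y) (mult_mat_vec (mat_inv (mat_of n R)) (Matrix.vec n y))"

lemma gauss_crit_difference:
 assumes "whitening n R0 c V W" "whitening n R1 c' V' W'" "orthogonal_family n Q"
  and "diagonalizes n Q x (conj_by n V (%i j. R1 i j - R0 i j))"
 shows "gauss_crit n R1 y - gauss_crit n R0 y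
  = (\<Sum>k<n. ln (1 + x k) + (mulv n Q (%l. \<Sum>i<n. V i l * y i) k)\<^sup>2 * (1 / (1 + x k) - 1))"
 unfolding gauss_crit_def
 by (rule gaussian_criterion_difference[OF assms(1,3,4) relative_eigenvalue_pos[OF assms]]) (simp_all add: mulv_def)

lemma gauss_crit_Lipschitz:
 assumes wh: "whitening n R0 c V W" "0 < c" and wh1: "whitening n R1 c' V' W'"
  and sym: "\<And>i j. i < n ==> j < n ==> R1 i j - R0 i j = R1 j i - R0 j i"
  and op: "op_le n (%i j. R1 i j - R0 i j) K" and K: "K / c <= 1/2"
 shows "\<bar>gauss_crit n R1 y - gauss_crit n R0 y\<bar> <= 2 * (K / c) * (real n + (vnorm n y)\<^sup>2 / c)"
proof -
 let ?X = "conj_by n V (%i j. R1 i j - R0 i j)"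
 obtain Q x where Q: "orthogonal_family n Q" and X: "mat_of n ?X = transpose_mat (mat_of n Q) * dmat n x * mat_of n Q"
  using spectral_decomposition[of n ?X] conj_by_sym[of n "%i j. R1 i j - R0 i j"] sym by blast
 define z where "z = (%l. \<Sum>i<n. V i l * y i)"
 define w where "w = mulv n Q z"
 have xk: "\<bar>x k\<bar> <= K / c" if "k < n" for k
  by (rule spectral_coordinates(5)[OF Q X op_le_conj_by[OF wh op] that])
 have K0: "0 <= K / c" using op_le_nonneg[OF op] wh(2) by simp
 have "\<bar>gauss_crit n R1 y - gauss_crit n R0 y\<bar> <= (\<Sum>k<n. 2 * (K / c) + (w k)\<^sup>2 * (2 * (K / c)))"
  unfolding gauss_crit_difference[OF wh(1) wh1 Q X] z_def[symmetric] w_def[symmetric]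
 proof (rule order_trans[OF sum_abs], rule sum_mono, rule order_trans[OF abs_triangle_ineq], rule add_mono)
  fix k assume "k \<in> {..<n}"
  then have x1: "\<bar>x k\<bar> <= K / c" using xk[of k] by simp
  have x: "\<bar>x k\<bar> <= K / c" "\<bar>x k\<bar> <= 1/2" by (rule x1) (rule order_trans[OF x1 K])
  have "\<bar>ln (1 + x k) - x k\<bar> <= 2 * (x k)\<^sup>2" by (rule abs_ln_one_plus_x_minus_x_bound) (use x in simp)
  moreover have "2 * (x k)\<^sup>2 <= \<bar>x k\<bar>"
   using mult_left_mono[OF x(2), of "\<bar>x k\<bar>"] by (simp add: power2_eq_square)
  ultimately show "\<bar>ln (1 + x k)\<bar> <= 2 * (K / c)" using x(1) by linarith
  have p: "1 + x k \<ge> 1/2" using x by linarith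
  have "1 / (1 + x k) - 1 = - x k / (1 + x k)" using p by (simp add: field_simps)
  then have "\<bar>1 / (1 + x k) - 1\<bar> = \<bar>x k\<bar> / (1 + x k)" using p by simp
  also have "... <= \<bar>x k\<bar> / (1/2)" using p by (intro divide_left_mono) auto
  also have "... <= 2 * (K / c)" using x by simp
  finally show "\<bar>(w k)\<^sup>2 * (1 / (1 + x k) - 1)\<bar> <= (w k)\<^sup>2 * (2 * (K / c))"
   unfolding abs_mult by (intro mult_mono) auto
 qed
 also have "... = 2 * (K / c) * (real n + (\<Sum>k<n. (w k)\<^sup>2))"
  by (simp only: sum.distrib sum_distrib_right[symmetric]) (simp add: algebra_simps)
 also have "... <= 2 * (K / c) * (real n + (vnorm n y)\<^sup>2 / c)"
 proof (intro mult_left_mono add_left_mono)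
  have "(\<Sum>k<n. (w k)\<^sup>2) = (\<Sum>l<n. (z l)\<^sup>2)"
   unfolding w_def mulv_def by (rule orthogonal_family_sum_squares(1)[OF Q])
  also have "... <= (\<Sum>i<n. (y i)\<^sup>2) / c" using wh(1) unfolding whitening_def z_def by blast
  finally show "(\<Sum>k<n. (w k)\<^sup>2) <= (vnorm n y)\<^sup>2 / c" by (simp only: vnorm_sq)
 qed (use K0 in simp)
 finally show ?thesis .
qed

lemma fnorm_envelope:
 assumes row: "\<And>i. i < n ==> (\<Sum>j<n. (a i j)\<^sup>2) <= S" and env: "\<And>i j. i < n ==> j < n ==> \<bar>G i j\<bar> <= k * a i j" and k: "0 <= k" "0 <= S"
 shows "fnorm n G <= k * sqrt S * sqrt (real n)"
proof -
 have "(fnorm n G)\<^sup>2 <= (\<Sum>i<n. \<Sum>j<n. (k * a i j)\<^sup>2)"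
  unfolding fnorm_sq using env by (intro sum_mono) (metis abs_ge_zero lessThan_iff power2_abs power_mono)
 also have "... = (\<Sum>i<n. k\<^sup>2 * (\<Sum>j<n. (a i j)\<^sup>2))" by (simp add: power_mult_distrib sum_distrib_left)
 also have "... <= (\<Sum>i<n. k\<^sup>2 * S)" using row by (intro sum_mono mult_left_mono) auto
 also have "... = (k * sqrt S * sqrt (real n))\<^sup>2" using k by (simp add: power_mult_distrib)
 finally show ?thesis by (rule power2_le_imp_le) (use k in simp)
qed

text \<open>The entries of \<open>D\<close> outside the truncation carry at most half of its squared Frobenius norm, so \<open>fdot n D T\<close> for the truncation
\<open>T\<close> of \<open>D\<close> is at least the other half, while the operator norm of \<open>T\<close> is bounded.\<close>
lemma truncated_test_bound:
 assumes symD: "\<And>i j. i < n ==> j < n ==> D i j = D j i" and symG: "\<And>i j. i < n ==> j < n ==> G i j = G j i"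
  and D: "mat_of n D = transpose_mat P * dmat n x * P" and G: "mat_of n G = transpose_mat P * dmat n s * P"
  and P: "P \<in> carrier_mat n n" and s: "\<And>k. k < n ==> 0 < s k"
  and env: "\<And>i j. i < n ==> j < n ==> \<bar>D i j\<bar> <= k * a i j" and k: "0 < k"
  and N: "\<And>i j. N i j \<longleftrightarrow> N j i"
   "\<And>i. i < n ==> (\<Sum>j<n. if N i j then a i j else 0) <= B"
   "\<And>i. i < n ==> (\<Sum>j<n. if N i j then 0 else (a i j)\<^sup>2) <= \<epsilon>"
  and B: "0 < B" and low: "2 * k\<^sup>2 * \<epsilon> * real n <= (fnorm n D)\<^sup>2"
  and up: "(fnorm n G)\<^sup>2 <= C * real n" "0 < C" and n: "0 < n"
 shows "((fnorm n D)\<^sup>2)\<^sup>2 / (4 * k\<^sup>2 * B\<^sup>2 * C * real n) <= (\<Sum>k<n. (x k / s k)\<^sup>2)"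
proof -
 define T where "T i j = (if N i j then D i j else 0)" for i j
 have symT: "T i j = T j i" if "i < n" "j < n" for i j using symD[OF that] N(1)[of i j] by (auto simp: T_def)
 have op: "op_le n T (k * B)"
 proof (rule Schur_row_sum[OF symT])
  fix i assume i: "i < n"
  have "(\<Sum>j<n. \<bar>T i j\<bar>) <= (\<Sum>j<n. k * (if N i j then a i j else 0))"
   using env[OF i] by (intro sum_mono) (auto simp: T_def)
  also have "... <= k * B" unfolding sum_distrib_left[symmetric] using N(2)[OF i] k by (intro mult_left_mono) auto
  finally show "(\<Sum>j<n. \<bar>T i j\<bar>) <= k * B" .
 qed (use k B in auto)
 have "(fnorm n D)\<^sup>2 - fdot n D T = (\<Sum>i<n. \<Sum>j<n. (D i j)\<^sup>2 - D i j * T i j)"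
  unfolding fnorm_sq fdot_def by (simp add: sum_subtractf)
 also have "... <= (\<Sum>i<n. \<Sum>j<n. k\<^sup>2 * (if N i j then 0 else (a i j)\<^sup>2))"
 proof (intro sum_mono)
  fix i j assume "i \<in> {..<n}" "j \<in> {..<n}"
  then have "\<bar>D i j\<bar> <= k * a i j" using env by simp
  then have "\<bar>D i j\<bar>\<^sup>2 <= (k * a i j)\<^sup>2" by (intro power_mono) auto
  then show "(D i j)\<^sup>2 - D i j * T i j <= k\<^sup>2 * (if N i j then 0 else (a i j)\<^sup>2)"
   by (simp add: T_def power2_eq_square[of "D i j", symmetric] power_mult_distrib)
 qed
 also have "... <= (\<Sum>i<n. k\<^sup>2 * \<epsilon>)"
  unfolding sum_distrib_left[symmetric] using N(3) by (intro mult_left_mono sum_mono) auto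
 finally have "(fnorm n D)\<^sup>2 - fdot n D T <= k\<^sup>2 * \<epsilon> * real n" by (simp add: ac_simps)
 then have half: "(fnorm n D)\<^sup>2 / 2 <= fdot n D T" using low by (simp add: field_simps)
 have "((fnorm n D)\<^sup>2)\<^sup>2 / 4 = ((fnorm n D)\<^sup>2 / 2)\<^sup>2" by (simp add: power_divide)
 also have "... <= (fdot n D T)\<^sup>2" using half by (intro power_mono) auto
 also have "... <= (\<Sum>k<n. (x k / s k)\<^sup>2) * (k * B * fnorm n G)\<^sup>2"
  by (rule weighted_eigenvalues_test[OF symT symG D G P s op])
 also have "... <= (\<Sum>k<n. (x k / s k)\<^sup>2) * (k\<^sup>2 * B\<^sup>2 * (C * real n))"
  unfolding power_mult_distrib using up by (intro mult_left_mono) (auto intro: sum_nonneg)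
 finally have "((fnorm n D)\<^sup>2)\<^sup>2 / 4 <= (\<Sum>k<n. (x k / s k)\<^sup>2) * (k\<^sup>2 * B\<^sup>2 * (C * real n))" .
 moreover have "0 < k\<^sup>2 * B\<^sup>2 * (C * real n)" using k B up n by simp
 ultimately have "((fnorm n D)\<^sup>2)\<^sup>2 / 4 / (k\<^sup>2 * B\<^sup>2 * (C * real n)) <= (\<Sum>k<n. (x k / s k)\<^sup>2)"
  by (simp add: pos_divide_le_eq)
 then show ?thesis by (simp add: ac_simps)
qed

text \<open>One point of \<open>A\<close> is chosen in every cell of a grid that meets \<open>A\<close>.\<close>
lemma finite_net:
 fixes A :: "(real^'p) set"
 assumes A: "\<And>v. v \<in> A ==> norm v <= B" and h: "0 < h" "h <= 1" and B: "0 <= B"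
 shows "\<exists>G. G \<subseteq> A \<and> finite G \<and> real (card G) <= ((2 * B + 3) / h) ^ CARD('p) \<and> (\<forall>v\<in>A. \<exists>g\<in>G. norm (v - g) <= real CARD('p) * h)"
proof -
 define cell where "cell v = (%m. \<lfloor>v $ m / h\<rfloor>)" for v :: "real^'p"
 define I where "I = {\<lfloor>- B / h\<rfloor>..\<lfloor>B / h\<rfloor>}"
 define Z where "Z = PiE (UNIV :: 'p set) (%_. I)"
 have fZ: "finite Z" unfolding Z_def I_def by (intro finite_PiE) auto
 have cZ: "real (card Z) <= ((2 * B + 3) / h) ^ CARD('p)"
 proof -
  have "real (card I) <= 2 * (B / h) + 2"
  proof -
   have "\<lfloor>- B / h\<rfloor> <= \<lfloor>B / h\<rfloor>" using B h by (intro floor_mono divide_right_mono) auto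
   then have "real (card I) = real_of_int \<lfloor>B / h\<rfloor> - real_of_int \<lfloor>- B / h\<rfloor> + 1" by (simp add: I_def)
   also have "... <= B / h - (- B / h - 1) + 1" using floor_correct[of "- B / h"] of_int_floor_le[of "B / h"] by linarith
   finally show ?thesis by simp
  qed
  also have "... <= (2 * B + 3) / h" using h by (simp add: add_divide_distrib) (simp add: pos_le_divide_eq)
  finally have "real (card I) <= (2 * B + 3) / h" .
  then have "real (card I) ^ CARD('p) <= ((2 * B + 3) / h) ^ CARD('p)" by (intro power_mono) auto
  then show ?thesis by (simp add: Z_def card_PiE)
 qed
 have img: "cell ` A \<subseteq> Z"
 proof
  fix c assume "c \<in> cell ` A"
  then obtain v where v: "v \<in> A" "c = cell v" by auto
  have vb: "\<bar>v $ m\<bar> <= B" for m using component_le_norm_cart[of v m] A[OF v(1)] by linarith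
  have "- B / h <= v $ m / h \<and> v $ m / h <= B / h" for m
  proof (intro conjI divide_right_mono)
   show "- B <= v $ m" "v $ m <= B" using vb[of m] by linarith+
  qed (use h in simp_all)
  then show "c \<in> Z" by (auto simp: Z_def I_def v(2) cell_def floor_mono)
 qed
 define rep where "rep c = (SOME v. v \<in> A \<and> cell v = c)" for c
 have rep: "rep (cell v) \<in> A" "cell (rep (cell v)) = cell v" if "v \<in> A" for v
  using someI[of "%u. u \<in> A \<and> cell u = cell v" v] that by (auto simp: rep_def)
 show ?thesis
 proof (intro exI[of _ "rep ` cell ` A"] conjI ballI)
  show "rep ` cell ` A \<subseteq> A" using rep by auto
  have f: "finite (cell ` A)" using img fZ finite_subset by blast
  then show "finite (rep ` cell ` A)" by simp
  have "card (rep ` cell ` A) <= card Z" using card_image_le[OF f, of rep] card_mono[OF fZ img] by linarith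
  then show "real (card (rep ` cell ` A)) <= ((2 * B + 3) / h) ^ CARD('p)" using cZ by linarith
  fix v assume v: "v \<in> A"
  define g where "g = rep (cell v)"
  have "\<bar>(v - g) $ m\<bar> <= h" for m
  proof -
   have "\<lfloor>v $ m / h\<rfloor> = \<lfloor>g $ m / h\<rfloor>" using fun_cong[OF rep(2)[OF v], of m] by (simp add: cell_def g_def)
   then have "\<bar>v $ m / h - g $ m / h\<bar> <= 1" by linarith
   then show ?thesis using h by (simp add: diff_divide_distrib[symmetric] pos_divide_le_eq)
  qed
  then have "(\<Sum>m\<in>UNIV. \<bar>(v - g) $ m\<bar>) <= (\<Sum>m\<in>(UNIV::'p set). h)" by (intro sum_mono)
  then have "norm (v - g) <= real CARD('p) * h" using norm_le_l1_cart[of "v - g"] by simp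
  then show "\<exists>g\<in>rep ` cell ` A. norm (v - g) <= real CARD('p) * h" using v by (auto simp: g_def)
 qed
qed

section \<open>Gaussian arrays with a square-summable envelope\<close>

text \<open>The envelope splits into a part with bounded row sums and a part with small row sums of squares, on symmetric index sets.\<close>
abbreviation truncates :: "nat => (nat => nat => real) => real => real => bool" where
 "truncates n a B \<epsilon> \<equiv> \<exists>N. (\<forall>i j. N i j \<longleftrightarrow> N j i) \<and>
  (\<forall>i<n. (\<Sum>j<n. if N i j then a i j else 0) <= B) \<and> (\<forall>i<n. (\<Sum>j<n. if N i j then 0 else (a i j)\<^sup>2) <= \<epsilon>)"

text \<open>Abstracts from the kernel: \<open>R\<close> are covariance matrices with envelope \<open>a\<close>, \<open>D1\<close> and \<open>D2\<close> their first two derivatives at \<open>\<theta>0\<close>,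
\<open>\<rho>\<close> the growth of the row sums of the envelope, and \<open>b\<close> a scale that grows more slowly than any of the margins but faster
than the logarithm.\<close>
locale gaussian_array = prob_space P for P :: "'w measure" +
 fixes R :: "nat => real^'p => nat => nat => real" and a :: "nat => nat => nat => real"
  and D1 :: "nat => 'p => nat => nat => real" and D2 :: "nat => 'p => 'p => nat => nat => real"
  and y :: "nat => nat => 'w => real" and \<Theta> :: "(real^'p) set" and \<theta>0 :: "real^'p"
  and \<kappa> S c \<delta> r\<^sub>0 :: real and \<rho> b :: "nat => real"
 assumes R_sym: "\<And>n \<theta> i j. \<theta> \<in> \<Theta> ==> R n \<theta> i j = R n \<theta> j i"
  and D1_sym: "\<And>n m i j. D1 n m i j = D1 n m j i"
  and D2_sym: "\<And>n m l i j. D2 n m l i j = D2 n m l j i"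
  and a_nonneg: "\<And>n i j. 0 <= a n i j"
  and row_square: "\<And>n i. 1 <= n ==> i < n ==> (\<Sum>j<n. (a n i j)\<^sup>2) <= S"
  and row_sum: "\<forall>\<^sub>F n in sequentially. \<forall>i<n. (\<Sum>j<n. a n i j) <= \<rho> n"
  and truncation: "\<And>\<epsilon>. 0 < \<epsilon> ==> \<exists>B>0. \<forall>n\<ge>1. truncates n (a n) B \<epsilon>"
  and \<rho>_ge_1: "\<And>n. 1 <= \<rho> n"
  and b_ge_1: "\<And>n. 1 <= n ==> 1 <= b n" and b_top: "filterlim b at_top sequentially"
  and b_pow: "\<forall>\<^sub>F n in sequentially. b n ^ 10 <= sqrt (real n)"
  and \<rho>_pow: "\<forall>\<^sub>F n in sequentially. \<rho> n * b n ^ 10 <= sqrt (real n)"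
  and b_exp: "\<And>q C. 0 < C ==> (%n. real n ^ q * exp (- C * b n ^ 4)) \<longlonglongrightarrow> 0"
  and \<Theta>_bounded: "bounded \<Theta>" and \<Theta>_ball: "0 < r\<^sub>0" "ball \<theta>0 r\<^sub>0 \<subseteq> \<Theta>"
  and \<kappa>: "1 <= \<kappa>" and S: "0 <= S" and c: "0 < c" and \<delta>: "0 < \<delta>"
  and envelope: "\<And>n \<theta> i j. \<theta> \<in> \<Theta> ==> i < n ==> j < n ==> \<bar>R n \<theta> i j\<bar> <= \<kappa> * a n i j"
  and lipschitz: "\<And>n \<theta> \<theta>' i j. \<theta> \<in> \<Theta> ==> \<theta>' \<in> \<Theta> ==> i < n ==> j < n ==>
    \<bar>R n \<theta> i j - R n \<theta>' i j\<bar> <= \<kappa> * norm (\<theta> - \<theta>') * a n i j"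
  and D1_bound: "\<And>n m i j. i < n ==> j < n ==> \<bar>D1 n m i j\<bar> <= \<kappa> * a n i j"
  and D2_bound: "\<And>n m l i j. i < n ==> j < n ==> \<bar>D2 n m l i j\<bar> <= \<kappa> * a n i j"
  and taylor: "\<And>n t i j. norm t < r\<^sub>0 ==> i < n ==> j < n ==>
    \<bar>R n (\<theta>0 + t) i j - (R n \<theta>0 i j + (\<Sum>m\<in>UNIV. t $ m * D1 n m i j)
     + (\<Sum>m\<in>UNIV. t $ m * (\<Sum>l\<in>UNIV. t $ l * D2 n m l i j)) / 2)\<bar> <= \<kappa> * norm t ^ 3 * a n i j"
  and eigen: "\<And>n \<theta>. 1 <= n ==> \<theta> \<in> \<Theta> ==> c <= Min (spectrum (mat_of n (R n \<theta>)))"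
  and identif: "\<forall>\<^sub>F n in sequentially. \<forall>\<theta>\<in>\<Theta>. \<delta> * real n * (norm (\<theta> - \<theta>0))\<^sup>2 <= (fnorm n (%i j. R n \<theta> i j - R n \<theta>0 i j))\<^sup>2"
  and identif_loc: "\<forall>\<^sub>F n in sequentially. \<forall>v. \<delta> * real n * (norm v)\<^sup>2 <= (fnorm n (%i j. \<Sum>m\<in>UNIV. v $ m * D1 n m i j))\<^sup>2"
  and y_meas: "\<And>n i. y n i \<in> borel_measurable P" "\<And>n i. integrable P (%\<xi>. (y n i \<xi>)\<^sup>2)"
    "\<And>n i. expectation (%\<xi>. (y n i \<xi>)\<^sup>2) = R n \<theta>0 i i"
  and y_gauss: "\<And>n V W. 1 <= n ==> whitening n (R n \<theta>0) c V W ==> std_normal_family P n (%k \<xi>. \<Sum>i<n. V i k * y n i \<xi>)"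
begin

lemma \<rho>_nonneg: "0 <= \<rho> n" using \<rho>_ge_1[of n] by simp

lemma \<theta>0_in: "\<theta>0 \<in> \<Theta>" using \<Theta>_ball by auto

lemma near_in: "norm t < r\<^sub>0 ==> \<theta>0 + t \<in> \<Theta>" using \<Theta>_ball by (auto simp: dist_norm)

lemma whitening_ex: "1 <= n ==> \<theta> \<in> \<Theta> ==> \<exists>V W. whitening n (R n \<theta>) c V W"
 using whitening_exists[of n "R n \<theta>" c] R_sym eigen c by blast

text \<open>A fixed choice of a whitening transformation for the true covariance matrix.\<close>
definition VV :: "nat => nat => nat => real" where
 "VV n = (SOME V. \<exists>W. whitening n (R n \<theta>0) c V W)"

definition WW :: "nat => nat => nat => real" where
 "WW n = (SOME W. whitening n (R n \<theta>0) c (VV n) W)"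

lemma VW: "1 <= n ==> whitening n (R n \<theta>0) c (VV n) (WW n)"
proof -
 assume "1 <= n"
 then have "\<exists>V. \<exists>W. whitening n (R n \<theta>0) c V W" by (rule whitening_ex[OF _ \<theta>0_in])
 then have "\<exists>W. whitening n (R n \<theta>0) c (VV n) W" unfolding VV_def by (rule someI_ex)
 then show ?thesis unfolding WW_def by (rule someI_ex)
qed

definition noise :: "nat => nat => 'w => real" where "noise n k \<xi> = (\<Sum>i<n. VV n i k * y n i \<xi>)"

lemma noise_normal: "1 <= n ==> std_normal_family P n (noise n)"
 using y_gauss[OF _ VW, of n] unfolding noise_def[abs_def] by simp

definition X1 :: "nat => 'p => nat => nat => real" where "X1 n m = conj_by n (VV n) (D1 n m)"
definition X2 :: "nat => 'p => 'p => nat => nat => real" where "X2 n m l = conj_by n (VV n) (D2 n m l)"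

text \<open>The Fisher information in whitened coordinates.\<close>
definition info :: "nat => real^'p^'p" where "info n = (\<chi> m l. 1 / (2 * real n) * fdot n (X1 n m) (X1 n l))"
text \<open>The gradient of the criterion at \<open>\<theta>0\<close>, up to the factor \<open>- sqrt n\<close>.\<close>
definition score :: "nat => 'w => real^'p" where "score n \<xi> = (\<chi> m. cqf n (X1 n m) (%k. noise n k \<xi>) / sqrt (real n))"
definition crit :: "nat => real^'p => 'w => real" where "crit n \<theta> \<xi> = gauss_crit n (R n \<theta>) (%i. y n i \<xi>)"

lemma fnorm_env:
 assumes "1 <= n" "\<And>i j. i < n ==> j < n ==> \<bar>G i j\<bar> <= k * a n i j" "0 <= k"
 shows "fnorm n G <= k * sqrt S * sqrt (real n)" "fnorm n (conj_by n (VV n) G) <= k * sqrt S / c * sqrt (real n)"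
proof -
 show 1: "fnorm n G <= k * sqrt S * sqrt (real n)"
  by (rule fnorm_envelope[of n "a n"]) (use row_square assms S in auto)
 have "fnorm n (conj_by n (VV n) G) <= fnorm n G / c" by (rule fnorm_conj_by[OF VW[OF assms(1)] c])
 also have "... <= k * sqrt S * sqrt (real n) / c" using 1 c by (intro divide_right_mono) auto
 finally show "fnorm n (conj_by n (VV n) G) <= k * sqrt S / c * sqrt (real n)" by simp
qed

lemma op_env:
 assumes row: "\<forall>i<n. (\<Sum>j<n. a n i j) <= \<rho> n" and sym: "\<And>i j. i < n ==> j < n ==> G i j = G j i"
  and env: "\<And>i j. i < n ==> j < n ==> \<bar>G i j\<bar> <= k * a n i j" "0 <= k"
 shows "op_le n G (k * \<rho> n)" "1 <= n ==> op_le n (conj_by n (VV n) G) (k * \<rho> n / c)"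
proof -
 show 1: "op_le n G (k * \<rho> n)"
 proof (rule Schur_row_sum[OF sym])
  fix i assume i: "i < n"
  have "(\<Sum>j<n. \<bar>G i j\<bar>) <= (\<Sum>j<n. k * a n i j)" using env(1)[OF i] by (intro sum_mono) auto
  also have "... <= k * \<rho> n" unfolding sum_distrib_left[symmetric] using row i env(2) by (intro mult_left_mono) auto
  finally show "(\<Sum>j<n. \<bar>G i j\<bar>) <= k * \<rho> n" .
 qed (use \<rho>_nonneg env in auto)
 show "op_le n (conj_by n (VV n) G) (k * \<rho> n / c)" if "1 <= n" by (rule op_le_conj_by[OF VW[OF that] c 1])
qed

lemma X1_sym: "X1 n m i j = X1 n m j i" unfolding X1_def by (rule conj_by_sym) (rule D1_sym)
lemma X2_sym: "X2 n m l i j = X2 n m l j i" unfolding X2_def by (rule conj_by_sym) (rule D2_sym)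

lemma info_sym: "transpose (info n) = info n"
 by (simp add: Finite_Cartesian_Product.vec_eq_iff transpose_def info_def fdot_commute)

lemma X1_lin: "(%i j. \<Sum>m\<in>UNIV. v $ m * X1 n m i j) = conj_by n (VV n) (%i j. \<Sum>m\<in>UNIV. v $ m * D1 n m i j)"
 unfolding X1_def by (simp only: conj_by_sum conj_by_scale)

lemma info_quadratic: "v \<bullet> (info n *v v) = (fnorm n (%i j. \<Sum>m\<in>UNIV. v $ m * X1 n m i j))\<^sup>2 / (2 * real n)"
proof -
 have "v \<bullet> (info n *v v) = (\<Sum>m\<in>UNIV. v $ m * (\<Sum>l\<in>UNIV. v $ l * fdot n (X1 n m) (X1 n l))) / (2 * real n)"
  by (simp add: inner_vec_def matrix_vector_mult_def info_def sum_divide_distrib sum_distrib_left ac_simps)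
 then show ?thesis unfolding fdot_self[symmetric] fdot_sum_left fdot_sum_right .
qed

lemma D1_comb_bound: "i < n ==> j < n ==> \<bar>\<Sum>m\<in>UNIV. v $ m * D1 n m i j\<bar> <= (real CARD('p) * \<kappa> * norm v) * a n i j"
proof -
 assume ij: "i < n" "j < n"
 have "\<bar>\<Sum>m\<in>UNIV. v $ m * D1 n m i j\<bar> <= (\<Sum>m\<in>UNIV. \<bar>v $ m\<bar> * \<bar>D1 n m i j\<bar>)" by (rule order_trans[OF sum_abs]) (simp add: abs_mult)
 also have "... <= (\<Sum>m\<in>(UNIV::'p set). norm v * (\<kappa> * a n i j))"
  using D1_bound[OF ij] component_le_norm_cart[of v] by (intro sum_mono mult_mono) auto
 finally show ?thesis by (simp add: ac_simps)
qed

definition info_upper_const :: real where "info_upper_const = (real CARD('p) * \<kappa> * sqrt S / c)\<^sup>2"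

lemma info_upper: "1 <= n ==> v \<bullet> (info n *v v) <= info_upper_const * (norm v)\<^sup>2"
proof -
 assume n: "1 <= n"
 have "fnorm n (%i j. \<Sum>m\<in>UNIV. v $ m * X1 n m i j) <= (real CARD('p) * \<kappa> * norm v) * sqrt S / c * sqrt (real n)"
  unfolding X1_lin using D1_comb_bound[of _ n _ v] \<kappa> by (intro fnorm_env(2)[OF n]) auto
 then have "(fnorm n (%i j. \<Sum>m\<in>UNIV. v $ m * X1 n m i j))\<^sup>2 <= ((real CARD('p) * \<kappa> * norm v) * sqrt S / c * sqrt (real n))\<^sup>2"
  by (intro power_mono) auto
 also have "... = info_upper_const * (norm v)\<^sup>2 * real n" by (simp add: info_upper_const_def power_mult_distrib power_divide)
 finally have "(fnorm n (%i j. \<Sum>m\<in>UNIV. v $ m * X1 n m i j))\<^sup>2 / (2 * real n) <= info_upper_const * (norm v)\<^sup>2 * real n / (2 * real n)"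
  by (intro divide_right_mono) auto
 also have "... = info_upper_const * (norm v)\<^sup>2 / 2" using n by simp
 also have "... <= info_upper_const * (norm v)\<^sup>2" by (simp add: info_upper_const_def)
 finally show ?thesis unfolding info_quadratic .
qed

lemma spectral_pair:
 assumes n: "1 <= n" and sym: "\<And>i j. D i j = D j i"
 obtains Q x where "orthogonal_family n Q" "diagonalizes n Q x (conj_by n (VV n) D)"
 using spectral_decomposition[of n "conj_by n (VV n) D"] conj_by_sym[of n D "VV n"] sym by metis

lemma fnorm_R_sq: "1 <= n ==> \<theta> \<in> \<Theta> ==> (fnorm n (R n \<theta>))\<^sup>2 <= (\<kappa>\<^sup>2 * S) * real n"
proof -
 assume n: "1 <= n" and t: "\<theta> \<in> \<Theta>"
 have "fnorm n (R n \<theta>) <= \<kappa> * sqrt S * sqrt (real n)" using \<kappa> by (intro fnorm_env(1)[OF n] envelope[OF t]) auto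
 then have "(fnorm n (R n \<theta>))\<^sup>2 <= (\<kappa> * sqrt S * sqrt (real n))\<^sup>2" by (intro power_mono) auto
 then show ?thesis using S by (simp add: power_mult_distrib)
qed

text \<open>The squared Frobenius norm of the unwhitened derivative grows linearly by identifiability; duality with its truncation
transfers this to the whitened derivative.\<close>
lemma info_lower: "\<exists>lo>0. \<forall>\<^sub>F n in sequentially. \<forall>v. lo * (norm v)\<^sup>2 <= v \<bullet> (info n *v v)"
proof -
 define k where "k = real CARD('p) * \<kappa>"
 have k: "0 < k" using \<kappa> by (simp add: k_def)
 \<comment> \<open>The part outside the truncation then carries at most half of the squared Frobenius norm.\<close>
 define \<epsilon> where "\<epsilon> = \<delta> / (2 * k\<^sup>2)"
 have e: "0 < \<epsilon>" using \<delta> k by (simp add: \<epsilon>_def)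
 obtain B where B: "B > 0" and trunc: "\<forall>n\<ge>1. truncates n (a n) B \<epsilon>"
  using truncation[OF e] by blast
 define C where "C = \<kappa>\<^sup>2 * S + 1"
 have C: "0 < C" using S by (simp add: C_def add_nonneg_pos)
 define lo where "lo = \<delta>\<^sup>2 / (4 * k\<^sup>2 * B\<^sup>2 * C) / 2"
 have lo: "0 < lo" using \<delta> k B C by (simp add: lo_def)
 have "\<forall>\<^sub>F n in sequentially. \<forall>v. lo * (norm v)\<^sup>2 <= v \<bullet> (info n *v v)"
  using identif_loc eventually_ge_at_top[of 1]
 proof eventually_elim
  case (elim n)
  then have n: "1 <= n" by simp
  show ?case
  proof
   fix v :: "real^'p"
   show "lo * (norm v)\<^sup>2 <= v \<bullet> (info n *v v)"
   proof (cases "v = 0")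
    case True then show ?thesis by simp
   next
    case False
    then have v0: "0 < norm v" by simp
    define D where "D = (%i j. \<Sum>m\<in>UNIV. v $ m * D1 n m i j)"
    have Dsym: "D i j = D j i" for i j unfolding D_def using D1_sym by metis
    obtain Q x where Q: "orthogonal_family n Q" and X: "diagonalizes n Q x (conj_by n (VV n) D)"
     using spectral_pair[OF n, of D] Dsym by blast
    obtain N where N: "\<forall>i j. N i j \<longleftrightarrow> N j i" "\<forall>i<n. (\<Sum>j<n. if N i j then a n i j else 0) <= B"
     "\<forall>i<n. (\<Sum>j<n. if N i j then 0 else (a n i j)\<^sup>2) <= \<epsilon>" using mp[OF spec[OF trunc] n] by (elim exE conjE) (rule that)
    note dec = whitened_decomposition[OF VW[OF n] Q X]
    have FD: "\<delta> * real n * (norm v)\<^sup>2 <= (fnorm n D)\<^sup>2" using elim by (simp add: D_def)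
    have fR: "(fnorm n (R n \<theta>0))\<^sup>2 <= C * real n"
     using fnorm_R_sq[OF n \<theta>0_in] by (simp add: C_def distrib_right)
    have "((fnorm n D)\<^sup>2)\<^sup>2 / (4 * (k * norm v)\<^sup>2 * B\<^sup>2 * C * real n) <= (\<Sum>k<n. (x k / 1)\<^sup>2)"
    proof (rule truncated_test_bound[where N=N, OF Dsym R_sym[OF \<theta>0_in] dec(2,1)])
     show "mat_of n Q * mat_of n (WW n) \<in> carrier_mat n n" by (simp add: square_mat_simps[of _ n])
     show "\<bar>D i j\<bar> <= k * norm v * a n i j" if "i < n" "j < n" for i j
      unfolding D_def k_def by (rule D1_comb_bound[OF that])
     show "2 * (k * norm v)\<^sup>2 * \<epsilon> * real n <= (fnorm n D)\<^sup>2"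
      using FD k by (simp add: \<epsilon>_def power_mult_distrib ac_simps)
    qed (use N k v0 B fR C n in auto)
    also have "(\<Sum>k<n. (x k / 1)\<^sup>2) = (fnorm n (conj_by n (VV n) D))\<^sup>2" by (simp add: spectral_coordinates(2)[OF Q X])
    also have "... = (v \<bullet> (info n *v v)) * (2 * real n)" using n by (simp add: info_quadratic X1_lin D_def)
    finally have 1: "((fnorm n D)\<^sup>2)\<^sup>2 / (4 * (k * norm v)\<^sup>2 * B\<^sup>2 * C * real n) <= (v \<bullet> (info n *v v)) * (2 * real n)" .
    have "lo * (norm v)\<^sup>2 * (2 * real n) = (\<delta> * real n * (norm v)\<^sup>2)\<^sup>2 / (4 * (k * norm v)\<^sup>2 * B\<^sup>2 * C * real n)"
     using k v0 B C n by (simp add: lo_def field_simps power2_eq_square)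
    also have "... <= ((fnorm n D)\<^sup>2)\<^sup>2 / (4 * (k * norm v)\<^sup>2 * B\<^sup>2 * C * real n)"
     using FD \<delta> C by (intro divide_right_mono power_mono) auto
    finally have "lo * (norm v)\<^sup>2 * (2 * real n) <= (v \<bullet> (info n *v v)) * (2 * real n)" using 1 by linarith
    then show ?thesis using n by simp
   qed
  qed
 qed
 then show ?thesis using lo by blast
qed

lemma crit_difference:
 assumes n: "1 <= n" and \<theta>: "\<theta> \<in> \<Theta>" and Q: "orthogonal_family n Q"
  and X: "diagonalizes n Q x (conj_by n (VV n) (%i j. R n \<theta> i j - R n \<theta>0 i j))"
 shows "crit n \<theta> \<xi> - crit n \<theta>0 \<xi> = (\<Sum>k<n. ln (1 + x k) + (mulv n Q (%l. noise n l \<xi>) k)\<^sup>2 * (1 / (1 + x k) - 1))"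
  "k < n ==> 0 < 1 + x k"
proof -
 obtain V' W' where w: "whitening n (R n \<theta>) c V' W'" using whitening_ex[OF n \<theta>] by blast
 show "crit n \<theta> \<xi> - crit n \<theta>0 \<xi> = (\<Sum>k<n. ln (1 + x k) + (mulv n Q (%l. noise n l \<xi>) k)\<^sup>2 * (1 / (1 + x k) - 1))"
  unfolding crit_def noise_def by (rule gauss_crit_difference[OF VW[OF n] w Q X])
 show "0 < 1 + x k" if "k < n" by (rule relative_eigenvalue_pos[OF VW[OF n] w Q X that])
qed

abbreviation far_excluded :: "nat => 'w => bool" where
 "far_excluded n \<xi> \<equiv> \<forall>\<theta>\<in>\<Theta>. (b n)\<^sup>2 <= norm (\<theta> - \<theta>0) * sqrt (real n) --> crit n \<theta>0 \<xi> < crit n \<theta> \<xi>"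

abbreviation expansion_error :: "nat => real^'p => 'w => real" where
 "expansion_error n t \<xi> \<equiv> \<bar>(crit n (\<theta>0 + t) \<xi> - crit n \<theta>0 \<xi>) - (- (sqrt (real n) * (t \<bullet> score n \<xi>)) + real n * (t \<bullet> (info n *v t)))\<bar>"

abbreviation close_call :: "nat => real^'p => 'w set" where
 "close_call n \<theta> \<equiv> {\<xi>\<in>space P. crit n \<theta> \<xi> - crit n \<theta>0 \<xi> <= 1}"

text \<open>The exponent is bounded below by \<open>truncated_test_bound\<close> for \<open>D = R \<theta> - R \<theta>0\<close> and the weights \<open>2 + x\<close>, which belong to
\<open>G = R \<theta> + R \<theta>0\<close>.\<close>
lemma crit_chernoff:
 "\<exists>C>0. \<forall>\<^sub>F n in sequentially. \<forall>\<theta>\<in>\<Theta>. \<theta> \<noteq> \<theta>0 --> (close_call n \<theta>) \<in> events \<and>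
  prob (close_call n \<theta>) <= 2 * exp (- C * real n * (norm (\<theta> - \<theta>0))\<^sup>2)"
proof -
 define \<epsilon> where "\<epsilon> = \<delta> / (2 * \<kappa>\<^sup>2)"
 have e: "0 < \<epsilon>" using \<delta> \<kappa> by (simp add: \<epsilon>_def)
 obtain B where B: "B > 0" and trunc: "\<forall>n\<ge>1. truncates n (a n) B \<epsilon>"
  using truncation[OF e] by blast
 define C where "C = 4 * \<kappa>\<^sup>2 * S + 1"
 have C: "0 < C" using S by (simp add: C_def add_nonneg_pos)
 define q where "q = \<delta>\<^sup>2 / (4 * \<kappa>\<^sup>2 * B\<^sup>2 * C)"
 have q: "0 < q" using \<delta> \<kappa> B C by (simp add: q_def)
 have "\<forall>\<^sub>F n in sequentially. \<forall>\<theta>\<in>\<Theta>. \<theta> \<noteq> \<theta>0 --> (close_call n \<theta>) \<in> events \<and>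
  prob (close_call n \<theta>) <= 2 * exp (- (q / 4) * real n * (norm (\<theta> - \<theta>0))\<^sup>2)"
  using identif eventually_ge_at_top[of 1]
 proof eventually_elim
  case (elim n)
  then have n: "1 <= n" by simp
  show ?case
  proof (intro ballI impI)
   fix \<theta> assume \<theta>: "\<theta> \<in> \<Theta>" "\<theta> \<noteq> \<theta>0"
   define t where "t = norm (\<theta> - \<theta>0)"
   have t: "0 < t" using \<theta> by (simp add: t_def)
   define D where "D = (%i j. R n \<theta> i j - R n \<theta>0 i j)"
   have Dsym: "D i j = D j i" for i j unfolding D_def using R_sym \<theta> \<theta>0_in by metis
   obtain Q x where Q: "orthogonal_family n Q" and X: "diagonalizes n Q x (conj_by n (VV n) D)"
    using spectral_pair[OF n, of D] Dsym by blast
   obtain N where N: "\<forall>i j. N i j \<longleftrightarrow> N j i" "\<forall>i<n. (\<Sum>j<n. if N i j then a n i j else 0) <= B"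
    "\<forall>i<n. (\<Sum>j<n. if N i j then 0 else (a n i j)\<^sup>2) <= \<epsilon>" using mp[OF spec[OF trunc] n] by (elim exE conjE) (rule that)
   note dec = whitened_decomposition[OF VW[OF n] Q X]
   note cd = crit_difference[OF n \<theta>(1) Q X[unfolded D_def]]
   define w where "w k \<xi> = mulv n Q (%l. noise n l \<xi>) k" for k \<xi>
   have wn: "std_normal_family P n w" unfolding w_def by (rule orthogonal_family_mulv[OF noise_normal[OF n] Q])
   have [measurable]: "w k \<in> borel_measurable P" if "k \<in> {..<n}" for k using wn that by (auto simp: std_normal_family_def)
   have ev: "(close_call n \<theta>) = {\<xi>\<in>space P. (\<Sum>k<n. ln (1 + x k) + (w k \<xi>)\<^sup>2 * (1 / (1 + x k) - 1)) <= 1}"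
    unfolding cd(1) w_def ..
 \<comment> \<open>The weights \<open>2 + x\<close> are the eigenvalues of this matrix relative to the true covariance matrix.\<close>
   define G where "G = (%i j. R n \<theta> i j + R n \<theta>0 i j)"
   have Gdec: "mat_of n G = transpose_mat (mat_of n Q * mat_of n (WW n)) * dmat n (%k. 2 + x k) * (mat_of n Q * mat_of n (WW n))"
   proof -
    define T where "T = mat_of n Q * mat_of n (WW n)"
    have T: "T \<in> carrier_mat n n" by (simp add: T_def square_mat_simps[of _ n])
    have "dmat n (%k. 2 + x k) = (dmat n (%_. 1) + dmat n (%_. 1)) + dmat n x" by (rule eq_matI) (auto simp: dmat_def)
    then have "transpose_mat T * dmat n (%k. 2 + x k) * T
     = (transpose_mat T * dmat n (%_. 1) * T + transpose_mat T * dmat n (%_. 1) * T) + transpose_mat T * dmat n x * T"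
     using T by (simp add: mult_add_distrib_mat[of _ n n _ n] add_mult_distrib_mat[of _ n n _ _ n] square_mat_simps[of _ n] add_carrier_mat[of _ n n])
    also have "... = (mat_of n (R n \<theta>0) + mat_of n (R n \<theta>0)) + mat_of n D" by (simp only: dec[folded T_def])
    also have "... = mat_of n G" by (rule eq_matI) (auto simp: G_def D_def)
    finally show ?thesis by (simp only: T_def)
   qed
   have FD: "\<delta> * real n * t\<^sup>2 <= (fnorm n D)\<^sup>2" using elim \<theta> by (simp add: D_def t_def)
   have fG: "(fnorm n G)\<^sup>2 <= C * real n"
   proof -
    have "fnorm n G <= (2 * \<kappa>) * sqrt S * sqrt (real n)"
    proof (rule fnorm_env(1)[OF n])
     fix i j assume "i < n" "j < n"
     then show "\<bar>G i j\<bar> <= 2 * \<kappa> * a n i j" using envelope[OF \<theta>(1), of i n j] envelope[OF \<theta>0_in, of i n j] unfolding G_def by linarith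
    qed (use \<kappa> in simp)
    then have "(fnorm n G)\<^sup>2 <= ((2 * \<kappa>) * sqrt S * sqrt (real n))\<^sup>2" by (intro power_mono) auto
    also have "... = 4 * \<kappa>\<^sup>2 * S * real n" using S by (simp add: power_mult_distrib)
    also have "... <= C * real n" by (simp add: C_def distrib_right)
    finally show ?thesis .
   qed
   have "((fnorm n D)\<^sup>2)\<^sup>2 / (4 * (\<kappa> * t)\<^sup>2 * B\<^sup>2 * C * real n) <= (\<Sum>k<n. (x k / (2 + x k))\<^sup>2)"
   proof (rule truncated_test_bound[where N=N, OF Dsym _ dec(2) Gdec])
    show "mat_of n Q * mat_of n (WW n) \<in> carrier_mat n n" by (simp add: square_mat_simps[of _ n])
    show "\<bar>D i j\<bar> <= \<kappa> * t * a n i j" if "i < n" "j < n" for i j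
     unfolding D_def t_def by (rule lipschitz[OF \<theta>(1) \<theta>0_in that])
    show "2 * (\<kappa> * t)\<^sup>2 * \<epsilon> * real n <= (fnorm n D)\<^sup>2"
     using FD \<kappa> by (simp add: \<epsilon>_def power_mult_distrib ac_simps)
    show "0 < 2 + x k" if "k < n" for k using cd(2)[OF that] by simp
    show "G i j = G j i" for i j unfolding G_def using R_sym \<theta> \<theta>0_in by metis
   qed (use N \<kappa> t B fG C n in auto)
   moreover have "q * real n * t\<^sup>2 = (\<delta> * real n * t\<^sup>2)\<^sup>2 / (4 * (\<kappa> * t)\<^sup>2 * B\<^sup>2 * C * real n)"
    using \<kappa> t B C n by (simp add: q_def field_simps power2_eq_square)
   moreover have "(\<delta> * real n * t\<^sup>2)\<^sup>2 / (4 * (\<kappa> * t)\<^sup>2 * B\<^sup>2 * C * real n) <= ((fnorm n D)\<^sup>2)\<^sup>2 / (4 * (\<kappa> * t)\<^sup>2 * B\<^sup>2 * C * real n)"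
    using FD \<delta> C by (intro divide_right_mono power_mono) auto
   ultimately have low: "q * real n * t\<^sup>2 <= (\<Sum>k<n. (x k / (2 + x k))\<^sup>2)" by linarith
   have "prob {\<xi>\<in>space P. (\<Sum>k<n. ln (1 + x k) + (w k \<xi>)\<^sup>2 * (1 / (1 + x k) - 1)) <= 1}
    <= 2 * exp (- (\<Sum>k<n. ((1 + x k - 1) / (1 + x k + 1))\<^sup>2) / 4)"
    by (rule gaussian_likelihood_chernoff[OF wn, of "%k. 1 + x k"]) (rule cd(2))
   also have "(\<Sum>k<n. ((1 + x k - 1) / (1 + x k + 1))\<^sup>2) = (\<Sum>k<n. (x k / (2 + x k))\<^sup>2)" by (simp add: ac_simps)
   also have "2 * exp (- (\<Sum>k<n. (x k / (2 + x k))\<^sup>2) / 4) <= 2 * exp (- (q / 4) * real n * t\<^sup>2)" using low by simp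
   finally show "(close_call n \<theta>) \<in> events \<and>
    prob (close_call n \<theta>) <= 2 * exp (- (q / 4) * real n * (norm (\<theta> - \<theta>0))\<^sup>2)"
    unfolding ev t_def by (intro conjI) measurable
  qed
 qed
 then show ?thesis using q by (intro exI[of _ "q / 4"]) simp
qed

end

section \<open>Far from the true parameter\<close>

context gaussian_array begin

lemma R_diag: "1 <= n ==> i < n ==> R n \<theta>0 i i <= \<kappa> * sqrt S"
proof -
 assume n: "1 <= n" and i: "i < n"
 have "(a n i i)\<^sup>2 <= (\<Sum>j<n. (a n i j)\<^sup>2)" by (rule member_le_sum[of i _ "%j. (a n i j)\<^sup>2"]) (use i in auto)
 also have "... <= S" by (rule row_square[OF n i])
 finally have "a n i i <= sqrt S" by (rule real_le_rsqrt)
 then have "\<kappa> * a n i i <= \<kappa> * sqrt S" using \<kappa> by (intro mult_left_mono) auto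
 then show ?thesis using envelope[OF \<theta>0_in i i] by linarith
qed

text \<open>Union bound over a net of mesh \<open>n ^ -4\<close>.  On the event that \<open>y\<close> has norm at most \<open>n\<close> the criterion changes by less than 1
between a point and its neighbour in the net.\<close>
lemma outer_region:
 "\<exists>\<eta>. \<eta> \<longlonglongrightarrow> 0 \<and> (\<forall>\<^sub>F n in sequentially. \<exists>B\<in>events. prob B <= \<eta> n \<and>
  (\<forall>\<xi>\<in>space P - B. far_excluded n \<xi>))"
proof -
 obtain C where C: "C > 0" and chern: "\<forall>\<^sub>F n in sequentially. \<forall>\<theta>\<in>\<Theta>. \<theta> \<noteq> \<theta>0 -->
   (close_call n \<theta>) \<in> events \<and>
   prob (close_call n \<theta>) <= 2 * exp (- C * real n * (norm (\<theta> - \<theta>0))\<^sup>2)"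
  using crit_chernoff by (elim exE conjE) (rule that)
 obtain B0 where B0: "0 < B0" "\<And>v. v \<in> \<Theta> ==> norm v <= B0" using \<Theta>_bounded unfolding bounded_pos by blast
 define p where "p = CARD('p)"
 define q where "q = 2 * (\<kappa> * real p / c) * (1 + 1 / c) + 2 * (\<kappa> * real p / c)"
 have p1: "1 <= real p" by (simp add: p_def Suc_le_eq)
 have q0: "0 < \<kappa> * real p / c" using \<kappa> c p1 by simp
 define \<eta> where "\<eta> n = \<kappa> * sqrt S / real n + (2 * B0 + 3) ^ p * 2 * (real n ^ (4 * p) * exp (- C * b n ^ 4))" for n
 have lim: "\<eta> \<longlonglongrightarrow> 0"
 proof -
  have "(%n. \<kappa> * sqrt S / real n) \<longlonglongrightarrow> 0" by (rule lim_const_over_n)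
  from tendsto_add[OF this tendsto_mult_right_zero[OF b_exp[OF C, of "4 * p"], of "(2 * B0 + 3) ^ p * 2"]]
  show ?thesis unfolding \<eta>_def by simp
 qed
 have "\<forall>\<^sub>F n in sequentially. q < real n" by (rule filterlim_at_top_dense[THEN iffD1, rule_format, OF filterlim_real_sequentially])
 then have "\<forall>\<^sub>F n in sequentially. \<exists>B\<in>events. prob B <= \<eta> n \<and>
  (\<forall>\<xi>\<in>space P - B. far_excluded n \<xi>)"
  using chern row_sum \<rho>_pow eventually_ge_at_top[of 1]
 proof eventually_elim
  case (elim n)
  then have n: "1 <= n" by simp
  have n0: "0 < real n" using n by simp
  have b1: "1 <= b n" by (rule b_ge_1[OF n])
  have \<rho>n: "\<rho> n <= real n"
  proof -
   have "\<rho> n * 1 <= \<rho> n * b n ^ 10" using \<rho>_nonneg one_le_power[OF b1] by (intro mult_left_mono) auto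
   also have "... <= sqrt (real n)" using elim by simp
   also have "... <= real n" using n by (intro real_le_lsqrt) (auto simp: power2_eq_square)
   finally show ?thesis by simp
  qed
  define A where "A = {\<theta>\<in>\<Theta>. (b n)\<^sup>2 <= norm (\<theta> - \<theta>0) * sqrt (real n)}"
 \<comment> \<open>The Lipschitz constant of the criterion is of order \<open>n ^ 3\<close> on the event that \<open>y\<close> has norm at most \<open>n\<close>.\<close>
  define h where "h = 1 / real n ^ 4"
  have h: "0 < h" "h <= 1" using n by (auto simp: h_def)
  obtain G where G: "G \<subseteq> A" "finite G" "real (card G) <= ((2 * B0 + 3) / h) ^ CARD('p)" "\<forall>v\<in>A. \<exists>g\<in>G. norm (v - g) <= real CARD('p) * h"
   using finite_net[of A B0 h, OF _ h] B0 by (auto simp: A_def)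
  define E where "E g = {\<xi>\<in>space P. crit n g \<xi> - crit n \<theta>0 \<xi> <= 1}" for g
  have E: "E g \<in> events \<and> prob (E g) <= 2 * exp (- C * b n ^ 4)" if "g \<in> G" for g
  proof -
   have g: "g \<in> \<Theta>" "(b n)\<^sup>2 <= norm (g - \<theta>0) * sqrt (real n)" using that G(1) by (auto simp: A_def)
   have "0 < (b n)\<^sup>2" using b1 by simp
   then have "g \<noteq> \<theta>0" using g(2) by (intro notI) simp
   then have e: "E g \<in> events" "prob (E g) <= 2 * exp (- C * real n * (norm (g - \<theta>0))\<^sup>2)"
    using elim g(1) by (auto simp: E_def)
   have "((b n)\<^sup>2)\<^sup>2 <= (norm (g - \<theta>0) * sqrt (real n))\<^sup>2" using g(2) by (intro power_mono) auto
   then have "b n ^ 4 <= real n * (norm (g - \<theta>0))\<^sup>2" by (simp add: power_mult_distrib power_mult[symmetric] mult.commute)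
   then have "C * b n ^ 4 <= C * (real n * (norm (g - \<theta>0))\<^sup>2)" using C by (intro mult_left_mono) auto
   then have "2 * exp (- C * real n * (norm (g - \<theta>0))\<^sup>2) <= 2 * exp (- C * b n ^ 4)" by (simp add: mult.assoc)
   then show ?thesis using e(1) order_trans[OF e(2)] by blast
  qed
  define B1 where "B1 = {\<xi> \<in> space P. real n < vnorm n (%k. y n k \<xi>)}"
  have B1: "prob B1 <= \<kappa> * sqrt S * real n / (real n)\<^sup>2" "B1 \<in> events"
   unfolding B1_def by (rule vnorm_tail; use y_meas R_diag[OF n] n0 in simp)+
  define B where "B = B1 \<union> (\<Union>g\<in>G. E g)"
  have UE: "(\<Union>g\<in>G. E g) \<in> events" using E G(2) by (intro sets.finite_UN) auto
  have "prob B <= prob B1 + prob (\<Union>g\<in>G. E g)" unfolding B_def by (rule measure_Un_le) (use B1 UE in auto)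
  also have "prob (\<Union>g\<in>G. E g) <= (\<Sum>g\<in>G. prob (E g))" by (rule measure_UNION_le[OF G(2)]) (use E in auto)
  also have "... <= (\<Sum>g\<in>G. 2 * exp (- C * b n ^ 4))" using E by (intro sum_mono) auto
  also have "... = real (card G) * (2 * exp (- C * b n ^ 4))" by simp
  also have "... <= ((2 * B0 + 3) / h) ^ CARD('p) * (2 * exp (- C * b n ^ 4))" using G(3) by (rule mult_right_mono) simp
  also have "... = (2 * B0 + 3) ^ p * 2 * (real n ^ (4 * p) * exp (- C * b n ^ 4))"
   by (simp add: h_def p_def power_mult_distrib power_mult[symmetric])
  also have "prob B1 <= \<kappa> * sqrt S / real n" using B1(1) n0 by (simp add: power2_eq_square)
  finally have pB: "prob B <= \<eta> n" unfolding \<eta>_def by simp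
  have "crit n \<theta>0 \<xi> < crit n \<theta> \<xi>" if \<xi>: "\<xi> \<in> space P - B" and \<theta>: "\<theta> \<in> \<Theta>" "(b n)\<^sup>2 <= norm (\<theta> - \<theta>0) * sqrt (real n)" for \<xi> \<theta>
  proof -
   have "\<theta> \<in> A" using \<theta> by (simp add: A_def)
   then obtain g where g: "g \<in> G" "norm (\<theta> - g) <= real p * h" using G(4) by (auto simp: p_def)
   have g\<Theta>: "g \<in> \<Theta>" using g(1) G(1) by (auto simp: A_def)
   have "\<xi> \<notin> E g" "\<xi> \<notin> B1" using \<xi> g(1) by (auto simp: B_def)
   then have big: "1 < crit n g \<xi> - crit n \<theta>0 \<xi>" and yb: "vnorm n (%k. y n k \<xi>) <= real n"
    using \<xi> by (auto simp: E_def B1_def)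
   obtain V W where w: "whitening n (R n g) c V W" using whitening_ex[OF n g\<Theta>] by blast
   obtain V' W' where w': "whitening n (R n \<theta>) c V' W'" using whitening_ex[OF n \<theta>(1)] by blast
   define k where "k = \<kappa> * norm (\<theta> - g) * \<rho> n"
   have op: "op_le n (%i j. R n \<theta> i j - R n g i j) k" unfolding k_def
    by (rule op_env(1)) (use elim lipschitz[OF \<theta>(1) g\<Theta>] R_sym[OF \<theta>(1)] R_sym[OF g\<Theta>] \<kappa> in auto)
   have k0: "0 <= k" by (rule op_le_nonneg[OF op])
   have "k <= \<kappa> * (real p * h) * real n"
    unfolding k_def using \<kappa> g(2) \<rho>n \<rho>_nonneg h p1 by (intro mult_mono mult_left_mono) auto
   also have "... = \<kappa> * real p / real n ^ 3" using n0 by (simp add: h_def power4_eq_xxxx power3_eq_cube)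
   finally have "k / c <= \<kappa> * real p / real n ^ 3 / c" using c by (intro divide_right_mono) auto
   then have kc: "k / c <= (\<kappa> * real p / c) / real n ^ 3" by (simp add: ac_simps)
   have qn: "2 * (\<kappa> * real p / c) <= real n" "2 * (\<kappa> * real p / c) * (1 + 1 / c) < real n"
   proof -
    have "0 <= 2 * (\<kappa> * real p / c) * (1 + 1 / c)" using q0 c by (intro mult_nonneg_nonneg) auto
    then show "2 * (\<kappa> * real p / c) <= real n" "2 * (\<kappa> * real p / c) * (1 + 1 / c) < real n" using elim(1) q0 unfolding q_def by linarith+
   qed
   have n3: "real n ^ 3 \<ge> real n" using n by (simp add: self_le_power)
   have half: "k / c <= 1 / 2"
   proof -
    have "(\<kappa> * real p / c) / real n ^ 3 <= (\<kappa> * real p / c) / real n" using q0 n3 n0 by (intro divide_left_mono) auto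
    also have "... <= 1 / 2"
    proof -
     have "x / real n <= 1 / 2" if "2 * x <= real n" for x using that n0 by (simp add: pos_divide_le_eq)
     from this[OF qn(1)] show ?thesis .
    qed
    finally show ?thesis by (rule order_trans[OF kc])
   qed
   have "\<bar>crit n \<theta> \<xi> - crit n g \<xi>\<bar> <= 2 * (k / c) * (real n + (vnorm n (%i. y n i \<xi>))\<^sup>2 / c)"
    unfolding crit_def
    by (rule gauss_crit_Lipschitz[OF w c w' _ op half]) (use R_sym[OF \<theta>(1)] R_sym[OF g\<Theta>] in metis)
   also have "... <= 2 * (k / c) * ((real n)\<^sup>2 + (real n)\<^sup>2 / c)"
   proof (rule mult_left_mono)
    have "(vnorm n (%i. y n i \<xi>))\<^sup>2 / c <= (real n)\<^sup>2 / c" using yb c by (intro divide_right_mono power_mono) auto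
    moreover have "real n <= (real n)\<^sup>2" using n by (simp add: self_le_power)
    ultimately show "real n + (vnorm n (%i. y n i \<xi>))\<^sup>2 / c <= (real n)\<^sup>2 + (real n)\<^sup>2 / c" by linarith
   qed (use k0 c in auto)
   also have "... = (2 * (1 + 1 / c) * (real n)\<^sup>2) * (k / c)" by (simp add: algebra_simps)
   also have "... <= (2 * (1 + 1 / c) * (real n)\<^sup>2) * ((\<kappa> * real p / c) / real n ^ 3)"
    using kc c by (intro mult_left_mono) auto
   also have "... = (2 * (\<kappa> * real p / c) * (1 + 1 / c)) / real n" using n0 by (simp add: power2_eq_square power3_eq_cube)
   also have "... < 1" using qn(2) n0 by (simp only: divide_less_eq_1_pos)
   finally show ?thesis using big by linarith
  qed
  then show ?case using pB B1 UE by (intro bexI[of _ B]) (auto simp: B_def)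
 qed
 with lim show ?thesis by blast
qed

end

section \<open>Near the true parameter\<close>

context gaussian_array begin

text \<open>A common envelope constant for the three Taylor terms.\<close>
definition k0 :: real where "k0 = \<kappa> * (1 + real CARD('p) + real CARD('p) ^ 2 + r\<^sub>0)"
definition expansion_const :: real where "expansion_const = 1 + real CARD('p) ^ 2 + k0 * (1 + sqrt S) / c"

lemma k0_pos: "0 < k0" using \<kappa> \<Theta>_ball(1) by (simp add: k0_def add_pos_nonneg)

lemma expansion_const_ge: "1 <= expansion_const" "real CARD('p) ^ 2 <= expansion_const" "k0 / c <= expansion_const" "k0 * sqrt S / c <= expansion_const"
proof -
 have "expansion_const = 1 + real CARD('p) ^ 2 + (k0 / c + k0 * sqrt S / c)" by (simp add: expansion_const_def distrib_left add_divide_distrib)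
 moreover have "0 <= k0 / c" "0 <= k0 * sqrt S / c" "0 <= real CARD('p) ^ 2" using k0_pos c S by auto
 ultimately show "1 <= expansion_const" "real CARD('p) ^ 2 <= expansion_const" "k0 / c <= expansion_const" "k0 * sqrt S / c <= expansion_const" by linarith+
qed

text \<open>Whitening costs a factor \<open>1 / c\<close> in both norms.\<close>
lemma env_H:
 assumes n: "1 <= n" and row: "\<forall>i<n. (\<Sum>j<n. a n i j) <= \<rho> n" and sym: "\<And>i j. i < n ==> j < n ==> G i j = G j i"
  and env: "\<And>i j. i < n ==> j < n ==> \<bar>G i j\<bar> <= k * \<tau> * a n i j" and k: "k <= k0" and \<tau>: "0 <= \<tau>"
 shows "op_le n (conj_by n (VV n) G) (expansion_const * \<tau> * \<rho> n)" "fnorm n (conj_by n (VV n) G) <= expansion_const * \<tau> * sqrt (real n)"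
proof -
 have env': "\<bar>G i j\<bar> <= (k0 * \<tau>) * a n i j" if "i < n" "j < n" for i j
  using env[OF that] mult_right_mono[OF mult_right_mono[OF k \<tau>] a_nonneg, of n i j] by linarith
 have kt: "0 <= k0 * \<tau>" using k0_pos \<tau> by simp
 have "op_le n (conj_by n (VV n) G) (k0 * \<tau> * \<rho> n / c)" by (rule op_env(2)[OF row sym env' kt n])
 moreover have "k0 * \<tau> * \<rho> n / c = (k0 / c) * (\<tau> * \<rho> n)" by simp
 moreover have "(k0 / c) * (\<tau> * \<rho> n) <= expansion_const * (\<tau> * \<rho> n)" using expansion_const_ge(3) \<tau> \<rho>_nonneg by (intro mult_right_mono) auto
 ultimately show "op_le n (conj_by n (VV n) G) (expansion_const * \<tau> * \<rho> n)" by (auto intro: op_le_mono simp: mult.assoc)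
 have "fnorm n (conj_by n (VV n) G) <= k0 * \<tau> * sqrt S / c * sqrt (real n)" by (rule fnorm_env(2)[OF n env' kt])
 also have "... = (k0 * sqrt S / c) * (\<tau> * sqrt (real n))" by simp
 also have "... <= expansion_const * (\<tau> * sqrt (real n))" using expansion_const_ge(4) \<tau> by (intro mult_right_mono) auto
 finally show "fnorm n (conj_by n (VV n) G) <= expansion_const * \<tau> * sqrt (real n)" by (simp add: mult.assoc)
qed

text \<open>The whitened difference of covariance matrices is split by the Taylor expansion of the kernel of order one and of order two.\<close>
lemma crit_expansion:
 assumes n: "1 <= n" and row: "\<forall>i<n. (\<Sum>j<n. a n i j) <= \<rho> n"
  and b10: "b n ^ 10 <= sqrt (real n)" "\<rho> n * b n ^ 10 <= sqrt (real n)" "2 * expansion_const <= b n"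
  and ev2: "\<And>m l. \<bar>cqf n (X2 n m l) (%k. noise n k w)\<bar> <= sqrt (real n) * b n"
  and ev3: "\<And>m l. \<bar>dotn n (mulv n (X1 n m) (%k. noise n k w)) (mulv n (X1 n l) (%k. noise n k w)) - fdot n (X1 n m) (X1 n l)\<bar> <= sqrt (real n) * \<rho> n * b n"
  and ev4: "vnorm n (%k. noise n k w) <= sqrt (real n) * b n"
  and t: "norm t < r\<^sub>0" "norm t * sqrt (real n) <= (b n)\<^sup>2"
 shows "expansion_error n t w <= 40 * expansion_const ^ 3 / b n"
proof -
 note inT = near_in[OF t(1)]
 define \<tau> where "\<tau> = norm t"
 have \<tau>: "0 <= \<tau>" "\<tau> <= r\<^sub>0" using t(1) by (auto simp: \<tau>_def)
 define D where "D = (%i j. R n (\<theta>0 + t) i j - R n \<theta>0 i j)"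
 define L where "L = (%i j. \<Sum>m\<in>UNIV. t $ m * D1 n m i j)"
 define Q2 where "Q2 = (%i j. \<Sum>m\<in>UNIV. t $ m * (\<Sum>l\<in>UNIV. t $ l * D2 n m l i j))"
 define E3 where "E3 = (%i j. D i j - (L i j + Q2 i j / 2))"
 define E2 where "E2 = (%i j. (1/2) * Q2 i j + E3 i j)"
 have Dsym: "D i j = D j i" for i j unfolding D_def using R_sym inT \<theta>0_in by metis
 have Lsym: "L i j = L j i" for i j unfolding L_def by (simp only: D1_sym[of n _ i j])
 have Q2sym: "Q2 i j = Q2 j i" for i j unfolding Q2_def by (simp only: D2_sym[of n _ _ i j])
 have E3sym: "E3 i j = E3 j i" for i j unfolding E3_def by (simp only: Dsym[of i j] Lsym[of i j] Q2sym[of i j])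
 have E2sym: "E2 i j = E2 j i" for i j unfolding E2_def by (simp only: E3sym[of i j] Q2sym[of i j])
 have Db: "\<bar>D i j\<bar> <= \<kappa> * \<tau> * a n i j" if "i < n" "j < n" for i j
  using lipschitz[OF inT \<theta>0_in that] by (simp add: D_def \<tau>_def)
 have Lb: "\<bar>L i j\<bar> <= (real CARD('p) * \<kappa>) * \<tau> * a n i j" if "i < n" "j < n" for i j
  using D1_comb_bound[OF that, of t] by (simp add: L_def \<tau>_def)
 have E3b: "\<bar>E3 i j\<bar> <= \<kappa> * \<tau> ^ 3 * a n i j" if "i < n" "j < n" for i j
  using taylor[OF t(1) that] by (simp add: E3_def D_def L_def Q2_def \<tau>_def algebra_simps)
 have Q2b: "\<bar>Q2 i j\<bar> <= (real CARD('p) ^ 2 * \<kappa>) * \<tau>\<^sup>2 * a n i j" if "i < n" "j < n" for i j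
 proof -
  have inner: "\<bar>\<Sum>l\<in>UNIV. t $ l * D2 n m l i j\<bar> <= real CARD('p) * (\<tau> * (\<kappa> * a n i j))" for m
  proof -
   have "\<bar>\<Sum>l\<in>UNIV. t $ l * D2 n m l i j\<bar> <= (\<Sum>l\<in>UNIV. \<bar>t $ l\<bar> * \<bar>D2 n m l i j\<bar>)"
    by (rule order_trans[OF sum_abs]) (simp add: abs_mult)
   also have "... <= (\<Sum>l\<in>(UNIV::'p set). \<tau> * (\<kappa> * a n i j))"
    using D2_bound[OF that] component_le_norm_cart[of t] unfolding \<tau>_def by (intro sum_mono mult_mono) auto
   finally show ?thesis by simp
  qed
  have "\<bar>Q2 i j\<bar> <= (\<Sum>m\<in>UNIV. \<bar>t $ m\<bar> * \<bar>\<Sum>l\<in>UNIV. t $ l * D2 n m l i j\<bar>)"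
   unfolding Q2_def by (rule order_trans[OF sum_abs]) (simp add: abs_mult)
  also have "... <= (\<Sum>m\<in>(UNIV::'p set). \<tau> * (real CARD('p) * (\<tau> * (\<kappa> * a n i j))))"
   using inner component_le_norm_cart[of t] unfolding \<tau>_def by (intro sum_mono mult_mono) auto
  finally show ?thesis by (simp add: power2_eq_square ac_simps)
 qed
 have E2b: "\<bar>E2 i j\<bar> <= (\<kappa> * (real CARD('p) ^ 2 + r\<^sub>0)) * \<tau>\<^sup>2 * a n i j" if "i < n" "j < n" for i j
 proof -
  have "\<tau> * (\<kappa> * \<tau>\<^sup>2 * a n i j) <= r\<^sub>0 * (\<kappa> * \<tau>\<^sup>2 * a n i j)" using \<tau> \<kappa> a_nonneg by (intro mult_right_mono) auto
  then have "\<kappa> * \<tau> ^ 3 * a n i j <= r\<^sub>0 * (\<kappa> * \<tau>\<^sup>2 * a n i j)" by (simp add: power3_eq_cube power2_eq_square ac_simps)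
  moreover have "\<bar>E2 i j\<bar> <= \<bar>Q2 i j\<bar> + \<bar>E3 i j\<bar>" unfolding E2_def by (simp add: abs_le_iff) linarith
  ultimately have "\<bar>E2 i j\<bar> <= (real CARD('p) ^ 2 * \<kappa>) * \<tau>\<^sup>2 * a n i j + r\<^sub>0 * (\<kappa> * \<tau>\<^sup>2 * a n i j)"
   using Q2b[OF that] E3b[OF that] by linarith
  then show ?thesis by (simp add: algebra_simps)
 qed
 have kk: "\<kappa> <= k0" "real CARD('p) * \<kappa> <= k0" "\<kappa> * (real CARD('p) ^ 2 + r\<^sub>0) <= k0"
 proof -
  have "k0 = \<kappa> + real CARD('p) * \<kappa> + \<kappa> * (real CARD('p) ^ 2 + r\<^sub>0)" by (simp add: k0_def algebra_simps)
  moreover have "0 <= \<kappa>" "0 <= real CARD('p) * \<kappa>" "0 <= \<kappa> * (real CARD('p) ^ 2 + r\<^sub>0)" using \<kappa> \<Theta>_ball(1) by auto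
  ultimately show "\<kappa> <= k0" "real CARD('p) * \<kappa> <= k0" "\<kappa> * (real CARD('p) ^ 2 + r\<^sub>0) <= k0" by linarith+
 qed
 obtain Q x where Q: "orthogonal_family n Q" and X: "diagonalizes n Q x (conj_by n (VV n) D)"
  using spectral_pair[OF n, of D] Dsym by blast
 have DL: "conj_by n (VV n) D i j = (\<Sum>m\<in>UNIV. t $ m * X1 n m i j) + conj_by n (VV n) E2 i j" for i j
 proof -
  have "D = (%i j. L i j + E2 i j)" by (rule ext)+ (simp add: E2_def E3_def)
  then have "conj_by n (VV n) D = (%i j. conj_by n (VV n) L i j + conj_by n (VV n) E2 i j)" by (simp only: conj_by_add)
  moreover have "conj_by n (VV n) L = (%i j. \<Sum>m\<in>UNIV. t $ m * X1 n m i j)" unfolding X1_lin L_def ..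
  ultimately show ?thesis by simp
   qed
 have E23: "conj_by n (VV n) E2 i j = (\<Sum>m\<in>UNIV. t $ m * (\<Sum>l\<in>UNIV. t $ l * X2 n m l i j)) / 2 + conj_by n (VV n) E3 i j" for i j
 proof -
  have "conj_by n (VV n) E2 = (%i j. (1/2) * conj_by n (VV n) Q2 i j + conj_by n (VV n) E3 i j)"
   unfolding E2_def by (simp only: conj_by_add conj_by_scale)
  moreover have "conj_by n (VV n) Q2 = (%i j. \<Sum>m\<in>UNIV. t $ m * (\<Sum>l\<in>UNIV. t $ l * X2 n m l i j))"
   unfolding Q2_def X2_def by (simp only: conj_by_sum conj_by_scale)
  ultimately show ?thesis by simp
 qed
 have main: "\<bar>(\<Sum>k<n. ln (1 + x k) + (mulv n Q (%k. noise n k w) k)\<^sup>2 * (1 / (1 + x k) - 1))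
   - (- (\<Sum>m\<in>UNIV. t $ m * cqf n (X1 n m) (%k. noise n k w)) + (\<Sum>m\<in>UNIV. t $ m * (\<Sum>l\<in>UNIV. t $ l * fdot n (X1 n m) (X1 n l))) / 2)\<bar> <= 40 * expansion_const ^ 3 / b n"
 proof (rule local_expansion[OF b_ge_1[OF n] refl b10(1) \<rho>_nonneg b10(2) t(2) expansion_const_ge(1,2) Q X _ _ _ _ _ DL _ E23 ev2 ev3 ev4 b10(3)])
  show "op_le n (conj_by n (VV n) D) (expansion_const * norm t * \<rho> n)" "fnorm n (conj_by n (VV n) D) <= expansion_const * norm t * sqrt (real n)"
   by (rule env_H[OF n row Dsym Db[unfolded \<tau>_def] kk(1)]; simp)+
  have "fnorm n (conj_by n (VV n) L) <= expansion_const * norm t * sqrt (real n)"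
   by (rule env_H(2)[OF n row Lsym Lb[unfolded \<tau>_def] kk(2)]) simp_all
  then show "fnorm n (%i j. \<Sum>m\<in>UNIV. t $ m * X1 n m i j) <= expansion_const * norm t * sqrt (real n)" by (simp only: X1_lin L_def)
  show "op_le n (conj_by n (VV n) E2) (expansion_const * (norm t)\<^sup>2 * \<rho> n)" "fnorm n (conj_by n (VV n) E2) <= expansion_const * (norm t)\<^sup>2 * sqrt (real n)"
   by (rule env_H[OF n row E2sym E2b[unfolded \<tau>_def] kk(3)]; simp)+
  show "op_le n (conj_by n (VV n) E3) (expansion_const * norm t ^ 3 * \<rho> n)"
   by (rule env_H(1)[OF n row E3sym E3b[unfolded \<tau>_def] kk(1)]) simp_all
 qed
 have cd: "crit n (\<theta>0 + t) w - crit n \<theta>0 w = (\<Sum>k<n. ln (1 + x k) + (mulv n Q (%l. noise n l w) k)\<^sup>2 * (1 / (1 + x k) - 1))"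
  by (rule crit_difference(1)[OF n inT Q X[unfolded D_def]])
 have sq: "sqrt (real n) * (t \<bullet> score n w) = (\<Sum>m\<in>UNIV. t $ m * cqf n (X1 n m) (%k. noise n k w))"
  using n by (simp add: inner_vec_def score_def sum_distrib_left)
 have fq: "real n * (t \<bullet> (info n *v t)) = (\<Sum>m\<in>UNIV. t $ m * (\<Sum>l\<in>UNIV. t $ l * fdot n (X1 n m) (X1 n l))) / 2"
  using n by (simp add: inner_vec_def matrix_vector_mult_def info_def sum_divide_distrib sum_distrib_left ac_simps)
 show ?thesis unfolding cd sq fq by (rule main)
qed

text \<open>Chebyshev's inequality for the quadratic forms at the whitened first and second derivatives and at the products of first derivatives.\<close>
lemma inner_region:
 "\<exists>\<eta> C. 0 < C \<and> \<eta> \<longlonglongrightarrow> 0 \<and> (\<forall>\<^sub>F n in sequentially. \<exists>B\<in>events. prob B <= \<eta> n \<and>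
  (\<forall>w\<in>space P - B. norm (score n w) <= real CARD('p) * b n \<and> (\<forall>t. norm t < r\<^sub>0 --> norm t * sqrt (real n) <= (b n)\<^sup>2 -->
   expansion_error n t w <= C / b n)))"
proof -
 define F where "F = \<kappa> * sqrt S / c"
 have F: "0 <= F" using \<kappa> S c by (simp add: F_def)
 define p where "p = real CARD('p)"
 define \<eta> where "\<eta> n = (p * (2 * F\<^sup>2) + p * (p * (2 * F\<^sup>2)) + p * (p * (2 * (\<kappa> / c * F)\<^sup>2)) + 1) * (1 / (b n)\<^sup>2)" for n
 have "\<eta> \<longlonglongrightarrow> 0"
 proof -
  have "filterlim (%n. (b n)\<^sup>2) at_top sequentially" by (rule filterlim_pow_at_top[OF _ b_top]) simp
  then have "(%n. inverse ((b n)\<^sup>2)) \<longlonglongrightarrow> 0" by (rule tendsto_inverse_0_at_top)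
  then show ?thesis unfolding \<eta>_def by (intro tendsto_mult_right_zero) (simp add: inverse_eq_divide)
 qed
 moreover have "\<forall>\<^sub>F n in sequentially. \<exists>B\<in>events. prob B <= \<eta> n \<and>
  (\<forall>w\<in>space P - B. norm (score n w) <= real CARD('p) * b n \<and> (\<forall>t. norm t < r\<^sub>0 --> norm t * sqrt (real n) <= (b n)\<^sup>2 -->
   expansion_error n t w <= 40 * expansion_const ^ 3 / b n))"
  using row_sum b_pow \<rho>_pow filterlim_at_top[THEN iffD1, rule_format, OF b_top, of "2 * expansion_const"] eventually_ge_at_top[of 1]
 proof eventually_elim
  case (elim n)
  then have n: "1 <= n" by simp
  have b1: "1 <= b n" by (rule b_ge_1[OF n])
  define s where "s = sqrt (real n)"
  have s0: "0 < s" "s\<^sup>2 = real n" using n by (auto simp: s_def)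
  note z = noise_normal[OF n]
  define \<rho>' where "\<rho>' = \<rho> n"
  have r1: "1 <= \<rho>'" by (simp add: \<rho>'_def \<rho>_ge_1)
  define G where "G m l i j = (matmul n (X1 n m) (X1 n l) i j + matmul n (X1 n l) (X1 n m) i j) / 2" for m l i j
  note G_props = product_cqf[of n "X1 n m" "X1 n l" for m l, OF X1_sym X1_sym, folded G_def]
  define A1 where "A1 m = {w\<in>space P. s * b n < \<bar>cqf n (X1 n m) (%k. noise n k w)\<bar>}" for m
  define A2 where "A2 m l = {w\<in>space P. s * b n < \<bar>cqf n (X2 n m l) (%k. noise n k w)\<bar>}" for m l
  define A3 where "A3 m l = {w\<in>space P. s * \<rho>' * b n < \<bar>cqf n (G m l) (%k. noise n k w)\<bar>}" for m l
  define A4 where "A4 = {w\<in>space P. s * b n < vnorm n (%k. noise n k w)}"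
  have sb: "0 < s * b n" "0 < s * \<rho>' * b n" using s0 b1 r1 by auto
  have f1: "fnorm n (X1 n m) <= F * s" for m
   unfolding X1_def F_def s_def by (rule fnorm_env(2)[OF n]) (use D1_bound \<kappa> in auto)
  have f2: "fnorm n (X2 n m l) <= F * s" for m l
   unfolding X2_def F_def s_def by (rule fnorm_env(2)[OF n]) (use D2_bound \<kappa> in auto)
  have o1: "op_le n (X1 n m) (\<kappa> * \<rho>' / c)" for m
   unfolding X1_def \<rho>'_def by (rule op_env(2)[OF _ D1_sym _ _ n]) (use elim D1_bound \<kappa> in auto)
  have f3: "fnorm n (G m l) <= (\<kappa> * \<rho>' / c) * (F * s)" for m l
   by (rule order_trans[OF G_props(3)[OF o1]], rule mult_left_mono[OF f1]) (use \<kappa> r1 c in simp)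
  have [measurable]: "A1 m \<in> events" "A2 m l \<in> events" "A3 m l \<in> events" for m l
  proof -
   have [measurable]: "(%w. cqf n (X1 n m) (%k. noise n k w)) \<in> borel_measurable P" by (rule cqf_second_moment(3)[OF z]) (rule X1_sym)
   have [measurable]: "(%w. cqf n (X2 n m l) (%k. noise n k w)) \<in> borel_measurable P" by (rule cqf_second_moment(3)[OF z]) (rule X2_sym)
   have [measurable]: "(%w. cqf n (G m l) (%k. noise n k w)) \<in> borel_measurable P" by (rule cqf_second_moment(3)[OF z]) (rule G_props(2))
   show "A1 m \<in> events" "A2 m l \<in> events" "A3 m l \<in> events" unfolding A1_def A2_def A3_def by measurable
  qed
  have p1: "prob (A1 m) <= 2 * F\<^sup>2 * (1 / (b n)\<^sup>2)" for m
  proof -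
   have "prob (A1 m) <= 2 * (F * s)\<^sup>2 / (s * b n)\<^sup>2" unfolding A1_def by (rule cqf_tail[OF z _ f1 sb(1)]) (rule X1_sym)
   then show ?thesis using s0(1) by (simp add: power_mult_distrib)
  qed
  have p2: "prob (A2 m l) <= 2 * F\<^sup>2 * (1 / (b n)\<^sup>2)" for m l
  proof -
   have "prob (A2 m l) <= 2 * (F * s)\<^sup>2 / (s * b n)\<^sup>2" unfolding A2_def by (rule cqf_tail[OF z _ f2 sb(1)]) (rule X2_sym)
   then show ?thesis using s0(1) by (simp add: power_mult_distrib)
  qed
  have p3: "prob (A3 m l) <= 2 * (\<kappa> / c * F)\<^sup>2 * (1 / (b n)\<^sup>2)" for m l
  proof -
   have "prob (A3 m l) <= 2 * ((\<kappa> * \<rho>' / c) * (F * s))\<^sup>2 / (s * \<rho>' * b n)\<^sup>2" unfolding A3_def by (rule cqf_tail[OF z _ f3 sb(2)]) (rule G_props(2))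
   then show ?thesis using s0(1) r1 c by (simp add: power_mult_distrib power_divide)
  qed
  have p4: "prob A4 <= 1 * (1 / (b n)\<^sup>2)" "A4 \<in> events"
  proof -
   have zm: "noise n k \<in> borel_measurable P" if "k < n" for k using z that by (simp add: std_normal_family_def)
   have zi: "integrable P (%w. (noise n k w)\<^sup>2)" "expectation (%w. (noise n k w)\<^sup>2) = 1" if "k < n" for k
    using std_normal_integral[OF z that, of "%x. x\<^sup>2"] std_normal_moments(3) integrable_std_normal_distribution_moment[of 2] by auto
   have "prob A4 <= 1 * real n / (s * b n)\<^sup>2" "A4 \<in> events"
    unfolding A4_def by (rule vnorm_tail[where C = 1]; use zm zi sb in simp)+
   then show "prob A4 <= 1 * (1 / (b n)\<^sup>2)" "A4 \<in> events" using s0 n by (simp_all add: power_mult_distrib)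
  qed
  define B where "B = (\<Union>m. A1 m) \<union> (\<Union>m. \<Union>l. A2 m l) \<union> (\<Union>m. \<Union>l. A3 m l) \<union> A4"
  have Bev: "B \<in> events" unfolding B_def using p4(2) by measurable
  have union1: "prob (\<Union>m. A m) <= p * q" if "\<And>m. A m \<in> events" "\<And>m. prob (A m) <= q" for A :: "'p => 'w set" and q
  proof -
   have "prob (\<Union>m. A m) <= (\<Sum>m\<in>UNIV. prob (A m))" by (rule measure_UNION_le) (use that in auto)
   also have "... <= (\<Sum>m\<in>(UNIV::'p set). q)" by (intro sum_mono that)
   finally show ?thesis by (simp add: p_def)
  qed
  have "prob B <= prob (\<Union>m. A1 m) + prob (\<Union>m. \<Union>l. A2 m l) + prob (\<Union>m. \<Union>l. A3 m l) + prob A4"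
  proof -
   have "prob B <= prob ((\<Union>m. A1 m) \<union> (\<Union>m. \<Union>l. A2 m l) \<union> (\<Union>m. \<Union>l. A3 m l)) + prob A4"
    unfolding B_def by (rule measure_Un_le) (use p4 in measurable)
   moreover have "prob ((\<Union>m. A1 m) \<union> (\<Union>m. \<Union>l. A2 m l) \<union> (\<Union>m. \<Union>l. A3 m l)) <= prob ((\<Union>m. A1 m) \<union> (\<Union>m. \<Union>l. A2 m l)) + prob (\<Union>m. \<Union>l. A3 m l)"
    by (rule measure_Un_le) measurable
   moreover have "prob ((\<Union>m. A1 m) \<union> (\<Union>m. \<Union>l. A2 m l)) <= prob (\<Union>m. A1 m) + prob (\<Union>m. \<Union>l. A2 m l)"
    by (rule measure_Un_le) measurable
   ultimately show ?thesis by linarith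
  qed
  also have "prob (\<Union>m. A1 m) <= p * (2 * F\<^sup>2 * (1 / (b n)\<^sup>2))" by (rule union1) (use p1 in measurable)
  also have "prob (\<Union>m. \<Union>l. A2 m l) <= p * (p * (2 * F\<^sup>2 * (1 / (b n)\<^sup>2)))" by (intro union1 p2) measurable
  also have "prob (\<Union>m. \<Union>l. A3 m l) <= p * (p * (2 * (\<kappa> / c * F)\<^sup>2 * (1 / (b n)\<^sup>2)))" by (intro union1 p3) measurable
  also note p4(1)
  finally have pB: "prob B <= \<eta> n" unfolding \<eta>_def by (simp only: distrib_right mult.assoc)
  have "norm (score n w) <= real CARD('p) * b n \<and> (\<forall>t. norm t < r\<^sub>0 --> norm t * sqrt (real n) <= (b n)\<^sup>2 -->
   expansion_error n t w <= 40 * expansion_const ^ 3 / b n)"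
   if w: "w \<in> space P - B" for w
  proof (intro conjI allI impI)
   have g1: "\<bar>cqf n (X1 n m) (%k. noise n k w)\<bar> <= s * b n" for m using w by (auto simp: B_def A1_def not_less)
   have g2: "\<bar>cqf n (X2 n m l) (%k. noise n k w)\<bar> <= s * b n" for m l using w by (auto simp: B_def A2_def not_less)
   have g3: "\<bar>cqf n (G m l) (%k. noise n k w)\<bar> <= s * \<rho>' * b n" for m l using w by (auto simp: B_def A3_def not_less)
   have g4: "vnorm n (%k. noise n k w) <= s * b n" using w by (auto simp: B_def A4_def not_less)
   have "norm (score n w) <= (\<Sum>m\<in>UNIV. \<bar>score n w $ m\<bar>)" by (rule norm_le_l1_cart)
   also have "... <= (\<Sum>m\<in>(UNIV::'p set). b n)"
   proof (rule sum_mono)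
    fix m
    have "\<bar>score n w $ m\<bar> = \<bar>cqf n (X1 n m) (%k. noise n k w)\<bar> / s" using s0 by (simp add: score_def s_def abs_divide)
    also have "... <= s * b n / s" using g1 s0 by (intro divide_right_mono) auto
    finally show "\<bar>score n w $ m\<bar> <= b n" using s0 by simp
   qed
   finally show "norm (score n w) <= real CARD('p) * b n" by simp
   fix t :: "real^'p" assume t: "norm t < r\<^sub>0" "norm t * sqrt (real n) <= (b n)\<^sup>2"
   show "expansion_error n t w <= 40 * expansion_const ^ 3 / b n"
   proof (rule crit_expansion[OF n _ _ _ _ _ _ _ t])
    show "\<bar>dotn n (mulv n (X1 n m) (%k. noise n k w)) (mulv n (X1 n l) (%k. noise n k w)) - fdot n (X1 n m) (X1 n l)\<bar> <= sqrt (real n) * \<rho> n * b n" for m l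
     unfolding G_props(1) using g3[of m l] by (simp add: s_def \<rho>'_def)
   qed (use elim g2 g4 in \<open>auto simp: s_def\<close>)
  qed
  with pB Bev show ?case by blast
 qed
 moreover have "0 < 40 * expansion_const ^ 3" using expansion_const_ge(1) by simp
 ultimately show ?thesis by blast
qed

end

section \<open>Asymptotic normality\<close>

text \<open>The facts about the square root and its inverse that are needed for a matrix bounded below by \<open>lo\<close>.\<close>
lemma psd_sqrt_bounded_below:
 fixes M :: "real^'p^'p"
 assumes sym: "transpose M = M" and lo: "0 < lo" "\<And>v. lo * (norm v)\<^sup>2 <= v \<bullet> (M *v v)"
 defines "B \<equiv> psd_sqrt M" and "B' \<equiv> matrix_inv (psd_sqrt M)"
 shows "u \<bullet> (B *v v) = (B *v u) \<bullet> v" "B *v (B *v v) = M *v v" "(norm (B *v v))\<^sup>2 = v \<bullet> (M *v v)"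
  "B *v (B' *v v) = v" "B' *v (B *v v) = v" "lo * (norm (B' *v v))\<^sup>2 <= (norm v)\<^sup>2"
proof -
 have pd: "0 < v \<bullet> (M *v v)" if "v \<noteq> 0" for v
 proof -
  have "0 < lo * (norm v)\<^sup>2" using lo(1) that by simp
  then show ?thesis using lo(2)[of v] by linarith
 qed
 note ps = psd_sqrt_pos_def[OF sym pd]
 show 1: "u \<bullet> (B *v v) = (B *v u) \<bullet> v" for u v
  using ps(1) unfolding matrix_symmetric_iff B_def by blast
 show 2: "B *v (B *v v) = M *v v" for v using ps(2) by (simp add: B_def matrix_vector_mul_assoc)
 show 3: "(norm (B *v v))\<^sup>2 = v \<bullet> (M *v v)" for v
  using 1[of v "B *v v"] by (simp add: 2 power2_norm_eq_inner)
 have "v = 0" if "B *v v = 0" for v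
 proof (rule ccontr)
  assume "v \<noteq> 0"
  then show False using pd[of v] 3[of v] that by simp
 qed
 then have inv: "invertible B" unfolding invertible_left_inverse matrix_left_invertible_ker by blast
 note mi = someI_ex[OF inv[unfolded invertible_def], folded matrix_inv_def]
 show 4: "B *v (B' *v v) = v" for v
  using mi by (simp add: B'_def B_def[symmetric] matrix_vector_mul_assoc)
 show "B' *v (B *v v) = v"
  using mi by (simp add: B'_def B_def[symmetric] matrix_vector_mul_assoc)
 show "lo * (norm (B' *v v))\<^sup>2 <= (norm v)\<^sup>2" using lo(2)[of "B' *v v"] 3[of "B' *v v"] by (simp add: 4)
qed

context gaussian_array begin

text \<open>The random vector that carries the limit law.\<close>
definition std_score :: "nat => 'w => real^'p" where
 "std_score n w = (if 1 <= n then (1/2) *\<^sub>R (matrix_inv (psd_sqrt (info n)) *v score n w) else 0)"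

lemma score_measurable: "1 <= n ==> score n \<in> borel_measurable P"
proof -
 assume n: "1 <= n"
 have [measurable]: "(%w. cqf n (X1 n m) (%k. noise n k w)) \<in> borel_measurable P" for m
  by (rule cqf_second_moment(3)[OF noise_normal[OF n]]) (rule X1_sym)
 have "(%w. score n w \<bullet> i) \<in> borel_measurable P" if i: "i \<in> Basis" for i
 proof -
  obtain m where m: "i = axis m 1" using i by (auto simp: Basis_vec_def)
  have "(%w. cqf n (X1 n m) (%k. noise n k w) / sqrt (real n)) \<in> borel_measurable P" by measurable
  then show ?thesis by (simp add: m inner_axis score_def)
 qed
 then show ?thesis using borel_measurable_euclidean_space[of "score n" P] by blast
qed

lemma mv_measurable: "X \<in> borel_measurable P ==> (%w. (A :: real^'p^'p) *v X w) \<in> borel_measurable P"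
proof -
 assume X: "X \<in> borel_measurable P"
 have "(%x. A *v x) \<in> borel_measurable borel"
  by (intro borel_measurable_continuous_onI linear_continuous_on linear_linear[THEN iffD1] matrix_vector_mul_bounded_linear)
 from measurable_compose[OF X this] show ?thesis .
qed

lemma std_score_measurable: "std_score n \<in> borel_measurable P"
proof (cases "1 <= n")
 case True
 have "(%w. (1/2) *\<^sub>R (matrix_inv (psd_sqrt (info n)) *v score n w)) \<in> borel_measurable P"
  by (intro borel_measurable_scaleR borel_measurable_const mv_measurable score_measurable True)
 then show ?thesis unfolding std_score_def[abs_def] using True by simp
next
 case False then show ?thesis unfolding std_score_def[abs_def] by simp
qed

text \<open>A linear functional of the standardised score is a quadratic form in \<open>noise\<close> whose matrix has Frobenius norm exactly
\<open>norm l / sqrt 2\<close> and operator norm tending to 0.\<close>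
lemma score_limit:
 "(%n. \<integral>w. cos (l \<bullet> std_score n w - \<alpha>) \<partial>P) \<longlonglongrightarrow> exp (- (norm l)\<^sup>2 / 2) * cos \<alpha>"
proof -
 obtain lo where lo: "lo > 0" and Fl: "\<forall>\<^sub>F n in sequentially. \<forall>v. lo * (norm v)\<^sup>2 <= v \<bullet> (info n *v v)"
  using info_lower by blast
 obtain C1 where C1: "\<forall>a. \<bar>a\<bar> <= 1 --> cmod ((CLINT x|std_gauss. iexp (a * (x\<^sup>2 - 1))) - of_real (exp (- a\<^sup>2))) <= C1 * \<bar>a\<bar> ^ 3"
  using std_normal_char_sq_approx by blast
 define C where "C = max C1 0"
 have C: "\<forall>a. \<bar>a\<bar> <= 1 --> cmod ((CLINT x|std_gauss. iexp (a * (x\<^sup>2 - 1))) - of_real (exp (- a\<^sup>2))) <= C * \<bar>a\<bar> ^ 3" "0 <= C"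
 proof (intro allI impI)
  fix a :: real assume "\<bar>a\<bar> <= 1"
  then have "cmod ((CLINT x|std_gauss. iexp (a * (x\<^sup>2 - 1))) - of_real (exp (- a\<^sup>2))) <= C1 * \<bar>a\<bar> ^ 3" using C1 by blast
  also have "... <= C * \<bar>a\<bar> ^ 3" by (rule mult_right_mono) (auto simp: C_def)
  finally show "cmod ((CLINT x|std_gauss. iexp (a * (x\<^sup>2 - 1))) - of_real (exp (- a\<^sup>2))) <= C * \<bar>a\<bar> ^ 3" .
 qed (simp add: C_def)
 define A where "A = real CARD('p) * \<kappa> / c * (norm l / sqrt lo)"
 have A0: "0 <= A" using \<kappa> c lo by (simp add: A_def)
 define \<epsilon> where "\<epsilon> n = A * inverse (b n)" for n
 have \<epsilon>0: "\<epsilon> \<longlonglongrightarrow> 0" unfolding \<epsilon>_def by (rule tendsto_mult_right_zero[OF tendsto_inverse_0_at_top[OF b_top]])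
 define L where "L = exp (- (norm l)\<^sup>2 / 2)"
 define \<phi> where "\<phi> n = (CLINT w|P. iexp (l \<bullet> std_score n w))" for n
 have est: "\<forall>\<^sub>F n in sequentially. norm (\<phi> n - of_real L) <= C * \<epsilon> n * ((norm l)\<^sup>2 / 2)"
  using Fl row_sum \<rho>_pow order_tendstoD(2)[OF \<epsilon>0, of 1, simplified] eventually_ge_at_top[of 1]
 proof eventually_elim
  case (elim n)
  then have n: "1 <= n" by simp
  have b1: "1 <= b n" by (rule b_ge_1[OF n])
  define B where "B = psd_sqrt (info n)"
  define B' where "B' = matrix_inv (psd_sqrt (info n))"
  note ps = psd_sqrt_bounded_below[OF info_sym lo elim(1)[rule_format], folded B_def B'_def]
  define m where "m = B' *v l"
  define v where "v = (1 / (2 * sqrt (real n))) *\<^sub>R m"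
  define G where "G = (%i j. \<Sum>k\<in>UNIV. v $ k * X1 n k i j)"
  have lT: "l \<bullet> std_score n w = cqf n G (%k. noise n k w)" for w
  proof -
   have "l \<bullet> (B' *v score n w) = (B *v m) \<bullet> (B' *v score n w)" by (simp add: m_def ps(4))
   also have "... = m \<bullet> score n w" by (simp add: ps(1)[symmetric] ps(4))
   finally have "l \<bullet> std_score n w = (1/2) * (m \<bullet> score n w)" using n by (simp add: std_score_def B'_def)
   also have "... = (\<Sum>k\<in>UNIV. v $ k * cqf n (X1 n k) (%k. noise n k w))"
    by (simp add: inner_vec_def v_def score_def sum_distrib_left)
   also have "... = cqf n G (%k. noise n k w)" unfolding G_def by (rule cqf_sum[symmetric])
   finally show ?thesis .
  qed
  have mn: "lo * (norm m)\<^sup>2 <= (norm l)\<^sup>2" unfolding m_def by (rule ps(6))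
  have fG: "(fnorm n G)\<^sup>2 = (norm l)\<^sup>2 / 2"
  proof -
   have "(fnorm n G)\<^sup>2 = v \<bullet> (info n *v v) * (2 * real n)" using n by (simp add: info_quadratic G_def)
   also have "v \<bullet> (info n *v v) = (norm (B *v v))\<^sup>2" by (simp add: ps(3))
   also have "B *v v = (1 / (2 * sqrt (real n))) *\<^sub>R l" by (simp add: v_def matrix_vector_mult_scaleR m_def ps(4))
   also have "(norm ((1 / (2 * sqrt (real n))) *\<^sub>R l))\<^sup>2 * (2 * real n) = (norm l)\<^sup>2 / 2"
    using n by (simp add: power_mult_distrib power_divide)
   finally show ?thesis .
  qed
  have nm: "norm m <= norm l / sqrt lo"
  proof -
   have "(norm m)\<^sup>2 <= (norm l / sqrt lo)\<^sup>2" using mn lo by (simp add: power_divide pos_le_divide_eq mult.commute)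
   then show ?thesis by (rule power2_le_imp_le) (use lo in simp)
  qed
  have op: "op_le n G (\<epsilon> n)"
  proof -
   have "op_le n (conj_by n (VV n) (%i j. \<Sum>m\<in>UNIV. v $ m * D1 n m i j)) (real CARD('p) * \<kappa> * norm v * \<rho> n / c)"
   proof (rule op_env(2)[OF elim(2) _ D1_comb_bound _ n])
    show "(\<Sum>m\<in>UNIV. v $ m * D1 n m i j) = (\<Sum>m\<in>UNIV. v $ m * D1 n m j i)" for i j by (simp only: D1_sym[of n _ i j])
   qed (use \<kappa> in \<open>auto intro!: mult_nonneg_nonneg\<close>)
   moreover have "real CARD('p) * \<kappa> * norm v * \<rho> n / c <= \<epsilon> n"
   proof -
    have s0: "0 < sqrt (real n)" using n by simp
    have "\<rho> n * b n <= \<rho> n * b n ^ 10" using \<rho>_nonneg b1 self_le_power[OF b1, of 10] by (intro mult_left_mono) auto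
    then have "\<rho> n * b n <= sqrt (real n)" using elim(3) by linarith
    then have rb: "\<rho> n / sqrt (real n) <= inverse (b n)" using s0 b1 by (simp add: field_simps)
    have "real CARD('p) * \<kappa> * norm v * \<rho> n / c = (real CARD('p) * \<kappa> / c * norm m) * (\<rho> n / sqrt (real n)) / 2"
     by (simp add: v_def)
    also have "... <= (real CARD('p) * \<kappa> / c * norm m) * (\<rho> n / sqrt (real n))"
    proof -
     have "0 <= (real CARD('p) * \<kappa> / c * norm m) * (\<rho> n / sqrt (real n))"
      using \<kappa> c \<rho>_nonneg[of n] by (intro mult_nonneg_nonneg divide_nonneg_nonneg) auto
     moreover have "x / 2 <= x" if "0 <= x" for x :: real using that by simp
     ultimately show ?thesis by blast
    qed
    also have "... <= A * inverse (b n)" unfolding A_def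
     using nm rb \<kappa> c \<rho>_nonneg lo by (intro mult_mono mult_left_mono) auto
    finally show ?thesis by (simp add: \<epsilon>_def)
   qed
   ultimately show ?thesis unfolding G_def X1_lin by (rule op_le_mono)
  qed
  have Gsym: "G i j = G j i" for i j unfolding G_def by (simp only: X1_sym[of n _ i j])
  have "cmod ((CLINT w|P. iexp (cqf n G (%k. noise n k w))) - of_real (exp (- (fnorm n G)\<^sup>2))) <= C * \<epsilon> n * (fnorm n G)\<^sup>2"
   by (rule cqf_char[OF noise_normal[OF n] Gsym C op]) (use elim(4) in simp)
  then show ?case unfolding \<phi>_def lT fG L_def by simp
 qed
 have "(%n. C * \<epsilon> n * ((norm l)\<^sup>2 / 2)) \<longlonglongrightarrow> 0"
  using tendsto_mult_left_zero[OF tendsto_mult_right_zero[OF \<epsilon>0, of C], of "(norm l)\<^sup>2 / 2"] by simp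
 from Lim_null_comparison[OF est this] have "(%n. \<phi> n - of_real L) \<longlonglongrightarrow> 0" .
 then have \<phi>: "\<phi> \<longlonglongrightarrow> of_real L" by (rule LIM_zero_cancel)
 have "(%n. Re (iexp (- \<alpha>) * \<phi> n)) \<longlonglongrightarrow> Re (iexp (- \<alpha>) * of_real L)"
  by (intro tendsto_Re tendsto_mult tendsto_const \<phi>)
 moreover have "(\<integral>w. cos (l \<bullet> std_score n w - \<alpha>) \<partial>P) = Re (iexp (- \<alpha>) * \<phi> n)" for n
  unfolding \<phi>_def using std_score_measurable[of n] by (intro cos_shift_eq_Re) measurable
 moreover have "Re (iexp (- \<alpha>) * of_real L) = L * cos \<alpha>" by (simp add: Re_exp)
 ultimately show ?thesis by (simp only: L_def)
qed

text \<open>The quadratic approximation exceeds its minimum at the estimator by at most twice the approximation error; this excess is the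
squared distance between the two vectors.\<close>
lemma estimator_near_score:
 assumes mle: "\<And>n w. 1 <= n ==> w \<in> space P ==> \<theta>h n w \<in> \<Theta> \<and> (\<forall>\<theta>\<in>\<Theta>. crit n (\<theta>h n w) w <= crit n \<theta> w)"
  and \<delta>': "0 < \<delta>'"
 shows "(%n. prob {w \<in> space P. \<delta>' < norm (sqrt (real n) *\<^sub>R (psd_sqrt (info n) *v (\<theta>h n w - \<theta>0)) - std_score n w)}) \<longlonglongrightarrow> 0"
proof -
 obtain lo where lo: "lo > 0" and Fl: "\<forall>\<^sub>F n in sequentially. \<forall>v. lo * (norm v)\<^sup>2 <= v \<bullet> (info n *v v)"
  using info_lower by blast
 obtain \<eta>1 where \<eta>1: "\<eta>1 \<longlonglongrightarrow> 0" and ev1: "\<forall>\<^sub>F n in sequentially. \<exists>B\<in>events. prob B <= \<eta>1 n \<and>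
  (\<forall>w\<in>space P - B. far_excluded n w)"
  using outer_region by (elim exE conjE) (rule that)
 obtain \<eta>2 C where C: "0 < C" and \<eta>2: "\<eta>2 \<longlonglongrightarrow> 0" and ev2: "\<forall>\<^sub>F n in sequentially. \<exists>B\<in>events. prob B <= \<eta>2 n \<and>
  (\<forall>w\<in>space P - B. norm (score n w) <= real CARD('p) * b n \<and> (\<forall>t. norm t < r\<^sub>0 --> norm t * sqrt (real n) <= (b n)\<^sup>2 -->
   expansion_error n t w <= C / b n))"
  using inner_region by (elim exE conjE) (rule that)
 define g where "g = real CARD('p) / lo + 1 / r\<^sub>0 + 2 * C / \<delta>'\<^sup>2 + 1"
 have g: "real CARD('p) / lo <= g" "1 / r\<^sub>0 < g" "2 * C / \<delta>'\<^sup>2 <= g" "1 <= g"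
 proof -
  have "0 <= real CARD('p) / lo" "0 <= 1 / r\<^sub>0" "0 <= 2 * C / \<delta>'\<^sup>2" using lo \<Theta>_ball(1) C by auto
  then show "real CARD('p) / lo <= g" "1 / r\<^sub>0 < g" "2 * C / \<delta>'\<^sup>2 <= g" "1 <= g" unfolding g_def by linarith+
 qed
 have "\<forall>\<^sub>F n in sequentially. prob {w \<in> space P. \<delta>' < norm (sqrt (real n) *\<^sub>R (psd_sqrt (info n) *v (\<theta>h n w - \<theta>0)) - std_score n w)} <= \<eta>1 n + \<eta>2 n"
  using Fl ev1 ev2 b_pow filterlim_at_top[THEN iffD1, rule_format, OF b_top, of g] eventually_ge_at_top[of 1]
 proof eventually_elim
  case (elim n)
  then have n: "1 <= n" by simp
  have bg: "g <= b n" using elim by simp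
  have b1: "1 <= b n" by (rule b_ge_1[OF n])
  define s where "s = sqrt (real n)"
  have s0: "0 < s" "s\<^sup>2 = real n" using n by (auto simp: s_def)
  define B where "B = psd_sqrt (info n)"
  define B' where "B' = matrix_inv (psd_sqrt (info n))"
  note ps = psd_sqrt_bounded_below[OF info_sym lo elim(1)[rule_format], folded B_def B'_def]
  obtain E1 where E1: "E1 \<in> events" "prob E1 <= \<eta>1 n"
   "\<forall>w\<in>space P - E1. \<forall>\<theta>\<in>\<Theta>. (b n)\<^sup>2 <= norm (\<theta> - \<theta>0) * s --> crit n \<theta>0 w < crit n \<theta> w"
   using elim(2) unfolding s_def by blast
  obtain E2 where E2: "E2 \<in> events" "prob E2 <= \<eta>2 n"
   "\<forall>w\<in>space P - E2. norm (score n w) <= real CARD('p) * b n \<and> (\<forall>t. norm t < r\<^sub>0 --> norm t * s <= (b n)\<^sup>2 -->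
    \<bar>(crit n (\<theta>0 + t) w - crit n \<theta>0 w) - (- (s * (t \<bullet> score n w)) + real n * (t \<bullet> (info n *v t)))\<bar> <= C / b n)"
   using elim(3) unfolding s_def by blast
  have small: "norm t < r\<^sub>0" if "norm t * s <= (b n)\<^sup>2" for t :: "real^'p"
  proof -
   have "b n * (b n)\<^sup>2 <= b n ^ 10" using b1 power_increasing[of 3 10 "b n"] by (simp add: power3_eq_cube power2_eq_square)
   then have "b n * (norm t * s) <= s" using mult_left_mono[OF that, of "b n"] b1 elim(4) unfolding s_def by linarith
   then have "b n * norm t <= 1" using s0 by (simp add: mult.assoc[symmetric])
   moreover have "1 / r\<^sub>0 < b n" using g(2) bg by linarith
   then have "1 < b n * r\<^sub>0" using \<Theta>_ball(1) by (simp add: divide_less_eq)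
   ultimately have "b n * norm t < b n * r\<^sub>0" by linarith
   then show ?thesis using b1 by simp
  qed
  have "norm (s *\<^sub>R (B *v (\<theta>h n w - \<theta>0)) - std_score n w) <= \<delta>'" if w: "w \<in> space P - (E1 \<union> E2)" for w
  proof -
   define th where "th = \<theta>h n w - \<theta>0"
   have \<theta>h: "\<theta>0 + th \<in> \<Theta>" "\<And>\<theta>. \<theta> \<in> \<Theta> ==> crit n (\<theta>0 + th) w <= crit n \<theta> w"
    using mle[OF n, of w] w by (auto simp: th_def)
   have ths: "norm th * s <= (b n)\<^sup>2"
   proof (rule ccontr)
    assume "\<not> norm th * s <= (b n)\<^sup>2"
    then have "(b n)\<^sup>2 <= norm ((\<theta>0 + th) - \<theta>0) * s" by simp
    then have "crit n \<theta>0 w < crit n (\<theta>0 + th) w" using E1(3) w \<theta>h(1) by blast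
    then show False using \<theta>h(2)[OF \<theta>0_in] by linarith
   qed
 \<comment> \<open>The minimiser of the quadratic approximation, relative to the true parameter.\<close>
   define ts where "ts = (1 / (2 * s)) *\<^sub>R (B' *v (B' *v score n w))"
   have Scb: "norm (score n w) <= real CARD('p) * b n" using E2(3) w by blast
   have tss: "norm ts * s <= (b n)\<^sup>2"
   proof -
    have "lo * (lo * (norm (B' *v (B' *v score n w)))\<^sup>2) <= lo * (norm (B' *v score n w))\<^sup>2" using ps(6)[of "B' *v score n w"] lo by (intro mult_left_mono) auto
    also have "... <= (norm (score n w))\<^sup>2" by (rule ps(6))
    also have "... <= (real CARD('p) * b n)\<^sup>2" using Scb by (intro power_mono) auto
    finally have "(lo * norm (B' *v (B' *v score n w)))\<^sup>2 <= (real CARD('p) * b n)\<^sup>2" by (simp add: power_mult_distrib power2_eq_square ac_simps)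
    then have "lo * norm (B' *v (B' *v score n w)) <= real CARD('p) * b n" by (rule power2_le_imp_le) (use b1 in simp)
    then have "norm (B' *v (B' *v score n w)) <= real CARD('p) / lo * b n" using lo by (simp add: pos_le_divide_eq mult.commute)
    also have "... <= b n * b n" using g(1) bg b1 by (intro mult_right_mono) auto
    finally have "norm (B' *v (B' *v score n w)) <= (b n)\<^sup>2" by (simp add: power2_eq_square)
    moreover have "norm ts * s = norm (B' *v (B' *v score n w)) / 2" using s0 by (simp add: ts_def)
    ultimately show ?thesis using norm_ge_zero[of "B' *v (B' *v score n w)"] by linarith
   qed
   define q where "q t = - (s * (t \<bullet> score n w)) + real n * (t \<bullet> (info n *v t))" for t
   have ex: "\<bar>(crit n (\<theta>0 + t) w - crit n \<theta>0 w) - q t\<bar> <= C / b n" if "norm t * s <= (b n)\<^sup>2" for t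
    using E2(3) w small[OF that] that unfolding q_def by blast
   have "crit n (\<theta>0 + th) w <= crit n (\<theta>0 + ts) w" by (rule \<theta>h(2)[OF near_in[OF small[OF tss]]])
   then have qq: "q th - q ts <= 2 * (C / b n)" using ex[OF ths] ex[OF tss] by linarith
   have St: "s *\<^sub>R (2 *\<^sub>R (info n *v ts)) = score n w"
    using s0 by (simp add: ts_def ps(2)[symmetric] matrix_vector_mult_scaleR ps(4))
   have FS: "u \<bullet> (info n *v v) = (info n *v u) \<bullet> v" for u v
    using info_sym[of n] unfolding matrix_symmetric_iff by blast
   have "q th - q ts = real n * ((th - ts) \<bullet> (info n *v (th - ts)))"
   proof -
    have e: "s * (t \<bullet> score n w) = real n * (2 * (t \<bullet> (info n *v ts)))" for t
     unfolding St[symmetric] s0(2)[symmetric] by (simp add: power2_eq_square)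
    have "th \<bullet> (info n *v ts) = ts \<bullet> (info n *v th)" using FS[of th ts] by (simp add: inner_commute)
    then show ?thesis unfolding q_def e
     by (simp add: matrix_vector_mult_diff_distrib inner_diff_left inner_diff_right algebra_simps)
   qed
   also have "... = (norm (s *\<^sub>R (B *v (th - ts))))\<^sup>2" by (simp add: ps(3)[symmetric] s0(2)[symmetric] power_mult_distrib)
   also have "s *\<^sub>R (B *v (th - ts)) = s *\<^sub>R (B *v th) - std_score n w"
   proof -
    have "s *\<^sub>R (B *v ts) = std_score n w" using s0 n by (simp add: ts_def std_score_def matrix_vector_mult_scaleR ps(4) B'_def[symmetric])
    then show ?thesis by (simp add: matrix_vector_mult_diff_distrib scaleR_right_diff_distrib)
   qed
   finally have "(norm (s *\<^sub>R (B *v th) - std_score n w))\<^sup>2 <= 2 * C / b n" using qq by simp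
   also have "... <= \<delta>'\<^sup>2"
   proof -
    have "2 * C / \<delta>'\<^sup>2 <= b n" using g(3) bg by linarith
    then show ?thesis using \<delta>' b1 by (simp add: divide_le_eq mult.commute)
   qed
   finally show ?thesis unfolding th_def by (rule power2_le_imp_le) (use \<delta>' in simp)
  qed
  then have "{w \<in> space P. \<delta>' < norm (s *\<^sub>R (B *v (\<theta>h n w - \<theta>0)) - std_score n w)} \<subseteq> E1 \<union> E2"
   by (fastforce simp: not_le[symmetric])
  then have "prob {w \<in> space P. \<delta>' < norm (s *\<^sub>R (B *v (\<theta>h n w - \<theta>0)) - std_score n w)} <= prob (E1 \<union> E2)"
   by (rule finite_measure_mono) (use E1 E2 in auto)
  also have "... <= prob E1 + prob E2" by (rule measure_Un_le) (use E1 E2 in auto)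
  finally show ?case using E1(2) E2(2) unfolding s_def B_def by linarith
 qed
 then show ?thesis
  by (rule tendsto_sandwich[OF always_eventually[OF allI[OF measure_nonneg]] _ tendsto_const])
    (use tendsto_add[OF \<eta>1 \<eta>2] in simp)
qed

theorem estimator_asymptotically_normal:
 assumes meas: "\<And>n. 1 <= n ==> \<theta>h n \<in> borel_measurable P"
  and mle: "\<And>n w. 1 <= n ==> w \<in> space P ==> \<theta>h n w \<in> \<Theta> \<and> (\<forall>\<theta>\<in>\<Theta>. crit n (\<theta>h n w) w <= crit n \<theta> w)"
 shows "converges_in_distribution P (%n w. sqrt (real n) *\<^sub>R (psd_sqrt (info n) *v (\<theta>h n w - \<theta>0))) std_normal_vec"
proof (rule converges_in_distribution_slutsky[OF prob_space_axioms std_score_measurable _ score_limit estimator_near_score[OF mle]])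
 fix n
 show "(%w. sqrt (real n) *\<^sub>R (psd_sqrt (info n) *v (\<theta>h n w - \<theta>0))) \<in> borel_measurable P"
 proof (cases "1 <= n")
  case True
  then show ?thesis using meas by (intro borel_measurable_scaleR borel_measurable_const mv_measurable borel_measurable_diff)
 next
  case False then show ?thesis by (simp add: not_le)
 qed
qed

theorem fisher_eigenvalue_bounds:
 "0 < liminf (%n. ereal (Min (eigenvalues (info n))))"
 "liminf (%n. ereal (Min (eigenvalues (info n)))) <= limsup (%n. ereal (Max (eigenvalues (info n))))"
 "limsup (%n. ereal (Max (eigenvalues (info n)))) < \<infinity>"
proof -
 obtain lo where lo: "lo > 0" and Fl: "\<forall>\<^sub>F n in sequentially. \<forall>v. lo * (norm v)\<^sup>2 <= v \<bullet> (info n *v v)"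
  using info_lower by blast
 note ev = eigenvalues_symmetric[OF info_sym]
 have "\<forall>\<^sub>F n in sequentially. ereal lo <= ereal (Min (eigenvalues (info n)))"
  using Fl
 proof eventually_elim
  case (elim n)
  have "lo <= Min (eigenvalues (info n))"
   by (rule Min.boundedI[OF ev(1,2)], rule ev(3), assumption) (rule elim[rule_format])
  then show ?case by simp
 qed
 then have "ereal lo <= liminf (%n. ereal (Min (eigenvalues (info n))))" by (rule Liminf_bounded)
 moreover have "0 < ereal lo" using lo by simp
 ultimately show "0 < liminf (%n. ereal (Min (eigenvalues (info n))))" by (rule less_le_trans[rotated])
 have "\<forall>\<^sub>F n in sequentially. ereal (Max (eigenvalues (info n))) <= ereal info_upper_const"
  using eventually_ge_at_top[of 1]
 proof eventually_elim
  case (elim n)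
  have "Max (eigenvalues (info n)) <= info_upper_const"
   by (rule Max.boundedI[OF ev(1,2)], rule ev(4), assumption) (rule info_upper[OF elim])
  then show ?case by simp
 qed
 then have "limsup (%n. ereal (Max (eigenvalues (info n)))) <= ereal info_upper_const" by (rule Limsup_bounded)
 then show "limsup (%n. ereal (Max (eigenvalues (info n)))) < \<infinity>" by (rule le_less_trans) simp
 have "liminf (%n. ereal (Min (eigenvalues (info n)))) <= limsup (%n. ereal (Min (eigenvalues (info n))))"
  by (rule Liminf_le_Limsup) simp
 also have "... <= limsup (%n. ereal (Max (eigenvalues (info n))))"
 proof (rule Limsup_mono, rule always_eventually, rule allI)
  fix n
  obtain x where x: "x \<in> eigenvalues (info n)" using ev(2)[of n] by blast
  have "Min (eigenvalues (info n)) <= Max (eigenvalues (info n))"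
   by (rule order_trans[OF Min_le[OF ev(1) x] Max_ge[OF ev(1) x]])
  then show "ereal (Min (eigenvalues (info n))) <= ereal (Max (eigenvalues (info n)))" by simp
 qed
 finally show "liminf (%n. ereal (Min (eigenvalues (info n)))) <= limsup (%n. ereal (Max (eigenvalues (info n))))" .
qed

end

section \<open>Row sums of the envelope\<close>

lemma power_eventually_dominates:
 fixes A e :: real assumes "0 < e"
 shows "\<forall>\<^sub>F n in sequentially. A <= real n powr e"
proof -
 have "filterlim (%n. real n powr e) at_top sequentially"
  using assms by real_asymp
 then show ?thesis unfolding filterlim_at_top by blast
qed

lemma power_exp_vanishes:
 fixes C e :: real assumes "0 < C" "0 < e"
 shows "(%n. real n ^ q * exp (- C * (real n powr e) ^ 4)) \<longlonglongrightarrow> 0"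
proof -
 have "((%x::real. x powr (real q / (4 * e)) * exp (- C * x)) \<longlongrightarrow> 0) at_top"
  using assms(1) by real_asymp
 moreover have "filterlim (%n. real n powr (4 * e)) at_top sequentially"
  using assms(2) by real_asymp
 ultimately have lim: "(%n. (real n powr (4 * e)) powr (real q / (4 * e)) * exp (- C * (real n powr (4 * e)))) \<longlonglongrightarrow> 0"
  by (rule filterlim_compose)
 show ?thesis
 proof (rule Lim_transform_eventually[OF lim])
  show "\<forall>\<^sub>F n in sequentially. (real n powr (4 * e)) powr (real q / (4 * e)) * exp (- C * (real n powr (4 * e)))
    = real n ^ q * exp (- C * (real n powr e) ^ 4)"
   using eventually_ge_at_top[of 1]
  proof eventually_elim
   case (elim n)
   then have n: "0 < real n" by simp
   have "(real n powr (4 * e)) powr (real q / (4 * e)) = real n ^ q"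
    using n assms(2) by (simp add: powr_powr powr_realpow)
   moreover have "real n powr (4 * e) = (real n powr e) ^ 4"
    using n by (simp add: powr_powr powr_realpow[symmetric] mult.commute)
   ultimately show ?case by simp
  qed
 qed
qed

text \<open>Index pairs are split at distance \<open>L\<close>.  Near pairs are counted, far pairs contribute little to the sums of squares.  For the row sums,
\<open>L\<close> is a small power of \<open>n\<close>, and the Cauchy-Schwarz inequality over the \<open>n\<close> far indices costs a factor \<open>sqrt n\<close> which the power of
\<open>L\<close> gained from \<open>m < 2 * \<gamma>\<close> improves upon.\<close>
lemma envelope_sums:
 fixes r :: "nat => nat => nat => real" and \<gamma> :: real and m :: nat
 assumes count: "\<And>n i x. 1 <= n ==> i < n ==> 0 <= x ==> real (card {j \<in> {..<n}. r n i j <= x}) <= C * (1 + x) ^ m"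
  and C: "1 <= C" and \<gamma>: "real m < 2 * \<gamma>"
  and r0: "\<And>n i j. 0 <= r n i j" and rsym: "\<And>n i j. r n i j = r n j i"
 defines "a \<equiv> %n i j. 1 / (1 + r n i j powr \<gamma>)"
 shows "\<exists>S\<ge>0. \<forall>n\<ge>1. \<forall>i<n. (\<Sum>j<n. (a n i j)\<^sup>2) <= S"
  and "0 < \<epsilon> ==> \<exists>B>0. \<forall>n\<ge>1. truncates n (a n) B \<epsilon>"
  and "\<exists>\<rho> e. 0 < e \<and> (\<forall>n. 1 <= \<rho> n) \<and> (\<forall>n\<ge>1. \<forall>i<n. (\<Sum>j<n. a n i j) <= \<rho> n)
    \<and> (\<forall>\<^sub>F n in sequentially. \<rho> n * (real n powr e) ^ 10 <= sqrt (real n))"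
proof -
 define K where "K = C * 4 ^ m / (1 - 2 powr (real m - 2 * \<gamma>))"
 have q: "2 powr (real m - 2 * \<gamma>) < 1" using \<gamma> by (simp add: powr_less_one)
 have K0: "0 < K" using q C by (simp add: K_def)
 have a0: "0 <= a n i j" for n i j by (simp add: a_def)
 have a1: "a n i j <= 1" for n i j
 proof -
  have "1 <= 1 + r n i j powr \<gamma>" by simp
  then have "1 / (1 + r n i j powr \<gamma>) <= 1 / 1" by (intro frac_le) auto
  then show ?thesis by (simp add: a_def)
 qed
 have asq: "(a n i j)\<^sup>2 <= a n i j" for n i j unfolding power2_eq_square by (rule mult_left_le[OF a1 a0])
 have near: "(\<Sum>j<n. if r n i j <= L then a n i j else 0) <= C * (2 * L) ^ m" if n: "1 <= n" "i < n" and L: "1 <= L" for n i L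
 proof -
  have "(\<Sum>j<n. if r n i j <= L then a n i j else 0) = (\<Sum>j\<in>{j \<in> {..<n}. r n i j <= L}. a n i j)"
   by (rule sum.inter_filter[symmetric]) simp
  also have "... <= (\<Sum>j\<in>{j \<in> {..<n}. r n i j <= L}. 1)" by (intro sum_mono a1)
  also have "... = real (card {j \<in> {..<n}. r n i j <= L})" by simp
  also have "... <= C * (1 + L) ^ m" by (rule count[OF n]) (use L in simp)
  also have "... <= C * (2 * L) ^ m" using C L by (intro mult_left_mono power_mono) auto
  finally show ?thesis .
 qed
 have far: "(\<Sum>j<n. if r n i j <= L then 0 else (a n i j)\<^sup>2) <= K * L powr (real m - 2 * \<gamma>)" if n: "1 <= n" "i < n" and L: "1 <= L" for n i L
 proof -
  have "(\<Sum>j<n. if r n i j <= L then 0 else (a n i j)\<^sup>2) = (\<Sum>j<n. if L < r n i j then (a n i j)\<^sup>2 else 0)"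
   by (intro sum.cong refl) auto
  also have "... = (\<Sum>j | j \<in> {..<n} \<and> L < r n i j. (1 / (1 + r n i j powr \<gamma>))\<^sup>2)"
   unfolding a_def by (rule sum.inter_filter[symmetric]) simp
  also have "... <= K * L powr (real m - 2 * \<gamma>)"
   unfolding K_def by (rule dyadic_tail_sum[OF _ count[OF n] _ \<gamma> L]) (use C in auto)
  finally show ?thesis .
 qed
 have split: "(\<Sum>j<n. (a n i j)\<^sup>2) <= C * 2 ^ m + K" if n: "1 <= n" "i < n" for n i
 proof -
  have "(\<Sum>j<n. (a n i j)\<^sup>2) = (\<Sum>j<n. (if r n i j <= 1 then (a n i j)\<^sup>2 else 0) + (if r n i j <= 1 then 0 else (a n i j)\<^sup>2))"
   by (intro sum.cong refl) auto
  also have "... = (\<Sum>j<n. if r n i j <= 1 then (a n i j)\<^sup>2 else 0) + (\<Sum>j<n. if r n i j <= 1 then 0 else (a n i j)\<^sup>2)"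
   by (rule sum.distrib)
  also have "(\<Sum>j<n. if r n i j <= 1 then (a n i j)\<^sup>2 else 0) <= (\<Sum>j<n. if r n i j <= 1 then a n i j else 0)"
   by (intro sum_mono) (simp add: asq)
  finally show ?thesis using near[OF n, of 1] far[OF n, of 1] by simp
 qed
 show "\<exists>S\<ge>0. \<forall>n\<ge>1. \<forall>i<n. (\<Sum>j<n. (a n i j)\<^sup>2) <= S"
  using split C K0 by (intro exI[of _ "C * 2 ^ m + K"]) simp
 show "\<exists>B>0. \<forall>n\<ge>1. truncates n (a n) B \<epsilon>" if \<epsilon>: "0 < \<epsilon>"
 proof -
  have "((%x::real. K * x powr (real m - 2 * \<gamma>)) \<longlongrightarrow> K * 0) at_top"
   by (intro tendsto_mult tendsto_const tendsto_neg_powr filterlim_ident) (use \<gamma> in simp)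
  then have "\<forall>\<^sub>F x in at_top. K * x powr (real m - 2 * \<gamma>) < \<epsilon> \<and> 1 <= x"
   using \<epsilon> by (intro eventually_conj order_tendstoD(2) eventually_ge_at_top) auto
  then obtain L where L: "K * L powr (real m - 2 * \<gamma>) < \<epsilon>" "1 <= L"
   using eventually_happens[of _ "at_top :: real filter"] by auto
  show ?thesis
  proof (intro exI[of _ "C * (2 * L) ^ m"] conjI allI impI)
   show "0 < C * (2 * L) ^ m" using C L by simp
   fix n :: nat assume n: "1 <= n"
   show "\<exists>N. (\<forall>i j. N i j \<longleftrightarrow> N j i) \<and> (\<forall>i<n. (\<Sum>j<n. if N i j then a n i j else 0) <= C * (2 * L) ^ m)
    \<and> (\<forall>i<n. (\<Sum>j<n. if N i j then 0 else (a n i j)\<^sup>2) <= \<epsilon>)"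
   proof (intro exI[of _ "%i j. r n i j <= L"] conjI allI impI)
    fix i assume i: "i < n"
    show "(\<Sum>j<n. if r n i j <= L then a n i j else 0) <= C * (2 * L) ^ m" by (rule near[OF n i L(2)])
    show "(\<Sum>j<n. if r n i j <= L then 0 else (a n i j)\<^sup>2) <= \<epsilon>" using far[OF n i L(2)] L(1) by linarith
   qed (use rsym[of n] in simp)
  qed
 qed
 \<comment> \<open>\<open>L\<close> will be \<open>n powr \<beta>\<close>; the near part is then at most \<open>n powr (1/4)\<close> and the far part gains \<open>n powr (\<beta> * g)\<close> over \<open>sqrt n\<close>.\<close>
 define g where "g = \<gamma> - real m / 2"
 have g: "0 < g" using \<gamma> by (simp add: g_def)
 define \<beta> where "\<beta> = 1 / (4 * (real m + 1))"
 have \<beta>: "0 < \<beta>" "\<beta> * real m <= 1/4" by (auto simp: \<beta>_def divide_le_eq)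
 define k where "k = min (1/4) (\<beta> * g)"
 have k: "0 < k" "k <= 1/4" "k <= \<beta> * g" using \<beta> g by (auto simp: k_def)
 have half_pos: "0 < k / 2" using k by simp
 define A where "A = C * 2 ^ m + sqrt K"
 have A: "1 <= A"
 proof -
  have "1 * 1 <= C * 2 ^ m" using C by (intro mult_mono) auto
  moreover have "0 <= sqrt K" using K0 by simp
  ultimately show ?thesis unfolding A_def by linarith
 qed
 define \<rho> where "\<rho> n = (if n = 0 then 1 else A * real n powr (1/2 - k))" for n :: nat
 show "\<exists>\<rho> e. 0 < e \<and> (\<forall>n. 1 <= \<rho> n) \<and> (\<forall>n\<ge>1. \<forall>i<n. (\<Sum>j<n. a n i j) <= \<rho> n)
    \<and> (\<forall>\<^sub>F n in sequentially. \<rho> n * (real n powr e) ^ 10 <= sqrt (real n))"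
 proof (intro exI[of _ \<rho>] exI[of _ "k / 20"] conjI allI impI)
  show "0 < k / 20" using k by simp
  show "1 <= \<rho> n" for n
  proof (cases "n = 0")
   case False
   then have "1 * 1 <= A * real n powr (1/2 - k)" using A k by (intro mult_mono ge_one_powr_ge_zero) auto
   then show ?thesis using False by (simp add: \<rho>_def)
  qed (simp add: \<rho>_def)
  show "(\<Sum>j<n. a n i j) <= \<rho> n" if n: "1 <= n" and i: "i < n" for n i
  proof -
   have n1: "1 <= real n" "0 < real n" using n by auto
   define L where "L = real n powr \<beta>"
   have L: "1 <= L" unfolding L_def using n1 \<beta> by (intro ge_one_powr_ge_zero) auto
   have "(\<Sum>j<n. a n i j) = (\<Sum>j<n. (if r n i j <= L then a n i j else 0) + (if r n i j <= L then 0 else a n i j))"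
    by (intro sum.cong refl) auto
   also have "... = (\<Sum>j<n. if r n i j <= L then a n i j else 0) + (\<Sum>j<n. if r n i j <= L then 0 else a n i j)"
    by (rule sum.distrib)
   also have "(\<Sum>j<n. if r n i j <= L then a n i j else 0) <= C * 2 ^ m * real n powr (1/2 - k)"
   proof -
    have "L ^ m = real n powr (\<beta> * real m)" using n1 by (simp add: L_def powr_powr powr_realpow[symmetric])
    also have "... <= real n powr (1/2 - k)" using n1 \<beta> k by (intro powr_mono) auto
    finally have "C * 2 ^ m * L ^ m <= C * 2 ^ m * real n powr (1/2 - k)" using C by (intro mult_left_mono) auto
    then show ?thesis using near[OF n i L] by (simp add: power_mult_distrib mult.assoc)
   qed
   also have "(\<Sum>j<n. if r n i j <= L then 0 else a n i j) <= sqrt K * real n powr (1/2 - k)"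
   proof -
    have "(\<Sum>j<n. (if r n i j <= L then 0 else a n i j) * 1)\<^sup>2 <= (\<Sum>j<n. (if r n i j <= L then 0 else a n i j)\<^sup>2) * (\<Sum>j<n. 1\<^sup>2)"
     by (rule Cauchy_Schwarz_ineq_sum)
    also have "(\<Sum>j<n. (if r n i j <= L then 0 else a n i j)\<^sup>2) = (\<Sum>j<n. if r n i j <= L then 0 else (a n i j)\<^sup>2)"
     by (intro sum.cong refl) auto
    also have "... * (\<Sum>j<n. 1\<^sup>2) <= K * L powr (real m - 2 * \<gamma>) * real n"
     using far[OF n i L] by (simp add: mult_right_mono)
    also have "... = (sqrt K * real n powr (1/2 - \<beta> * g))\<^sup>2"
    proof -
     have "L powr (real m - 2 * \<gamma>) = real n powr (- 2 * \<beta> * g)" by (simp add: L_def powr_powr g_def algebra_simps)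
     then have "L powr (real m - 2 * \<gamma>) * real n = real n powr (- 2 * \<beta> * g) * real n powr 1" using n1 by simp
     also have "... = real n powr (- 2 * \<beta> * g + 1)" by (rule powr_add[symmetric])
     also have "... = real n powr ((1/2 - \<beta> * g) * 2)" by (simp add: algebra_simps)
     also have "... = (real n powr (1/2 - \<beta> * g))\<^sup>2" using n1 by (simp add: powr_powr powr_realpow[symmetric])
     finally show ?thesis using K0 by (simp add: power_mult_distrib mult.assoc)
    qed
    also have "... <= (sqrt K * real n powr (1/2 - k))\<^sup>2"
     using n1 k K0 by (intro power_mono mult_left_mono powr_mono) auto
    finally have "(\<Sum>j<n. if r n i j <= L then 0 else a n i j)\<^sup>2 <= (sqrt K * real n powr (1/2 - k))\<^sup>2" by simp
    then show ?thesis by (rule power2_le_imp_le) (use K0 in simp)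
   qed
   finally show ?thesis using n by (simp add: \<rho>_def A_def distrib_right)
  qed
  show "\<forall>\<^sub>F n in sequentially. \<rho> n * (real n powr (k / 20)) ^ 10 <= sqrt (real n)"
   using power_eventually_dominates[OF half_pos, of A] eventually_ge_at_top[of 1]
  proof eventually_elim
   case (elim n)
   then have n: "0 < real n" "n \<noteq> 0" by auto
   have "(real n powr (k / 20)) ^ 10 = real n powr (k / 2)" using n by (simp add: powr_powr powr_realpow[symmetric])
   then have "\<rho> n * (real n powr (k / 20)) ^ 10 = A * (real n powr (1/2 - k) * real n powr (k / 2))" using n by (simp add: \<rho>_def)
   also have "... = A * real n powr (1/2 - k / 2)" by (simp add: powr_add[symmetric])
   also have "... <= real n powr (k / 2) * real n powr (1/2 - k / 2)" using elim(1) by (intro mult_right_mono) auto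
   also have "... = real n powr (1/2)" by (simp add: powr_add[symmetric])
   also have "... = sqrt (real n)" by (simp add: powr_half_sqrt)
   finally show ?case .
  qed
 qed
qed

section \<open>Regularity and identifiability of the kernel family\<close>

lemma envelope_compare:
 fixes r :: real assumes "0 < \<gamma>" "\<gamma> <= \<gamma>'" "0 <= r"
 shows "1 / (1 + r powr \<gamma>') <= 2 / (1 + r powr \<gamma>)"
proof (cases "1 <= r")
 case True
 then have "r powr \<gamma> <= r powr \<gamma>'" using assms by (intro powr_mono) auto
 then have "1 / (1 + r powr \<gamma>') <= 2 / (1 + r powr \<gamma>)" by (intro frac_le) (auto intro: add_pos_nonneg)
 then show ?thesis .
next
 case False
 then have "r powr \<gamma> <= 1" using assms powr_mono2[of \<gamma> r 1] by simp
 then have "1 + r powr \<gamma> <= 2" "0 < 1 + r powr \<gamma>" by (auto intro: add_pos_nonneg)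
 then have "1 <= 2 / (1 + r powr \<gamma>)" by simp
 moreover have "1 / (1 + r powr \<gamma>') <= 1 / 1" by (intro frac_le) auto
 ultimately show ?thesis by simp
qed

text \<open>Values, increments, first two derivatives at \<open>\<theta>0\<close> and Taylor remainder of the kernel have the same decay.\<close>
abbreviation kernel_regular :: "(real^'p) set => real^'p => real => (real^'p => 'h::real_normed_vector => real) => real => real => bool" where
 "kernel_regular \<Theta> \<theta>0 r\<^sub>0 k \<gamma> \<kappa> \<equiv>
  (\<forall>\<theta>\<in>\<Theta>. \<forall>g. \<bar>k \<theta> g\<bar> <= \<kappa> * (1 / (1 + norm g powr \<gamma>)))
  \<and> (\<forall>\<theta>\<in>\<Theta>. \<forall>\<theta>'\<in>\<Theta>. \<forall>g. \<bar>k \<theta> g - k \<theta>' g\<bar> <= \<kappa> * norm (\<theta> - \<theta>') * (1 / (1 + norm g powr \<gamma>)))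
  \<and> (\<forall>m g. \<bar>partial m (%\<theta>. k \<theta> g) \<theta>0\<bar> <= \<kappa> * (1 / (1 + norm g powr \<gamma>)))
  \<and> (\<forall>m l g. \<bar>partial l (partial m (%\<theta>. k \<theta> g)) \<theta>0\<bar> <= \<kappa> * (1 / (1 + norm g powr \<gamma>)))
  \<and> (\<forall>t g. norm t < r\<^sub>0 --> \<bar>k (\<theta>0 + t) g - (k \<theta>0 g + (\<Sum>m\<in>UNIV. t $ m * partial m (%\<theta>. k \<theta> g) \<theta>0)
    + (\<Sum>m\<in>UNIV. t $ m * (\<Sum>l\<in>UNIV. t $ l * partial l (partial m (%\<theta>. k \<theta> g)) \<theta>0)) / 2)\<bar>
   <= \<kappa> * norm t ^ 3 * (1 / (1 + norm g powr \<gamma>)))"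

text \<open>Nearby parameters are joined by a segment in \<open>U\<close>, where the mean value theorem applies; for parameters at distance at least \<open>\<eta>\<close>
the bound on the values suffices.\<close>
lemma kernel_bounds:
 fixes k :: "real^'p => 'h::real_normed_vector => real"
 assumes \<Theta>: "compact \<Theta>" "ball \<theta>0 r\<^sub>0 \<subseteq> \<Theta>" "0 < r\<^sub>0" and U: "open U" "\<Theta> \<subseteq> U"
  and \<gamma>: "0 < \<gamma>" "\<gamma> <= \<gamma>\<^sub>0" "\<gamma> <= \<gamma>\<^sub>1" "\<gamma> <= \<gamma>\<^sub>2" and C: "0 < C" "0 < C\<^sub>1" "0 < C\<^sub>2"
  and decay: "\<And>\<theta> g. \<theta> \<in> \<Theta> ==> \<bar>k \<theta> g\<bar> <= C / (1 + norm g powr \<gamma>\<^sub>0)"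
  and smooth: "\<And>g. Ck_on 3 (%\<theta>. k \<theta> g) U"
  and D1: "\<And>\<theta> m g. \<theta> \<in> U ==> \<bar>partial m (%\<theta>. k \<theta> g) \<theta>\<bar> <= C\<^sub>1 / (1 + norm g powr \<gamma>\<^sub>1)"
  and D23: "\<And>\<theta> ms g. \<theta> \<in> \<Theta> ==> length ms \<in> {2, 3} ==>
    \<bar>partials ms (%\<theta>. k \<theta> g) \<theta>\<bar> <= C\<^sub>2 / (1 + norm g powr \<gamma>\<^sub>2)"
 shows "\<exists>\<kappa>\<ge>1. kernel_regular \<Theta> \<theta>0 r\<^sub>0 k \<gamma> \<kappa>"
proof -
 define w where "w g = 1 / (1 + norm g powr \<gamma>)" for g :: 'h
 have w0: "0 <= w g" for g by (simp add: w_def)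
 have cmp: "D / (1 + norm g powr \<gamma>') <= 2 * D * w g" if "\<gamma> <= \<gamma>'" "0 < D" for D \<gamma>' and g :: 'h
  using mult_left_mono[OF envelope_compare[OF \<gamma>(1) that(1) norm_ge_zero[of g]], of D] that(2) by (simp add: w_def ac_simps)
 define p where "p = real CARD('p)"
 have p0: "1 <= p" by (simp add: p_def Suc_le_eq)
 obtain \<eta> where \<eta>: "0 < \<eta>" "(\<Union>x\<in>\<Theta>. ball x \<eta>) \<subseteq> U"
  by (rule compact_subset_open_imp_ball_epsilon_subset[OF \<Theta>(1) U])
 define \<kappa> where "\<kappa> = 1 + 2 * C + 4 * C / \<eta> + p * (2 * C\<^sub>1) + 2 * C\<^sub>1 + 2 * C\<^sub>2 + p ^ 3 * (2 * C\<^sub>2)"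
 have k: "1 <= \<kappa>" "2 * C <= \<kappa>" "4 * C / \<eta> <= \<kappa>" "p * (2 * C\<^sub>1) <= \<kappa>" "2 * C\<^sub>1 <= \<kappa>" "2 * C\<^sub>2 <= \<kappa>" "p ^ 3 * (2 * C\<^sub>2) <= \<kappa>"
 proof -
  have "0 <= 2 * C" "0 <= 4 * C / \<eta>" "0 <= p * (2 * C\<^sub>1)" "0 <= 2 * C\<^sub>1" "0 <= 2 * C\<^sub>2" "0 <= p ^ 3 * (2 * C\<^sub>2)"
   using C \<eta>(1) p0 by auto
  then show "1 <= \<kappa>" "2 * C <= \<kappa>" "4 * C / \<eta> <= \<kappa>" "p * (2 * C\<^sub>1) <= \<kappa>" "2 * C\<^sub>1 <= \<kappa>" "2 * C\<^sub>2 <= \<kappa>" "p ^ 3 * (2 * C\<^sub>2) <= \<kappa>"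
   unfolding \<kappa>_def by linarith+
 qed
 have F0: "(%\<theta>. k \<theta> g) differentiable (at \<theta>)" if "\<theta> \<in> U" for \<theta> g using smooth[of g] that by (simp add: numeral_3_eq_3)
 have F1: "partial m (%\<theta>. k \<theta> g) differentiable (at \<theta>)" if "\<theta> \<in> U" for \<theta> g m using smooth[of g] that by (simp add: numeral_3_eq_3)
 have F2: "partial l (partial m (%\<theta>. k \<theta> g)) differentiable (at \<theta>)" if "\<theta> \<in> U" for \<theta> g m l using smooth[of g] that by (simp add: numeral_3_eq_3)
 have \<theta>0: "\<theta>0 \<in> \<Theta>" using \<Theta> by auto
 have val: "\<bar>k \<theta> g\<bar> <= 2 * C * w g" if "\<theta> \<in> \<Theta>" for \<theta> g
  by (rule order_trans[OF decay[OF that] cmp[OF \<gamma>(2) C(1)]])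
 show ?thesis
 proof (intro exI[of _ \<kappa>] conjI k(1) ballI allI impI; (fold w_def)?)
  fix \<theta> g assume "\<theta> \<in> \<Theta>"
  then show "\<bar>k \<theta> g\<bar> <= \<kappa> * w g" using val mult_right_mono[OF k(2) w0] by (blast intro: order_trans)
 next
  fix \<theta> \<theta>' g assume \<theta>: "\<theta> \<in> \<Theta>" "\<theta>' \<in> \<Theta>"
  show "\<bar>k \<theta> g - k \<theta>' g\<bar> <= \<kappa> * norm (\<theta> - \<theta>') * w g"
  proof (cases "norm (\<theta> - \<theta>') < \<eta>")
   case True
   have seg: "\<theta>' + t *\<^sub>R (\<theta> - \<theta>') \<in> U" if "0 <= t" "t <= 1" for t
   proof -
    have "t * norm (\<theta> - \<theta>') <= 1 * norm (\<theta> - \<theta>')" using that by (intro mult_right_mono) auto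
    then have "\<theta>' + t *\<^sub>R (\<theta> - \<theta>') \<in> ball \<theta>' \<eta>" using True that by (simp add: dist_norm)
    then show ?thesis using \<eta>(2) \<theta>(2) by blast
   qed
   have "\<bar>k (\<theta>' + (\<theta> - \<theta>')) g - k \<theta>' g\<bar> <= CARD('p) * norm (\<theta> - \<theta>') * (2 * C\<^sub>1 * w g)"
   proof (rule Lipschitz_of_partials, intro conjI allI)
    fix t :: real assume "0 <= t" "t <= 1"
    note s = seg[OF this]
    show "(%\<theta>. k \<theta> g) differentiable (at (\<theta>' + t *\<^sub>R (\<theta> - \<theta>')))" by (rule F0[OF s])
    show "\<bar>partial m (%\<theta>. k \<theta> g) (\<theta>' + t *\<^sub>R (\<theta> - \<theta>'))\<bar> <= 2 * C\<^sub>1 * w g" for m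
     by (rule order_trans[OF D1[OF s] cmp[OF \<gamma>(3) C(2)]])
   qed
   also have "... = (p * (2 * C\<^sub>1)) * (norm (\<theta> - \<theta>') * w g)" by (simp add: p_def)
   also have "... <= \<kappa> * (norm (\<theta> - \<theta>') * w g)" by (rule mult_right_mono[OF k(4)]) (simp add: w0)
   finally show ?thesis by (simp add: mult.assoc)
  next
   case False
   have "\<bar>k \<theta> g - k \<theta>' g\<bar> <= 4 * C * w g" using val[OF \<theta>(1), of g] val[OF \<theta>(2), of g] by linarith
   also have "... = (4 * C / \<eta>) * (\<eta> * w g)" using \<eta> by simp
   also have "... <= \<kappa> * (norm (\<theta> - \<theta>') * w g)" using k(1,3) False w0 \<eta>(1) by (intro mult_mono mult_right_mono) auto
   finally show ?thesis by (simp add: mult.assoc)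
  qed
 next
  fix m g
  show "\<bar>partial m (%\<theta>. k \<theta> g) \<theta>0\<bar> <= \<kappa> * w g"
   using order_trans[OF D1 cmp[OF \<gamma>(3) C(2)]] \<theta>0 U(2) mult_right_mono[OF k(5) w0] by (blast intro: order_trans)
 next
  fix m l g
  have "\<bar>partials [l, m] (%\<theta>. k \<theta> g) \<theta>0\<bar> <= 2 * C\<^sub>2 * w g"
   by (rule order_trans[OF D23[OF \<theta>0] cmp[OF \<gamma>(4) C(3)]]) simp
  also have "... <= \<kappa> * w g" by (rule mult_right_mono[OF k(6) w0])
  finally show "\<bar>partial l (partial m (%\<theta>. k \<theta> g)) \<theta>0\<bar> <= \<kappa> * w g" by (simp add: partials_def)
 next
  fix t :: "real^'p" and g assume t: "norm t < r\<^sub>0"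
  have seg: "\<theta>0 + x *\<^sub>R t \<in> \<Theta>" if "0 <= x" "x <= 1" for x
  proof -
   have "x * norm t <= 1 * norm t" using that by (intro mult_right_mono) auto
   then have "\<theta>0 + x *\<^sub>R t \<in> ball \<theta>0 r\<^sub>0" using t that by (simp add: dist_norm)
   then show ?thesis using \<Theta>(2) by blast
  qed
  note segU = subsetD[OF U(2) seg]
  have "\<bar>k (\<theta>0 + t) g - (k \<theta>0 g + (\<Sum>m\<in>UNIV. t $ m * partial m (%\<theta>. k \<theta> g) \<theta>0)
    + (\<Sum>m\<in>UNIV. t $ m * (\<Sum>l\<in>UNIV. t $ l * partial l (partial m (%\<theta>. k \<theta> g)) \<theta>0)) / 2)\<bar>
   <= CARD('p) ^ 3 * norm t ^ 3 * (2 * C\<^sub>2 * w g)"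
  proof (rule third_order_Taylor_partials)
   fix x :: real and m l r assume x: "0 <= x" "x <= 1"
   show "(%\<theta>. k \<theta> g) differentiable (at (\<theta>0 + x *\<^sub>R t))" by (rule F0[OF segU[OF x]])
   show "partial m (%\<theta>. k \<theta> g) differentiable (at (\<theta>0 + x *\<^sub>R t))" by (rule F1[OF segU[OF x]])
   show "partial l (partial m (%\<theta>. k \<theta> g)) differentiable (at (\<theta>0 + x *\<^sub>R t))" by (rule F2[OF segU[OF x]])
   have "\<bar>partials [r, l, m] (%\<theta>. k \<theta> g) (\<theta>0 + x *\<^sub>R t)\<bar> <= 2 * C\<^sub>2 * w g"
    by (rule order_trans[OF D23[OF seg[OF x]] cmp[OF \<gamma>(4) C(3)]]) simp
   then show "\<bar>partial r (partial l (partial m (%\<theta>. k \<theta> g))) (\<theta>0 + x *\<^sub>R t)\<bar> <= 2 * C\<^sub>2 * w g" by (simp add: partials_def)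
  qed
  also have "... = (p ^ 3 * (2 * C\<^sub>2)) * (norm t ^ 3 * w g)" by (simp add: p_def)
  also have "... <= \<kappa> * (norm t ^ 3 * w g)" by (rule mult_right_mono[OF k(7)]) (simp add: w0)
  finally show "\<bar>k (\<theta>0 + t) g - (k \<theta>0 g + (\<Sum>m\<in>UNIV. t $ m * partial m (%\<theta>. k \<theta> g) \<theta>0)
    + (\<Sum>m\<in>UNIV. t $ m * (\<Sum>l\<in>UNIV. t $ l * partial l (partial m (%\<theta>. k \<theta> g)) \<theta>0)) / 2)\<bar> <= \<kappa> * norm t ^ 3 * w g"
   by (simp add: mult.assoc)
 qed
qed

lemma fnorm_sum_le: "finite A ==> fnorm n (%i j. \<Sum>m\<in>A. w m * G m i j) <= (\<Sum>m\<in>A. \<bar>w m\<bar> * fnorm n (G m))"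
proof (induction A rule: finite_induct)
 case empty
 have "(fnorm n (%i j. 0))\<^sup>2 = 0" unfolding fnorm_sq by simp
 then show ?case by simp
next
 case (insert x A)
 have "fnorm n (%i j. \<Sum>m\<in>insert x A. w m * G m i j) = fnorm n (%i j. w x * G x i j + (\<Sum>m\<in>A. w m * G m i j))"
  using insert by simp
 also have "... <= fnorm n (%i j. w x * G x i j) + fnorm n (%i j. \<Sum>m\<in>A. w m * G m i j)" by (rule fnorm_triangle)
 also have "fnorm n (%i j. w x * G x i j) = \<bar>w x\<bar> * fnorm n (G x)" by (rule fnorm_scale)
 finally show ?case using insert by simp
qed

lemma positive_liminf_lower_bound:
 fixes x :: "nat => ereal"
 assumes "0 < liminf x"
 shows "\<exists>c>0. \<forall>\<^sub>F n in sequentially. ereal c <= x n"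
proof -
 obtain c where c: "0 < ereal c" "ereal c < liminf x" using ereal_dense2[OF assms] by blast
 from less_LiminfD[OF c(2)] have "\<forall>\<^sub>F n in sequentially. ereal c <= x n" by (rule eventually_mono) simp
 then show ?thesis using c(1) by (intro exI[of _ c]) simp
qed

text \<open>The Frobenius norm is Lipschitz in the direction, uniformly in \<open>n\<close> after division by \<open>sqrt n\<close>, so a finite cover of the unit
sphere makes the pointwise lower bounds uniform.\<close>
lemma local_identifiability_uniform:
 fixes D :: "nat => 'p::finite => nat => nat => real"
 assumes bound: "\<And>n m. 1 <= n ==> fnorm n (D n m) <= F * sqrt (real n)" and F: "0 <= F"
  and pos: "\<And>l :: real^'p. l \<noteq> 0 ==> 0 < liminf (%n. ereal (1 / real n * (fnorm n (%i j. \<Sum>m\<in>UNIV. l $ m * D n m i j))\<^sup>2))"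
 shows "\<exists>\<delta>>0. \<forall>\<^sub>F n in sequentially. \<forall>v :: real^'p. \<delta> * real n * (norm v)\<^sup>2 <= (fnorm n (%i j. \<Sum>m\<in>UNIV. v $ m * D n m i j))\<^sup>2"
proof -
 define N where "N n v = fnorm n (%i j. \<Sum>m\<in>UNIV. v $ m * D n m i j)" for n and v :: "real^'p"
 define p where "p = real CARD('p)"
 have Nb: "N n v <= p * F * norm v * sqrt (real n)" if "1 <= n" for n v
 proof -
  have "N n v <= (\<Sum>m\<in>UNIV. \<bar>v $ m\<bar> * fnorm n (D n m))" unfolding N_def by (rule fnorm_sum_le) simp
  also have "... <= (\<Sum>m\<in>(UNIV::'p set). norm v * (F * sqrt (real n)))"
   using bound[OF that] component_le_norm_cart[of v] by (intro sum_mono mult_mono) auto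
  finally show ?thesis by (simp add: p_def ac_simps)
 qed
 have Nt: "N n u <= N n v + N n (u - v)" for n u v
 proof -
  have "N n u = fnorm n (%i j. (\<Sum>m\<in>UNIV. v $ m * D n m i j) + (\<Sum>m\<in>UNIV. (u - v) $ m * D n m i j))"
   unfolding N_def by (simp add: sum.distrib[symmetric] algebra_simps)
  also have "... <= N n v + N n (u - v)" unfolding N_def by (rule fnorm_triangle)
  finally show ?thesis .
 qed
 have Ns: "N n (x *\<^sub>R v) = \<bar>x\<bar> * N n v" for n x v
 proof -
  have "(%i j. \<Sum>m\<in>UNIV. (x *\<^sub>R v) $ m * D n m i j) = (%i j. x * (\<Sum>m\<in>UNIV. v $ m * D n m i j))"
   by (simp add: sum_distrib_left mult.assoc)
  then show ?thesis unfolding N_def by (simp only: fnorm_scale)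
 qed
 have "\<exists>c>0. \<forall>\<^sub>F n in sequentially. c * real n <= (N n l)\<^sup>2" if l0: "l \<noteq> 0" for l
 proof -
  obtain c where c: "c > 0" "\<forall>\<^sub>F n in sequentially. ereal c <= ereal (1 / real n * (N n l)\<^sup>2)"
   using positive_liminf_lower_bound[OF pos[OF l0]] unfolding N_def by blast
  have "\<forall>\<^sub>F n in sequentially. c * real n <= (N n l)\<^sup>2"
   using c(2) eventually_ge_at_top[of 1] by eventually_elim (simp add: field_simps)
  then show ?thesis using c(1) by blast
 qed
 then obtain c where c: "\<And>l. l \<noteq> 0 ==> 0 < c l" "\<And>l. l \<noteq> 0 ==> \<forall>\<^sub>F n in sequentially. c l * real n <= (N n l)\<^sup>2" by metis
 \<comment> \<open>Within this radius the Frobenius norm drops by at most one half.\<close>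
 define e where "e l = sqrt (c l) / (2 * (p * F + 1))" for l
 have p0: "0 <= p * F" using F by (simp add: p_def)
 have e0: "0 < e l" if "l \<noteq> 0" for l using c(1)[OF that] p0 by (simp add: e_def)
 have "sphere (0 :: real^'p) 1 \<subseteq> (\<Union>l\<in>sphere 0 1. ball l (e l))"
 proof
  fix l :: "real^'p" assume l: "l \<in> sphere 0 1"
  then have "l \<noteq> 0" by auto
  then have "l \<in> ball l (e l)" using e0 by simp
  then show "l \<in> (\<Union>l\<in>sphere 0 1. ball l (e l))" using l by blast
 qed
 then obtain G where G: "G \<subseteq> sphere (0 :: real^'p) 1" "finite G" "sphere 0 1 \<subseteq> (\<Union>l\<in>G. ball l (e l))"
  by (rule compactE_image[OF compact_sphere, rotated]) auto
 have Gn: "l \<noteq> 0" if "l \<in> G" for l using G(1) that by auto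
 have "axis undefined 1 \<in> sphere (0 :: real^'p) 1" by simp
 then have "G \<noteq> {}" using G(3) by auto
 define \<delta> where "\<delta> = Min (c ` G) / 4"
 have \<delta>: "0 < \<delta>" unfolding \<delta>_def using G(2) \<open>G \<noteq> {}\<close> c(1) Gn by simp
 have \<delta>c: "\<delta> <= c l / 4" if "l \<in> G" for l unfolding \<delta>_def using G(2) that by simp
 have "\<forall>\<^sub>F n in sequentially. \<forall>l\<in>G. c l * real n <= (N n l)\<^sup>2"
  by (rule eventually_ball_finite[OF G(2)]) (use c(2) Gn in blast)
 then have "\<forall>\<^sub>F n in sequentially. \<forall>v. \<delta> * real n * (norm v)\<^sup>2 <= (N n v)\<^sup>2"
  using eventually_ge_at_top[of 1]
 proof eventually_elim
  case (elim n)
  show ?case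
  proof
   fix v :: "real^'p"
   show "\<delta> * real n * (norm v)\<^sup>2 <= (N n v)\<^sup>2"
   proof (cases "v = 0")
    case False
    define u where "u = (1 / norm v) *\<^sub>R v"
    have "u \<in> sphere 0 1" using False by (simp add: u_def)
    then obtain l where l: "l \<in> G" "norm (l - u) < e l" using G(3) by (auto simp: dist_norm)
    have "sqrt (c l) * sqrt (real n) <= N n l"
    proof -
     have "sqrt (c l * real n) <= sqrt ((N n l)\<^sup>2)" using elim(1) l(1) by (intro real_sqrt_le_mono) blast
     then show ?thesis by (simp add: real_sqrt_mult N_def)
    qed
    also have "... <= N n u + N n (l - u)" by (rule Nt)
    also have "N n (l - u) <= (p * F + 1) * e l * sqrt (real n)"
    proof (rule order_trans[OF Nb[OF elim(2)] mult_right_mono])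
     show "p * F * norm (l - u) <= (p * F + 1) * e l" using l p0 by (intro mult_mono) auto
    qed simp
    also have "(p * F + 1) * e l = sqrt (c l) / 2"
    proof -
     have "x * (y / (2 * x)) = y / 2" if "x \<noteq> 0" for x y :: real using that by simp
     moreover have "p * F + 1 \<noteq> 0" using p0 by linarith
     ultimately show ?thesis unfolding e_def by blast
    qed
    finally have "sqrt (c l) / 2 * sqrt (real n) <= N n u" by linarith
    then have "(sqrt (c l) / 2 * sqrt (real n))\<^sup>2 <= (N n u)\<^sup>2" using c(1)[OF Gn[OF l(1)]] by (intro power_mono) auto
    then have "c l / 4 * real n <= (N n u)\<^sup>2" using c(1)[OF Gn[OF l(1)]] by (simp add: power_mult_distrib power_divide)
    moreover have "\<delta> * real n <= c l / 4 * real n" by (rule mult_right_mono[OF \<delta>c[OF l(1)]]) simp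
    ultimately have "\<delta> * real n * (norm v)\<^sup>2 <= (N n u)\<^sup>2 * (norm v)\<^sup>2" by (intro mult_right_mono) auto
    also have "... = (N n v)\<^sup>2" using Ns[of n "norm v" u] False by (simp add: u_def power_mult_distrib)
    finally show ?thesis .
   qed simp
  qed
 qed
 then show ?thesis unfolding N_def using \<delta> by blast
qed

text \<open>Near \<open>\<theta>0\<close> the linear term dominates the quadratic remainder; away from it \<open>norm (\<theta> - \<theta>0)\<close> is bounded and the
lower bound for a fixed distance applies.\<close>
lemma identifiability_uniform:
 fixes D :: "nat => 'p::finite => nat => nat => real" and G :: "nat => real^'p => nat => nat => real"
 assumes glob: "\<And>\<alpha>. 0 < \<alpha> ==> 0 < liminf (%n. INF \<theta>\<in>{\<theta> \<in> \<Theta>. \<alpha> <= norm (\<theta> - \<theta>0)}. ereal (1 / real n * (fnorm n (G n \<theta>))\<^sup>2))"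
  and loc: "0 < \<delta>" "\<forall>\<^sub>F n in sequentially. \<forall>v :: real^'p. \<delta> * real n * (norm v)\<^sup>2 <= (fnorm n (%i j. \<Sum>m\<in>UNIV. v $ m * D n m i j))\<^sup>2"
  and expand: "\<And>n \<theta>. 1 <= n ==> \<theta> \<in> \<Theta> ==> norm (\<theta> - \<theta>0) < r\<^sub>0 ==>
    fnorm n (%i j. (\<Sum>m\<in>UNIV. (\<theta> - \<theta>0) $ m * D n m i j) - G n \<theta> i j) <= F * (norm (\<theta> - \<theta>0))\<^sup>2 * sqrt (real n)"
  and F: "0 <= F" and r0: "0 < r\<^sub>0" and \<Theta>: "bounded \<Theta>"
 shows "\<exists>\<delta>'>0. \<delta>' <= \<delta> \<and> (\<forall>\<^sub>F n in sequentially. \<forall>\<theta>\<in>\<Theta>. \<delta>' * real n * (norm (\<theta> - \<theta>0))\<^sup>2 <= (fnorm n (G n \<theta>))\<^sup>2)"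
proof -
 \<comment> \<open>Within this radius the quadratic remainder is at most half of the linear term.\<close>
 define \<alpha> where "\<alpha> = min r\<^sub>0 (sqrt \<delta> / (2 * (F + 1)))"
 have \<alpha>: "0 < \<alpha>" "\<alpha> <= r\<^sub>0" "F * \<alpha> <= sqrt \<delta> / 2"
 proof -
  show "0 < \<alpha>" "\<alpha> <= r\<^sub>0" using r0 loc(1) F by (auto simp: \<alpha>_def)
  have "F * \<alpha> <= (F + 1) * (sqrt \<delta> / (2 * (F + 1)))" using F \<open>0 < \<alpha>\<close> by (intro mult_mono) (auto simp: \<alpha>_def)
  moreover have "x * (y / (2 * x)) = y / 2" if "x \<noteq> 0" for x y :: real using that by simp
  from this[of "F + 1" "sqrt \<delta>"] have "(F + 1) * (sqrt \<delta> / (2 * (F + 1))) = sqrt \<delta> / 2" using F by linarith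
  ultimately show "F * \<alpha> <= sqrt \<delta> / 2" by linarith
 qed
 obtain B0 where B0: "0 < B0" "\<And>v. v \<in> \<Theta> ==> norm v <= B0" using \<Theta> unfolding bounded_pos by blast
 define B where "B = B0 + norm \<theta>0"
 have B: "0 < B" "norm (\<theta> - \<theta>0) <= B" if "\<theta> \<in> \<Theta>" for \<theta>
  using B0(1) B0(2)[OF that] norm_triangle_ineq4[of \<theta> \<theta>0] unfolding B_def by (auto intro: add_pos_nonneg)
 have B': "0 < B" using B0(1) by (auto simp: B_def intro: add_pos_nonneg)
 obtain c where c: "c > 0" "\<forall>\<^sub>F n in sequentially. ereal c <= (INF \<theta>\<in>{\<theta> \<in> \<Theta>. \<alpha> <= norm (\<theta> - \<theta>0)}. ereal (1 / real n * (fnorm n (G n \<theta>))\<^sup>2))"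
  using positive_liminf_lower_bound[OF glob[OF \<alpha>(1)]] by blast
 define \<delta>' where "\<delta>' = min (\<delta> / 4) (c / B\<^sup>2)"
 have "0 < c / B\<^sup>2" using c(1) B' by simp
 then have "0 < \<delta>'" using loc(1) by (simp add: \<delta>'_def)
 moreover have "\<delta>' <= \<delta> / 4" "\<delta>' <= c / B\<^sup>2" unfolding \<delta>'_def by (rule min.cobounded1, rule min.cobounded2)
 ultimately have \<delta>': "0 < \<delta>'" "\<delta>' <= \<delta> / 4" "\<delta>' <= c / B\<^sup>2" by blast+
 have "\<forall>\<^sub>F n in sequentially. \<forall>\<theta>\<in>\<Theta>. \<delta>' * real n * (norm (\<theta> - \<theta>0))\<^sup>2 <= (fnorm n (G n \<theta>))\<^sup>2"
  using c(2) loc(2) eventually_ge_at_top[of 1]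
 proof eventually_elim
  case (elim n)
  then have n: "0 < real n" by simp
  show ?case
  proof
   fix \<theta> assume \<theta>: "\<theta> \<in> \<Theta>"
   define t where "t = norm (\<theta> - \<theta>0)"
   show "\<delta>' * real n * (norm (\<theta> - \<theta>0))\<^sup>2 <= (fnorm n (G n \<theta>))\<^sup>2"
   proof (cases "\<alpha> <= norm (\<theta> - \<theta>0)")
    case True
    have "ereal c <= ereal (1 / real n * (fnorm n (G n \<theta>))\<^sup>2)"
     by (rule order_trans[OF elim(1) INF_lower]) (use \<theta> True in simp)
    then have cn: "c * real n <= (fnorm n (G n \<theta>))\<^sup>2" using n by (simp add: field_simps)
    have "(norm (\<theta> - \<theta>0))\<^sup>2 <= B\<^sup>2" using B(2)[OF \<theta>] by (intro power_mono) auto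
    then have "\<delta>' * real n * (norm (\<theta> - \<theta>0))\<^sup>2 <= (c / B\<^sup>2) * real n * B\<^sup>2"
     using \<delta>' c(1) by (intro mult_mono) auto
    also have "... = c * real n" using B' by simp
    finally show ?thesis using cn by linarith
   next
    case False
    define L where "L = fnorm n (%i j. \<Sum>m\<in>UNIV. (\<theta> - \<theta>0) $ m * D n m i j)"
    have t0: "0 <= t" by (simp add: t_def)
    have "\<delta> * real n * t\<^sup>2 <= L\<^sup>2" using elim(2)[rule_format, of "\<theta> - \<theta>0"] by (simp only: L_def t_def)
    then have "(sqrt \<delta> * sqrt (real n) * t)\<^sup>2 <= L\<^sup>2" using loc(1) by (simp add: power_mult_distrib)
    then have "sqrt \<delta> * sqrt (real n) * t <= L" by (rule power2_le_imp_le) (simp add: L_def)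
    also have "L <= fnorm n (G n \<theta>) + fnorm n (%i j. (\<Sum>m\<in>UNIV. (\<theta> - \<theta>0) $ m * D n m i j) - G n \<theta> i j)"
     using fnorm_triangle[of n "G n \<theta>" "%i j. (\<Sum>m\<in>UNIV. (\<theta> - \<theta>0) $ m * D n m i j) - G n \<theta> i j"] by (simp add: L_def)
    also have "fnorm n (%i j. (\<Sum>m\<in>UNIV. (\<theta> - \<theta>0) $ m * D n m i j) - G n \<theta> i j) <= F * t\<^sup>2 * sqrt (real n)"
     unfolding t_def by (rule expand) (use elim \<theta> False \<alpha>(2) in auto)
    also have "F * t\<^sup>2 * sqrt (real n) <= sqrt \<delta> / 2 * sqrt (real n) * t"
    proof -
     have "F * t <= sqrt \<delta> / 2" using \<alpha>(3) False F mult_left_mono[of t \<alpha> F] by (simp add: t_def)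
     then have "(F * t) * (t * sqrt (real n)) <= (sqrt \<delta> / 2) * (t * sqrt (real n))" using t0 by (intro mult_right_mono) auto
     then show ?thesis by (simp add: power2_eq_square ac_simps)
    qed
    finally have "sqrt \<delta> / 2 * sqrt (real n) * t <= fnorm n (G n \<theta>)" by linarith
    then have "(sqrt \<delta> / 2 * sqrt (real n) * t)\<^sup>2 <= (fnorm n (G n \<theta>))\<^sup>2" using loc(1) t0 by (intro power_mono) auto
    then have "\<delta> / 4 * (real n * t\<^sup>2) <= (fnorm n (G n \<theta>))\<^sup>2" using loc(1) by (simp add: power_mult_distrib power_divide)
    moreover have "\<delta>' * (real n * t\<^sup>2) <= \<delta> / 4 * (real n * t\<^sup>2)" by (rule mult_right_mono[OF \<delta>'(2)]) simp
    ultimately show ?thesis by (simp add: t_def mult.assoc)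
   qed
  qed
 qed
 then show ?thesis using \<delta>' loc(1) by (intro exI[of _ \<delta>']) auto
qed

section \<open>Whitened Gaussian processes\<close>

text \<open>The degenerate case is included: a constant with mean zero vanishes.\<close>
lemma (in prob_space) centred_gaussian_variable:
 assumes X: "gaussian_variable M X" and mean: "(\<integral>w. X w \<partial>M) = 0"
 shows "integrable M (%w. (X w)\<^sup>2)" "(\<integral>w. cos (X w - a) \<partial>M) = exp (- (\<integral>w. (X w)\<^sup>2 \<partial>M) / 2) * cos a"
proof -
 have [measurable]: "X \<in> borel_measurable M" using X by (simp add: gaussian_variable_def)
 consider (dens) \<mu> \<sigma> where "0 < \<sigma>" "distributed M lborel X (normal_density \<mu> \<sigma>)" | (const) \<mu> where "AE w in M. X w = \<mu>"
  using X by (auto simp: gaussian_variable_def)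
 then have "integrable M (%w. (X w)\<^sup>2) \<and> (\<integral>w. cos (X w - a) \<partial>M) = exp (- (\<integral>w. (X w)\<^sup>2 \<partial>M) / 2) * cos a"
 proof cases
  case dens
  have \<mu>: "\<mu> = 0" using normal_distributed_expectation[OF dens] mean by simp
  note d = dens(2)[unfolded \<mu>]
  have i: "integrable M (%w. (X w)\<^sup>2)"
   using distributed_integrable[OF d, of "%x. x\<^sup>2"] integrable_normal_moment[OF dens(1), of 0 2] by simp
  have v: "(\<integral>w. (X w)\<^sup>2 \<partial>M) = \<sigma>\<^sup>2"
   using normal_distributed_variance[OF dens(1) d] mean by simp
  have z: "distributed M lborel (%w. X w / \<sigma>) std_normal_density"
   using normal_standard_normal_convert[OF dens(1), of X 0] d by simp
  have "(CLINT w|M. iexp (X w)) = (CLINT w|M. iexp (\<sigma> * (X w / \<sigma>)))" using dens(1) by simp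
  also have "... = (CLINT x|distr M lborel (%w. X w / \<sigma>). iexp (\<sigma> * x))"
   by (subst integral_distr) auto
  also have "... = char std_gauss \<sigma>"
   unfolding char_def distributed_distr_eq_density[OF z] by simp
  also have "... = of_real (exp (- \<sigma>\<^sup>2 / 2))" by (simp add: char_std_normal_distribution)
  finally have c: "(CLINT w|M. iexp (X w)) = of_real (exp (- \<sigma>\<^sup>2 / 2))" .
  have "(\<integral>w. cos (X w - a) \<partial>M) = Re (iexp (- a) * of_real (exp (- \<sigma>\<^sup>2 / 2)))"
   by (subst cos_shift_eq_Re) (simp_all add: c)
  then show ?thesis using i v by (simp add: Re_exp)
 next
  case const
  have "(\<integral>w. X w \<partial>M) = (\<integral>w. \<mu> \<partial>M)" by (rule integral_cong_AE) (use const in auto)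
  then have \<mu>: "\<mu> = 0" using mean by (simp add: prob_space)
  have z: "AE w in M. X w = 0" using const \<mu> by simp
  have "(\<integral>w. (X w)\<^sup>2 \<partial>M) = (\<integral>w. 0 \<partial>M)" by (rule integral_cong_AE) (use z in auto)
  moreover have "integrable M (%w. (X w)\<^sup>2) \<longleftrightarrow> integrable M (%w. 0 :: real)" by (rule integrable_cong_AE) (use z in auto)
  moreover have "(\<integral>w. cos (X w - a) \<partial>M) = (\<integral>w. cos a \<partial>M)" by (rule integral_cong_AE) (use z in auto)
  ultimately show ?thesis by (simp add: prob_space)
 qed
 then show "integrable M (%w. (X w)\<^sup>2)" "(\<integral>w. cos (X w - a) \<partial>M) = exp (- (\<integral>w. (X w)\<^sup>2 \<partial>M) / 2) * cos a" by auto
qed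

lemma whitening_quadratic:
 assumes wh: "whitening n A c V W"
 defines "u \<equiv> %t i. \<Sum>k<n. V i k * t k"
 shows "(\<Sum>i<n. \<Sum>j<n. u t i * u t j * A i j) = (\<Sum>k<n. (t k)\<^sup>2)"
proof -
 have A: "A i j = (\<Sum>k<n. W k i * W k j)" if "i < n" "j < n" for i j
 proof -
  have "mat_of n A = mat_of n (%i j. \<Sum>k<n. W k i * W k j)"
   using wh unfolding whitening_def mat_of_transpose mat_of_mult by blast
  then have "mat_of n A $$ (i, j) = mat_of n (%i j. \<Sum>k<n. W k i * W k j) $$ (i, j)" by (rule arg_cong)
  then show ?thesis using that by simp
 qed
 have WV: "(\<Sum>i<n. W k i * V i l) = (if k = l then 1 else 0)" if "k < n" "l < n" for k l
 proof -
  have "mat_of n (%k l. \<Sum>i<n. W k i * V i l) = 1\<^sub>m n"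
   using wh unfolding whitening_def mat_of_mult by blast
  then have "mat_of n (%k l. \<Sum>i<n. W k i * V i l) $$ (k, l) = 1\<^sub>m n $$ (k, l)" by (rule arg_cong)
  then show ?thesis using that by simp
 qed
 have Wu: "(\<Sum>i<n. W k i * u t i) = t k" if k: "k < n" for k
 proof -
  have "(\<Sum>i<n. W k i * u t i) = (\<Sum>i<n. \<Sum>l<n. W k i * V i l * t l)" by (simp add: u_def sum_distrib_left mult.assoc)
  also have "... = (\<Sum>l<n. \<Sum>i<n. W k i * V i l * t l)" by (rule sum.swap)
  also have "... = (\<Sum>l<n. (if k = l then t k else 0))"
   by (intro sum.cong refl) (use k in \<open>simp add: sum_distrib_right[symmetric] WV\<close>)
  also have "... = t k" using k by simp
  finally show ?thesis .
 qed
 have "(\<Sum>i<n. \<Sum>j<n. u t i * u t j * A i j) = (\<Sum>i<n. \<Sum>j<n. \<Sum>k<n. (W k i * u t i) * (W k j * u t j))"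
  by (intro sum.cong refl) (simp add: A sum_distrib_left ac_simps)
 also have "... = (\<Sum>i<n. \<Sum>k<n. \<Sum>j<n. (W k i * u t i) * (W k j * u t j))" by (intro sum.cong refl sum.swap)
 also have "... = (\<Sum>k<n. \<Sum>i<n. \<Sum>j<n. (W k i * u t i) * (W k j * u t j))" by (rule sum.swap)
 also have "... = (\<Sum>k<n. (\<Sum>i<n. W k i * u t i) * (\<Sum>j<n. W k j * u t j))" by (simp only: sum_product)
 also have "... = (\<Sum>k<n. (t k)\<^sup>2)" by (intro sum.cong refl) (simp add: Wu power2_eq_square)
 finally show ?thesis .
qed

text \<open>A linear combination of the whitened variables is a linear combination of values of the process, hence a centred Gaussian variable,
whose variance is the sum of the squared coefficients.\<close>
lemma (in prob_space) gaussian_process_whitened: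
 fixes f :: "nat => 'h"
 assumes Y: "centred_gaussian_process M Y k" and f: "inj_on f {..<n}"
  and wh: "whitening n (%i j. k (f i) (f j)) c V W"
 shows "std_normal_family M n (%l w. \<Sum>i<n. V i l * Y (f i) w)"
proof -
 note Y' = Y[unfolded centred_gaussian_process_def]
 have gp: "gaussian_variable M (%w. \<Sum>g\<in>T. a g * Y g w)" if "finite T" for T a
  using Y' that by (auto simp: gaussian_process_def)
 have g1: "gaussian_variable M (Y g)" for g using gp[of "{g}" "%_. 1"] by simp
 have m0: "(\<integral>w. Y g w \<partial>M) = 0" for g using Y' by blast
 have Ym [measurable]: "Y g \<in> borel_measurable M" for g using g1 by (simp add: gaussian_variable_def)
 note sq = centred_gaussian_variable(1)[OF g1 m0]
 have Yi: "integrable M (Y g)" for g by (rule square_integrable_imp_integrable[OF Ym sq])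
 have Yp: "integrable M (%w. Y g w * Y h w)" for g h
 proof (rule Bochner_Integration.integrable_bound)
  show "integrable M (%w. (Y g w)\<^sup>2 + (Y h w)\<^sup>2)" using sq by auto
  have "\<bar>x * y\<bar> <= x\<^sup>2 + y\<^sup>2" for x y :: real
  proof -
   have "0 <= (\<bar>x\<bar> - \<bar>y\<bar>)\<^sup>2" by simp
   then have "2 * (\<bar>x\<bar> * \<bar>y\<bar>) <= x\<^sup>2 + y\<^sup>2" by (simp add: power2_diff)
   moreover have "0 <= \<bar>x\<bar> * \<bar>y\<bar>" by simp
   ultimately show ?thesis unfolding abs_mult by linarith
  qed
  then show "AE w in M. norm (Y g w * Y h w) <= norm ((Y g w)\<^sup>2 + (Y h w)\<^sup>2)" by simp
 qed measurable
 have cov: "(\<integral>w. Y g w * Y h w \<partial>M) = k g h" for g h using Y' by blast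
 have "(\<integral>w. cos ((\<Sum>l<n. t l * (\<Sum>i<n. V i l * Y (f i) w)) - a) \<partial>M) = exp (- (\<Sum>l<n. (t l)\<^sup>2) / 2) * cos a" for t a
 proof -
  define u where "u i = (\<Sum>l<n. V i l * t l)" for i
  define X where "X w = (\<Sum>i<n. u i * Y (f i) w)" for w
  have "(\<Sum>l<n. t l * (\<Sum>i<n. V i l * Y (f i) w)) = X w" for w
  proof -
   have "(\<Sum>l<n. t l * (\<Sum>i<n. V i l * Y (f i) w)) = (\<Sum>l<n. \<Sum>i<n. V i l * t l * Y (f i) w)"
    by (simp add: sum_distrib_left ac_simps)
   also have "... = (\<Sum>i<n. \<Sum>l<n. V i l * t l * Y (f i) w)" by (rule sum.swap)
   finally show ?thesis by (simp add: X_def u_def sum_distrib_right)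
  qed
  moreover have "gaussian_variable M X"
  proof -
   have "X = (%w. \<Sum>g\<in>f ` {..<n}. u (the_inv_into {..<n} f g) * Y g w)"
    by (rule ext) (simp add: X_def sum.reindex[OF f] the_inv_into_f_f[OF f])
   then show ?thesis by (simp add: gp)
  qed
  moreover have "(\<integral>w. X w \<partial>M) = 0" unfolding X_def using Yi m0 by simp
  moreover have "(\<integral>w. (X w)\<^sup>2 \<partial>M) = (\<Sum>l<n. (t l)\<^sup>2)"
  proof -
   have "(\<integral>w. (X w)\<^sup>2 \<partial>M) = (\<integral>w. (\<Sum>i<n. \<Sum>j<n. u i * u j * (Y (f i) w * Y (f j) w)) \<partial>M)"
    by (simp add: X_def power2_eq_square sum_product ac_simps)
   also have "... = (\<Sum>i<n. \<Sum>j<n. u i * u j * k (f i) (f j))" using Yp cov by simp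
   also have "... = (\<Sum>l<n. (t l)\<^sup>2)" using whitening_quadratic[OF wh, of t] by (simp add: u_def)
   finally show ?thesis .
  qed
  ultimately show ?thesis using centred_gaussian_variable(2)[of X a] by simp
 qed
 then show ?thesis by (simp add: std_normal_family_def)
qed

section \<open>Maximum likelihood estimation\<close>

lemma centred_gaussian_processD:
 assumes Y: "centred_gaussian_process P Y k"
 shows "gaussian_variable P (Y g)" "(\<integral>w. Y g w \<partial>P) = 0" "(\<integral>w. Y g w * Y h w \<partial>P) = k g h"
proof -
 note Y' = Y[unfolded centred_gaussian_process_def gaussian_process_def]
 have "gaussian_variable P (%w. \<Sum>h\<in>{g}. 1 * Y h w)"
  by (rule mp[OF spec[OF spec[OF conjunct1[OF Y']]]]) simp
 then show "gaussian_variable P (Y g)" by simp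
 show "(\<integral>w. Y g w \<partial>P) = 0" by (rule spec[OF conjunct1[OF conjunct2[OF Y']]])
 show "(\<integral>w. Y g w * Y h w \<partial>P) = k g h" by (rule spec[OF spec[OF conjunct2[OF conjunct2[OF Y']]]])
qed

theorem theorem4p9:
  fixes scl :: "'k::{real_normed_field, conjugatable_field} \<Rightarrow> 'h::{banach, second_countable_topology} \<Rightarrow> 'h"
    and ip :: "'h \<Rightarrow> 'h \<Rightarrow> 'k"
    and e :: "nat \<Rightarrow> 'h"
    and \<Theta> U :: "(real^'p) set" and \<theta>\<^sub>0 :: "real^'p"
    and K :: "real^'p \<Rightarrow> 'h \<Rightarrow> 'h \<Rightarrow> real" and k :: "real^'p \<Rightarrow> 'h \<Rightarrow> real"
    and P :: "'w measure" and Y :: "'h \<Rightarrow> 'w \<Rightarrow> real"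
    and f :: "nat \<Rightarrow> nat \<Rightarrow> 'h"
    and \<Delta> :: real and J\<^sub>0 d\<^sub>0 :: nat and s :: "nat \<Rightarrow> real"
    and \<gamma>\<^sub>0 \<gamma>\<^sub>1 \<gamma>\<^sub>2 C C\<^sub>1 C\<^sub>2 c :: real
    and \<theta>hat :: "nat \<Rightarrow> 'w \<Rightarrow> real^'p"
  assumes hilbert: "hilbert_space scl ip"
    and basis: "orthonormal_basis scl ip e"
    and \<Theta>: "compact \<Theta>" "\<theta>\<^sub>0 \<in> interior \<Theta>"
    and U: "open U" "\<Theta> \<subseteq> U"
    and cov: "\<And>\<theta>. \<theta> \<in> \<Theta> \<Longrightarrow> covariance_function (K \<theta>)"
    and prob: "prob_space P"
    and Y: "centred_gaussian_process P Y (K \<theta>\<^sub>0)"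
    and separation: "0 < \<Delta>"
      "\<And>n i j. n \<ge> 1 \<Longrightarrow> i < n \<Longrightarrow> j < n \<Longrightarrow> i \<noteq> j \<Longrightarrow> 2 * \<Delta> \<le> norm (f n i - f n j)"
    and projection_control: "1 \<le> J\<^sub>0" "\<And>j. J\<^sub>0 \<le> j \<Longrightarrow> 0 \<le> s j"
      "(\<lambda>j. (s j)\<^sup>2) summable_on {J\<^sub>0..}"
      "\<And>n i j. n \<ge> 1 \<Longrightarrow> i < n \<Longrightarrow> J\<^sub>0 \<le> j \<Longrightarrow> norm (ip (f n i) (e j)) \<le> s j"
    and d\<^sub>0: "J\<^sub>0 \<le> d\<^sub>0"
      "\<And>n i j. n \<ge> 1 \<Longrightarrow> i < j \<Longrightarrow> j < n \<Longrightarrow>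
        \<Delta> \<le> norm (onb_projection scl ip e d\<^sub>0 (f n i) - onb_projection scl ip e d\<^sub>0 (f n j))"
      "(\<Sum>\<^sub>\<infinity>j\<in>{d\<^sub>0 + 1..}. (s j)\<^sup>2) < \<Delta>\<^sup>2 / 16"
    and stationarity: "\<And>\<theta> g h. \<theta> \<in> \<Theta> \<Longrightarrow> K \<theta> g h = k \<theta> (g - h)"
    and decay: "real d\<^sub>0 < \<gamma>\<^sub>0" "0 < C"
      "\<And>\<theta> g. \<theta> \<in> \<Theta> \<Longrightarrow> \<bar>k \<theta> g\<bar> \<le> C / (1 + norm g powr \<gamma>\<^sub>0)"
    and min_eigenvalue: "0 < c"
      "\<And>n \<theta>. n \<ge> 1 \<Longrightarrow> \<theta> \<in> \<Theta> \<Longrightarrow> c \<le> Min (spectrum (gram_mat (K \<theta>) n (f n)))"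
    and global_identifiability:
      "\<And>\<alpha>. 0 < \<alpha> \<Longrightarrow>
        0 < liminf (\<lambda>n. INF \<theta>\<in>{\<theta> \<in> \<Theta>. \<alpha> \<le> norm (\<theta> - \<theta>\<^sub>0)}.
          ereal (1 / real n * (\<Sum>i<n. \<Sum>j<n. (K \<theta> (f n i) (f n j) - K \<theta>\<^sub>0 (f n i) (f n j))\<^sup>2)))"
    and local_identifiability:
      "\<And>l :: real^'p. l \<noteq> 0 \<Longrightarrow>
        0 < liminf (\<lambda>n. ereal (1 / real n * (\<Sum>i<n. \<Sum>j<n.
          (\<Sum>m\<in>UNIV. l $ m * partial m (\<lambda>\<theta>. K \<theta> (f n i) (f n j)) \<theta>\<^sub>0)\<^sup>2)))"
    and C1: "\<And>g. Ck_on 1 (\<lambda>\<theta>. k \<theta> g) U" "real d\<^sub>0 < \<gamma>\<^sub>1" "0 < C\<^sub>1"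
      "\<And>\<theta> m g. \<theta> \<in> U \<Longrightarrow> \<bar>partial m (\<lambda>\<theta>. k \<theta> g) \<theta>\<bar> \<le> C\<^sub>1 / (1 + norm g powr \<gamma>\<^sub>1)"
    and C3: "\<And>g. Ck_on 3 (\<lambda>\<theta>. k \<theta> g) U" "real d\<^sub>0 < \<gamma>\<^sub>2" "0 < C\<^sub>2"
      "\<And>\<theta> ms g. \<theta> \<in> \<Theta> \<Longrightarrow> length ms \<in> {2, 3} \<Longrightarrow>
        \<bar>partials ms (\<lambda>\<theta>. k \<theta> g) \<theta>\<bar> \<le> C\<^sub>2 / (1 + norm g powr \<gamma>\<^sub>2)"
    and mle: "\<And>n. n \<ge> 1 \<Longrightarrow> \<theta>hat n \<in> borel_measurable P"
      "\<And>n \<omega>. n \<ge> 1 \<Longrightarrow> \<omega> \<in> space P \<Longrightarrow>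
        is_arg_min (likelihood_criterion K n (f n) (\<lambda>g. Y g \<omega>)) (\<lambda>\<theta>. \<theta> \<in> \<Theta>) (\<theta>hat n \<omega>)"
  shows "converges_in_distribution P
      (\<lambda>n \<omega>. sqrt (real n) *\<^sub>R (psd_sqrt (fisher_mat K \<theta>\<^sub>0 n (f n)) *v (\<theta>hat n \<omega> - \<theta>\<^sub>0)))
      std_normal_vec
    \<and> 0 < liminf (\<lambda>n. ereal (Min (eigenvalues (fisher_mat K \<theta>\<^sub>0 n (f n)))))
    \<and> liminf (\<lambda>n. ereal (Min (eigenvalues (fisher_mat K \<theta>\<^sub>0 n (f n)))))
        \<le> limsup (\<lambda>n. ereal (Max (eigenvalues (fisher_mat K \<theta>\<^sub>0 n (f n)))))
    \<and> limsup (\<lambda>n. ereal (Max (eigenvalues (fisher_mat K \<theta>\<^sub>0 n (f n))))) < \<infinity>"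
proof -
 interpret H: hilbert_space scl ip by (rule hilbert)
 interpret prob_space P by (rule prob)
 obtain r\<^sub>0 where r0: "0 < r\<^sub>0" "ball \<theta>\<^sub>0 r\<^sub>0 \<subseteq> \<Theta>" using \<Theta>(2) unfolding mem_interior by blast
 have \<theta>0: "\<theta>\<^sub>0 \<in> \<Theta>" using r0 by auto
 define \<gamma> where "\<gamma> = min \<gamma>\<^sub>0 (min \<gamma>\<^sub>1 \<gamma>\<^sub>2)"
 have \<gamma>d: "real d\<^sub>0 < \<gamma>" and \<gamma>le: "\<gamma> <= \<gamma>\<^sub>0" "\<gamma> <= \<gamma>\<^sub>1" "\<gamma> <= \<gamma>\<^sub>2"
  using decay(1) C1(2) C3(2) by (auto simp: \<gamma>_def)
 have \<gamma>0: "0 < \<gamma>" using \<gamma>d by linarith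
 define p where "p = real CARD('p)"
 define r where "r n i j = norm (f n i - f n j)" for n i j
 define a where "a n i j = 1 / (1 + r n i j powr \<gamma>)" for n i j
 have a0: "0 <= a n i j" for n i j by (simp add: a_def)
 define R where "R n \<theta> i j = K \<theta> (f n i) (f n j)" for n \<theta> i j
 define D1 where "D1 n m i j = partial m (%\<theta>. k \<theta> (f n i - f n j)) \<theta>\<^sub>0" for n m i j
 define D2 where "D2 n m l i j = partial l (partial m (%\<theta>. k \<theta> (f n i - f n j))) \<theta>\<^sub>0" for n m l i j
 define y where "y n i = Y (f n i)" for n i
 have "\<exists>\<kappa>\<ge>1. kernel_regular \<Theta> \<theta>\<^sub>0 r\<^sub>0 k \<gamma> \<kappa>"
  by (rule kernel_bounds[OF \<Theta>(1) r0(2,1) U \<gamma>0 \<gamma>le decay(2) C1(3) C3(3) _ C3(1)]) (rule decay(3) C1(4) C3(4); assumption)+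
 then obtain \<kappa> where \<kappa>: "1 <= \<kappa>"
  and kval: "\<forall>\<theta>\<in>\<Theta>. \<forall>g. \<bar>k \<theta> g\<bar> <= \<kappa> * (1 / (1 + norm g powr \<gamma>))"
  and klip: "\<forall>\<theta>\<in>\<Theta>. \<forall>\<theta>'\<in>\<Theta>. \<forall>g. \<bar>k \<theta> g - k \<theta>' g\<bar> <= \<kappa> * norm (\<theta> - \<theta>') * (1 / (1 + norm g powr \<gamma>))"
  and kd1: "\<forall>m g. \<bar>partial m (%\<theta>. k \<theta> g) \<theta>\<^sub>0\<bar> <= \<kappa> * (1 / (1 + norm g powr \<gamma>))"
  and kd2: "\<forall>m l g. \<bar>partial l (partial m (%\<theta>. k \<theta> g)) \<theta>\<^sub>0\<bar> <= \<kappa> * (1 / (1 + norm g powr \<gamma>))"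
  and ktay: "\<forall>t g. norm t < r\<^sub>0 --> \<bar>k (\<theta>\<^sub>0 + t) g - (k \<theta>\<^sub>0 g + (\<Sum>m\<in>UNIV. t $ m * partial m (%\<theta>. k \<theta> g) \<theta>\<^sub>0)
    + (\<Sum>m\<in>UNIV. t $ m * (\<Sum>l\<in>UNIV. t $ l * partial l (partial m (%\<theta>. k \<theta> g)) \<theta>\<^sub>0)) / 2)\<bar>
   <= \<kappa> * norm t ^ 3 * (1 / (1 + norm g powr \<gamma>))"
  by (elim exE conjE) (rule that)
 have inT: "\<theta>\<^sub>0 + t \<in> \<Theta>" if "norm t < r\<^sub>0" for t using r0(2) that by (auto simp: dist_norm)
 have Rk: "R n \<theta> i j = k \<theta> (f n i - f n j)" if "\<theta> \<in> \<Theta>" for n \<theta> i j unfolding R_def by (rule stationarity[OF that])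
 have env: "\<bar>R n \<theta> i j\<bar> <= \<kappa> * a n i j" if "\<theta> \<in> \<Theta>" for n \<theta> i j
  unfolding Rk[OF that] a_def r_def by (rule kval[rule_format, OF that])
 have lip: "\<bar>R n \<theta> i j - R n \<theta>' i j\<bar> <= \<kappa> * norm (\<theta> - \<theta>') * a n i j" if "\<theta> \<in> \<Theta>" "\<theta>' \<in> \<Theta>" for n \<theta> \<theta>' i j
  unfolding Rk[OF that(1)] Rk[OF that(2)] a_def r_def by (rule klip[rule_format, OF that])
 have D1b: "\<bar>D1 n m i j\<bar> <= \<kappa> * a n i j" for n m i j unfolding D1_def a_def r_def by (rule kd1[rule_format])
 have D2b: "\<bar>D2 n m l i j\<bar> <= \<kappa> * a n i j" for n m l i j unfolding D2_def a_def r_def by (rule kd2[rule_format])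
 have tay: "\<bar>R n (\<theta>\<^sub>0 + t) i j - (R n \<theta>\<^sub>0 i j + (\<Sum>m\<in>UNIV. t $ m * D1 n m i j)
    + (\<Sum>m\<in>UNIV. t $ m * (\<Sum>l\<in>UNIV. t $ l * D2 n m l i j)) / 2)\<bar> <= \<kappa> * norm t ^ 3 * a n i j" if "norm t < r\<^sub>0" for n t i j
  unfolding Rk[OF inT[OF that]] Rk[OF \<theta>0] D1_def D2_def a_def r_def by (rule ktay[rule_format, OF that])
 have F0: "(%\<theta>. k \<theta> g) differentiable (at \<theta>)" and F1: "partial m (%\<theta>. k \<theta> g) differentiable (at \<theta>)" if "\<theta> \<in> ball \<theta>\<^sub>0 r\<^sub>0" for \<theta> g m
 proof -
  have "\<theta> \<in> U" using that r0(2) U(2) by blast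
  then show "(%\<theta>. k \<theta> g) differentiable (at \<theta>)" "partial m (%\<theta>. k \<theta> g) differentiable (at \<theta>)"
   using C3(1)[of g] by (simp_all add: numeral_3_eq_3)
 qed
 have b0: "\<theta>\<^sub>0 \<in> ball \<theta>\<^sub>0 r\<^sub>0" using r0 by simp
 have ksym: "k \<theta> g = k \<theta> (- g)" if "\<theta> \<in> \<Theta>" for \<theta> g
  using cov[OF that] stationarity[OF that, of g 0] stationarity[OF that, of 0 g] by (simp add: covariance_function_def)
 have psym: "partial m (%\<theta>. k \<theta> g) \<theta> = partial m (%\<theta>. k \<theta> (- g)) \<theta>" if "\<theta> \<in> ball \<theta>\<^sub>0 r\<^sub>0" for m \<theta> g
  by (rule partial_cong_open[OF open_ball that ksym F0[OF that]]) (use r0(2) in blast)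
 have p2sym: "partial l (partial m (%\<theta>. k \<theta> g)) \<theta>\<^sub>0 = partial l (partial m (%\<theta>. k \<theta> (- g))) \<theta>\<^sub>0" for m l g
  by (rule partial_cong_open[OF open_ball b0 psym F1[OF b0]])
 have Kpart: "partial m (%\<theta>. K \<theta> g h) \<theta>\<^sub>0 = partial m (%\<theta>. k \<theta> (g - h)) \<theta>\<^sub>0" for m g h
  by (rule partial_cong_open[OF open_ball b0 _ F0[OF b0], symmetric]) (use r0(2) stationarity in auto)
 have D1_sym: "D1 n m i j = D1 n m j i" for n m i j unfolding D1_def using psym[OF b0, of m "f n i - f n j"] by simp
 have D2_sym: "D2 n m l i j = D2 n m l j i" for n m l i j unfolding D2_def using p2sym[of l m "f n i - f n j"] by simp
 have R_sym: "R n \<theta> i j = R n \<theta> j i" if "\<theta> \<in> \<Theta>" for n \<theta> i j using cov[OF that] by (simp add: R_def covariance_function_def)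
 obtain Cc where Cc: "1 <= Cc" and cnt: "\<forall>n (x :: nat => 'h) i r.
  (\<forall>i j. i < j --> j < n --> \<Delta> <= norm (onb_projection scl ip e d\<^sub>0 (x i) - onb_projection scl ip e d\<^sub>0 (x j))) --> 0 <= r -->
  real (card {j \<in> {..<n}. norm (x i - x j) <= r}) <= Cc * (1 + r) ^ (2 * d\<^sub>0)"
  using H.separated_projections_count[OF basis separation(1), of d\<^sub>0] by (elim exE conjE) (rule that)
 have count: "real (card {j \<in> {..<n}. r n i j <= x}) <= Cc * (1 + x) ^ (2 * d\<^sub>0)" if "1 <= n" "i < n" "0 <= x" for n i x
  unfolding r_def by (rule cnt[rule_format]) (use d\<^sub>0(2)[OF that(1)] that(3) in auto)
 have es: "real (2 * d\<^sub>0) < 2 * \<gamma>" "\<And>n i j. 0 <= r n i j" "\<And>n i j. r n i j = r n j i"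
  using \<gamma>d by (auto simp: r_def norm_minus_commute)
 have "\<exists>S\<ge>0. \<forall>n\<ge>1. \<forall>i<n. (\<Sum>j<n. (a n i j)\<^sup>2) <= S"
  unfolding a_def by (rule envelope_sums(1)[OF _ Cc es]) (rule count; assumption)
 then obtain S where S: "0 <= S" "\<forall>n\<ge>1. \<forall>i<n. (\<Sum>j<n. (a n i j)\<^sup>2) <= S" by (elim exE conjE) (rule that)
 have trunc: "\<exists>B>0. \<forall>n\<ge>1. truncates n (a n) B x" if "0 < x" for x
  unfolding a_def by (rule envelope_sums(2)[OF _ Cc es that]) (rule count; assumption)
 have "\<exists>\<rho> \<epsilon>. 0 < \<epsilon> \<and> (\<forall>n. 1 <= \<rho> n) \<and> (\<forall>n\<ge>1. \<forall>i<n. (\<Sum>j<n. a n i j) <= \<rho> n)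
    \<and> (\<forall>\<^sub>F n in sequentially. \<rho> n * (real n powr \<epsilon>) ^ 10 <= sqrt (real n))"
  unfolding a_def by (rule envelope_sums(3)[OF _ Cc es]) (rule count; assumption)
 then obtain \<rho> \<epsilon> where \<epsilon>: "0 < \<epsilon>" and \<rho>1: "\<forall>n. 1 <= \<rho> n" and \<rho>s: "\<forall>n\<ge>1. \<forall>i<n. (\<Sum>j<n. a n i j) <= \<rho> n"
  and \<rho>p: "\<forall>\<^sub>F n in sequentially. \<rho> n * (real n powr \<epsilon>) ^ 10 <= sqrt (real n)"
  by (elim exE conjE) (rule that)
 define b where "b n = real n powr \<epsilon>" for n :: nat
 have fenv: "fnorm n G <= x * sqrt S * sqrt (real n)" if "1 <= n" "\<And>i j. \<bar>G i j\<bar> <= x * a n i j" "0 <= x" for n G x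
  by (rule fnorm_envelope[of n "a n"]) (use S that in auto)
 have k0: "0 <= \<kappa>" using \<kappa> by simp
 have "\<exists>\<delta>>0. \<forall>\<^sub>F n in sequentially. \<forall>v :: real^'p. \<delta> * real n * (norm v)\<^sup>2 <= (fnorm n (%i j. \<Sum>m\<in>UNIV. v $ m * D1 n m i j))\<^sup>2"
 proof (rule local_identifiability_uniform)
  show "fnorm n (D1 n m) <= \<kappa> * sqrt S * sqrt (real n)" if "1 <= n" for n m by (rule fenv[OF that D1b k0])
  show "0 <= \<kappa> * sqrt S" using \<kappa> S by simp
  show "0 < liminf (%n. ereal (1 / real n * (fnorm n (%i j. \<Sum>m\<in>UNIV. l $ m * D1 n m i j))\<^sup>2))" if "l \<noteq> 0" for l :: "real^'p"
   using local_identifiability[OF that] by (simp only: fnorm_sq D1_def Kpart)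
 qed
 then obtain \<delta> where \<delta>: "0 < \<delta>" and loc: "\<forall>\<^sub>F n in sequentially. \<forall>v :: real^'p. \<delta> * real n * (norm v)\<^sup>2 <= (fnorm n (%i j. \<Sum>m\<in>UNIV. v $ m * D1 n m i j))\<^sup>2"
  by (elim exE conjE) (rule that)
 have bdd: "bounded \<Theta>" using \<Theta>(1) by (rule compact_imp_bounded)
 define F where "F = \<kappa> * (r\<^sub>0 + p\<^sup>2) * sqrt S"
 have F: "0 <= F" using \<kappa> r0 S by (auto simp: F_def intro!: mult_nonneg_nonneg add_nonneg_nonneg)
 have "\<exists>\<delta>'>0. \<delta>' <= \<delta> \<and> (\<forall>\<^sub>F n in sequentially. \<forall>\<theta>\<in>\<Theta>. \<delta>' * real n * (norm (\<theta> - \<theta>\<^sub>0))\<^sup>2 <= (fnorm n (%i j. R n \<theta> i j - R n \<theta>\<^sub>0 i j))\<^sup>2)"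
 proof (rule identifiability_uniform[OF _ \<delta> loc _ F r0(1) bdd])
  show "0 < liminf (%n. INF \<theta>\<in>{\<theta> \<in> \<Theta>. \<alpha> <= norm (\<theta> - \<theta>\<^sub>0)}. ereal (1 / real n * (fnorm n (%i j. R n \<theta> i j - R n \<theta>\<^sub>0 i j))\<^sup>2))" if "0 < \<alpha>" for \<alpha>
   using global_identifiability[OF that] by (simp only: fnorm_sq R_def)
  fix n :: nat and \<theta> assume n: "1 <= n" and \<theta>: "\<theta> \<in> \<Theta>" "norm (\<theta> - \<theta>\<^sub>0) < r\<^sub>0"
  define t where "t = \<theta> - \<theta>\<^sub>0"
  define T where "T = norm t"
  have T: "0 <= T" "T <= r\<^sub>0" using \<theta>(2) by (auto simp: T_def t_def)
  have "\<bar>(\<Sum>m\<in>UNIV. t $ m * D1 n m i j) - (R n (\<theta>\<^sub>0 + t) i j - R n \<theta>\<^sub>0 i j)\<bar> <= (\<kappa> * (r\<^sub>0 + p\<^sup>2) * T\<^sup>2) * a n i j" for i j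
  proof -
   have in1: "\<bar>\<Sum>l\<in>UNIV. t $ l * D2 n m l i j\<bar> <= CARD('p) * norm t * (\<kappa> * a n i j)" for m
    by (rule sum_abs_le_card_norm) (rule D2b)
   have "\<bar>\<Sum>m\<in>UNIV. t $ m * (\<Sum>l\<in>UNIV. t $ l * D2 n m l i j)\<bar> <= CARD('p) * norm t * (CARD('p) * norm t * (\<kappa> * a n i j))"
    by (rule sum_abs_le_card_norm) (rule in1)
   also have "... = \<kappa> * p\<^sup>2 * T\<^sup>2 * a n i j" by (simp add: p_def T_def power2_eq_square ac_simps)
   finally have q: "\<bar>\<Sum>m\<in>UNIV. t $ m * (\<Sum>l\<in>UNIV. t $ l * D2 n m l i j)\<bar> <= \<kappa> * p\<^sup>2 * T\<^sup>2 * a n i j" .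
   have "T * (\<kappa> * T\<^sup>2 * a n i j) <= r\<^sub>0 * (\<kappa> * T\<^sup>2 * a n i j)" using T k0 a0 by (intro mult_right_mono) auto
   then have c3: "\<kappa> * T ^ 3 * a n i j <= \<kappa> * r\<^sub>0 * T\<^sup>2 * a n i j" by (simp add: power3_eq_cube power2_eq_square ac_simps)
   have "norm t < r\<^sub>0" using \<theta>(2) by (simp add: t_def)
   from tay[OF this, of n i j] q c3 have "\<bar>(\<Sum>m\<in>UNIV. t $ m * D1 n m i j) - (R n (\<theta>\<^sub>0 + t) i j - R n \<theta>\<^sub>0 i j)\<bar> <= \<kappa> * r\<^sub>0 * T\<^sup>2 * a n i j + \<kappa> * p\<^sup>2 * T\<^sup>2 * a n i j"
    unfolding T_def by linarith
   then show ?thesis by (simp add: algebra_simps)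
  qed
  then have "fnorm n (%i j. (\<Sum>m\<in>UNIV. t $ m * D1 n m i j) - (R n (\<theta>\<^sub>0 + t) i j - R n \<theta>\<^sub>0 i j)) <= (\<kappa> * (r\<^sub>0 + p\<^sup>2) * T\<^sup>2) * sqrt S * sqrt (real n)"
   by (rule fenv[OF n]) (use k0 r0 in auto)
  then show "fnorm n (%i j. (\<Sum>m\<in>UNIV. (\<theta> - \<theta>\<^sub>0) $ m * D1 n m i j) - (R n \<theta> i j - R n \<theta>\<^sub>0 i j)) <= F * (norm (\<theta> - \<theta>\<^sub>0))\<^sup>2 * sqrt (real n)"
   by (simp add: t_def T_def F_def ac_simps)
 qed
 then obtain \<delta>' where \<delta>': "0 < \<delta>'" "\<delta>' <= \<delta>" and glob: "\<forall>\<^sub>F n in sequentially. \<forall>\<theta>\<in>\<Theta>. \<delta>' * real n * (norm (\<theta> - \<theta>\<^sub>0))\<^sup>2 <= (fnorm n (%i j. R n \<theta> i j - R n \<theta>\<^sub>0 i j))\<^sup>2"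
  by (elim exE conjE) (rule that)
 have loc': "\<forall>\<^sub>F n in sequentially. \<forall>v :: real^'p. \<delta>' * real n * (norm v)\<^sup>2 <= (fnorm n (%i j. \<Sum>m\<in>UNIV. v $ m * D1 n m i j))\<^sup>2"
  using loc
 proof eventually_elim
  case (elim n)
  show ?case
  proof
   fix v :: "real^'p"
   have "\<delta>' * (real n * (norm v)\<^sup>2) <= \<delta> * (real n * (norm v)\<^sup>2)" by (rule mult_right_mono[OF \<delta>'(2)]) simp
   then show "\<delta>' * real n * (norm v)\<^sup>2 <= (fnorm n (%i j. \<Sum>m\<in>UNIV. v $ m * D1 n m i j))\<^sup>2"
    using elim[rule_format, of v] by (simp only: mult.assoc)
  qed
 qed
 have gram: "gram_mat (K \<theta>) n (f n) = mat_of n (R n \<theta>)" for n \<theta> by (simp add: gram_mat_def R_def)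
 note Yg = centred_gaussian_processD[OF Y]
 have inj: "inj_on (f n) {..<n}" if n: "1 <= n" for n
 proof (rule inj_onI, rule ccontr)
  fix i j assume ij: "i \<in> {..<n}" "j \<in> {..<n}" "f n i = f n j" "i \<noteq> j"
  then have "2 * \<Delta> <= norm (f n i - f n j)" using separation(2)[OF n, of i j] by simp
  then show False using ij(3) separation(1) by simp
 qed
 have bp: "\<forall>\<^sub>F n in sequentially. b n ^ 10 <= sqrt (real n)"
  using \<rho>p
 proof eventually_elim
  case (elim n)
  have "1 * b n ^ 10 <= \<rho> n * b n ^ 10" by (rule mult_right_mono) (use \<rho>1 in \<open>auto simp: b_def\<close>)
  then show ?case using elim unfolding b_def by linarith
 qed
 interpret G: gaussian_array P R a D1 D2 y \<Theta> \<theta>\<^sub>0 \<kappa> S c \<delta>' r\<^sub>0 \<rho> b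
 proof (intro gaussian_array.intro gaussian_array_axioms.intro prob)
  show "(\<Sum>j<n. (a n i j)\<^sup>2) <= S" if "1 <= n" "i < n" for n i using S(2) that by blast
  show "\<forall>\<^sub>F n in sequentially. \<forall>i<n. (\<Sum>j<n. a n i j) <= \<rho> n" using \<rho>s by (auto simp: eventually_sequentially)
  show "\<exists>B>0. \<forall>n\<ge>1. truncates n (a n) B x" if "0 < x" for x
   by (rule trunc[OF that])
  show "1 <= b n" if "1 <= n" for n unfolding b_def using that \<epsilon> by (intro ge_one_powr_ge_zero) auto
  show "filterlim b at_top sequentially" unfolding b_def[abs_def] using \<epsilon> by real_asymp
  show "\<forall>\<^sub>F n in sequentially. \<rho> n * b n ^ 10 <= sqrt (real n)" unfolding b_def by (rule \<rho>p)
  show "(%n. real n ^ q * exp (- x * b n ^ 4)) \<longlonglongrightarrow> 0" if "0 < x" for q x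
   unfolding b_def by (rule power_exp_vanishes[OF that \<epsilon>])
  show "c <= Min (spectrum (mat_of n (R n \<theta>)))" if "1 <= n" "\<theta> \<in> \<Theta>" for n \<theta>
   unfolding gram[symmetric] by (rule min_eigenvalue(2)[OF that])
  show "y n i \<in> borel_measurable P" for n i using Yg(1) unfolding y_def by (simp add: gaussian_variable_def)
  show "integrable P (%w. (y n i w)\<^sup>2)" for n i unfolding y_def by (rule centred_gaussian_variable(1)[OF Yg(1,2)])
  show "expectation (%w. (y n i w)\<^sup>2) = R n \<theta>\<^sub>0 i i" for n i using Yg(3) by (simp add: y_def R_def power2_eq_square)
  show "std_normal_family P n (%l w. \<Sum>i<n. V i l * y n i w)" if "1 <= n" "whitening n (R n \<theta>\<^sub>0) c V W" for n V W
   unfolding y_def by (rule gaussian_process_whitened[OF Y inj[OF that(1)]]) (use that(2) in \<open>simp add: R_def[abs_def]\<close>)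
 qed (fact R_sym D1_sym D2_sym a0 bp bdd r0 \<kappa> S(1) min_eigenvalue(1) \<delta>'(1) glob loc' \<rho>1[rule_format] | rule env lip D1b D2b tay; assumption)+
 have fisher: "fisher_mat K \<theta>\<^sub>0 n (f n) = G.info n" for n
 proof (cases "1 <= n")
  case True
  have dm: "gram_mat_deriv m K \<theta>\<^sub>0 n (f n) = mat_of n (D1 n m)" for m
   by (simp add: gram_mat_deriv_def gram_mat_def D1_def Kpart)
  have "mat_trace (mat_inv (mat_of n (R n \<theta>\<^sub>0)) * mat_of n (D1 n m) * mat_inv (mat_of n (R n \<theta>\<^sub>0)) * mat_of n (D1 n l))
   = fdot n (G.X1 n m) (G.X1 n l)" for m l
   unfolding fdot_def G.X1_def by (rule whitened_trace[OF G.VW[OF True] D1_sym])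
  then show ?thesis unfolding fisher_mat_def G.info_def gram dm by simp
 next
  case False
  then have "n = 0" by simp
  then show ?thesis by (simp add: fisher_mat_def G.info_def)
 qed
 have crit: "likelihood_criterion K n (f n) (%g. Y g w) \<theta> = 1 / real n * G.crit n \<theta> w" for n w \<theta>
  unfolding likelihood_criterion_def Let_def G.crit_def gauss_crit_def gram y_def by (simp only: distrib_left)
 have arg: "\<theta>hat n w \<in> \<Theta> \<and> (\<forall>\<theta>\<in>\<Theta>. G.crit n (\<theta>hat n w) w <= G.crit n \<theta> w)" if n: "1 <= n" and w: "w \<in> space P" for n w
 proof -
  have am: "\<theta>hat n w \<in> \<Theta>" "\<And>\<theta>. \<theta> \<in> \<Theta> ==> \<not> 1 / real n * G.crit n \<theta> w < 1 / real n * G.crit n (\<theta>hat n w) w"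
   using mle(2)[OF n w] unfolding is_arg_min_def crit by blast+
  have "0 < 1 / real n" using n by simp
  from mult_le_cancel_left_pos[OF this] show ?thesis using am unfolding not_less by blast
 qed
 show ?thesis unfolding fisher
  using G.estimator_asymptotically_normal[OF mle(1) arg] G.fisher_eigenvalue_bounds by blast
qed

end
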